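(* Let $\nabla(\mathbf s)=d-\sum_{j=1}^n s_jB_j$ be a periodic pencil of flat connections defined over $\overline{\mathbb Q}$, on a smooth irreducible variety $X$ with values in a finite dimensional space $V$. Then for any $\mathbf s\in\mathbb Q^n$ the connection $\nabla(\mathbf s)$ is globally nilpotent.
   Context: Pencil: a family of flat connections $\nabla(\mathbf s)=d-\sum_{j=1}^n s_jB_j$ on the trivial bundle $X\times V\to X$, with $B_j\in\Omega^1(X)\otimes\mathrm{End}\,V$ independent of $\mathbf s$. Over a field $\mathbf k$ it is periodic if there exist $A_j\in GL(V)(\mathbf k(\mathbf s)[X])$, $1\le j\le n$, with $\nabla(\mathbf s+\mathbf e_j)\circ A_j(\mathbf s)=A_j(\mathbf s)\circ\nabla(\mathbf s)$, where $\{\mathbf e_j\}$ is the standard basis; here $\mathbf k=\overline{\mathbb Q}$. Reduction at $p$: an object $Y$ over $\overline{\mathbb Q}$ has a form $Y_R$ over a finitely generated subring $R\subset\overline{\mathbb Q}$; a reduction of $Y$ at $p$ is $Y_R\otimes_{R,\phi}\overline{\mathbb F}_p$ for a ring homomorphism $\phi:R\to\overline{\mathbb F}_p$. Any two choices of $(R,Y_R)$ give the same collection of reductions for almost all (all but finitely many) $p$. The $p$-curvature of a flat connection in characteristic $p$ is the collection of operators $C_i=\nabla_i^p$, where $\nabla_i$ are the covariant derivatives along local coordinate vector fields. A flat connection over $\overline{\mathbb Q}$ is globally nilpotent if the $p$-curvature of its reduction to characteristic $p$ is nilpotent for almost all $p$. *)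

theory Defs
  imports
    "HOL-Algebra.Algebraic_Closure_Type"
    "HOL-Algebra.Generated_Rings"
    "HOL-Algebra.QuotRing"
    "HOL-Algebra.UnivPoly"
    "HOL-Number_Theory.Residues"
    "HOL-Library.Poly_Mapping"
    "HOL-Library.FuncSet"
begin

section \<open>Differential forms, coordinates and connections over a commutative ring\<close>

text \<open>
  Throughout, \<open>C\<close> is a commutative ring and \<open>S\<close> a subring of constants (the image of the base
  ring), so that \<open>C\<close> is an \<open>S\<close>-algebra.
\<close>

definition derivations :: "'a set \<Rightarrow> ('a, 'm) ring_scheme \<Rightarrow> ('a \<Rightarrow> 'a) set" where
  "derivations S C = {D \<in> carrier C \<rightarrow> carrier C.
     (\<forall>x\<in>carrier C. \<forall>y\<in>carrier C. D (x \<oplus>\<^bsub>C\<^esub> y) = D x \<oplus>\<^bsub>C\<^esub> D y) \<and>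
     (\<forall>x\<in>carrier C. \<forall>y\<in>carrier C. D (x \<otimes>\<^bsub>C\<^esub> y) = x \<otimes>\<^bsub>C\<^esub> D y \<oplus>\<^bsub>C\<^esub> y \<otimes>\<^bsub>C\<^esub> D x) \<and>
     (\<forall>c\<in>S. D c = \<zero>\<^bsub>C\<^esub>)}"

text \<open>
  The list \<open>[(a\<^sub>1, b\<^sub>1), \<dots>, (a\<^sub>r, b\<^sub>r)]\<close> stands for the element
  \<open>a\<^sub>1 db\<^sub>1 + \<dots> + a\<^sub>r db\<^sub>r\<close> of the module of Kaehler differentials of \<open>C\<close> over \<open>S\<close>;
  \<open>kaehler_eq C S\<close> is equality in that module, given by its usual presentation.
\<close>

type_synonym 'a kform = "('a \<times> 'a) list"

definition kforms :: "('a, 'm) ring_scheme \<Rightarrow> 'a kform set" where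
  "kforms C = lists (carrier C \<times> carrier C)"

inductive kaehler_eq :: "('a, 'm) ring_scheme \<Rightarrow> 'a set \<Rightarrow> 'a kform \<Rightarrow> 'a kform \<Rightarrow> bool"
  for C S where
  refl: "w \<in> kforms C \<Longrightarrow> kaehler_eq C S w w"
| sym: "kaehler_eq C S v w \<Longrightarrow> kaehler_eq C S w v"
| trans: "kaehler_eq C S u v \<Longrightarrow> kaehler_eq C S v w \<Longrightarrow> kaehler_eq C S u w"
| comm: "v \<in> kforms C \<Longrightarrow> w \<in> kforms C \<Longrightarrow> kaehler_eq C S (v @ w) (w @ v)"
| cong: "kaehler_eq C S v v' \<Longrightarrow> kaehler_eq C S w w' \<Longrightarrow> kaehler_eq C S (v @ w) (v' @ w')"
| coeff_zero: "b \<in> carrier C \<Longrightarrow> kaehler_eq C S [(\<zero>\<^bsub>C\<^esub>, b)] []"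
| coeff_add: "a \<in> carrier C \<Longrightarrow> a' \<in> carrier C \<Longrightarrow> b \<in> carrier C \<Longrightarrow>
    kaehler_eq C S [(a \<oplus>\<^bsub>C\<^esub> a', b)] [(a, b), (a', b)]"
| d_const: "a \<in> carrier C \<Longrightarrow> c \<in> S \<Longrightarrow> c \<in> carrier C \<Longrightarrow> kaehler_eq C S [(a, c)] []"
| d_add: "a \<in> carrier C \<Longrightarrow> b \<in> carrier C \<Longrightarrow> c \<in> carrier C \<Longrightarrow>
    kaehler_eq C S [(a, b \<oplus>\<^bsub>C\<^esub> c)] [(a, b), (a, c)]"
| d_mult: "a \<in> carrier C \<Longrightarrow> b \<in> carrier C \<Longrightarrow> c \<in> carrier C \<Longrightarrow>
    kaehler_eq C S [(a, b \<otimes>\<^bsub>C\<^esub> c)] [(a \<otimes>\<^bsub>C\<^esub> b, c), (a \<otimes>\<^bsub>C\<^esub> c, b)]"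

definition contract :: "('a, 'm) ring_scheme \<Rightarrow> ('a \<Rightarrow> 'a) \<Rightarrow> 'a kform \<Rightarrow> 'a" where
  "contract C D w = foldr (\<lambda>(a, b) r. a \<otimes>\<^bsub>C\<^esub> D b \<oplus>\<^bsub>C\<^esub> r) w \<zero>\<^bsub>C\<^esub>"

text \<open>Local coordinates: the differentials \<open>dx\<^sub>0, \<dots>, dx\<^sub>d\<^sub>-\<^sub>1\<close> form a basis of the Kaehler module.\<close>

definition coordinates ::
    "('a, 'm) ring_scheme \<Rightarrow> 'a set \<Rightarrow> nat \<Rightarrow> (nat \<Rightarrow> 'a) \<Rightarrow> bool" where
  "coordinates C S d x \<longleftrightarrow>
     x \<in> {..<d} \<rightarrow> carrier C \<and>
     (\<forall>w\<in>kforms C. \<exists>c \<in> {..<d} \<rightarrow> carrier C.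
        kaehler_eq C S w (map (\<lambda>i. (c i, x i)) [0..<d])) \<and>
     (\<forall>c \<in> {..<d} \<rightarrow> carrier C.
        kaehler_eq C S (map (\<lambda>i. (c i, x i)) [0..<d]) [] \<longrightarrow> (\<forall>i<d. c i = \<zero>\<^bsub>C\<^esub>))"

definition coordinate_fields ::
    "('a, 'm) ring_scheme \<Rightarrow> 'a set \<Rightarrow> nat \<Rightarrow> (nat \<Rightarrow> 'a) \<Rightarrow> (nat \<Rightarrow> 'a \<Rightarrow> 'a) \<Rightarrow> bool" where
  "coordinate_fields C S d x \<delta> \<longleftrightarrow>
     (\<forall>i<d. \<delta> i \<in> derivations S C \<and>
        (\<forall>j<d. \<delta> i (x j) = (if i = j then \<one>\<^bsub>C\<^esub> else \<zero>\<^bsub>C\<^esub>)))"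

text \<open>
  The trivial bundle has fibre \<open>V = k\<^sup>N\<close>; an \<open>End V\<close>-valued form is an \<open>N \<times> N\<close> matrix \<open>W\<close> of
  forms, and \<open>cov_deriv C N W D\<close> is the covariant derivative of \<open>d - W\<close> along \<open>D\<close>.
\<close>

definition vecs :: "('a, 'm) ring_scheme \<Rightarrow> nat \<Rightarrow> (nat \<Rightarrow> 'a) set" where
  "vecs C N = {..<N} \<rightarrow>\<^sub>E carrier C"

definition mat_app :: "('a, 'm) ring_scheme \<Rightarrow> nat \<Rightarrow> (nat \<Rightarrow> nat \<Rightarrow> 'a) \<Rightarrow> (nat \<Rightarrow> 'a) \<Rightarrow> (nat \<Rightarrow> 'a)"
  where
  "mat_app C N M v = (\<lambda>a\<in>{..<N}. \<Oplus>\<^bsub>C\<^esub>b\<in>{..<N}. M a b \<otimes>\<^bsub>C\<^esub> v b)"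

definition cov_deriv :: "('a, 'm) ring_scheme \<Rightarrow> nat \<Rightarrow> (nat \<Rightarrow> nat \<Rightarrow> 'a kform) \<Rightarrow>
    ('a \<Rightarrow> 'a) \<Rightarrow> (nat \<Rightarrow> 'a) \<Rightarrow> (nat \<Rightarrow> 'a)" where
  "cov_deriv C N W D v =
     (\<lambda>a\<in>{..<N}. D (v a) \<ominus>\<^bsub>C\<^esub> mat_app C N (\<lambda>a b. contract C D (W a b)) v a)"

text \<open>Flatness is vanishing of the curvature \<open>[\<nabla>\<^sub>D, \<nabla>\<^sub>E] - \<nabla>\<^bsub>[D,E]\<^esub>\<close>.\<close>

definition flat_connection ::
    "('a, 'm) ring_scheme \<Rightarrow> 'a set \<Rightarrow> nat \<Rightarrow> (nat \<Rightarrow> nat \<Rightarrow> 'a kform) \<Rightarrow> bool" where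
  "flat_connection C S N W \<longleftrightarrow>
     (\<forall>D\<in>derivations S C. \<forall>E\<in>derivations S C. \<forall>v\<in>vecs C N. \<forall>a<N.
        cov_deriv C N W D (cov_deriv C N W E v) a \<ominus>\<^bsub>C\<^esub> cov_deriv C N W E (cov_deriv C N W D v) a
        = cov_deriv C N W (\<lambda>f. D (E f) \<ominus>\<^bsub>C\<^esub> E (D f)) v a)"

text \<open>
  The following is vacuous when \<open>C\<close> has no coordinates; it is applied to all basic open subsets of
  an affine scheme, and on a smooth scheme those with coordinates form a basis of the topology.
\<close>

definition nilpotent_p_curvature ::
    "nat \<Rightarrow> ('a, 'm) ring_scheme \<Rightarrow> 'a set \<Rightarrow> nat \<Rightarrow> (nat \<Rightarrow> nat \<Rightarrow> 'a kform) \<Rightarrow> bool" where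
  "nilpotent_p_curvature p C S N W \<longleftrightarrow>
     (\<forall>d x \<delta>. coordinates C S d x \<longrightarrow> coordinate_fields C S d x \<delta> \<longrightarrow>
        (\<forall>i<d. \<exists>m. \<forall>v\<in>vecs C N.
           ((cov_deriv C N W (\<delta> i) ^^ p) ^^ m) v = (\<lambda>a\<in>{..<N}. \<zero>\<^bsub>C\<^esub>)))"

text \<open>The form \<open>s\<^sub>0 B\<^sub>0 + \<dots> + s\<^sub>n\<^sub>-\<^sub>1 B\<^sub>n\<^sub>-\<^sub>1\<close>; the parameters of a pencil are indexed from \<open>0\<close>.\<close>

definition pencil :: "('a, 'm) ring_scheme \<Rightarrow> nat \<Rightarrow> (nat \<Rightarrow> nat \<Rightarrow> nat \<Rightarrow> 'a kform) \<Rightarrow>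
    (nat \<Rightarrow> 'a) \<Rightarrow> nat \<Rightarrow> nat \<Rightarrow> 'a kform" where
  "pencil C n B s a b =
     concat (map (\<lambda>j. map (\<lambda>(f, g). (s j \<otimes>\<^bsub>C\<^esub> f, g)) (B j a b)) [0..<n])"


section \<open>Varieties as sets of local rings in the function field\<close>

text \<open>
  An integral separated scheme of finite type over a Noetherian domain \<open>k\<close> is rendered as a
  Chevalley scheme: the set of its local rings inside its function field, which is the type \<open>'a\<close>
  (or a subfield of it).  \<open>spec A\<close> is the set of local rings of the affine scheme of a subring \<open>A\<close>.
\<close>

abbreviation subr :: "'a::field set \<Rightarrow> 'a ring" where
  "subr A \<equiv> ring_of_type_algebra\<lparr>carrier := A\<rparr>"

abbreviation gen :: "'a::field set \<Rightarrow> 'a set" where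
  "gen G \<equiv> generate_ring ring_of_type_algebra G"

definition localization_at :: "'a::field set \<Rightarrow> 'a set \<Rightarrow> 'a set" where
  "localization_at A P = {a / b | a b. a \<in> A \<and> b \<in> A - P}"

definition spec :: "'a::field set \<Rightarrow> 'a set set" where
  "spec A = {localization_at A P | P. primeideal P (subr A)}"

definition fg_algebra :: "'a::field set \<Rightarrow> 'a set \<Rightarrow> bool" where
  "fg_algebra k A \<longleftrightarrow> (\<exists>G. finite G \<and> A = gen (k \<union> G))"

text \<open>
  The last clause says that \<open>spec A\<close> and \<open>spec B\<close> meet in the affine open subset \<open>spec (AB)\<close> of
  both.  It makes the charts glue, and it makes the resulting scheme separated.
\<close>

definition affine_atlas :: "'a::field set \<Rightarrow> 'a set set \<Rightarrow> bool" where
  "affine_atlas k \<A> \<longleftrightarrow> finite \<A> \<and> \<A> \<noteq> {} \<and> (\<forall>A\<in>\<A>. fg_algebra k A) \<and>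
     (\<forall>A\<in>\<A>. \<forall>B\<in>\<A>. spec (gen (A \<union> B)) \<subseteq> spec A \<inter> spec B)"

definition irreducible_variety :: "'a::field set \<Rightarrow> 'a set set \<Rightarrow> bool" where
  "irreducible_variety k Y \<longleftrightarrow>
     (\<exists>\<A>. affine_atlas k \<A> \<and> Y = (\<Union>A\<in>\<A>. spec A) \<and>
        (\<forall>A\<in>\<A>. {a / b | a b. a \<in> A \<and> b \<in> A \<and> b \<noteq> 0} = UNIV))"

text \<open>
  Smoothness: at every point the Kaehler differentials of the local ring are free with a basis of
  differentials.  Over a field of characteristic \<open>0\<close> the rank is then automatically the dimension.
\<close>

definition smooth :: "'a::field_char_0 set \<Rightarrow> 'a set set \<Rightarrow> bool" where
  "smooth k Y \<longleftrightarrow> (\<forall>P\<in>Y. \<exists>d x. coordinates (subr P) k d x)"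

definition regular_functions :: "'a set set \<Rightarrow> 'a set" where
  "regular_functions Y = \<Inter>Y"

text \<open>
  On a smooth variety the cotangent sheaf is locally free, so a global section is the same as a
  rational form (over the function field) that comes from the Kaehler module of each local ring.
\<close>

definition regular_form :: "'a::field set \<Rightarrow> 'a set set \<Rightarrow> 'a kform \<Rightarrow> bool" where
  "regular_form k Y w \<longleftrightarrow>
     (\<forall>P\<in>Y. \<exists>w'\<in>kforms (subr P). kaehler_eq ring_of_type_algebra k w' w)"

text \<open>
  The algebraic elements of the function field.  For a variety over the algebraic closure of the
  rationals these are exactly the constants.
\<close>

definition Qbar :: "'a::field_char_0 set" where
  "Qbar = {x. algebraic x}"


section \<open>Periodic pencils\<close>

text \<open>Polynomials in \<open>s\<^sub>0, \<dots>, s\<^sub>n\<^sub>-\<^sub>1\<close> with coefficients in \<open>A\<close>, and quotients of such.\<close>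

type_synonym 'a ratfun = "((nat \<Rightarrow>\<^sub>0 nat) \<Rightarrow>\<^sub>0 'a) fract"

definition polys :: "nat \<Rightarrow> 'a::zero set \<Rightarrow> ((nat \<Rightarrow>\<^sub>0 nat) \<Rightarrow>\<^sub>0 'a) set" where
  "polys n A = {P. (\<forall>m\<in>Poly_Mapping.keys P. Poly_Mapping.lookup P m \<in> A \<and>
     Poly_Mapping.keys m \<subseteq> {..<n})}"

definition ratfuns :: "nat \<Rightarrow> 'a::field set \<Rightarrow> 'a set \<Rightarrow> 'a ratfun set" where
  "ratfuns n A B = {Fract P Q | P Q. P \<in> polys n A \<and> Q \<in> polys n B \<and> Q \<noteq> 0}"

definition const_fun :: "'a::field \<Rightarrow> 'a ratfun" where
  "const_fun c = Fract (Poly_Mapping.single 0 c) 1"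

definition param :: "nat \<Rightarrow> 'a::field ratfun" where
  "param j = Fract (Poly_Mapping.single (Poly_Mapping.single j 1) 1) 1"

text \<open>
  With \<open>K\<close> the function field of \<open>Y\<close>, the following are the function field \<open>K(s)\<close> of the base change
  of \<open>Y\<close> to \<open>k(s)\<close>, its field of constants \<open>k(s)\<close>, and the ring \<open>k(s)[Y]\<close>.
\<close>

definition fun_field_s :: "nat \<Rightarrow> 'a::field ratfun ring" where
  "fun_field_s n = subr (ratfuns n UNIV UNIV)"

definition const_field_s :: "nat \<Rightarrow> 'a::field set \<Rightarrow> 'a ratfun set" where
  "const_field_s n k = ratfuns n k k"

definition regular_functions_s :: "nat \<Rightarrow> 'a::field set \<Rightarrow> 'a set set \<Rightarrow> 'a ratfun set" where
  "regular_functions_s n k Y = ratfuns n (regular_functions Y) k"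

definition GL :: "('a, 'm) ring_scheme \<Rightarrow> nat \<Rightarrow> 'a set \<Rightarrow> (nat \<Rightarrow> nat \<Rightarrow> 'a) set" where
  "GL C N A = {M. (\<forall>a<N. \<forall>b<N. M a b \<in> A) \<and>
     (\<exists>M'. (\<forall>a<N. \<forall>b<N. M' a b \<in> A) \<and>
        (\<forall>v\<in>vecs C N. mat_app C N M (mat_app C N M' v) = v \<and>
                       mat_app C N M' (mat_app C N M v) = v))}"

definition flat_pencil ::
    "'a::field set \<Rightarrow> 'a set set \<Rightarrow> nat \<Rightarrow> nat \<Rightarrow> (nat \<Rightarrow> nat \<Rightarrow> nat \<Rightarrow> 'a kform) \<Rightarrow> bool" where
  "flat_pencil k Y n N B \<longleftrightarrow>
     (\<forall>j<n. \<forall>a<N. \<forall>b<N. regular_form k Y (B j a b)) \<and>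
     (\<forall>s \<in> {..<n} \<rightarrow> k.
        flat_connection ring_of_type_algebra k N (pencil ring_of_type_algebra n B s))"

definition periodic_pencil ::
    "'a::field set \<Rightarrow> 'a set set \<Rightarrow> nat \<Rightarrow> nat \<Rightarrow> (nat \<Rightarrow> nat \<Rightarrow> nat \<Rightarrow> 'a kform) \<Rightarrow> bool" where
  "periodic_pencil k Y n N B \<longleftrightarrow>
     flat_pencil k Y n N B \<and>
     (\<forall>j<n. \<exists>A \<in> GL (fun_field_s n) N (regular_functions_s n k Y).
        let L = fun_field_s n;
            B' = (\<lambda>i a b. map (map_prod const_fun const_fun) (B i a b));
            conn = (\<lambda>t. cov_deriv L N (pencil L n B' t))
        in \<forall>D\<in>derivations (const_field_s n k) L. \<forall>v\<in>vecs L N.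
             conn (\<lambda>i. param i + (if i = j then 1 else 0)) D (mat_app L N A v)
             = mat_app L N A (conn param D v))"


section \<open>Base change, reduction modulo p and global nilpotence\<close>

text \<open>The polynomial ring over \<open>F\<close> with one variable for each element of \<open>I\<close>.\<close>

definition mpoly_ring :: "('f, 'm) ring_scheme \<Rightarrow> 'i set \<Rightarrow> ('i multiset \<Rightarrow> 'f) ring" where
  "mpoly_ring F I = \<lparr>
     carrier = {P. (\<forall>m. P m \<in> carrier F) \<and> finite {m. P m \<noteq> \<zero>\<^bsub>F\<^esub>} \<and>
                   (\<forall>m. P m \<noteq> \<zero>\<^bsub>F\<^esub> \<longrightarrow> set_mset m \<subseteq> I)},
     monoid.mult = (\<lambda>P Q m. \<Oplus>\<^bsub>F\<^esub>u\<in>{u. u \<subseteq># m}. P u \<otimes>\<^bsub>F\<^esub> Q (m - u)),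
     one = (\<lambda>m. if m = {#} then \<one>\<^bsub>F\<^esub> else \<zero>\<^bsub>F\<^esub>),
     zero = (\<lambda>m. \<zero>\<^bsub>F\<^esub>),
     add = (\<lambda>P Q m. P m \<oplus>\<^bsub>F\<^esub> Q m)\<rparr>"

definition mconst :: "('f, 'm) ring_scheme \<Rightarrow> 'f \<Rightarrow> 'i multiset \<Rightarrow> 'f" where
  "mconst F c = (\<lambda>m. if m = {#} then c else \<zero>\<^bsub>F\<^esub>)"

definition mvar :: "('f, 'm) ring_scheme \<Rightarrow> 'i \<Rightarrow> 'i multiset \<Rightarrow> 'f" where
  "mvar F i = (\<lambda>m. if m = {#i#} then \<one>\<^bsub>F\<^esub> else \<zero>\<^bsub>F\<^esub>)"

text \<open>
  The tensor product of \<open>A\<close> and \<open>F\<close> over a subring \<open>R\<close> of \<open>A\<close>, where \<open>F\<close> is an \<open>R\<close>-algebra via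
  \<open>\<phi>\<close>: the \<open>F\<close>-algebra generated by symbols \<open>X\<^sub>a\<close> for \<open>a\<close> in \<open>A\<close>, subject to the relations making
  \<open>a \<mapsto> X\<^sub>a\<close> a homomorphism of rings that agrees with \<open>\<phi>\<close> on \<open>R\<close>.
\<close>

definition base_change_ideal :: "'b set \<Rightarrow> ('b \<Rightarrow> 'f) \<Rightarrow> ('b, 'n) ring_scheme \<Rightarrow>
    ('f, 'm) ring_scheme \<Rightarrow> ('b multiset \<Rightarrow> 'f) set" where
  "base_change_ideal R \<phi> A F =
    (let M = mpoly_ring F (carrier A) in
     Idl\<^bsub>M\<^esub> ({mvar F a \<oplus>\<^bsub>M\<^esub> mvar F b \<ominus>\<^bsub>M\<^esub> mvar F (a \<oplus>\<^bsub>A\<^esub> b) | a b. a \<in> carrier A \<and> b \<in> carrier A} \<union>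
            {mvar F a \<otimes>\<^bsub>M\<^esub> mvar F b \<ominus>\<^bsub>M\<^esub> mvar F (a \<otimes>\<^bsub>A\<^esub> b) | a b. a \<in> carrier A \<and> b \<in> carrier A} \<union>
            {mvar F r \<ominus>\<^bsub>M\<^esub> mconst F (\<phi> r) | r. r \<in> R}))"

definition base_change :: "'b set \<Rightarrow> ('b \<Rightarrow> 'f) \<Rightarrow> ('b, 'n) ring_scheme \<Rightarrow> ('f, 'm) ring_scheme \<Rightarrow>
    ('b multiset \<Rightarrow> 'f) set ring" where
  "base_change R \<phi> A F = mpoly_ring F (carrier A) Quot base_change_ideal R \<phi> A F"

definition base_change_in :: "'b set \<Rightarrow> ('b \<Rightarrow> 'f) \<Rightarrow> ('b, 'n) ring_scheme \<Rightarrow> ('f, 'm) ring_scheme \<Rightarrow>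
    'b \<Rightarrow> ('b multiset \<Rightarrow> 'f) set" where
  "base_change_in R \<phi> A F a = base_change_ideal R \<phi> A F +>\<^bsub>mpoly_ring F (carrier A)\<^esub> mvar F a"

definition base_change_const :: "'b set \<Rightarrow> ('b \<Rightarrow> 'f) \<Rightarrow> ('b, 'n) ring_scheme \<Rightarrow>
    ('f, 'm) ring_scheme \<Rightarrow> 'f \<Rightarrow> ('b multiset \<Rightarrow> 'f) set" where
  "base_change_const R \<phi> A F c = base_change_ideal R \<phi> A F +>\<^bsub>mpoly_ring F (carrier A)\<^esub> mconst F c"

text \<open>The localization \<open>C[1/g] = C[T]/(gT - 1)\<close>, with its structure map.\<close>

definition away_ideal :: "('a, 'm) ring_scheme \<Rightarrow> 'a \<Rightarrow> (nat \<Rightarrow> 'a) set" where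
  "away_ideal C g = Idl\<^bsub>UP C\<^esub> {up_ring.monom (UP C) g 1 \<ominus>\<^bsub>UP C\<^esub> \<one>\<^bsub>UP C\<^esub>}"

definition away :: "('a, 'm) ring_scheme \<Rightarrow> 'a \<Rightarrow> (nat \<Rightarrow> 'a) set ring" where
  "away C g = UP C Quot away_ideal C g"

definition away_in :: "('a, 'm) ring_scheme \<Rightarrow> 'a \<Rightarrow> 'a \<Rightarrow> (nat \<Rightarrow> 'a) set" where
  "away_in C g c = away_ideal C g +>\<^bsub>UP C\<^esub> up_ring.monom (UP C) c 0"

text \<open>
  A form over \<open>R\<close> of a variety \<open>Y\<close> over \<open>Qbar\<close> with the connection \<open>d - W\<close>: a scheme over \<open>R\<close>, with
  atlas \<open>\<A>\<close>, whose base change to \<open>Qbar\<close> is \<open>Y\<close>, and a global matrix of forms on it, given by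
  \<open>\<omega> A\<close> on the chart \<open>A\<close>, which becomes \<open>W\<close> on \<open>Y\<close>.  Forms are taken integral and separated.
\<close>

definition form_over :: "'a::field_char_0 set set \<Rightarrow> nat \<Rightarrow> (nat \<Rightarrow> nat \<Rightarrow> 'a kform) \<Rightarrow>
    'a set \<Rightarrow> 'a set set \<Rightarrow> ('a set \<Rightarrow> nat \<Rightarrow> nat \<Rightarrow> 'a kform) \<Rightarrow> bool" where
  "form_over Y N W R \<A> \<omega> \<longleftrightarrow>
     (\<exists>G. finite G \<and> G \<subseteq> Qbar \<and> R = gen G) \<and>
     affine_atlas R \<A> \<and>
     Y = (\<Union>A\<in>\<A>. spec (gen (Qbar \<union> A))) \<and>
     (\<forall>A\<in>\<A>. \<exists>h \<in> ring_iso (base_change R id (subr A) (subr Qbar)) (subr (gen (Qbar \<union> A))).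
        (\<forall>a\<in>A. h (base_change_in R id (subr A) (subr Qbar) a) = a) \<and>
        (\<forall>c\<in>Qbar. h (base_change_const R id (subr A) (subr Qbar) c) = c)) \<and>
     (\<forall>a<N. \<forall>b<N.
        (\<forall>A\<in>\<A>. \<omega> A a b \<in> kforms (subr A) \<and>
           kaehler_eq ring_of_type_algebra Qbar (\<omega> A a b) (W a b)) \<and>
        (\<forall>A\<in>\<A>. \<forall>B\<in>\<A>. kaehler_eq (subr (gen (A \<union> B))) R (\<omega> A a b) (\<omega> B a b)))"

definition Fpbar :: "nat \<Rightarrow> ((int list \<times> nat) multiset \<Rightarrow> int) ring" where
  "Fpbar p = field.alg_closure (residue_ring (int p))"

text \<open>
  Nilpotence of the p-curvature of the reduction along \<open>\<phi>\<close> from \<open>R\<close> to \<open>Fpbar p\<close>, tested on the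
  basic open subsets of the charts of the reduction, which form a basis of its topology.
\<close>

definition reduction_nilpotent :: "nat \<Rightarrow> nat \<Rightarrow> 'a::field_char_0 set \<Rightarrow> 'a set set \<Rightarrow>
    ('a set \<Rightarrow> nat \<Rightarrow> nat \<Rightarrow> 'a kform) \<Rightarrow>
    ('a \<Rightarrow> (int list \<times> nat) multiset \<Rightarrow> int) \<Rightarrow> bool" where
  "reduction_nilpotent p N R \<A> \<omega> \<phi> \<longleftrightarrow>
     (\<forall>A\<in>\<A>. let C = base_change R \<phi> (subr A) (Fpbar p) in
        \<forall>g\<in>carrier C.
          let \<iota> = (\<lambda>a. away_in C g (base_change_in R \<phi> (subr A) (Fpbar p) a));
              S = (\<lambda>c. away_in C g (base_change_const R \<phi> (subr A) (Fpbar p) c)) ` carrier (Fpbar p)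
          in nilpotent_p_curvature p (away C g) S N (\<lambda>a b. map (map_prod \<iota> \<iota>) (\<omega> A a b)))"

text \<open>
  Any two forms have the same reductions at almost all primes, so quantifying over all forms, each
  with its own finite set of exceptional primes, does not depend on a choice of form.
\<close>

definition globally_nilpotent ::
    "'a::field_char_0 set set \<Rightarrow> nat \<Rightarrow> (nat \<Rightarrow> nat \<Rightarrow> 'a kform) \<Rightarrow> bool" where
  "globally_nilpotent Y N W \<longleftrightarrow>
     (\<forall>R \<A> \<omega>. form_over Y N W R \<A> \<omega> \<longrightarrow>
        finite {p::nat. Factorial_Ring.prime p \<and>
          \<not> (\<forall>\<phi>\<in>ring_hom (subr R) (Fpbar p). reduction_nilpotent p N R \<A> \<omega> \<phi>)})"

end

theory Submission
  imports Defs "Jordan_Normal_Form.Determinant"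
begin

text \<open>
  Let \<open>C(s)\<close> be the p-th power of the covariant derivative of the reduced connection, at the
  parameter \<open>s\<close>, along a coordinate field \<open>D\<close>.  Since \<open>D\<^sup>p = 0\<close>, the Leibniz rule makes \<open>C(s)\<close>
  linear over functions.  A matrix that intertwines the connections at \<open>s\<close> and at \<open>s + e\<^sub>j\<close>
  intertwines \<open>C(s)\<close> and \<open>C(s + e\<^sub>j)\<close>, so the polynomial \<open>\<chi>(s) = det (1 - x C(s))\<close> does not change
  when a parameter is raised by \<open>1\<close>.  At \<open>s = 0\<close> the connection is \<open>d\<close>, hence \<open>C(0) = 0\<close> and
  \<open>\<chi>(0) = 1\<close>.  So \<open>\<chi> = 1\<close> at every natural point, and there \<open>C(s)\<close> is nilpotent.  A rational
  parameter reduces to a residue of a natural number modulo every prime that does not divide its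
  denominator.  This is \<open>periodic_imp_nilpotent\<close>.

  The intertwining matrices are only rational in \<open>s\<close>, so their common denominator may vanish at the
  given point.  They are therefore restricted to the line that joins this point to a natural point
  \<open>z\<close> where the denominator \<open>Q\<close> is not zero.  On this line \<open>\<chi>\<close> is polynomial in the coordinate \<open>t\<close>
  with origin \<open>z\<close>, and a polynomial in \<open>t\<close> whose constant term is invertible can be cancelled, even
  over a ring with zero divisors; the resulting identity is then evaluated at \<open>t = 1\<close>.

  It remains to reduce the data of the pencil modulo \<open>p\<close> in a way that is compatible with the given
  reductions of the chart.  Suppose that infinitely many primes are bad, for one chart \<open>A\<close> over a
  ring \<open>R\<close>, and choose a bad reduction for each.  By Chevalley's extension theorem every
  homomorphism from \<open>R\<close> to the residue field extends to a valuation ring of the function field.  An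
  algebraic number lies in almost all of these valuation rings, since it can only be excluded at a
  prime that divides the leading coefficient of an integer polynomial with this root.  Modulo equality at
  almost all members of the sequence, the places together form a ring homomorphism on \<open>Qbar\<close>, and
  since the chart of \<open>Y\<close> is the base change of \<open>A\<close>, it extends to this chart
  (\<open>limit_of_reductions\<close>).  Every algebraic identity on \<open>Y\<close> consequently holds after reduction at
  almost all members of the sequence.  Smoothness enters here: an identity of forms over the function
  field can be tested by contraction with derivations, it then holds in each local ring because the
  differentials there are free, and it holds on the chart by a partition of unity
  (\<open>pair_form_zero_if_killed\<close>).
\<close>

section \<open>A product of all commutative rings on a type\<close>

text \<open>
  The rings that occur as reductions are records on one type, and the record varies with the
  prime. A fixed type with a ring structure that contains all of them as direct factors lets
  matrices, determinants and polynomials be used uniformly. The extra integer coordinate makes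
  \<open>0\<close> and \<open>1\<close> distinct even if no commutative ring lives on the type.
\<close>

typedef 'b ring_product =
  "{(z :: int, f :: 'b ring \<Rightarrow> 'b). \<forall>R. if cring R then f R \<in> carrier R else f R = undefined}"
  by (rule exI[of _ "(0, \<lambda>R. if cring R then \<zero>\<^bsub>R\<^esub> else undefined)"])
     (auto intro: cring.cring_simprules)

setup_lifting type_definition_ring_product

definition on_crings :: "('b ring \<Rightarrow> 'b) \<Rightarrow> 'b ring \<Rightarrow> 'b" where
  "on_crings f = (\<lambda>R. if cring R then f R else undefined)"

lemma on_crings_eqI: "(\<And>R. cring R \<Longrightarrow> f R = g R) \<Longrightarrow> on_crings f = on_crings g"
  by (auto simp: on_crings_def)

instantiation ring_product :: (type) comm_ring_1
begin

lift_definition zero_ring_product :: "'b ring_product" is "(0, on_crings (\<lambda>R. \<zero>\<^bsub>R\<^esub>))"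
  by (auto simp: on_crings_def intro: cring.cring_simprules)

lift_definition one_ring_product :: "'b ring_product" is "(1, on_crings (\<lambda>R. \<one>\<^bsub>R\<^esub>))"
  by (auto simp: on_crings_def intro: cring.cring_simprules)

lift_definition plus_ring_product :: "'b ring_product \<Rightarrow> 'b ring_product \<Rightarrow> 'b ring_product"
  is "\<lambda>(z, f) (w, g). (z + w, on_crings (\<lambda>R. f R \<oplus>\<^bsub>R\<^esub> g R))"
  by (auto simp: on_crings_def intro!: cring.cring_simprules)

lift_definition times_ring_product :: "'b ring_product \<Rightarrow> 'b ring_product \<Rightarrow> 'b ring_product"
  is "\<lambda>(z, f) (w, g). (z * w, on_crings (\<lambda>R. f R \<otimes>\<^bsub>R\<^esub> g R))"
  by (auto simp: on_crings_def intro!: cring.cring_simprules)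

lift_definition uminus_ring_product :: "'b ring_product \<Rightarrow> 'b ring_product"
  is "\<lambda>(z, f). (- z, on_crings (\<lambda>R. \<ominus>\<^bsub>R\<^esub> f R))"
  by (auto simp: on_crings_def intro!: cring.cring_simprules)

lift_definition minus_ring_product :: "'b ring_product \<Rightarrow> 'b ring_product \<Rightarrow> 'b ring_product"
  is "\<lambda>(z, f) (w, g). (z - w, on_crings (\<lambda>R. f R \<ominus>\<^bsub>R\<^esub> g R))"
  by (auto simp: on_crings_def intro!: cring.cring_simprules)

instance
proof
  fix a b c :: "'b ring_product"
  show "a + b + c = a + (b + c)"
    by transfer (auto simp: on_crings_def intro!: ext cring.cring_simprules)
  show "a + b = b + a"
    by transfer (auto simp: on_crings_def intro!: ext cring.cring_simprules)
  show "0 + a = a"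
    by transfer (auto simp: on_crings_def fun_eq_iff cring.cring_simprules)
  show "- a + a = 0"
    by transfer (auto simp: on_crings_def fun_eq_iff cring.cring_simprules)
  show "a - b = a + - b"
    by transfer (auto simp: on_crings_def fun_eq_iff a_minus_def)
  show "a * b * c = a * (b * c)"
    by transfer (auto simp: on_crings_def intro!: ext cring.cring_simprules)
  show "a * b = b * a"
    by transfer (auto simp: on_crings_def intro!: ext cring.cring_simprules)
  show "1 * a = a"
    by transfer (auto simp: on_crings_def fun_eq_iff cring.cring_simprules(12))
  show "(a + b) * c = a * c + b * c"
    by transfer (auto simp: on_crings_def fun_eq_iff cring.cring_simprules algebra_simps)
  show "(0 :: 'b ring_product) \<noteq> 1"
    by transfer auto
qed

end

lift_definition proj :: "'b ring \<Rightarrow> 'b ring_product \<Rightarrow> 'b" is "\<lambda>R (z, f). f R" .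

text \<open>
  The inclusion of a factor is additive and multiplicative, but it sends the unit to an
  idempotent.
\<close>

definition emb :: "'b ring \<Rightarrow> 'b \<Rightarrow> 'b ring_product" where
  "emb R x = Abs_ring_product (0, on_crings (\<lambda>Q. if Q = R then x else \<zero>\<^bsub>Q\<^esub>))"

context
  fixes R :: "'b ring"
  assumes R: "cring R"
begin

interpretation cring R by (rule R)

lemma proj_closed [simp, intro]: "proj R u \<in> carrier R"
  using Rep_ring_product[of u] R by (auto simp: proj.rep_eq split: prod.splits if_splits)



lemma proj_add: "proj R (u + v) = proj R u \<oplus>\<^bsub>R\<^esub> proj R v"
  by (simp add: proj.rep_eq plus_ring_product.rep_eq on_crings_def R split: prod.splits)

lemma proj_mult: "proj R (u * v) = proj R u \<otimes>\<^bsub>R\<^esub> proj R v"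
  by (simp add: proj.rep_eq times_ring_product.rep_eq on_crings_def R split: prod.splits)

lemma Rep_emb: "x \<in> carrier R \<Longrightarrow>
    Rep_ring_product (emb R x) = (0, on_crings (\<lambda>Q. if Q = R then x else \<zero>\<^bsub>Q\<^esub>))"
  unfolding emb_def
  by (rule Abs_ring_product_inverse) (auto simp: on_crings_def intro: cring.cring_simprules)

lemma proj_emb: "x \<in> carrier R \<Longrightarrow> proj R (emb R x) = x"
  by (simp add: proj.rep_eq Rep_emb on_crings_def R)

lemma emb_inject: "x \<in> carrier R \<Longrightarrow> y \<in> carrier R \<Longrightarrow> emb R x = emb R y \<longleftrightarrow> x = y"
  by (metis proj_emb)

lemma emb_zero: "emb R \<zero>\<^bsub>R\<^esub> = 0"
  by (subst Rep_ring_product_inject[symmetric])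
     (auto simp: Rep_emb zero_ring_product.rep_eq intro!: on_crings_eqI)

lemma emb_add: "x \<in> carrier R \<Longrightarrow> y \<in> carrier R \<Longrightarrow> emb R (x \<oplus>\<^bsub>R\<^esub> y) = emb R x + emb R y"
  by (subst Rep_ring_product_inject[symmetric])
     (auto simp: Rep_emb plus_ring_product.rep_eq on_crings_def fun_eq_iff cring.cring_simprules)

lemma emb_mult: "x \<in> carrier R \<Longrightarrow> y \<in> carrier R \<Longrightarrow> emb R (x \<otimes>\<^bsub>R\<^esub> y) = emb R x * emb R y"
  by (subst Rep_ring_product_inject[symmetric])
     (auto simp: Rep_emb times_ring_product.rep_eq on_crings_def fun_eq_iff cring.cring_simprules)

lemma emb_proj: "emb R (proj R u) = emb R \<one>\<^bsub>R\<^esub> * u"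
  by (subst Rep_ring_product_inject[symmetric])
     (use R Rep_ring_product[of u] in \<open>auto simp: Rep_emb proj.rep_eq times_ring_product.rep_eq 
       on_crings_def fun_eq_iff cring.cring_simprules split: prod.splits if_splits\<close>)

lemma emb_one_mult: "x \<in> carrier R \<Longrightarrow> emb R \<one>\<^bsub>R\<^esub> * emb R x = emb R x"
  by (simp flip: emb_mult)

lemma emb_uminus: "x \<in> carrier R \<Longrightarrow> emb R (\<ominus>\<^bsub>R\<^esub> x) = - emb R x"
  using emb_add[of x "\<ominus>\<^bsub>R\<^esub> x"] by (simp add: r_neg emb_zero eq_neg_iff_add_eq_0 add.commute)

lemma emb_minus: "x \<in> carrier R \<Longrightarrow> y \<in> carrier R \<Longrightarrow> emb R (x \<ominus>\<^bsub>R\<^esub> y) = emb R x - emb R y"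
  by (simp add: a_minus_def emb_add emb_uminus)

lemma emb_finsum:
  "finite A \<Longrightarrow> f \<in> A \<rightarrow> carrier R \<Longrightarrow> emb R (\<Oplus>\<^bsub>R\<^esub>a\<in>A. f a) = (\<Sum>a\<in>A. emb R (f a))"
  by (induction A rule: finite_induct) (auto simp: emb_zero emb_add finsum_closed Pi_def)

lemma emb_pow: "x \<in> carrier R \<Longrightarrow> emb R (x [^]\<^bsub>R\<^esub> (n::nat)) = emb R \<one>\<^bsub>R\<^esub> * emb R x ^ n"
  by (induction n) (auto simp: emb_mult emb_one_mult ac_simps)

lemma emb_ring_of_nat: "emb R ([n] \<cdot>\<^bsub>R\<^esub> \<one>\<^bsub>R\<^esub>) = of_nat n * emb R \<one>\<^bsub>R\<^esub>"
  by (induction n) (auto simp: emb_zero emb_add algebra_simps)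

end

section \<open>Sequences modulo equality at almost all indices\<close>

text \<open>
  The reduced product modulo the filter of cofinite sets. It needs no common unit: the sequences
  below have units that vary with the index.
\<close>

quotient_type 'r reduced = "nat \<Rightarrow> 'r" / "\<lambda>f g. eventually (\<lambda>n. f n = g n) sequentially"
  by (rule equivpI) (auto simp: reflp_def symp_def transp_def eq_commute elim: eventually_elim2)

instantiation reduced :: (comm_ring) comm_ring
begin

lift_definition zero_reduced :: "'a reduced" is "\<lambda>_. 0" .

lift_definition plus_reduced :: "'a reduced \<Rightarrow> 'a reduced \<Rightarrow> 'a reduced" is "\<lambda>f g n. f n + g n"
  by (auto elim: eventually_elim2)

lift_definition times_reduced :: "'a reduced \<Rightarrow> 'a reduced \<Rightarrow> 'a reduced" is "\<lambda>f g n. f n * g n"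
  by (auto elim: eventually_elim2)

lift_definition minus_reduced :: "'a reduced \<Rightarrow> 'a reduced \<Rightarrow> 'a reduced" is "\<lambda>f g n. f n - g n"
  by (auto elim: eventually_elim2)

lift_definition uminus_reduced :: "'a reduced \<Rightarrow> 'a reduced" is "\<lambda>f n. - f n"
  by (auto elim: eventually_mono)

instance
  by standard (transfer, simp add: algebra_simps)+

end

lemma abs_reduced_eq_iff: "abs_reduced f = abs_reduced g \<longleftrightarrow> (\<forall>\<^sub>F n in sequentially. f n = g n)"
  by (rule reduced.abs_eq_iff)

lemma abs_rep_reduced: "abs_reduced (rep_reduced x) = x"
  by (rule Quotient3_abs_rep[OF Quotient3_reduced])

lemma abs_reduced_zero: "abs_reduced (\<lambda>_. 0) = 0"
  by (simp add: zero_reduced.abs_eq)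

lemma abs_reduced_sum: "abs_reduced (\<lambda>n. \<Sum>i\<in>A. f i n) = (\<Sum>i\<in>A. abs_reduced (f i))"
  by (induction A rule: infinite_finite_induct)
     (auto simp: abs_reduced_zero plus_reduced.abs_eq[symmetric])

section \<open>Extension of homomorphisms to valuation rings\<close>

text \<open>
  An algebraically closed field \<open>F\<close> with unit \<open>e\<close>, sitting as a subset
  without the ambient unit in a ring that is a type.
\<close>

locale closed_field_in_ring =
  fixes F :: "'r::comm_ring_1 set" and e :: 'r
  assumes e_in: "e \<in> F" and e_nz: "e \<noteq> 0"
    and add_in: "x \<in> F \<Longrightarrow> y \<in> F \<Longrightarrow> x + y \<in> F"
    and mult_in: "x \<in> F \<Longrightarrow> y \<in> F \<Longrightarrow> x * y \<in> F"
    and uminus_in: "x \<in> F \<Longrightarrow> - x \<in> F"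
    and unit: "x \<in> F \<Longrightarrow> e * x = x"
    and inv: "x \<in> F \<Longrightarrow> x \<noteq> 0 \<Longrightarrow> \<exists>y\<in>F. x * y = e"
    and root: "(\<And>i. c i \<in> F) \<Longrightarrow> 0 < (d::nat) \<Longrightarrow> c d \<noteq> 0 \<Longrightarrow> \<exists>\<beta>\<in>F. (\<Sum>i\<le>d. c i * \<beta> ^ i) = 0"
begin

lemma zero_in: "0 \<in> F"
  using add_in[OF e_in uminus_in[OF e_in]] by simp

lemma unit': "x \<in> F \<Longrightarrow> x * e = x"
  using unit[of x] by (simp add: mult.commute)

definition partial_hom :: "('a::field \<times> 'r) set \<Rightarrow> bool" where
  "partial_hom G \<longleftrightarrow> G \<subseteq> UNIV \<times> F \<and> (1, e) \<in> G \<and>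
     (\<forall>a y b z. (a, y) \<in> G \<longrightarrow> (b, z) \<in> G \<longrightarrow> (a + b, y + z) \<in> G \<and> (a * b, y * z) \<in> G) \<and>
     (\<forall>a y. (a, y) \<in> G \<longrightarrow> (- a, - y) \<in> G) \<and>
     (\<forall>y. (0, y) \<in> G \<longrightarrow> y = 0)"

context
  fixes G :: "('a::field \<times> 'r) set"
  assumes G: "partial_hom G"
begin

lemma hom_range: "(a, y) \<in> G \<Longrightarrow> y \<in> F"
  using G by (auto simp: partial_hom_def)

lemma hom_one: "(1, e) \<in> G"
  using G by (auto simp: partial_hom_def)

lemma hom_add: "(a, y) \<in> G \<Longrightarrow> (b, z) \<in> G \<Longrightarrow> (a + b, y + z) \<in> G"
  using G by (auto simp: partial_hom_def)

lemma hom_mult: "(a, y) \<in> G \<Longrightarrow> (b, z) \<in> G \<Longrightarrow> (a * b, y * z) \<in> G"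
  using G by (auto simp: partial_hom_def)

lemma hom_uminus: "(a, y) \<in> G \<Longrightarrow> (- a, - y) \<in> G"
  using G by (auto simp: partial_hom_def)

lemma hom_minus: "(a, y) \<in> G \<Longrightarrow> (b, z) \<in> G \<Longrightarrow> (a - b, y - z) \<in> G"
  using hom_add[OF _ hom_uminus] by force

lemma hom_zero: "(0, 0) \<in> G"
  using hom_minus[OF hom_one hom_one] by simp

lemma hom_unique: "(a, y) \<in> G \<Longrightarrow> (a, z) \<in> G \<Longrightarrow> y = z"
proof -
  assume "(a, y) \<in> G" "(a, z) \<in> G"
  then have "(0, y - z) \<in> G" using hom_minus by fastforce
  then have "y - z = 0" using G unfolding partial_hom_def by blast
  then show ?thesis by simp
qed

lemma hom_sum: "(\<And>i. i \<in> I \<Longrightarrow> (f i, g i) \<in> G) \<Longrightarrow> ((\<Sum>i\<in>I. f i), (\<Sum>i\<in>I. g i)) \<in> G"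
  by (induction I rule: infinite_finite_induct) (auto simp: hom_zero hom_add)

lemma hom_of_nat: "(of_nat n, of_nat n * e) \<in> G"
  by (induction n) (auto simp: hom_zero algebra_simps intro: hom_add hom_one)

lemma hom_of_int: "(of_int n, of_int n * e) \<in> G"
  by (cases n rule: int_diff_cases) (auto simp: left_diff_distrib intro: hom_minus hom_of_nat)

lemma hom_power: "(a, y) \<in> G \<Longrightarrow> (a ^ k, e * y ^ k) \<in> G"
  by (induction k) (auto simp: hom_one dest: hom_mult simp: ac_simps)

end

lemma extend_maximal:
  assumes G0: "partial_hom (G0 :: ('a::field \<times> 'r) set)"
  obtains G where "G0 \<subseteq> G" "partial_hom G" "\<And>G'. partial_hom G' \<Longrightarrow> G \<subseteq> G' \<Longrightarrow> G' = G"
proof -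
  define S where "S = {G :: ('a \<times> 'r) set. partial_hom G \<and> G0 \<subseteq> G}"
  have "\<exists>M\<in>S. (\<forall>Z\<in>S. M \<subseteq> Z \<longrightarrow> Z = M)"
  proof (rule subset_Zorn_nonempty)
    show "S \<noteq> {}" using G0 by (auto simp: S_def)
    fix C assume C: "C \<noteq> {}" "subset.chain S C"
    have mem: "partial_hom Z" "G0 \<subseteq> Z" if "Z \<in> C" for Z
      using C that by (auto simp: subset_chain_def S_def)
    have pair: "\<exists>Z\<in>C. x \<in> Z \<and> y \<in> Z" if "x \<in> \<Union>C" "y \<in> \<Union>C" for x y
      using C(2) that unfolding subset_chain_def by blast
    have "partial_hom (\<Union>C)"
      unfolding partial_hom_def
    proof (intro conjI allI impI)
      show "\<Union>C \<subseteq> UNIV \<times> F" using hom_range[OF mem(1)] by auto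
      obtain Z where "Z \<in> C" using C(1) by blast
      then show "(1, e) \<in> \<Union>C" using hom_one[OF mem(1)] by blast
    next
      fix a y b z assume "(a, y) \<in> \<Union>C" "(b, z) \<in> \<Union>C"
      from pair[OF this] obtain Z where Z: "Z \<in> C" "(a, y) \<in> Z" "(b, z) \<in> Z" by blast
      show "(a + b, y + z) \<in> \<Union>C" "(a * b, y * z) \<in> \<Union>C"
        using Z hom_add[OF mem(1)[OF Z(1)]] hom_mult[OF mem(1)[OF Z(1)]] by blast+
    next
      fix a y assume "(a, y) \<in> \<Union>C"
      then obtain Z where Z: "Z \<in> C" "(a, y) \<in> Z" by blast
      then show "(- a, - y) \<in> \<Union>C" using hom_uminus[OF mem(1)[OF Z(1)] Z(2)] by blast
    next
      fix y assume "(0, y) \<in> \<Union>C"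
      then obtain Z where Z: "Z \<in> C" "(0, y) \<in> Z" by blast
      then show "y = 0" using hom_unique[OF mem(1)[OF Z(1)] Z(2) hom_zero[OF mem(1)[OF Z(1)]]] by simp
    qed
    moreover obtain Z where "Z \<in> C" using C(1) by blast
    then have "G0 \<subseteq> \<Union>C" using mem(2)[of Z] by blast
    ultimately show "\<Union>C \<in> S" by (simp add: S_def)
  qed
  then obtain M where M: "M \<in> S" and max: "\<forall>Z\<in>S. M \<subseteq> Z \<longrightarrow> Z = M" by (rule bexE)
  show thesis
  proof (rule that[of M])
    fix G' assume "partial_hom G'" "M \<subseteq> G'"
    then show "G' = M" using M max by (auto simp: S_def)
  qed (use M in \<open>auto simp: S_def\<close>)
qed

context
  fixes G :: "('a::field \<times> 'r) set"
  assumes G: "partial_hom G"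
    and max: "\<And>G'. partial_hom G' \<Longrightarrow> G \<subseteq> G' \<Longrightarrow> G' = G"
begin

text \<open>
  Otherwise the homomorphism would extend to the localization at the elements with nonzero
  value.
\<close>

lemma maximal_inverse:
  assumes b: "(b, w) \<in> G" and wz: "w * z = e" and z: "z \<in> F"
  shows "(inverse b, z) \<in> G"
proof -
  define G' where "G' = {(a / b, y * z) | a b y w z. (a, y) \<in> G \<and> (b, w) \<in> G \<and> z \<in> F \<and> w * z = e}"
  have I: "(a / b, y * z) \<in> G'" if "(a, y) \<in> G" "(b, w) \<in> G" "z \<in> F" "w * z = e" for a b y w z
    using that unfolding G'_def by blast
  have nz: "b \<noteq> 0" if "(b, w) \<in> G" "w * z = e" for b w z
    using that e_nz hom_unique[OF G _ hom_zero[OF G], of w] by auto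
  have sub: "G \<subseteq> G'"
  proof
    fix x assume "x \<in> G"
    then have "(fst x / 1, snd x * e) \<in> G'"
      by (intro I[of _ _ 1 e]) (use hom_one[OF G] e_in unit[OF e_in] in auto)
    then show "x \<in> G'" using \<open>x \<in> G\<close> unit' hom_range[OF G, of "fst x" "snd x"] by simp
  qed
  have "partial_hom G'"
    unfolding partial_hom_def
  proof (intro conjI allI impI)
    show "G' \<subseteq> UNIV \<times> F" unfolding G'_def using hom_range[OF G] by (auto intro!: mult_in)
    show "(1, e) \<in> G'" using sub hom_one[OF G] by blast
  next
    fix x u x' u' assume "(x, u) \<in> G'" "(x', u') \<in> G'"
    then obtain a b y w z a' b' y' w' z' where *: "x = a / b" "u = y * z" "(a, y) \<in> G" "(b, w) \<in> G" "z \<in> F" "w * z = e"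
      "x' = a' / b'" "u' = y' * z'" "(a', y') \<in> G" "(b', w') \<in> G" "z' \<in> F" "w' * z' = e"
      unfolding G'_def by auto
    have nzs: "b \<noteq> 0" "b' \<noteq> 0" using nz * by blast+
    have ee: "w * w' * (z * z') = e"
    proof -
      have "w * w' * (z * z') = (w * z) * (w' * z')" by (simp only: ac_simps)
      then show ?thesis using * unit[OF e_in] by simp
    qed
    have "((a * b' + a' * b) / (b * b'), (y * w' + y' * w) * (z * z')) \<in> G'"
      by (rule I[of _ _ _ "w * w'"]) (use * ee in \<open>auto intro!: hom_add[OF G] hom_mult[OF G] mult_in\<close>)
    moreover have "(a * b' + a' * b) / (b * b') = x + x'"
      using nzs * by (simp add: add_frac_eq)
    moreover have "(y * w' + y' * w) * (z * z') = u + u'"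
    proof -
      have "(y * w' + y' * w) * (z * z') = (w' * z') * (y * z) + (w * z) * (y' * z')"
        by (simp only: distrib_right distrib_left ac_simps)
      then show ?thesis using * by (simp add: unit mult_in hom_range[OF G])
    qed
    ultimately show "(x + x', u + u') \<in> G'" by simp
    have "((a * a') / (b * b'), (y * y') * (z * z')) \<in> G'"
      by (rule I[of _ _ _ "w * w'"]) (use * ee in \<open>auto intro!: hom_add[OF G] hom_mult[OF G] mult_in\<close>)
    then show "(x * x', u * u') \<in> G'" using * by (simp add: ac_simps)
  next
    fix x u assume "(x, u) \<in> G'"
    then obtain a b y w z where *: "x = a / b" "u = y * z" "(a, y) \<in> G" "(b, w) \<in> G" "z \<in> F" "w * z = e"
      unfolding G'_def by auto
    show "(- x, - u) \<in> G'" using I[OF hom_uminus[OF G *(3)] *(4-6)] * by simp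
  next
    fix u assume "(0, u) \<in> G'"
    then obtain a b y w z where *: "0 = a / b" "u = y * z" "(a, y) \<in> G" "(b, w) \<in> G" "z \<in> F" "w * z = e"
      unfolding G'_def by blast
    then have "a = 0" using nz by auto
    then have "y = 0" using * hom_unique[OF G _ hom_zero[OF G]] by blast
    then show "u = 0" using * by simp
  qed
  with max sub have "G' = G" by blast
  moreover have "(1 / b, e * z) \<in> G'" using b wz z hom_one[OF G] by (intro I)
  ultimately show ?thesis using unit z by (simp add: inverse_eq_divide)
qed

definition small_relation :: "'a \<Rightarrow> 'a poly \<Rightarrow> bool" where
  "small_relation x f \<longleftrightarrow> poly f x = 1 \<and> (\<forall>i. (Polynomial.coeff f i, 0) \<in> G)"

text \<open>
  If the maximal ideal generates a proper ideal after adjoining \<open>x\<close>, then the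
  residue field of the new ring is generated by the image of \<open>x\<close>; the target being
  algebraically closed, the homomorphism extends, so maximality puts \<open>x\<close> into the
  domain.
\<close>

lemma maximal_adjoin:
  assumes no: "\<And>f. \<not> small_relation x f"
  shows "\<exists>\<beta>. (x, \<beta>) \<in> G"
proof -
  define P where "P = {(f, g). \<forall>i. (Polynomial.coeff f i, Polynomial.coeff g i) \<in> G}"
  have coeffF: "Polynomial.coeff g i \<in> F" if "(f, g) \<in> P" for f g i
    using that hom_range[OF G] unfolding P_def by blast
  have P_add: "(f + f', g + g') \<in> P" and P_mult: "(f * f', g * g') \<in> P"
    if "(f, g) \<in> P" "(f', g') \<in> P" for f g f' g'
    using that by (auto simp: P_def coeff_mult intro!: hom_add[OF G] hom_sum[OF G] hom_mult[OF G])
  have P_uminus: "(- f, - g) \<in> P" if "(f, g) \<in> P" for f g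
    using that by (auto simp: P_def intro!: hom_uminus[OF G])
  have P_minus: "(f - f', g - g') \<in> P" if "(f, g) \<in> P" "(f', g') \<in> P" for f g f' g'
    using P_add[OF that(1) P_uminus[OF that(2)]] by simp
  have P_monom: "(Polynomial.monom a k, Polynomial.monom y k) \<in> P" if "(a, y) \<in> G" for a y k
    using that by (auto simp: P_def hom_zero[OF G])
  have polyF: "poly g \<beta> \<in> F" if "(f, g) \<in> P" "\<beta> \<in> F" for f g \<beta>
  proof -
    have pw: "c * \<beta> ^ i \<in> F" if "c \<in> F" for c i
      using \<open>\<beta> \<in> F\<close> that by (induction i arbitrary: c) (auto simp: mult.assoc[symmetric] intro: mult_in)
    have sm: "sum h A \<in> F" if "\<And>i. i \<in> A \<Longrightarrow> h i \<in> F" for h :: "nat \<Rightarrow> 'r" and A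
      using that by (induction A rule: infinite_finite_induct) (auto intro: add_in zero_in)
    show ?thesis unfolding poly_altdef by (intro sm pw coeffF[OF that(1)])
  qed
  define rel where "rel = {(f, g). (f, g) \<in> P \<and> poly f x = 0}"
  have "\<exists>\<beta>\<in>F. \<forall>(f, g)\<in>rel. poly g \<beta> = 0"
  proof (cases "\<forall>(f, g)\<in>rel. g = 0")
    case True
    then show ?thesis using zero_in by (intro bexI[of _ 0]) auto
  next
    case False
    define Q where "Q d \<longleftrightarrow> (\<exists>f g. (f, g) \<in> rel \<and> g \<noteq> 0 \<and> Polynomial.degree g = d)" for d
    define d where "d = (LEAST d. Q d)"
    have "\<exists>d. Q d" using False by (auto simp: Q_def)
    then have "Q d" unfolding d_def by (rule LeastI_ex)
    then obtain f0 g0 where fg0: "(f0, g0) \<in> rel" "g0 \<noteq> 0" "Polynomial.degree g0 = d"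
      by (auto simp: Q_def)
    have min: "d \<le> Polynomial.degree g" if "(f, g) \<in> rel" "g \<noteq> 0" for f g
      unfolding d_def by (rule Least_le) (use that in \<open>auto simp: Q_def\<close>)
    have P0: "(f0, g0) \<in> P" "poly f0 x = 0" using fg0 by (auto simp: rel_def)
    have G0: "(Polynomial.coeff f0 i, Polynomial.coeff g0 i) \<in> G" for i
      using P0 by (auto simp: P_def)
    have lc: "Polynomial.coeff g0 d \<noteq> 0" using fg0 by (metis leading_coeff_0_iff)
    then obtain z where z: "z \<in> F" "Polynomial.coeff g0 d * z = e"
      using inv coeffF[OF P0(1)] by blast
    have invd: "(inverse (Polynomial.coeff f0 d), z) \<in> G"
      by (rule maximal_inverse[OF G0 z(2,1)])
    have f0d: "Polynomial.coeff f0 d \<noteq> 0"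
      using G0[of d] lc hom_unique[OF G _ hom_zero[OF G]] by auto
    have "0 < d"
    proof (rule ccontr)
      assume "\<not> 0 < d"
      then have d: "d = 0" by simp
      define f where "f = 1 - Polynomial.smult (inverse (Polynomial.coeff f0 0)) f0"
      have "(Polynomial.coeff f i, 0) \<in> G" for i
      proof (cases "i = 0")
        case True
        then show ?thesis using f0d d hom_zero[OF G] by (simp add: f_def)
      next
        case False
        then have "Polynomial.coeff g0 i = 0" using fg0 d by (simp add: coeff_eq_0)
        then have "(Polynomial.coeff f0 i, 0) \<in> G" using G0[of i] by simp
        then have "(inverse (Polynomial.coeff f0 0) * Polynomial.coeff f0 i, z * 0) \<in> G"
          using hom_mult[OF G] invd d by blast
        from hom_uminus[OF G this] show ?thesis using False by (simp add: f_def coeff_1)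
      qed
      moreover have "poly f x = 1" using P0 by (simp add: f_def)
      ultimately show False using no[of f] by (simp add: small_relation_def)
    qed
    then obtain \<beta> where \<beta>: "\<beta> \<in> F" "(\<Sum>i\<le>d. Polynomial.coeff g0 i * \<beta> ^ i) = 0"
      using root[of "Polynomial.coeff g0" d] coeffF[OF P0(1)] lc by blast
    then have g0\<beta>: "poly g0 \<beta> = 0" by (simp add: poly_altdef fg0)
    have "poly g \<beta> = 0" if "(f, g) \<in> rel" for f g
      using that
    proof (induction "Polynomial.degree g" arbitrary: f g rule: less_induct)
      case less
      show ?case
      proof (cases "g = 0")
        case False
        define n where "n = Polynomial.degree g"
        define c where "c = Polynomial.coeff g n"
        define a where "a = Polynomial.coeff f n"
        have dn: "d \<le> n" using min[OF less.prems False] by (simp add: n_def)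
        have fgP: "(f, g) \<in> P" using less.prems by (simp add: rel_def)
        have ac: "(a * inverse (Polynomial.coeff f0 d), c * z) \<in> G"
          unfolding a_def c_def by (intro hom_mult[OF G] invd) (use fgP in \<open>auto simp: P_def\<close>)
        define f' where "f' = f - Polynomial.monom (a * inverse (Polynomial.coeff f0 d)) (n - d) * f0"
        define g' where "g' = g - Polynomial.monom (c * z) (n - d) * g0"
        have rel': "(f', g') \<in> rel"
          using less.prems fgP P0 P_minus[OF fgP P_mult[OF P_monom[OF ac] P0(1)]]
          by (auto simp: rel_def f'_def g'_def)
        have top: "Polynomial.coeff g' k = 0" if "n \<le> k" for k
        proof (cases "k = n")
          case True
          have "c * z * Polynomial.coeff g0 d = c"
            using z(2) unit'[OF coeffF[OF fgP, of n]] by (simp add: mult.assoc mult.commute[of z] c_def)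
          then show ?thesis using True dn by (simp add: g'_def coeff_monom_mult c_def)
        next
          case False
          then have "n < k" using that by simp
          then show ?thesis using dn fg0
            by (simp add: g'_def coeff_monom_mult n_def[symmetric] coeff_eq_0)
        qed
        have "poly g' \<beta> = 0"
        proof (cases "g' = 0")
          case False
          then have "Polynomial.degree g' < n"
            using top by (metis leading_coeff_0_iff not_le)
          then show ?thesis using less.hyps rel' by (simp add: n_def)
        qed simp
        then show ?thesis by (simp add: g'_def g0\<beta>)
      qed simp
    qed
    then show ?thesis using \<beta> by blast
  qed
  then obtain \<beta> where \<beta>: "\<beta> \<in> F" "\<And>f g. (f, g) \<in> P \<Longrightarrow> poly f x = 0 \<Longrightarrow> poly g \<beta> = 0"
    by (auto simp: rel_def)
  define G' where "G' = {(poly f x, poly g \<beta>) | f g. (f, g) \<in> P}"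
  have I: "(poly f x, poly g \<beta>) \<in> G'" if "(f, g) \<in> P" for f g
    using that by (auto simp: G'_def)
  have sub: "G \<subseteq> G'"
  proof
    fix p assume "p \<in> G"
    then have "(Polynomial.monom (fst p) 0, Polynomial.monom (snd p) 0) \<in> P"
      by (intro P_monom) simp
    from I[OF this] show "p \<in> G'" by (simp add: poly_monom)
  qed
  have "partial_hom G'"
    unfolding partial_hom_def
  proof (intro conjI allI impI)
    show "G' \<subseteq> UNIV \<times> F" using polyF \<beta>(1) by (auto simp: G'_def)
    show "(1, e) \<in> G'" using sub hom_one[OF G] by blast
  next
    fix a y b z assume "(a, y) \<in> G'" "(b, z) \<in> G'"
    then obtain f g f' g' where *: "(f, g) \<in> P" "(f', g') \<in> P" "a = poly f x" "y = poly g \<beta>"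
      "b = poly f' x" "z = poly g' \<beta>" by (auto simp: G'_def)
    show "(a + b, y + z) \<in> G'" "(a * b, y * z) \<in> G'"
      using I[OF P_add[OF *(1,2)]] I[OF P_mult[OF *(1,2)]] * by auto
  next
    fix a y assume "(a, y) \<in> G'"
    then obtain f g where *: "(f, g) \<in> P" "a = poly f x" "y = poly g \<beta>" by (auto simp: G'_def)
    show "(- a, - y) \<in> G'" using I[OF P_uminus[OF *(1)]] * by auto
  next
    fix y assume "(0, y) \<in> G'"
    then show "y = 0" using \<beta>(2) by (fastforce simp: G'_def)
  qed
  with max sub have "G' = G" by blast
  moreover have "(poly (Polynomial.monom 1 1) x, poly (Polynomial.monom e 1) \<beta>) \<in> G'"
    by (intro I P_monom hom_one[OF G])
  ultimately show ?thesis by (auto simp: poly_monom)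
qed

text \<open>
  The classical descent of Chevalley: the constant terms are units up to the maximal ideal, so
  the shorter relation for \<open>1/x\<close>, multiplied by a power of \<open>x\<close>,
  removes the leading term of the longer relation for \<open>x\<close>.
\<close>

lemma small_relation_reduce:
  assumes x: "x \<noteq> 0" and f: "small_relation x f" and g: "small_relation (inverse x) g"
    and le: "Polynomial.degree g \<le> Polynomial.degree f"
  shows "\<exists>f'. small_relation x f' \<and> Polynomial.degree f' < Polynomial.degree f"
proof -
  define l where "l = Polynomial.degree g"
  define m where "m = Polynomial.degree f"
  have small_mult: "(a * b, 0) \<in> G" if "(a, y) \<in> G" "(b, 0) \<in> G" for a b y
    using hom_mult[OF G that] by simp
  have gc: "(Polynomial.coeff g i, 0) \<in> G" and fc: "(Polynomial.coeff f i, 0) \<in> G" for i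
    using f g by (auto simp: small_relation_def)
  have "(1 - Polynomial.coeff g 0, e - 0) \<in> G"
    by (intro hom_minus[OF G] hom_one[OF G] gc)
  then have one: "(1 - Polynomial.coeff g 0, e) \<in> G" by simp
  have u: "(inverse (1 - Polynomial.coeff g 0), e) \<in> G"
    by (rule maximal_inverse[OF one]) (use e_in unit in auto)
  have nz: "1 - Polynomial.coeff g 0 \<noteq> 0"
    using one hom_unique[OF G _ hom_zero[OF G]] e_nz by fastforce
  have m0: "m \<noteq> 0"
  proof
    assume "m = 0"
    then obtain c where "f = [:c:]"
      unfolding m_def by (rule degree_eq_zeroE)
    then have "Polynomial.coeff f 0 = 1"
      using f by (simp add: small_relation_def)
    then have "(1, 0) \<in> G" using fc[of 0] by simp
    then show False using hom_unique[OF G hom_one[OF G]] e_nz by blast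
  qed
  define h where "h = (\<Sum>i\<in>{1..l}. Polynomial.monom (inverse (1 - Polynomial.coeff g 0) * Polynomial.coeff g i) (l - i))"
  have hx: "poly h x = x ^ l"
  proof -
    have "1 = (\<Sum>i\<le>l. Polynomial.coeff g i * inverse x ^ i)"
      using g by (simp add: small_relation_def poly_altdef l_def)
    then have "x ^ l = x ^ l * (\<Sum>i\<le>l. Polynomial.coeff g i * inverse x ^ i)" by simp
    also have "\<dots> = (\<Sum>i\<le>l. Polynomial.coeff g i * x ^ (l - i))"
      unfolding sum_distrib_left using x by (intro sum.cong) (auto simp: power_diff power_inverse field_simps)
    also have "\<dots> = Polynomial.coeff g 0 * x ^ l + (\<Sum>i\<in>{1..l}. Polynomial.coeff g i * x ^ (l - i))"
      by (simp add: atMost_atLeast0 sum.atLeast_Suc_atMost)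
    finally have "(1 - Polynomial.coeff g 0) * x ^ l = (\<Sum>i\<in>{1..l}. Polynomial.coeff g i * x ^ (l - i))"
      by (simp add: algebra_simps)
    then have "x ^ l = inverse (1 - Polynomial.coeff g 0) * (\<Sum>i\<in>{1..l}. Polynomial.coeff g i * x ^ (l - i))"
      using nz by (metis (no_types, lifting) divide_inverse_commute nonzero_mult_div_cancel_left)
    then show ?thesis by (simp add: h_def poly_sum poly_monom sum_distrib_left mult.assoc)
  qed
  have hdeg: "Polynomial.coeff h k = 0" if "l \<le> k" for k
    unfolding h_def coeff_sum using that by (intro sum.neutral) auto
  have hc: "(Polynomial.coeff h k, 0) \<in> G" for k
  proof -
    have "(Polynomial.coeff h k, \<Sum>i\<in>{1..l}. 0) \<in> G"
      unfolding h_def coeff_sum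
      by (intro hom_sum[OF G]) (auto intro: small_mult[OF u gc] hom_zero[OF G])
    then show ?thesis by simp
  qed
  define a where "a = Polynomial.coeff f m"
  define f' where "f' = f - Polynomial.monom a m + Polynomial.monom a (m - l) * h"
  have lm: "l \<le> m" using le by (simp add: l_def m_def)
  have "poly f' x = 1"
    using f lm by (simp add: f'_def hx poly_monom small_relation_def mult.assoc power_add[symmetric])
  moreover have "(Polynomial.coeff f' k, 0) \<in> G" for k
  proof -
    have "(a, 0) \<in> G" by (simp add: a_def fc)
    then have "(Polynomial.coeff f k - Polynomial.coeff (Polynomial.monom a m) k +
        Polynomial.coeff (Polynomial.monom a (m - l) * h) k, 0 - 0 + 0) \<in> G"
      by (intro hom_add[OF G] hom_minus[OF G] fc)
        (auto simp: coeff_monom_mult hom_zero[OF G] intro!: small_mult hc)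
    then show ?thesis by (simp add: f'_def)
  qed
  ultimately have "small_relation x f'" by (simp add: small_relation_def)
  moreover have "Polynomial.coeff f' k = 0" if "m \<le> k" for k
    using that lm hdeg[of "k - (m - l)"] coeff_eq_0[of f k]
    by (cases "k = m") (auto simp: f'_def coeff_monom_mult a_def m_def)
  then have "Polynomial.degree f' < m"
    using m0 by (metis degree_0 leading_coeff_0_iff not_le neq0_conv)
  ultimately show ?thesis by (auto simp: m_def)
qed

lemma no_small_relations:
  assumes "x \<noteq> 0" "small_relation x f" "small_relation (inverse x) g"
  shows False
  using assms
proof (induction "Polynomial.degree f + Polynomial.degree g" arbitrary: x f g rule: less_induct)
  case less
  show ?case
  proof (cases "Polynomial.degree g \<le> Polynomial.degree f")
    case True
    then obtain f' where "small_relation x f'" "Polynomial.degree f' < Polynomial.degree f"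
      using small_relation_reduce[of x f g] less.prems by auto
    then show ?thesis using less.hyps[of f' g x] less.prems by simp
  next
    case False
    then obtain g' where "small_relation (inverse x) g'" "Polynomial.degree g' < Polynomial.degree g"
      using small_relation_reduce[of "inverse x" g f] less.prems by auto
    then show ?thesis using less.hyps[of f g' x] less.prems by simp
  qed
qed

lemma maximal_valuation:
  "(\<exists>y. (x, y) \<in> G) \<or> (x \<noteq> 0 \<and> (inverse x, 0) \<in> G)"
proof (cases "x = 0 \<or> (\<exists>y. (x, y) \<in> G)")
  case True
  then show ?thesis using hom_zero[OF G] by auto
next
  case False
  then obtain f where "small_relation x f"
    using maximal_adjoin[of x] by blast
  then have "\<not> small_relation (inverse x) g" for g
    using no_small_relations[of x f g] False by blast
  then have "\<exists>y. (inverse x, y) \<in> G"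
    using maximal_adjoin[of "inverse x"] by blast
  then obtain y where y: "(inverse x, y) \<in> G" by blast
  have "y = 0"
  proof (rule ccontr)
    assume "y \<noteq> 0"
    then obtain z where "z \<in> F" "y * z = e" using inv hom_range[OF G y] by blast
    then have "(inverse (inverse x), z) \<in> G" using maximal_inverse[OF y] by blast
    then show False using False by simp
  qed
  then show ?thesis using False y by blast
qed

end

text \<open>
  A maximal extension has a valuation ring as its domain, since \<open>x\<close> and
  \<open>1/x\<close> cannot both generate the unit ideal together with the maximal ideal.
\<close>

theorem extension_to_valuation_ring:
  assumes "partial_hom (G0 :: ('a::field \<times> 'r) set)"
  obtains G where "G0 \<subseteq> G" "partial_hom G"
    "\<And>x. (\<exists>y. (x, y) \<in> G) \<or> (x \<noteq> 0 \<and> (inverse x, 0) \<in> G)"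
proof -
  obtain G where G: "G0 \<subseteq> G" "partial_hom G" "\<And>G'. partial_hom G' \<Longrightarrow> G \<subseteq> G' \<Longrightarrow> G' = G"
    using extend_maximal[OF assms] by blast
  then show thesis using that maximal_valuation by blast
qed

end

section \<open>Connections in characteristic p and gauge transformations\<close>

lemma sum_below:
  "(\<Sum>b<N. f b * (if b < N then g b else c)) = (\<Sum>b<N. f b * g b)"
  for N :: nat
  by (rule sum.cong) auto

locale derivation =
  fixes D :: "'r::comm_ring_1 \<Rightarrow> 'r"
  assumes add: "D (x + y) = D x + D y"
    and mult: "D (x * y) = x * D y + y * D x"
begin

lemma zero [simp]: "D 0 = 0"
  using add[of 0 0] by simp

lemma uminus: "D (- x) = - D x"
  using add[of x "- x"] by (simp add: eq_neg_iff_add_eq_0 add.commute)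

lemma minus: "D (x - y) = D x - D y"
  using add[of x "- y"] by (simp add: uminus)

lemma one [simp]: "D 1 = 0"
  using mult[of 1 1] by simp

lemma sum: "D (\<Sum>i\<in>A. f i) = (\<Sum>i\<in>A. D (f i))"
  by (induction A rule: infinite_finite_induct) (auto simp: add)

lemma of_nat [simp]: "D (of_nat n) = 0"
  by (induction n) (auto simp: add)

lemma of_int [simp]: "D (of_int n) = 0"
  by (cases n) (auto simp: uminus minus add)


lemma const_power: "D c = 0 \<Longrightarrow> D (c ^ k) = 0"
  by (induction k) (auto simp: mult)

lemma const_prod: "(\<And>i. i \<in> A \<Longrightarrow> D (f i) = 0) \<Longrightarrow> D (\<Prod>i\<in>A. f i) = 0"
  by (induction A rule: infinite_finite_induct) (auto simp: mult)

definition cov :: "nat \<Rightarrow> (nat \<Rightarrow> nat \<Rightarrow> 'r) \<Rightarrow> (nat \<Rightarrow> 'r) \<Rightarrow> nat \<Rightarrow> 'r" where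
  "cov N W v = (\<lambda>a. if a < N then D (v a) - (\<Sum>b<N. W a b * v b) else 0)"

lemma cov_add: "cov N W (\<lambda>a. v a + w a) = (\<lambda>a. cov N W v a + cov N W w a)"
  by (auto simp: cov_def fun_eq_iff add algebra_simps sum.distrib)

lemma cov_cong: "(\<And>a. a < N \<Longrightarrow> v a = w a) \<Longrightarrow> cov N W v = cov N W w"
  by (auto simp: cov_def fun_eq_iff intro!: sum.cong)

lemma cov_pow_cong:
  assumes "\<And>a. a < N \<Longrightarrow> v a = w a" "0 < k"
  shows "(cov N W ^^ k) v = (cov N W ^^ k) w"
proof -
  obtain l where k: "k = Suc l" using assms(2) by (cases k) auto
  show ?thesis unfolding k using cov_cong[OF assms(1)] by (simp add: funpow_Suc_right del: funpow.simps)
qed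

lemma cov_pow_add:
  "(cov N W ^^ k) (\<lambda>a. v a + w a) = (\<lambda>a. (cov N W ^^ k) v a + (cov N W ^^ k) w a)"
  by (induction k) (auto simp: cov_add)

lemma cov_pow_zero: "(cov N W ^^ k) (\<lambda>a. 0) = (\<lambda>a. 0)"
  by (induction k) (auto simp: cov_def fun_eq_iff)

lemma cov_pow_sum:
  "(cov N W ^^ k) (\<lambda>a. \<Sum>i\<in>A. f i a) = (\<lambda>a. \<Sum>i\<in>A. (cov N W ^^ k) (f i) a)"
  by (induction A rule: infinite_finite_induct) (auto simp: cov_pow_zero cov_pow_add)

lemma binomial_shift:
  fixes g :: "nat \<Rightarrow> nat \<Rightarrow> 'r"
  shows "(\<Sum>i\<le>k. of_nat (k choose i) * (g (Suc i) (k - i) + g i (Suc k - i))) =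
    (\<Sum>i\<le>Suc k. of_nat (Suc k choose i) * g i (Suc k - i))"
proof -
  have "(\<Sum>i\<le>Suc k. of_nat (Suc k choose i) * g i (Suc k - i)) =
      g 0 (Suc k) + (\<Sum>i\<le>k. of_nat (k choose Suc i) * g (Suc i) (k - i))
      + (\<Sum>i\<le>k. of_nat (k choose i) * g (Suc i) (k - i))"
    unfolding sum.atMost_Suc_shift[of _ k] by (simp add: algebra_simps sum.distrib)
  also have "g 0 (Suc k) + (\<Sum>i\<le>k. of_nat (k choose Suc i) * g (Suc i) (k - i)) =
      (\<Sum>i\<le>Suc k. of_nat (k choose i) * g i (Suc k - i))"
    unfolding sum.atMost_Suc_shift[of _ k] by simp
  also have "\<dots> = (\<Sum>i\<le>k. of_nat (k choose i) * g i (Suc k - i))"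
    by (simp add: binomial_eq_0)
  finally show ?thesis by (simp add: algebra_simps sum.distrib)
qed

text \<open>
  In characteristic \<open>p\<close> only the two outer terms survive for \<open>k = p\<close>,
  and one of them vanishes if \<open>D\<^sup>p = 0\<close>; this is why the p-th power is linear
  over functions.
\<close>

lemma cov_pow_leibniz:
  assumes "a < N"
  shows "(cov N W ^^ k) (\<lambda>a. f * v a) a =
    (\<Sum>i\<le>k. of_nat (k choose i) * ((D ^^ i) f * (cov N W ^^ (k - i)) v a))"
  using assms
proof (induction k arbitrary: a)
  case 0
  then show ?case by simp
next
  case (Suc k)
  have "(cov N W ^^ Suc k) (\<lambda>a. f * v a) a =
     D ((cov N W ^^ k) (\<lambda>a. f * v a) a) - (\<Sum>b<N. W a b * (cov N W ^^ k) (\<lambda>a. f * v a) b)"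
    using Suc.prems by (simp add: cov_def)
  also have "\<dots> = (\<Sum>i\<le>k. D (of_nat (k choose i) * ((D ^^ i) f * (cov N W ^^ (k - i)) v a)))
     - (\<Sum>i\<le>k. of_nat (k choose i) * ((D ^^ i) f * (\<Sum>b<N. W a b * (cov N W ^^ (k - i)) v b)))"
    using Suc by (simp add: sum sum_distrib_left sum.swap[of _ "{..k}"] ac_simps)
  also have "\<dots> = (\<Sum>i\<le>k. of_nat (k choose i) *
     ((D ^^ Suc i) f * (cov N W ^^ (k - i)) v a + (D ^^ i) f * (cov N W ^^ (Suc k - i)) v a))"
    unfolding sum_subtractf[symmetric]
    using Suc.prems by (intro sum.cong) (auto simp: mult Suc_diff_le cov_def algebra_simps)
  also have "\<dots> = (\<Sum>i\<le>Suc k. of_nat (Suc k choose i) * ((D ^^ i) f * (cov N W ^^ (Suc k - i)) v a))"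
    by (rule binomial_shift)
  finally show ?case .
qed

definition app :: "nat \<Rightarrow> (nat \<Rightarrow> nat \<Rightarrow> 'r) \<Rightarrow> (nat \<Rightarrow> 'r) \<Rightarrow> nat \<Rightarrow> 'r" where
  "app N P v = (\<lambda>a. if a < N then (\<Sum>b<N. P a b * v b) else 0)"

text \<open>
  The equation \<open>dP = W' P - P W\<close>, contracted with the derivation; it says that
  \<open>P\<close> maps \<open>d - W\<close> to \<open>d - W'\<close>.
\<close>

definition gauge :: "nat \<Rightarrow> (nat \<Rightarrow> nat \<Rightarrow> 'r) \<Rightarrow> (nat \<Rightarrow> nat \<Rightarrow> 'r) \<Rightarrow> (nat \<Rightarrow> nat \<Rightarrow> 'r) \<Rightarrow> bool" where
  "gauge N W W' P \<longleftrightarrow> (\<forall>a<N. \<forall>b<N.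
     D (P a b) = (\<Sum>c<N. W' a c * P c b) - (\<Sum>c<N. P a c * W c b))"

lemma cov_gauge:
  assumes "gauge N W W' P"
  shows "cov N W' (app N P v) = app N P (cov N W v)"
proof
  fix a
  have "D (\<Sum>b<N. P a b * v b) - (\<Sum>c<N. W' a c * (\<Sum>b<N. P c b * v b)) =
     (\<Sum>b<N. P a b * (D (v b) - (\<Sum>c<N. W b c * v c)))" if "a < N"
  proof -
    have "D (\<Sum>b<N. P a b * v b) = (\<Sum>b<N. P a b * D (v b)) +
       (\<Sum>b<N. v b * ((\<Sum>c<N. W' a c * P c b) - (\<Sum>c<N. P a c * W c b)))"
      using assms that by (simp add: sum mult gauge_def sum.distrib)
    also have "(\<Sum>b<N. v b * ((\<Sum>c<N. W' a c * P c b) - (\<Sum>c<N. P a c * W c b))) =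
       (\<Sum>c<N. W' a c * (\<Sum>b<N. P c b * v b)) - (\<Sum>b<N. P a b * (\<Sum>c<N. W b c * v c))"
      using sum.swap[of "\<lambda>b n. v n * (P a b * W b n)" "{..<N}" "{..<N}"]
        sum.swap[of "\<lambda>b n. v b * (P n b * W' a n)" "{..<N}" "{..<N}"]
      by (simp add: algebra_simps sum_distrib_left sum_subtractf)
    finally show ?thesis by (simp add: algebra_simps sum_subtractf)
  qed
  then show "cov N W' (app N P v) a = app N P (cov N W v) a"
    by (auto simp: cov_def app_def sum_below)
qed

lemma cov_pow_gauge:
  assumes "gauge N W W' P"
  shows "(cov N W' ^^ k) (app N P v) = app N P ((cov N W ^^ k) v)"
  by (induction k) (auto simp: cov_gauge[OF assms])

definition unit_vec :: "nat \<Rightarrow> nat \<Rightarrow> 'r" where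
  "unit_vec b = (\<lambda>a. if a = b then 1 else 0)"

definition curv :: "nat \<Rightarrow> nat \<Rightarrow> (nat \<Rightarrow> nat \<Rightarrow> 'r) \<Rightarrow> nat \<Rightarrow> nat \<Rightarrow> 'r" where
  "curv p N W a b = (cov N W ^^ p) (unit_vec b) a"

end

lemma (in derivation) derivation_map_poly: "derivation (map_poly D)"
proof
  fix x y :: "'r poly"
  show "map_poly D (x + y) = map_poly D x + map_poly D y"
    by (simp add: poly_eq_iff coeff_map_poly add)
  show "map_poly D (x * y) = x * map_poly D y + y * map_poly D x"
  proof (rule poly_eqI)
    fix n
    have "Polynomial.coeff (map_poly D (x * y)) n = (\<Sum>i\<le>n. Polynomial.coeff x i * D (Polynomial.coeff y (n - i)))
       + (\<Sum>i\<le>n. D (Polynomial.coeff x i) * Polynomial.coeff y (n - i))"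
      by (simp add: coeff_map_poly coeff_mult mult sum sum.distrib mult.commute[of "D _"])
    also have "\<dots> = Polynomial.coeff (x * map_poly D y + map_poly D x * y) n"
      by (simp add: coeff_map_poly coeff_mult)
    finally show "Polynomial.coeff (map_poly D (x * y)) n = Polynomial.coeff (x * map_poly D y + y * map_poly D x) n"
      by (simp add: mult.commute)
  qed
qed

text \<open>
  Only the values of \<open>D\<close> have to be killed by \<open>p\<close>, since the ambient
  ring of the application contains factors of other characteristics.
\<close>

locale p_derivation = derivation D for D :: "'r::comm_ring_1 \<Rightarrow> 'r" +
  fixes p :: nat
  assumes prime: "Factorial_Ring.prime p"
    and p_mult: "of_nat p * D x = 0"
    and pow_p: "(D ^^ p) x = 0"
begin

lemma p_pos: "0 < p"
  using prime by (rule prime_gt_0_nat)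

lemma cov_pow_p_scale:
  assumes "a < N"
  shows "(cov N W ^^ p) (\<lambda>a. f * v a) a = f * (cov N W ^^ p) v a"
proof -
  have z: "of_nat (p choose i) * ((D ^^ i) f * x) = 0" if i: "i \<in> {..p} - {0}" for i x
  proof (cases "i = p")
    case False
    then have "p dvd (p choose i)"
      using i prime by (intro dvd_choose_prime) auto
    then obtain m where m: "p choose i = p * m" by blast
    obtain l where l: "i = Suc l" using i by (cases i) auto
    have "of_nat (p choose i) * ((D ^^ i) f * x) = of_nat m * x * (of_nat p * (D ^^ i) f)"
      by (simp add: m ac_simps)
    also have "of_nat p * (D ^^ i) f = 0"
      by (simp add: l p_mult)
    finally show ?thesis by simp
  qed (simp add: pow_p)
  have "(cov N W ^^ p) (\<lambda>a. f * v a) a = (\<Sum>i\<in>{0}. of_nat (p choose i) * ((D ^^ i) f * (cov N W ^^ (p - i)) v a))"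
    unfolding cov_pow_leibniz[OF assms]
    by (rule sum.mono_neutral_right) (use z in auto)
  then show ?thesis by simp
qed

lemma cov_pow_p: "(cov N W ^^ p) v = app N (curv p N W) v"
proof
  fix a
  have "(cov N W ^^ p) v = (cov N W ^^ p) (\<lambda>a. \<Sum>b<N. v b * unit_vec b a)"
    by (rule cov_pow_cong) (auto simp: p_pos unit_vec_def if_distrib cong: if_cong)
  then have *: "(cov N W ^^ p) v a = (\<Sum>b<N. (cov N W ^^ p) (\<lambda>a. v b * unit_vec b a) a)"
    by (simp add: cov_pow_sum)
  show "(cov N W ^^ p) v a = app N (curv p N W) v a"
  proof (cases "a < N")
    case True
    then show ?thesis by (simp add: * cov_pow_p_scale app_def curv_def ac_simps)
  next
    case False
    obtain l where "p = Suc l" using p_pos by (cases p) auto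
    with False show ?thesis by (simp add: cov_def app_def)
  qed
qed

lemma curv_gauge:
  assumes "gauge N W W' P" "a < N" "b < N"
  shows "(\<Sum>c<N. curv p N W' a c * P c b) = (\<Sum>c<N. P a c * curv p N W c b)"
proof -
  have u: "(\<Sum>d<N. P c d * unit_vec b d) = P c b" for c
    using assms(3) by (simp add: unit_vec_def if_distrib cong: if_cong)
  have "app N (curv p N W') (app N P (unit_vec b)) a = app N P (app N (curv p N W) (unit_vec b)) a"
    by (simp only: cov_pow_p[symmetric] cov_pow_gauge[OF assms(1)])
  moreover have "app N (curv p N W) (unit_vec b) c = curv p N W c b" if "c < N" for c
    using that assms(3) by (simp add: app_def unit_vec_def if_distrib cong: if_cong)
  moreover have "app N P (unit_vec b) c = P c b" if "c < N" for c
    using that assms(3) by (simp add: app_def u)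
  ultimately show ?thesis using assms(2) by (simp add: app_def[of N _ "app N _ _"] cong: sum.cong_simp)
qed

lemma curv_zero: "a < N \<Longrightarrow> curv p N (\<lambda>_ _. 0) a b = 0"
proof -
  assume a: "a < N"
  have "(cov N (\<lambda>_ _. 0) ^^ k) v a = (D ^^ k) (v a)" for k v
    using a by (induction k arbitrary: v) (auto simp: cov_def)
  then show ?thesis by (simp add: curv_def pow_p)
qed

end

definition char_mat :: "nat \<Rightarrow> (nat \<Rightarrow> nat \<Rightarrow> 'r::comm_ring_1) \<Rightarrow> 'r poly mat" where
  "char_mat N C = mat N N (\<lambda>(a, b). [:of_bool (a = b), - C a b:])"

text \<open>
  The reversed characteristic polynomial \<open>det (1 - x C)\<close>, where \<open>x\<close> is
  the variable of the polynomials. Unlike the characteristic polynomial it is \<open>1\<close>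
  for every nilpotent \<open>C\<close> over a reduced ring, whatever the size.
\<close>

definition chi :: "nat \<Rightarrow> (nat \<Rightarrow> nat \<Rightarrow> 'r::comm_ring_1) \<Rightarrow> 'r poly" where
  "chi N C = det (char_mat N C)"

lemma chi_cong: "(\<And>a b. a < N \<Longrightarrow> b < N \<Longrightarrow> C a b = C' a b) \<Longrightarrow> chi N C = chi N C'"
  unfolding chi_def char_mat_def by (rule arg_cong[of _ _ det], rule eq_matI) auto

lemma chi_zero: "chi N (\<lambda>_ _. 0) = 1"
proof -
  have "char_mat N (\<lambda>_ _. 0) = (1\<^sub>m N :: 'a poly mat)"
    by (rule eq_matI) (auto simp: char_mat_def)
  then show ?thesis by (simp add: chi_def)
qed

text \<open>
  Multiplicativity of the determinant, applied to \<open>(1 - x C') P = P (1 - x C)\<close> and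
  \<open>P P' = q\<close>. The factor \<open>q\<close> cannot be cancelled at this point.
\<close>

lemma chi_intertwined:
  fixes C C' P P' :: "nat \<Rightarrow> nat \<Rightarrow> 'r::comm_ring_1"
  assumes CP: "\<And>a b. a < N \<Longrightarrow> b < N \<Longrightarrow> (\<Sum>c<N. C' a c * P c b) = (\<Sum>c<N. P a c * C c b)"
    and PP: "\<And>a b. a < N \<Longrightarrow> b < N \<Longrightarrow> (\<Sum>c<N. P a c * P' c b) = (if a = b then q else 0)"
  shows "[:q:] ^ N * chi N C' = [:q:] ^ N * chi N C"
proof -
  define A where "A = mat N N (\<lambda>(a, b). [:P a b:])"
  define A' where "A' = mat N N (\<lambda>(a, b). [:P' a b:])"
  have carr [simp]: "A \<in> carrier_mat N N" "A' \<in> carrier_mat N N"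
    "char_mat N C \<in> carrier_mat N N" "char_mat N C' \<in> carrier_mat N N"
    by (auto simp: A_def A'_def char_mat_def)
  have sc: "(\<Sum>c<N. [:f c:]) = [:\<Sum>c<N. f c:]" for f :: "nat \<Rightarrow> 'r"
    by (induction N) auto
  have split: "[:x, - y:] * [:z:] = [:x * z:] - Polynomial.monom 1 1 * [:y * z:]"
    "[:z:] * [:x, - y:] = [:z * x:] - Polynomial.monom 1 1 * [:z * y:]" for x y z :: 'r
    by (auto simp: monom_altdef)
  have "char_mat N C' * A = A * char_mat N C"
  proof (rule eq_matI)
    fix a b assume "a < dim_row (A * char_mat N C)" "b < dim_col (A * char_mat N C)"
    then have ab: "a < N" "b < N" by (auto simp: A_def char_mat_def)
    have "(char_mat N C' * A) $$ (a, b) = (\<Sum>c<N. [:of_bool (a = c), - C' a c:] * [:P c b:])"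
      using ab by (simp add: A_def char_mat_def scalar_prod_def lessThan_atLeast0)
    also have "\<dots> = [:P a b:] - Polynomial.monom 1 1 * [:\<Sum>c<N. C' a c * P c b:]"
      using ab by (simp only: split sum_subtractf sum_distrib_left[symmetric] sc)
        (simp add: if_distrib of_bool_def if_distribR cong: if_cong)
    also have "\<dots> = [:P a b:] - Polynomial.monom 1 1 * [:\<Sum>c<N. P a c * C c b:]"
      by (simp add: CP ab)
    also have "\<dots> = (\<Sum>c<N. [:P a c:] * [:of_bool (c = b), - C c b:])"
      using ab by (simp only: split sum_subtractf sum_distrib_left[symmetric] sc)
        (simp add: if_distrib of_bool_def if_distribR cong: if_cong)
    also have "\<dots> = (A * char_mat N C) $$ (a, b)"
      using ab by (simp add: A_def char_mat_def scalar_prod_def lessThan_atLeast0)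
    finally show "(char_mat N C' * A) $$ (a, b) = (A * char_mat N C) $$ (a, b)" .
  qed (auto simp: A_def char_mat_def)
  then have "chi N C' * det A = det A * chi N C"
    unfolding chi_def by (metis det_mult carr)
  then have "det A * det A' * chi N C' = det A * det A' * chi N C"
    by (metis mult.assoc mult.commute)
  moreover have "A * A' = [:q:] \<cdot>\<^sub>m 1\<^sub>m N"
  proof (rule eq_matI)
    fix a b assume "a < dim_row ([:q:] \<cdot>\<^sub>m 1\<^sub>m N)" "b < dim_col ([:q:] \<cdot>\<^sub>m 1\<^sub>m N)"
    then have ab: "a < N" "b < N" by auto
    have "(A * A') $$ (a, b) = [:\<Sum>c<N. P a c * P' c b:]"
      using ab by (simp add: A_def A'_def scalar_prod_def lessThan_atLeast0[symmetric] sc mult.commute)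
    then show "(A * A') $$ (a, b) = ([:q:] \<cdot>\<^sub>m 1\<^sub>m N) $$ (a, b)"
      using ab by (simp add: PP)
  qed (auto simp: A_def A'_def)
  then have "det A * det A' = [:q:] ^ N"
    by (simp add: det_mult[of A N A', symmetric])
  ultimately show ?thesis by simp
qed

text \<open>
  The adjugate is a polynomial inverse of \<open>1 - x C\<close> when the determinant is
  \<open>1\<close>, and its coefficients are the powers of \<open>C\<close>; a polynomial has
  only finitely many.
\<close>

lemma chi_trivial_imp_nilpotent:
  fixes C :: "nat \<Rightarrow> nat \<Rightarrow> 'r::comm_ring_1"
  assumes "[:e:] * chi N C = [:e:]"
  obtains G m where
    "\<And>a b. a < N \<Longrightarrow> b < N \<Longrightarrow> G 0 a b = (if a = b then e else 0)"
    "\<And>k a b. a < N \<Longrightarrow> b < N \<Longrightarrow> G (Suc k) a b = (\<Sum>c<N. C a c * G k c b)"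
    "\<And>a b. a < N \<Longrightarrow> b < N \<Longrightarrow> G m a b = 0"
proof -
  define J where "J = adj_mat (char_mat N C)"
  define G where "G k a b = Polynomial.coeff ([:e:] * J $$ (a, b)) k" for k a b
  have carr: "char_mat N C \<in> carrier_mat N N" by (simp add: char_mat_def)
  have J: "J \<in> carrier_mat N N" "char_mat N C * J = chi N C \<cdot>\<^sub>m 1\<^sub>m N"
    using adj_mat[OF carr] by (auto simp: J_def chi_def)
  have eq: "[:e:] * J $$ (a, b) - Polynomial.monom 1 1 * (\<Sum>c<N. [:C a c:] * ([:e:] * J $$ (c, b))) =
      (if a = b then [:e:] else 0)" if ab: "a < N" "b < N" for a b
  proof -
    have split: "[:x, - y:] = [:x:] - Polynomial.monom 1 1 * [:y:]" for x y :: 'r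
      by (auto simp: monom_altdef)
    have "(if a = b then [:e:] else 0) = [:e:] * (char_mat N C * J) $$ (a, b)"
      unfolding J using ab assms by auto
    also have "(char_mat N C * J) $$ (a, b) = (\<Sum>c<N. [:of_bool (a = c), - C a c:] * J $$ (c, b))"
      using ab J(1) by (simp add: char_mat_def scalar_prod_def lessThan_atLeast0)
    also have "\<dots> = (\<Sum>c<N. [:of_bool (a = c):] * J $$ (c, b))
         - Polynomial.monom 1 1 * (\<Sum>c<N. [:C a c:] * J $$ (c, b))"
      by (simp only: split left_diff_distrib sum_subtractf sum_distrib_left mult.assoc)
    also have "(\<Sum>c<N. [:of_bool (a = c):] * J $$ (c, b)) = J $$ (a, b)"
    proof -
      have "(\<Sum>c<N. [:of_bool (a = c):] * J $$ (c, b)) = (\<Sum>c<N. if a = c then J $$ (c, b) else 0)"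
        by (rule sum.cong) auto
      then show ?thesis using ab by simp
    qed
    finally show ?thesis
      by (simp add: right_diff_distrib sum_distrib_left mult.left_commute del: mult_pCons_left)
  qed
  have G: "G k a b - (if k = 0 then 0 else \<Sum>c<N. C a c * G (k - 1) c b) =
      (if k = 0 \<and> a = b then e else 0)" if "a < N" "b < N" for k a b
    using arg_cong[OF eq[OF that], of "\<lambda>P. Polynomial.coeff P k"]
    by (auto simp: G_def coeff_monom_mult coeff_sum coeff_pCons ac_simps split: nat.splits if_splits)
  define m where "m = Suc (\<Sum>a<N. \<Sum>b<N. Polynomial.degree ([:e:] * J $$ (a, b)))"
  show thesis
  proof (rule that[of G m])
    fix a b assume ab: "a < N" "b < N"
    show "G 0 a b = (if a = b then e else 0)" using G[OF ab, of 0] by simp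
    have "Polynomial.degree ([:e:] * J $$ (a, b)) \<le> (\<Sum>b<N. Polynomial.degree ([:e:] * J $$ (a, b)))"
      using ab by (intro member_le_sum) auto
    also have "\<dots> \<le> (\<Sum>a<N. \<Sum>b<N. Polynomial.degree ([:e:] * J $$ (a, b)))"
      using ab by (intro member_le_sum[of a "{..<N}" "\<lambda>a. \<Sum>b<N. Polynomial.degree ([:e:] * J $$ (a, b))"]) auto
    finally show "G m a b = 0"
      unfolding G_def m_def by (intro coeff_eq_0) linarith
    fix k show "G (Suc k) a b = (\<Sum>c<N. C a c * G k c b)"
      using G[OF ab, of "Suc k"] by simp
  qed
qed

text \<open>
  The segment from the point \<open>z\<close>, at \<open>t = 0\<close>, to the point
  \<open>m\<close>, at \<open>t = 1\<close>.
\<close>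

definition line :: "(nat \<Rightarrow> nat) \<Rightarrow> (nat \<Rightarrow> nat) \<Rightarrow> nat \<Rightarrow> 'r::comm_ring_1 poly" where
  "line z m i = [:of_nat (z i), of_int (int (m i) - int (z i)):]"

definition pencil_matrix :: "nat \<Rightarrow> (nat \<Rightarrow> nat \<Rightarrow> nat \<Rightarrow> 'r::comm_ring_1) \<Rightarrow> (nat \<Rightarrow> nat) \<Rightarrow> nat \<Rightarrow> nat \<Rightarrow> 'r" where
  "pencil_matrix n b m = (\<lambda>c d. \<Sum>i<n. of_nat (m i) * b i c d)"

text \<open>
  The periodicity relation for the parameter \<open>j\<close>, restricted to a line. The matrix
  \<open>P\<close> has the inverse \<open>P'\<close> up to the scalar polynomial
  \<open>q\<close>, and \<open>q\<close> is invertible at the origin \<open>z\<close> of the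
  line, but possibly not at its end.
\<close>

definition (in derivation) shifts_along_line ::
    "nat \<Rightarrow> nat \<Rightarrow> (nat \<Rightarrow> nat \<Rightarrow> nat \<Rightarrow> 'r) \<Rightarrow> 'r \<Rightarrow> nat \<Rightarrow> (nat \<Rightarrow> nat) \<Rightarrow> (nat \<Rightarrow> nat) \<Rightarrow> bool" where
  "shifts_along_line n N b e j z m \<longleftrightarrow> (\<exists>P P' q w.
      derivation.gauge (map_poly D) N (\<lambda>c d. \<Sum>i<n. line z m i * [:b i c d:])
        (\<lambda>c d. (\<Sum>i<n. line z m i * [:b i c d:]) + [:b j c d:]) P \<and>
      (\<forall>c<N. \<forall>d<N. (\<Sum>a<N. P c a * P' a d) = (if c = d then q else 0)) \<and>
      Polynomial.coeff q 0 * w = e)"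

lemma poly_at_1_map_poly:
  assumes "derivation D"
  shows "poly (map_poly D x) 1 = D (poly x 1)"
proof -
  interpret derivation D by fact
  have *: "poly y 1 = (\<Sum>i\<le>n. Polynomial.coeff y i)" if "Polynomial.degree y \<le> n" for y :: "'a poly" and n
    unfolding poly_altdef using that by (simp, intro sum.mono_neutral_left) (auto simp: coeff_eq_0)
  have "Polynomial.degree (map_poly D x) \<le> Polynomial.degree x"
    by (rule degree_le) (simp add: coeff_map_poly coeff_eq_0)
  then show ?thesis
    by (simp add: *[of _ "Polynomial.degree x"] coeff_map_poly sum)
qed

lemma p_derivation_map_poly:
  assumes "p_derivation D p"
  shows "p_derivation (map_poly D) p"
proof -
  interpret p_derivation D p by fact
  interpret P: derivation "map_poly D" by (rule derivation_map_poly)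
  show ?thesis
  proof
    fix x
    show "of_nat p * map_poly D x = 0"
      by (simp add: poly_eq_iff coeff_map_poly of_nat_poly p_mult)
    have "Polynomial.coeff ((map_poly D ^^ k) x) i = (D ^^ k) (Polynomial.coeff x i)" for k i
      by (induction k) (auto simp: coeff_map_poly)
    then show "(map_poly D ^^ p) x = 0"
      by (simp add: poly_eq_iff pow_p)
  qed (rule prime)
qed

context p_derivation
begin

lemma curv_at_1:
  "poly (derivation.curv (map_poly D) p N W a b) 1 = curv p N (\<lambda>a b. poly (W a b) 1) a b"
proof -
  interpret P: derivation "map_poly D" by (rule derivation_map_poly)
  have "poly ((P.cov N W ^^ k) v a) 1 = (cov N (\<lambda>a b. poly (W a b) 1) ^^ k) (\<lambda>a. poly (v a) 1) a" for k v
  proof (induction k arbitrary: a)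
    case (Suc k)
    then show ?case
      by (auto simp: cov_def P.cov_def poly_at_1_map_poly[OF derivation_axioms] poly_sum)
  qed auto
  moreover have "(\<lambda>a. poly (P.unit_vec b a) 1) = unit_vec b"
    by (auto simp: unit_vec_def P.unit_vec_def)
  ultimately show ?thesis by (simp add: curv_def P.curv_def)
qed

text \<open>
  The coefficients of \<open>H\<close> vanish one after the other, since the constant term of
  \<open>q\<close> can be cancelled.
\<close>

lemma unit_constant_term_cancel:
  fixes q H :: "'r poly"
  assumes "q * H = 0" "Polynomial.coeff q 0 * w = e" "e * e = e"
  shows "Polynomial.smult e H = 0"
proof (rule poly_eqI)
  fix k
  show "Polynomial.coeff (Polynomial.smult e H) k = Polynomial.coeff 0 k"
  proof (induction k rule: less_induct)
    case (less k)
    have "0 = e * Polynomial.coeff (q * H) k" by (simp add: assms(1))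
    also have "\<dots> = e * (\<Sum>i\<in>{..k}. Polynomial.coeff q i * Polynomial.coeff H (k - i))"
      by (simp add: coeff_mult)
    also have "\<dots> = (\<Sum>i\<in>{..k}. Polynomial.coeff q i * (e * Polynomial.coeff H (k - i)))"
      by (simp add: sum_distrib_left ac_simps)
    also have "\<dots> = (\<Sum>i\<in>{0}. Polynomial.coeff q i * (e * Polynomial.coeff H (k - i)))"
      using less by (intro sum.mono_neutral_right) auto
    finally have "Polynomial.coeff q 0 * (e * Polynomial.coeff H k) = 0" by simp
    then have "(Polynomial.coeff q 0 * w) * (e * Polynomial.coeff H k) = 0"
      by (simp add: mult.assoc mult.left_commute[of _ w])
    then have "e * (e * Polynomial.coeff H k) = 0"
      by (simp only: assms(2))
    then show ?case by (simp add: assms(3) mult.assoc[symmetric])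
  qed
qed

lemma chi_at_1:
  "chi N (\<lambda>a b. poly (C a b) 1) = map_poly (\<lambda>x. poly x 1) (chi N C)" for C :: "nat \<Rightarrow> nat \<Rightarrow> 'r poly"
proof -
  interpret h: comm_ring_hom "\<lambda>x :: 'r poly. poly x 1"
    by standard auto
  interpret H: comm_ring_hom "map_poly (\<lambda>x :: 'r poly. poly x 1)"
    by standard (auto simp: poly_eq_iff coeff_map_poly coeff_mult poly_sum)
  have "char_mat N (\<lambda>a b. poly (C a b) 1) = map_mat (map_poly (\<lambda>x. poly x 1)) (char_mat N C)"
    by (rule eq_matI) (auto simp: char_mat_def map_poly_pCons)
  then show ?thesis by (simp add: chi_def H.hom_det)
qed

lemma chi_step:
  fixes W W' P P' :: "nat \<Rightarrow> nat \<Rightarrow> 'r poly"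
  assumes g: "derivation.gauge (map_poly D) N W W' P"
    and PP: "\<And>a b. a < N \<Longrightarrow> b < N \<Longrightarrow> (\<Sum>c<N. P a c * P' c b) = (if a = b then q else 0)"
    and q: "Polynomial.coeff q 0 * w = e" and e: "e * e = e"
  shows "Polynomial.smult e (chi N (curv p N (\<lambda>a b. poly (W' a b) 1))) =
         Polynomial.smult e (chi N (curv p N (\<lambda>a b. poly (W a b) 1)))"
proof -
  interpret P: p_derivation "map_poly D" p
    by (rule p_derivation_map_poly) unfold_locales
  define H where "H = chi N (P.curv p N W') - chi N (P.curv p N W)"
  have "[:q:] ^ N * H = 0"
    unfolding H_def right_diff_distrib
    using chi_intertwined[of N "P.curv p N W'" P "P.curv p N W" P' q] P.curv_gauge[OF g] PP by simp
  moreover have "[:q:] ^ N = [:q ^ N:]" by (induction N) auto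
  ultimately have qH: "Polynomial.smult (q ^ N) H = 0" by simp
  have w: "Polynomial.coeff (q ^ N) 0 * w ^ N = e ^ N"
    using q by (simp add: coeff_0_power power_mult_distrib[symmetric])
  have "Polynomial.smult e (Polynomial.coeff H i) = 0" for i
  proof (cases "N = 0")
    case True
    then show ?thesis using qH by simp
  next
    case False
    have "e ^ Suc l = e" for l
      using e by (induction l) auto
    then have "e ^ N = e"
      using False by (cases N) auto
    moreover have "q ^ N * Polynomial.coeff H i = 0"
      using arg_cong[OF qH, of "\<lambda>x. Polynomial.coeff x i"] by simp
    ultimately show ?thesis using unit_constant_term_cancel[of "q ^ N" _ "w ^ N" e] w e by simp
  qed
  then have "e * poly (Polynomial.coeff H i) 1 = 0" for i
    by (metis poly_0 poly_smult)
  then have "Polynomial.smult e (map_poly (\<lambda>x. poly x 1) H) = 0"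
    by (simp add: poly_eq_iff coeff_map_poly)
  moreover have "map_poly (\<lambda>x. poly x 1) H =
      chi N (curv p N (\<lambda>a b. poly (W' a b) 1)) - chi N (curv p N (\<lambda>a b. poly (W a b) 1))"
    unfolding curv_at_1[symmetric] chi_at_1 H_def by (auto simp: poly_eq_iff coeff_map_poly)
  ultimately show ?thesis by (simp add: smult_diff_right)
qed

text \<open>
  Raising the coordinates of \<open>0\<close> by \<open>1\<close> reaches every natural point,
  and \<open>\<chi>\<close> stays equal to its value \<open>1\<close> at \<open>0\<close>.
\<close>

theorem periodic_imp_nilpotent:
  fixes b :: "nat \<Rightarrow> nat \<Rightarrow> nat \<Rightarrow> 'r"
  assumes e: "e * e = e"
    and step: "\<And>j. j < n \<Longrightarrow> \<exists>z. \<forall>m. shifts_along_line n N b e j z m"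
  shows "\<exists>k. \<forall>v. \<forall>a<N. e * ((cov N (pencil_matrix n b m) ^^ p) ^^ k) v a = 0"
proof -
  have shift: "Polynomial.smult e (chi N (curv p N (pencil_matrix n b (m(j := Suc (m j)))))) =
      Polynomial.smult e (chi N (curv p N (pencil_matrix n b m)))" if j: "j < n" for j m
  proof -
    obtain z P P' q w where *: "derivation.gauge (map_poly D) N (\<lambda>c d. \<Sum>i<n. line z m i * [:b i c d:])
        (\<lambda>c d. (\<Sum>i<n. line z m i * [:b i c d:]) + [:b j c d:]) P"
      "\<forall>c<N. \<forall>d<N. (\<Sum>a<N. P c a * P' a d) = (if c = d then q else 0)"
      "Polynomial.coeff q 0 * w = e"
      using step[OF j] unfolding shifts_along_line_def by blast
    have line1: "poly (line z m i) 1 = of_nat (m i)" for i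
      by (simp add: line_def)
    have "(\<Sum>i<n. of_nat ((m(j := Suc (m j))) i) * b i c d) = (\<Sum>i<n. of_nat (m i) * b i c d) + b j c d" for c d
    proof -
      have "(\<Sum>i<n. of_nat ((m(j := Suc (m j))) i) * b i c d) =
          (\<Sum>i<n. of_nat (m i) * b i c d + (if i = j then b j c d else 0))"
        by (rule sum.cong) (auto simp: algebra_simps)
      then show ?thesis using j by (simp add: sum.distrib)
    qed
    then show ?thesis
      using chi_step[OF *(1) *(2)[rule_format] *(3) e]
      by (simp add: pencil_matrix_def poly_sum line1 mult.commute[of "b _ _ _"])
  qed
  have "Polynomial.smult e (chi N (curv p N (pencil_matrix n b m))) = [:e:]" for m
  proof (induction "\<Sum>i<n. m i" arbitrary: m)
    case 0
    then have "pencil_matrix n b m = (\<lambda>_ _. 0)"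
      by (auto simp: pencil_matrix_def)
    then have "chi N (curv p N (pencil_matrix n b m)) = chi N (\<lambda>_ _. 0)"
      by (intro chi_cong) (auto simp: curv_zero)
    then show ?case by (simp add: chi_zero)
  next
    case (Suc l)
    then obtain j where j: "j < n" "m j \<noteq> 0"
      by (metis (no_types, lifting) lessThan_iff nat.distinct(1) sum.neutral)
    define m' where "m' = m(j := m j - 1)"
    have m: "m = m'(j := Suc (m' j))" using j by (auto simp: m'_def)
    have "(\<Sum>i<n. m i) = (\<Sum>i<n. m' i + (if i = j then 1 else 0))"
      by (rule sum.cong) (use j in \<open>auto simp: m'_def\<close>)
    then have "l = (\<Sum>i<n. m' i)" using j Suc.hyps(2) by (simp add: sum.distrib)
    from Suc.hyps(1)[OF this] show ?case
      using shift[OF j(1), of m'] m by simp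
  qed
  then have "[:e:] * chi N (curv p N (pencil_matrix n b m)) = [:e:]" by simp
  then obtain G k where G: "\<And>c d. c < N \<Longrightarrow> d < N \<Longrightarrow> G 0 c d = (if c = d then e else 0)"
    "\<And>k c d. c < N \<Longrightarrow> d < N \<Longrightarrow>
        G (Suc k) c d = (\<Sum>a<N. curv p N (pencil_matrix n b m) c a * G k a d)"
    "\<And>c d. c < N \<Longrightarrow> d < N \<Longrightarrow> G k c d = 0"
    by (rule chi_trivial_imp_nilpotent) blast
  have "e * ((cov N (pencil_matrix n b m) ^^ p) ^^ k) v a = (\<Sum>d<N. G k a d * v d)" if "a < N" for v a k
    using that
  proof (induction k arbitrary: a)
    case 0
    have "(\<Sum>d<N. G 0 a d * v d) = (\<Sum>d<N. if a = d then e * v d else 0)"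
      by (rule sum.cong) (auto simp: G(1) 0)
    then show ?case using 0 by simp
  next
    case (Suc k)
    let ?C = "curv p N (pencil_matrix n b m)"
    have "e * ((cov N (pencil_matrix n b m) ^^ p) ^^ Suc k) v a =
        (\<Sum>c<N. ?C a c * (e * ((cov N (pencil_matrix n b m) ^^ p) ^^ k) v c))"
      using Suc.prems by (simp add: cov_pow_p[of N _ "((cov N (pencil_matrix n b m) ^^ p) ^^ k) v"]
        app_def sum_distrib_left ac_simps)
    also have "\<dots> = (\<Sum>c<N. ?C a c * (\<Sum>d<N. G k c d * v d))"
      using Suc.IH by simp
    also have "\<dots> = (\<Sum>d<N. G (Suc k) a d * v d)"
      using Suc.prems sum.swap[of "\<lambda>c d. ?C a c * (G k c d * v d)" "{..<N}" "{..<N}"]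
      by (simp add: G(2) sum_distrib_left sum_distrib_right mult.assoc)
    finally show ?case .
  qed
  then show ?thesis using G(3) by (intro exI[of _ k]) simp
qed

end

section \<open>Subrings, base change and localization\<close>

definition subring_set :: "'a::comm_ring_1 set \<Rightarrow> bool" where
  "subring_set A \<longleftrightarrow> 1 \<in> A \<and> (\<forall>x\<in>A. \<forall>y\<in>A. x + y \<in> A \<and> x * y \<in> A) \<and> (\<forall>x\<in>A. - x \<in> A)"

lemma subring_setD:
  assumes "subring_set A"
  shows "1 \<in> A" "x \<in> A \<Longrightarrow> y \<in> A \<Longrightarrow> x + y \<in> A" "x \<in> A \<Longrightarrow> y \<in> A \<Longrightarrow> x * y \<in> A"
    "x \<in> A \<Longrightarrow> - x \<in> A" "x \<in> A \<Longrightarrow> y \<in> A \<Longrightarrow> x - y \<in> A" "0 \<in> A" "x \<in> A \<Longrightarrow> x ^ n \<in> A"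
    "of_nat n \<in> A" "of_int i \<in> A"
proof -
  show 1: "1 \<in> A" and add: "\<And>x y. x \<in> A \<Longrightarrow> y \<in> A \<Longrightarrow> x + y \<in> A"
    and mult: "\<And>x y. x \<in> A \<Longrightarrow> y \<in> A \<Longrightarrow> x * y \<in> A" and um: "\<And>x. x \<in> A \<Longrightarrow> - x \<in> A"
    using assms by (auto simp: subring_set_def)
  show mi: "x \<in> A \<Longrightarrow> y \<in> A \<Longrightarrow> x - y \<in> A" for x y using add[OF _ um] by force
  show 0: "0 \<in> A" using mi[OF 1 1] by simp
  show "x \<in> A \<Longrightarrow> x ^ n \<in> A" by (induction n) (auto intro: 1 mult)
  show n: "of_nat n \<in> A" for n by (induction n) (auto intro: 0 1 add)
  show "of_int i \<in> A" by (cases i rule: int_diff_cases) (auto intro: mi n)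
qed

lemma subring_set_sum: "subring_set A \<Longrightarrow> (\<And>i. i \<in> I \<Longrightarrow> f i \<in> A) \<Longrightarrow> sum f I \<in> A"
  by (induction I rule: infinite_finite_induct) (auto intro: subring_setD)


lemma subr_simps [simp]:
  "carrier (subr A) = A" "one (subr A) = 1" "zero (subr A) = 0"
  "x \<oplus>\<^bsub>subr A\<^esub> y = x + y" "x \<otimes>\<^bsub>subr A\<^esub> y = x * y"
  by (simp_all add: ring_of_type_algebra_def)

lemma ring_of_type_algebra_simps [simp]:
  "carrier ring_of_type_algebra = UNIV" "one ring_of_type_algebra = 1" "zero ring_of_type_algebra = 0"
  "x \<oplus>\<^bsub>ring_of_type_algebra\<^esub> y = x + y" "x \<otimes>\<^bsub>ring_of_type_algebra\<^esub> y = x * y"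
  by (simp_all add: ring_of_type_algebra_def)

lemma subr_UNIV: "subr UNIV = ring_of_type_algebra"
  by (simp add: ring_of_type_algebra_def)

lemma cring_subr: "subring_set A \<Longrightarrow> cring (subr A)"
  by (rule cringI, rule abelian_groupI)
    (auto intro!: comm_monoidI bexI[of _ "- _"] simp: algebra_simps intro: subring_setD)

lemma subr_uminus:
  assumes "subring_set A" "x \<in> A" shows "\<ominus>\<^bsub>subr A\<^esub> x = - x"
proof -
  interpret cring "subr A" by (rule cring_subr) fact
  have "\<ominus>\<^bsub>subr A\<^esub> x \<oplus>\<^bsub>subr A\<^esub> x = \<zero>\<^bsub>subr A\<^esub>" by (rule l_neg) (use assms in simp)
  then show ?thesis by (simp add: eq_neg_iff_add_eq_0)
qed

lemma subr_minus: "subring_set A \<Longrightarrow> x \<in> A \<Longrightarrow> y \<in> A \<Longrightarrow> x \<ominus>\<^bsub>subr A\<^esub> y = x - y"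
  by (simp add: a_minus_def subr_uminus)

lemma finsum_subr:
  assumes "subring_set A" "finite I" "f \<in> I \<rightarrow> A"
  shows "finsum (subr A) f I = sum f I"
proof -
  interpret cring "subr A" by (rule cring_subr) fact
  show ?thesis using assms(2,3) by (induction I) (auto simp: Pi_def)
qed

lemma subring_set_UNIV: "subring_set UNIV"
  by (simp add: subring_set_def)

lemma gen_incl: "G \<subseteq> gen G"
  by (auto intro: generate_ring.incl)

lemma subring_set_gen: "subring_set (gen G)"
proof -
  have c: "carrier ring_of_type_algebra = UNIV" by (simp add: ring_of_type_algebra_def)
  have um: "\<ominus>\<^bsub>ring_of_type_algebra\<^esub> x = - x" for x :: 'a
    using subr_uminus[OF subring_set_UNIV, of x] by (simp add: subr_UNIV)
  have ops: "x \<oplus>\<^bsub>ring_of_type_algebra\<^esub> y = x + y" "x \<otimes>\<^bsub>ring_of_type_algebra\<^esub> y = x * y"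
     "\<one>\<^bsub>ring_of_type_algebra\<^esub> = 1" for x y :: 'a
    by (auto simp: ring_of_type_algebra_def)
  show ?thesis
    unfolding subring_set_def
    using generate_ring.one[of ring_of_type_algebra G] generate_ring.eng_add[of _ ring_of_type_algebra G]
      generate_ring.eng_mult[of _ ring_of_type_algebra G] generate_ring.a_inv[of _ ring_of_type_algebra G]
    by (auto simp: um ops)
qed

text \<open>
  The product of power series in many variables; multiplication of polynomials over a ring with
  carrier becomes this convolution after embedding the coefficients.
\<close>

definition conv :: "('i multiset \<Rightarrow> 'r::comm_ring_1) \<Rightarrow> ('i multiset \<Rightarrow> 'r) \<Rightarrow> 'i multiset \<Rightarrow> 'r" where
  "conv f g m = (\<Sum>u\<in>{u. u \<subseteq># m}. f u * g (m - u))"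

lemma finite_submultisets: "finite {u. u \<subseteq># m}"
proof (induction m)
  case (add x m)
  have "{u. u \<subseteq># add_mset x m} \<subseteq> {u. u \<subseteq># m} \<union> add_mset x ` {u. u \<subseteq># m}"
  proof
    fix u assume u: "u \<in> {u. u \<subseteq># add_mset x m}"
    show "u \<in> {u. u \<subseteq># m} \<union> add_mset x ` {u. u \<subseteq># m}"
    proof (cases "x \<in># u")
      case True
      then obtain v where "u = add_mset x v" by (metis insert_DiffM)
      then show ?thesis using u by auto
    next
      case False
      have "count u y \<le> count m y" for y
        using u False by (cases "y = x") (auto simp: subseteq_mset_def not_in_iff dest: spec[of _ y])
      then have "u \<subseteq># m" by (simp add: subseteq_mset_def)
      then show ?thesis by simp
    qed
  qed
  then show ?case using add by (meson finite_Un finite_imageI finite_subset)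
qed simp

lemma conv_commute: "conv f g = conv g f"
proof
  fix m
  show "conv f g m = conv g f m"
    unfolding conv_def
    by (rule sum.reindex_bij_witness[of _ "\<lambda>u. m - u" "\<lambda>u. m - u"])
      (auto simp: subset_mset.diff_diff_right mult.commute)
qed

lemma conv_assoc: "conv (conv f g) h = conv f (conv g h)"
proof
  fix m
  have "conv (conv f g) h m = (\<Sum>(u, v)\<in>(SIGMA u:{u. u \<subseteq># m}. {v. v \<subseteq># u}). f v * g (u - v) * h (m - u))"
    by (simp add: conv_def sum_distrib_right sum.Sigma finite_submultisets)
  also have "\<dots> = (\<Sum>(v, w)\<in>(SIGMA v:{v. v \<subseteq># m}. {w. w \<subseteq># m - v}). f v * (g w * h (m - v - w)))"
  proof -
    have 1: "m - v - (u - v) = m - u" "v \<subseteq># m" "u - v \<subseteq># m - v" "v + (u - v) = u"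
      if "u \<subseteq># m" "v \<subseteq># u" for u v
      using that
      by (auto simp: subseteq_mset_def multiset_eq_iff intro: diff_le_mono order_trans)
    have 2: "v + w \<subseteq># m" if "v \<subseteq># m" "w \<subseteq># m - v" for v w
      using that by (simp add: subset_mset.le_diff_conv2 add.commute)
    show ?thesis
    by (rule sum.reindex_bij_witness[of _ "\<lambda>(v, w). (v + w, v)" "\<lambda>(u, v). (v, u - v)"])
      (auto simp: mult.assoc 1 2)
  qed
  also have "\<dots> = conv f (conv g h) m"
    by (simp add: conv_def sum_distrib_left sum.Sigma finite_submultisets)
  finally show "conv (conv f g) h m = conv f (conv g h) m" .
qed

lemma conv_add: "conv (\<lambda>m. f m + g m) h = (\<lambda>m. conv f h m + conv g h m)"
  by (simp add: conv_def fun_eq_iff distrib_right sum.distrib)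

lemma conv_single: "conv (\<lambda>m. if m = {#} then c else 0) f m = c * f m"
proof -
  have "conv (\<lambda>m. if m = {#} then c else 0) f m = (\<Sum>u\<in>{u. u \<subseteq># m}. if u = {#} then c * f m else 0)"
    unfolding conv_def by (rule sum.cong) auto
  then show ?thesis by (simp add: finite_submultisets)
qed

context
  fixes F :: "'f ring" and I :: "'i set"
  assumes F: "cring F"
begin

interpretation F: cring F by (rule F)

lemma mpoly_carrierD:
  assumes "P \<in> carrier (mpoly_ring F I)"
  shows "P m \<in> carrier F" "finite {m. P m \<noteq> \<zero>\<^bsub>F\<^esub>}" "P m \<noteq> \<zero>\<^bsub>F\<^esub> \<Longrightarrow> set_mset m \<subseteq> I"
  using assms by (auto simp: mpoly_ring_def)

lemma emb_eq_zero_iff: "x \<in> carrier F \<Longrightarrow> emb F x = 0 \<longleftrightarrow> x = \<zero>\<^bsub>F\<^esub>"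
  using emb_inject[OF F, of x "\<zero>\<^bsub>F\<^esub>"] by (simp add: emb_zero[OF F])

lemma emb_mpoly_mult:
  assumes "P \<in> carrier (mpoly_ring F I)" "Q \<in> carrier (mpoly_ring F I)"
  shows "(P \<otimes>\<^bsub>mpoly_ring F I\<^esub> Q) m \<in> carrier F"
    "emb F ((P \<otimes>\<^bsub>mpoly_ring F I\<^esub> Q) m) = conv (\<lambda>m. emb F (P m)) (\<lambda>m. emb F (Q m)) m"
  using mpoly_carrierD(1)[OF assms(1)] mpoly_carrierD(1)[OF assms(2)]
  by (auto simp: mpoly_ring_def conv_def emb_finsum[OF F] emb_mult[OF F] finite_submultisets Pi_def
      intro!: F.finsum_closed)

lemma mpoly_mult_nonzeroE:
  assumes "P \<in> carrier (mpoly_ring F I)" "Q \<in> carrier (mpoly_ring F I)"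
    and "(P \<otimes>\<^bsub>mpoly_ring F I\<^esub> Q) m \<noteq> \<zero>\<^bsub>F\<^esub>"
  obtains u v where "m = u + v" "P u \<noteq> \<zero>\<^bsub>F\<^esub>" "Q v \<noteq> \<zero>\<^bsub>F\<^esub>"
proof -
  have "conv (\<lambda>m. emb F (P m)) (\<lambda>m. emb F (Q m)) m \<noteq> 0"
    using assms(3) emb_eq_zero_iff[OF emb_mpoly_mult(1)[OF assms(1,2)]]
    by (simp add: emb_mpoly_mult(2)[OF assms(1,2)])
  then obtain u where "u \<in> {u. u \<subseteq># m}" "emb F (P u) * emb F (Q (m - u)) \<noteq> 0"
    unfolding conv_def by (rule sum.not_neutral_contains_not_neutral)
  moreover from this have "P u \<noteq> \<zero>\<^bsub>F\<^esub>" "Q (m - u) \<noteq> \<zero>\<^bsub>F\<^esub>"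
    by (auto simp: emb_zero[OF F])
  ultimately show thesis using that[of u "m - u"] by simp
qed

lemma mpoly_eqI:
  assumes "P \<in> carrier (mpoly_ring F I)" "Q \<in> carrier (mpoly_ring F I)"
    and "\<And>m. emb F (P m) = emb F (Q m)"
  shows "P = Q"
  by (rule ext, rule iffD1[OF emb_inject[OF F]]) (auto intro: mpoly_carrierD(1) assms)

lemma mpoly_mult_closed:
  assumes "P \<in> carrier (mpoly_ring F I)" "Q \<in> carrier (mpoly_ring F I)"
  shows "P \<otimes>\<^bsub>mpoly_ring F I\<^esub> Q \<in> carrier (mpoly_ring F I)"
proof -
  let ?R = "P \<otimes>\<^bsub>mpoly_ring F I\<^esub> Q"
  have "{m. ?R m \<noteq> \<zero>\<^bsub>F\<^esub>} \<subseteq> (\<lambda>(u, v). u + v) ` ({m. P m \<noteq> \<zero>\<^bsub>F\<^esub>} \<times> {m. Q m \<noteq> \<zero>\<^bsub>F\<^esub>})"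
  proof
    fix m assume "m \<in> {m. ?R m \<noteq> \<zero>\<^bsub>F\<^esub>}"
    then have "?R m \<noteq> \<zero>\<^bsub>F\<^esub>" by simp
    then obtain u v where "m = u + v" "P u \<noteq> \<zero>\<^bsub>F\<^esub>" "Q v \<noteq> \<zero>\<^bsub>F\<^esub>"
      by (rule mpoly_mult_nonzeroE[OF assms])
    then show "m \<in> (\<lambda>(u, v). u + v) ` ({m. P m \<noteq> \<zero>\<^bsub>F\<^esub>} \<times> {m. Q m \<noteq> \<zero>\<^bsub>F\<^esub>})"
      by (intro image_eqI[of _ _ "(u, v)"]) auto
  qed
  then have "finite {m. ?R m \<noteq> \<zero>\<^bsub>F\<^esub>}"
    by (rule finite_subset) (intro finite_imageI finite_cartesian_product mpoly_carrierD(2) assms)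
  moreover have "set_mset m \<subseteq> I" if m: "?R m \<noteq> \<zero>\<^bsub>F\<^esub>" for m
  proof -
    obtain u v where "m = u + v" "P u \<noteq> \<zero>\<^bsub>F\<^esub>" "Q v \<noteq> \<zero>\<^bsub>F\<^esub>"
      by (rule mpoly_mult_nonzeroE[OF assms m])
    then show ?thesis using mpoly_carrierD(3)[OF assms(1)] mpoly_carrierD(3)[OF assms(2)] by auto
  qed
  moreover have "?R m \<in> carrier F" for m by (rule emb_mpoly_mult[OF assms])
  moreover have "carrier (mpoly_ring F I) = {P. (\<forall>m. P m \<in> carrier F) \<and> finite {m. P m \<noteq> \<zero>\<^bsub>F\<^esub>} \<and>
                   (\<forall>m. P m \<noteq> \<zero>\<^bsub>F\<^esub> \<longrightarrow> set_mset m \<subseteq> I)}"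
    by (simp add: mpoly_ring_def)
  ultimately show ?thesis by blast
qed

lemma mpoly_simps:
  "(P \<oplus>\<^bsub>mpoly_ring F I\<^esub> Q) m = P m \<oplus>\<^bsub>F\<^esub> Q m" "\<zero>\<^bsub>mpoly_ring F I\<^esub> m = \<zero>\<^bsub>F\<^esub>"
  "\<one>\<^bsub>mpoly_ring F I\<^esub> m = (if m = {#} then \<one>\<^bsub>F\<^esub> else \<zero>\<^bsub>F\<^esub>)"
  by (simp_all add: mpoly_ring_def)

lemma mpoly_add_closed:
  assumes "P \<in> carrier (mpoly_ring F I)" "Q \<in> carrier (mpoly_ring F I)"
  shows "P \<oplus>\<^bsub>mpoly_ring F I\<^esub> Q \<in> carrier (mpoly_ring F I)"
proof -
  have "{m. P m \<oplus>\<^bsub>F\<^esub> Q m \<noteq> \<zero>\<^bsub>F\<^esub>} \<subseteq> {m. P m \<noteq> \<zero>\<^bsub>F\<^esub>} \<union> {m. Q m \<noteq> \<zero>\<^bsub>F\<^esub>}"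
    by auto
  then have "finite {m. P m \<oplus>\<^bsub>F\<^esub> Q m \<noteq> \<zero>\<^bsub>F\<^esub>}"
    by (rule finite_subset) (use assms in \<open>auto intro: mpoly_carrierD\<close>)
  moreover have "set_mset m \<subseteq> I" if m: "P m \<oplus>\<^bsub>F\<^esub> Q m \<noteq> \<zero>\<^bsub>F\<^esub>" for m
  proof -
    have "P m \<noteq> \<zero>\<^bsub>F\<^esub> \<or> Q m \<noteq> \<zero>\<^bsub>F\<^esub>" using m by auto
    then show ?thesis using mpoly_carrierD(3)[OF assms(1)] mpoly_carrierD(3)[OF assms(2)] by blast
  qed
  ultimately show ?thesis using assms by (auto simp: mpoly_ring_def)
qed

lemma cring_mpoly: "cring (mpoly_ring F I)"
proof (rule cringI)
  note D = mpoly_carrierD(1)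
  note es = emb_add[OF F] emb_zero[OF F] mpoly_simps D
  have zero: "\<zero>\<^bsub>mpoly_ring F I\<^esub> \<in> carrier (mpoly_ring F I)"
    and one: "\<one>\<^bsub>mpoly_ring F I\<^esub> \<in> carrier (mpoly_ring F I)"
    by (auto simp: mpoly_ring_def)
  show "abelian_group (mpoly_ring F I)"
  proof (rule abelian_groupI)
    fix P assume P: "P \<in> carrier (mpoly_ring F I)"
    have n: "(\<ominus>\<^bsub>F\<^esub> P m \<noteq> \<zero>\<^bsub>F\<^esub>) \<longleftrightarrow> P m \<noteq> \<zero>\<^bsub>F\<^esub>" for m
      using D[OF P] by (metis F.add.inv_eq_1_iff)
    have "(\<lambda>m. \<ominus>\<^bsub>F\<^esub> P m) \<in> carrier (mpoly_ring F I)"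
      using P D[OF P] by (simp add: mpoly_ring_def n)
    moreover have "(\<lambda>m. \<ominus>\<^bsub>F\<^esub> P m) \<oplus>\<^bsub>mpoly_ring F I\<^esub> P = \<zero>\<^bsub>mpoly_ring F I\<^esub>"
      using D[OF P] by (auto simp: mpoly_simps F.l_neg)
    ultimately show "\<exists>y\<in>carrier (mpoly_ring F I). y \<oplus>\<^bsub>mpoly_ring F I\<^esub> P = \<zero>\<^bsub>mpoly_ring F I\<^esub>"
      by blast
  qed (auto intro!: mpoly_add_closed zero mpoly_eqI simp: es algebra_simps)
  show "comm_monoid (mpoly_ring F I)"
  proof (rule comm_monoidI)
    fix P Q R assume P: "P \<in> carrier (mpoly_ring F I)" and Q: "Q \<in> carrier (mpoly_ring F I)"
      and R: "R \<in> carrier (mpoly_ring F I)"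
    show "(P \<otimes>\<^bsub>mpoly_ring F I\<^esub> Q) \<otimes>\<^bsub>mpoly_ring F I\<^esub> R = P \<otimes>\<^bsub>mpoly_ring F I\<^esub> (Q \<otimes>\<^bsub>mpoly_ring F I\<^esub> R)"
      by (rule mpoly_eqI) (simp_all add: mpoly_mult_closed P Q R emb_mpoly_mult conv_assoc)
    show "P \<otimes>\<^bsub>mpoly_ring F I\<^esub> Q = Q \<otimes>\<^bsub>mpoly_ring F I\<^esub> P"
      by (rule mpoly_eqI) (simp_all add: mpoly_mult_closed P Q emb_mpoly_mult conv_commute)
    have "emb F (\<one>\<^bsub>mpoly_ring F I\<^esub> m) = (if m = {#} then emb F \<one>\<^bsub>F\<^esub> else 0)" for m
      by (simp add: mpoly_simps emb_zero[OF F])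
    then show "\<one>\<^bsub>mpoly_ring F I\<^esub> \<otimes>\<^bsub>mpoly_ring F I\<^esub> P = P"
      by (intro mpoly_eqI) (simp_all add: mpoly_mult_closed P one emb_mpoly_mult conv_single emb_one_mult[OF F] D[OF P])
  qed (auto intro: mpoly_mult_closed one)
  fix P Q R assume P: "P \<in> carrier (mpoly_ring F I)" and Q: "Q \<in> carrier (mpoly_ring F I)"
    and R: "R \<in> carrier (mpoly_ring F I)"
  show "(P \<oplus>\<^bsub>mpoly_ring F I\<^esub> Q) \<otimes>\<^bsub>mpoly_ring F I\<^esub> R =
      P \<otimes>\<^bsub>mpoly_ring F I\<^esub> R \<oplus>\<^bsub>mpoly_ring F I\<^esub> Q \<otimes>\<^bsub>mpoly_ring F I\<^esub> R"
    by (rule mpoly_eqI)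
      (simp_all add: mpoly_mult_closed mpoly_add_closed P Q R emb_mpoly_mult es conv_add)
qed

lemma mvar_closed: "a \<in> I \<Longrightarrow> mvar F a \<in> carrier (mpoly_ring F I)"
  by (auto simp: mpoly_ring_def mvar_def)

lemma mconst_hom: "mconst F \<in> Ring.ring_hom F (mpoly_ring F I)"
proof (rule ring_hom_memI)
  have c: "mconst F x \<in> carrier (mpoly_ring F I)" if "x \<in> carrier F" for x
    using that by (auto simp: mpoly_ring_def mconst_def)
  fix x y assume x: "x \<in> carrier F" and y: "y \<in> carrier F"
  show "mconst F x \<in> carrier (mpoly_ring F I)" by (rule c[OF x])
  have e: "emb F (mconst F x m) = (if m = {#} then emb F x else 0)" for m x
    by (simp add: mconst_def emb_zero[OF F])
  show "mconst F (x \<otimes>\<^bsub>F\<^esub> y) = mconst F x \<otimes>\<^bsub>mpoly_ring F I\<^esub> mconst F y"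
    by (rule mpoly_eqI)
      (simp_all add: mpoly_mult_closed c x y emb_mpoly_mult e[abs_def] conv_single emb_mult[OF F])
  show "mconst F (x \<oplus>\<^bsub>F\<^esub> y) = mconst F x \<oplus>\<^bsub>mpoly_ring F I\<^esub> mconst F y"
    by (auto simp: mconst_def mpoly_simps fun_eq_iff)
next
  show "mconst F \<one>\<^bsub>F\<^esub> = \<one>\<^bsub>mpoly_ring F I\<^esub>"
    by (auto simp: mconst_def mpoly_simps fun_eq_iff)
qed

end

lemma base_change_ideal_eq:
  "base_change_ideal R \<phi> A F = genideal (mpoly_ring F (carrier A))
     ({mvar F a \<oplus>\<^bsub>mpoly_ring F (carrier A)\<^esub> mvar F b \<ominus>\<^bsub>mpoly_ring F (carrier A)\<^esub> mvar F (a \<oplus>\<^bsub>A\<^esub> b) | a b. a \<in> carrier A \<and> b \<in> carrier A} \<union>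
      {mvar F a \<otimes>\<^bsub>mpoly_ring F (carrier A)\<^esub> mvar F b \<ominus>\<^bsub>mpoly_ring F (carrier A)\<^esub> mvar F (a \<otimes>\<^bsub>A\<^esub> b) | a b. a \<in> carrier A \<and> b \<in> carrier A} \<union>
      {mvar F r \<ominus>\<^bsub>mpoly_ring F (carrier A)\<^esub> mconst F (\<phi> r) | r. r \<in> R})"
  (is "_ = genideal _ ?gens")
  by (simp add: base_change_ideal_def Let_def)

context
  fixes F :: "'f ring" and A :: "'b ring" and R \<phi>
  assumes F: "cring F" and A: "cring A" and R: "R \<subseteq> carrier A" "\<one>\<^bsub>A\<^esub> \<in> R"
    and \<phi>: "\<phi> \<in> R \<rightarrow> carrier F" "\<phi> \<one>\<^bsub>A\<^esub> = \<one>\<^bsub>F\<^esub>"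
begin

interpretation A: cring A by (rule A)
interpretation M: cring "mpoly_ring F (carrier A)" by (rule cring_mpoly[OF F])

lemma base_change_gens:
  "ideal (base_change_ideal R \<phi> A F) (mpoly_ring F (carrier A))"
  "a \<in> carrier A \<Longrightarrow> b \<in> carrier A \<Longrightarrow>
     mvar F a \<oplus>\<^bsub>mpoly_ring F (carrier A)\<^esub> mvar F b \<ominus>\<^bsub>mpoly_ring F (carrier A)\<^esub> mvar F (a \<oplus>\<^bsub>A\<^esub> b) \<in> base_change_ideal R \<phi> A F"
  "a \<in> carrier A \<Longrightarrow> b \<in> carrier A \<Longrightarrow>
     mvar F a \<otimes>\<^bsub>mpoly_ring F (carrier A)\<^esub> mvar F b \<ominus>\<^bsub>mpoly_ring F (carrier A)\<^esub> mvar F (a \<otimes>\<^bsub>A\<^esub> b) \<in> base_change_ideal R \<phi> A F"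
  "r \<in> R \<Longrightarrow> mvar F r \<ominus>\<^bsub>mpoly_ring F (carrier A)\<^esub> mconst F (\<phi> r) \<in> base_change_ideal R \<phi> A F"
proof -
  let ?gens = "({mvar F a \<oplus>\<^bsub>mpoly_ring F (carrier A)\<^esub> mvar F b \<ominus>\<^bsub>mpoly_ring F (carrier A)\<^esub> mvar F (a \<oplus>\<^bsub>A\<^esub> b) | a b. a \<in> carrier A \<and> b \<in> carrier A} \<union>
      {mvar F a \<otimes>\<^bsub>mpoly_ring F (carrier A)\<^esub> mvar F b \<ominus>\<^bsub>mpoly_ring F (carrier A)\<^esub> mvar F (a \<otimes>\<^bsub>A\<^esub> b) | a b. a \<in> carrier A \<and> b \<in> carrier A} \<union>
      {mvar F r \<ominus>\<^bsub>mpoly_ring F (carrier A)\<^esub> mconst F (\<phi> r) | r. r \<in> R})"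
  have "?gens \<subseteq> carrier (mpoly_ring F (carrier A))"
    using R(1) \<phi>(1) by (auto intro!: mvar_closed[OF F] ring_hom_memE(1)[OF mconst_hom[OF F]])
  then show "ideal (base_change_ideal R \<phi> A F) (mpoly_ring F (carrier A))"
    unfolding base_change_ideal_eq by (rule M.genideal_ideal)
  have "?gens \<subseteq> base_change_ideal R \<phi> A F"
    unfolding base_change_ideal_eq using \<open>?gens \<subseteq> carrier (mpoly_ring F (carrier A))\<close> by (rule M.genideal_self)
  then show "a \<in> carrier A \<Longrightarrow> b \<in> carrier A \<Longrightarrow>
     mvar F a \<oplus>\<^bsub>mpoly_ring F (carrier A)\<^esub> mvar F b \<ominus>\<^bsub>mpoly_ring F (carrier A)\<^esub> mvar F (a \<oplus>\<^bsub>A\<^esub> b) \<in> base_change_ideal R \<phi> A F"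
    "a \<in> carrier A \<Longrightarrow> b \<in> carrier A \<Longrightarrow>
     mvar F a \<otimes>\<^bsub>mpoly_ring F (carrier A)\<^esub> mvar F b \<ominus>\<^bsub>mpoly_ring F (carrier A)\<^esub> mvar F (a \<otimes>\<^bsub>A\<^esub> b) \<in> base_change_ideal R \<phi> A F"
    "r \<in> R \<Longrightarrow> mvar F r \<ominus>\<^bsub>mpoly_ring F (carrier A)\<^esub> mconst F (\<phi> r) \<in> base_change_ideal R \<phi> A F"
    by blast+
qed

lemma cring_base_change: "cring (base_change R \<phi> A F)"
  unfolding base_change_def by (rule ideal.quotient_is_cring[OF base_change_gens(1)]) (rule M.is_cring)

lemma coset_hom: "(+>\<^bsub>mpoly_ring F (carrier A)\<^esub>) (base_change_ideal R \<phi> A F) \<in> Ring.ring_hom (mpoly_ring F (carrier A)) (base_change R \<phi> A F)"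
  unfolding base_change_def by (rule ideal.rcos_ring_hom[OF base_change_gens(1)])

lemma coset_eq:
  assumes "P \<in> carrier (mpoly_ring F (carrier A))" "Q \<in> carrier (mpoly_ring F (carrier A))" "P \<ominus>\<^bsub>mpoly_ring F (carrier A)\<^esub> Q \<in> base_change_ideal R \<phi> A F"
  shows "base_change_ideal R \<phi> A F +>\<^bsub>mpoly_ring F (carrier A)\<^esub> P = base_change_ideal R \<phi> A F +>\<^bsub>mpoly_ring F (carrier A)\<^esub> Q"
  using M.quotient_eq_iff_same_a_r_cos[OF base_change_gens(1) assms(1,2)] assms(3) by simp

lemma base_change_in_const:
  "r \<in> R \<Longrightarrow> base_change_in R \<phi> A F r = base_change_const R \<phi> A F (\<phi> r)"
  unfolding base_change_in_def base_change_const_def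
  using R(1) \<phi>(1)
  by (intro coset_eq base_change_gens(4) mvar_closed[OF F] ring_hom_memE(1)[OF mconst_hom[OF F]]) auto

lemma base_change_const_hom: "base_change_const R \<phi> A F \<in> Ring.ring_hom F (base_change R \<phi> A F)"
  using ring_hom_trans[OF mconst_hom[OF F] coset_hom]
  by (simp add: base_change_const_def[abs_def] comp_def)

lemma base_change_in_hom: "base_change_in R \<phi> A F \<in> Ring.ring_hom A (base_change R \<phi> A F)"
proof (rule ring_hom_memI)
  note v = mvar_closed[OF F, of _ "carrier A"]
  note H = ring_hom_memE[OF coset_hom]
  fix a b assume a: "a \<in> carrier A" and b: "b \<in> carrier A"
  show "base_change_in R \<phi> A F a \<in> carrier (base_change R \<phi> A F)"
    unfolding base_change_in_def by (rule H(1)[OF v[OF a]])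
  show "base_change_in R \<phi> A F (a \<otimes>\<^bsub>A\<^esub> b) =
      base_change_in R \<phi> A F a \<otimes>\<^bsub>base_change R \<phi> A F\<^esub> base_change_in R \<phi> A F b"
    unfolding base_change_in_def H(2)[OF v[OF a] v[OF b], symmetric]
    by (rule coset_eq[symmetric]) (auto intro!: base_change_gens v a b)
  show "base_change_in R \<phi> A F (a \<oplus>\<^bsub>A\<^esub> b) =
      base_change_in R \<phi> A F a \<oplus>\<^bsub>base_change R \<phi> A F\<^esub> base_change_in R \<phi> A F b"
    unfolding base_change_in_def H(3)[OF v[OF a] v[OF b], symmetric]
    by (rule coset_eq[symmetric]) (auto intro!: base_change_gens v a b)
next
  show "base_change_in R \<phi> A F \<one>\<^bsub>A\<^esub> = \<one>\<^bsub>base_change R \<phi> A F\<^esub>"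
    using base_change_in_const[OF R(2)] ring_hom_memE(4)[OF base_change_const_hom] \<phi>(2) by simp
qed

end

lemma cring_away_hom:
  assumes "cring C" "g \<in> carrier C"
  shows "cring (away C g)" "away_in C g \<in> Ring.ring_hom C (away C g)"
proof -
  interpret UP_cring C "UP C" by (simp_all add: UP_cring_def assms)
  have i: "ideal (away_ideal C g) (UP C)"
    unfolding away_ideal_def by (rule P.genideal_ideal) (use assms in auto)
  show "cring (away C g)"
    unfolding away_def by (rule ideal.quotient_is_cring[OF i]) (rule P.is_cring)
  have "(\<lambda>c. up_ring.monom (UP C) c 0) \<in> Ring.ring_hom C (UP C)"
    using monom_mult[of _ _ 0 0] by (auto intro!: ring_hom_memI simp: monom_one simp del: monom_mult)
  from ring_hom_trans[OF this ideal.rcos_ring_hom[OF i]] show "away_in C g \<in> Ring.ring_hom C (away C g)"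
    by (simp add: away_in_def[abs_def] away_def comp_def)
qed

text \<open>
  Both homomorphisms are evaluated on polynomials, which kills the defining relations of the
  base change, and the isomorphism \<open>h\<close> transports the resulting homomorphism to
  \<open>T\<close>. The target is not supposed to have a unit, as for a reduced product of rings
  with varying units.
\<close>

lemma base_change_universal:
  fixes k A T R :: "'a::field set" and \<kappa> \<iota> :: "'a \<Rightarrow> 'c::comm_ring"
  assumes k: "subring_set k" and A: "subring_set A" and R: "R \<subseteq> A" "R \<subseteq> k" "1 \<in> R"
    and T: "subring_set T"
    and h: "h \<in> ring_iso (base_change R id (subr A) (subr k)) (subr T)"
    and h_in: "\<And>a. a \<in> A \<Longrightarrow> h (base_change_in R id (subr A) (subr k) a) = a"
    and h_const: "\<And>c. c \<in> k \<Longrightarrow> h (base_change_const R id (subr A) (subr k) c) = c"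
    and \<iota>: "\<And>a b. a \<in> A \<Longrightarrow> b \<in> A \<Longrightarrow> \<iota> (a + b) = \<iota> a + \<iota> b"
      "\<And>a b. a \<in> A \<Longrightarrow> b \<in> A \<Longrightarrow> \<iota> (a * b) = \<iota> a * \<iota> b"
    and \<kappa>: "\<And>a b. a \<in> k \<Longrightarrow> b \<in> k \<Longrightarrow> \<kappa> (a + b) = \<kappa> a + \<kappa> b"
      "\<And>a b. a \<in> k \<Longrightarrow> b \<in> k \<Longrightarrow> \<kappa> (a * b) = \<kappa> a * \<kappa> b"
    and agree: "\<And>r. r \<in> R \<Longrightarrow> \<iota> r = \<kappa> r"
  obtains \<Psi> :: "'a \<Rightarrow> 'c" where
    "\<And>x y. x \<in> T \<Longrightarrow> y \<in> T \<Longrightarrow> \<Psi> (x + y) = \<Psi> x + \<Psi> y"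
    "\<And>x y. x \<in> T \<Longrightarrow> y \<in> T \<Longrightarrow> \<Psi> (x * y) = \<Psi> x * \<Psi> y"
    "\<And>a. a \<in> A \<Longrightarrow> \<Psi> a = \<iota> a" "\<And>c. c \<in> k \<Longrightarrow> \<Psi> c = \<kappa> c"
proof -
  define E where "E = \<kappa> 1"
  define mon where "mon m = fold_mset (\<lambda>a. (*) (\<iota> a)) E m" for m
  define ev where "ev P = (\<Sum>m\<in>{m. P m \<noteq> 0}. \<kappa> (P m) * mon m)" for P
  let ?M = "mpoly_ring (subr k) A"
  note kD = subring_setD[OF k] and AD = subring_setD[OF A]
  interpret k: cring "subr k" by (rule cring_subr[OF k])
  interpret M: cring ?M by (rule cring_mpoly[OF cring_subr[OF k]])
  interpret mon: comp_fun_commute "\<lambda>a. (*) (\<iota> a)"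
    by standard (auto simp: fun_eq_iff ac_simps)
  have \<kappa>0: "\<kappa> 0 = 0" using \<kappa>(1)[of 0 0] kD by simp
  have \<kappa>sum: "\<kappa> (sum f S) = (\<Sum>i\<in>S. \<kappa> (f i))" if "\<And>i. i \<in> S \<Longrightarrow> f i \<in> k" for f and S :: "'a multiset set"
    using that by (induction S rule: infinite_finite_induct) (auto simp: \<kappa>0 \<kappa> subring_set_sum[OF k])
  have \<iota>E: "E * \<iota> a = \<iota> a" if "a \<in> A" for a
    using \<iota>(2)[of 1 a] that AD R agree[of 1] by (simp add: E_def)
  have \<kappa>E: "\<kappa> c * E = \<kappa> c" if "c \<in> k" for c
    using \<kappa>(2)[of c 1] that kD by (simp add: E_def)
  have mon0: "mon {#} = E" and mon_Suc: "mon (add_mset a m) = \<iota> a * mon m" for a m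
    by (simp_all add: mon_def)
  have Emon: "E * mon m = mon m" for m
    using \<kappa>E[OF kD(1)] by (induction m) (simp_all add: mon0 mon_Suc E_def[symmetric] mult.left_commute[of E])
  have mon_add: "mon (u + v) = mon u * mon v" for u v
    by (induction u) (auto simp: mon0 mon_Suc Emon mult.assoc)
  note MD = mpoly_carrierD[OF cring_subr[OF k], of _ A, simplified]
  have ev_super: "ev P = (\<Sum>m\<in>S. \<kappa> (P m) * mon m)" if "finite S" "{m. P m \<noteq> 0} \<subseteq> S" for P S
    unfolding ev_def using that by (intro sum.mono_neutral_left) (auto simp: \<kappa>0)
  have ev_add: "ev (P \<oplus>\<^bsub>?M\<^esub> Q) = ev P + ev Q" if P: "P \<in> carrier ?M" and Q: "Q \<in> carrier ?M" for P Q
  proof -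
    let ?S = "{m. P m \<noteq> 0} \<union> {m. Q m \<noteq> 0}"
    have f: "finite ?S" using MD(2)[OF P] MD(2)[OF Q] by simp
    have "ev (P \<oplus>\<^bsub>?M\<^esub> Q) = (\<Sum>m\<in>?S. \<kappa> (P m + Q m) * mon m)"
      by (subst ev_super[OF f]) (auto simp: mpoly_simps[OF cring_subr[OF k]])
    also have "\<dots> = ev P + ev Q"
      using MD(1)[OF P] MD(1)[OF Q]
      by (subst (1 2) ev_super[OF f]) (auto simp: \<kappa> sum.distrib distrib_right)
    finally show ?thesis .
  qed
  have ev_mult: "ev (P \<otimes>\<^bsub>?M\<^esub> Q) = ev P * ev Q" if P: "P \<in> carrier ?M" and Q: "Q \<in> carrier ?M" for P Q
  proof -
    define SP where "SP = {m. P m \<noteq> 0}"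
    define SQ where "SQ = {m. Q m \<noteq> 0}"
    have fin: "finite SP" "finite SQ" using MD(2)[OF P] MD(2)[OF Q] by (auto simp: SP_def SQ_def)
    define S where "S = (\<lambda>(u, v). u + v) ` (SP \<times> SQ)"
    define t where "t u v = (\<kappa> (P u) * mon u) * (\<kappa> (Q v) * mon v)" for u v
    have fS: "finite S" unfolding S_def using fin by blast
    have PQ: "(P \<otimes>\<^bsub>?M\<^esub> Q) m = (\<Sum>u\<in>{u. u \<subseteq># m}. P u * Q (m - u))" for m
      using MD(1)[OF P] MD(1)[OF Q] kD
      by (simp add: mpoly_ring_def finsum_subr[OF k] finite_submultisets Pi_def)
    have kPQ: "\<kappa> ((P \<otimes>\<^bsub>?M\<^esub> Q) m) * mon m = (\<Sum>(u, v)\<in>{x \<in> SP \<times> SQ. (case x of (u, v) \<Rightarrow> u + v) = m}. t u v)" for m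
    proof -
      have "\<kappa> ((P \<otimes>\<^bsub>?M\<^esub> Q) m) * mon m = (\<Sum>u\<in>{u. u \<subseteq># m}. \<kappa> (P u) * \<kappa> (Q (m - u)) * mon m)"
        unfolding PQ using MD(1)[OF P] MD(1)[OF Q] kD
        by (subst \<kappa>sum) (auto simp: \<kappa> sum_distrib_right)
      also have "\<dots> = (\<Sum>u\<in>{u. u \<subseteq># m}. t u (m - u))"
      proof (rule sum.cong)
        fix u assume "u \<in> {u. u \<subseteq># m}"
        then have "mon m = mon u * mon (m - u)" by (simp flip: mon_add)
        then show "\<kappa> (P u) * \<kappa> (Q (m - u)) * mon m = t u (m - u)" by (simp add: t_def ac_simps)
      qed simp
      also have "\<dots> = (\<Sum>(u, v)\<in>{x \<in> SP \<times> SQ. (case x of (u, v) \<Rightarrow> u + v) = m}. t u v)"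
        by (rule sum.reindex_bij_witness_not_neutral[of
              "{u. u \<subseteq># m \<and> t u (m - u) = 0}" "{x \<in> SP \<times> SQ. (case x of (u, v) \<Rightarrow> t u v) = 0}" _ "fst" "\<lambda>u. (u, m - u)"])
          (use fin in \<open>auto simp: finite_submultisets SP_def SQ_def t_def \<kappa>0\<close>)
      finally show ?thesis .
    qed
    have "{m. (P \<otimes>\<^bsub>?M\<^esub> Q) m \<noteq> 0} \<subseteq> S"
    proof
      fix m assume "m \<in> {m. (P \<otimes>\<^bsub>?M\<^esub> Q) m \<noteq> 0}"
      then have "(P \<otimes>\<^bsub>?M\<^esub> Q) m \<noteq> \<zero>\<^bsub>subr k\<^esub>" by simp
      then obtain u v where "m = u + v" "P u \<noteq> \<zero>\<^bsub>subr k\<^esub>" "Q v \<noteq> \<zero>\<^bsub>subr k\<^esub>"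
        by (rule mpoly_mult_nonzeroE[OF cring_subr[OF k] P Q])
      then show "m \<in> S" unfolding S_def by (intro image_eqI[of _ _ "(u, v)"]) (auto simp: SP_def SQ_def)
    qed
    then have "ev (P \<otimes>\<^bsub>?M\<^esub> Q) = (\<Sum>m\<in>S. \<Sum>(u, v)\<in>{x \<in> SP \<times> SQ. (case x of (u, v) \<Rightarrow> u + v) = m}. t u v)"
      by (subst ev_super[OF fS]) (auto simp: kPQ)
    also have "\<dots> = (\<Sum>(u, v)\<in>SP \<times> SQ. t u v)"
      by (rule sum.group) (use fin fS in \<open>auto simp: S_def\<close>)
    also have "\<dots> = ev P * ev Q"
      by (simp add: ev_def sum_product sum.cartesian_product t_def SP_def SQ_def)
    finally show ?thesis .
  qed
  have ev_var: "ev (mvar (subr k) a) = \<iota> a" if "a \<in> A" for a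
  proof -
    have "ev (mvar (subr k) a) = (\<Sum>m\<in>{{#a#}}. \<kappa> (mvar (subr k) a m) * mon m)"
      by (rule ev_super) (auto simp: mvar_def)
    then show ?thesis using \<iota>E[OF that] \<kappa>E[of 1] kD
      by (simp add: mvar_def mon0 mon_Suc E_def[symmetric] ac_simps)
  qed
  have ev_const: "ev (mconst (subr k) c) = \<kappa> c" if "c \<in> k" for c
  proof -
    have "ev (mconst (subr k) c) = (\<Sum>m\<in>{{#}}. \<kappa> (mconst (subr k) c m) * mon m)"
      by (rule ev_super) (auto simp: mconst_def)
    then show ?thesis using \<kappa>E[OF that] by (simp add: mconst_def mon0)
  qed
  have ev_minus: "ev (P \<ominus>\<^bsub>?M\<^esub> Q) = ev P - ev Q" if P: "P \<in> carrier ?M" and Q: "Q \<in> carrier ?M" for P Q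
  proof -
    have "(P \<ominus>\<^bsub>?M\<^esub> Q) \<oplus>\<^bsub>?M\<^esub> Q = P"
      using P Q by (simp add: a_minus_def M.a_assoc M.l_neg)
    then show ?thesis using ev_add[of "P \<ominus>\<^bsub>?M\<^esub> Q" Q] P Q by (simp add: algebra_simps)
  qed
  let ?I = "base_change_ideal R id (subr A) (subr k)"
  let ?K = "{P \<in> carrier ?M. ev P = 0}"
  have v: "mvar (subr k) a \<in> carrier ?M" if "a \<in> A" for a by (rule mvar_closed[OF cring_subr[OF k] that])
  note c = ring_hom_memE(1)[OF mconst_hom[OF cring_subr[OF k], of A], simplified]
  have K: "ideal ?K ?M"
  proof (rule idealI)
    show "Ring.ring ?M" ..
    show "subgroup ?K (add_monoid ?M)"
    proof (rule M.add.subgroupI)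
      show "?K \<noteq> {}" using ev_minus[of "\<zero>\<^bsub>?M\<^esub>" "\<zero>\<^bsub>?M\<^esub>"] M.r_neg[of "\<zero>\<^bsub>?M\<^esub>"] by (auto simp: a_minus_def intro!: exI[of _ "\<zero>\<^bsub>?M\<^esub>"])
      fix P assume P: "P \<in> ?K"
      have "ev \<zero>\<^bsub>?M\<^esub> = 0" using ev_add[of "\<zero>\<^bsub>?M\<^esub>" "\<zero>\<^bsub>?M\<^esub>"] by simp
      moreover have "ev (\<ominus>\<^bsub>?M\<^esub> P) + ev P = ev \<zero>\<^bsub>?M\<^esub>" using ev_add[of "\<ominus>\<^bsub>?M\<^esub> P" P] P by (simp add: M.l_neg)
      ultimately show "\<ominus>\<^bsub>?M\<^esub> P \<in> ?K" using P by auto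
    qed (auto simp: ev_add)
  qed (auto simp: ev_mult)
  have IK: "?I \<subseteq> ?K"
    unfolding base_change_ideal_eq subr_simps
    by (rule M.genideal_minimal[OF K])
      (use R in \<open>auto simp: ev_minus ev_add ev_mult v c ev_var ev_const \<iota> AD agree subset_iff\<close>)
  note bc = cring_subr[OF k] cring_subr[OF A]
  have "R \<subseteq> carrier (subr A)" "\<one>\<^bsub>subr A\<^esub> \<in> R" "id \<in> R \<rightarrow> carrier (subr k)" "id \<one>\<^bsub>subr A\<^esub> = \<one>\<^bsub>subr k\<^esub>"
    using R by auto
  note bc = bc this
  note cos = ring_hom_memE[OF coset_hom[where \<phi>=id, OF bc], unfolded subr_simps]
  have inj: "inj_on h (carrier (base_change R id (subr A) (subr k)))"
    and surj: "h ` carrier (base_change R id (subr A) (subr k)) = T"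
    and hom: "h \<in> Ring.ring_hom (base_change R id (subr A) (subr k)) (subr T)"
    using h by (auto simp: ring_iso_def bij_betw_def)
  define rep where "rep x = (SOME P. P \<in> carrier ?M \<and> h (?I +>\<^bsub>?M\<^esub> P) = x)" for x
  have rep: "rep x \<in> carrier ?M" "h (?I +>\<^bsub>?M\<^esub> rep x) = x" if "x \<in> T" for x
  proof -
    have "carrier (base_change R id (subr A) (subr k)) = (\<lambda>P. ?I +>\<^bsub>?M\<^esub> P) ` carrier ?M"
      by (auto simp: base_change_def FactRing_def A_RCOSETS_def RCOSETS_def a_r_coset_def)
    with surj that have "\<exists>P. P \<in> carrier ?M \<and> h (?I +>\<^bsub>?M\<^esub> P) = x" by auto
    from someI_ex[OF this] show "rep x \<in> carrier ?M" "h (?I +>\<^bsub>?M\<^esub> rep x) = x"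
      by (auto simp: rep_def)
  qed
  have key: "ev (rep x) = ev P" if "x \<in> T" "P \<in> carrier ?M" "h (?I +>\<^bsub>?M\<^esub> P) = x" for x P
  proof -
    have "?I +>\<^bsub>?M\<^esub> rep x = ?I +>\<^bsub>?M\<^esub> P"
    proof (rule inj_onD[OF inj])
      show "h (?I +>\<^bsub>?M\<^esub> rep x) = h (?I +>\<^bsub>?M\<^esub> P)" using rep(2)[OF that(1)] that(3) by simp
    qed (rule cos(1), rule rep(1)[OF that(1)], rule cos(1), rule that(2))
    then have "rep x \<ominus>\<^bsub>?M\<^esub> P \<in> ?I"
      using M.quotient_eq_iff_same_a_r_cos[OF base_change_gens(1)[where \<phi>=id, OF bc, unfolded subr_simps] rep(1)[OF that(1)] that(2)] by simp
    then have "ev (rep x \<ominus>\<^bsub>?M\<^esub> P) = 0" using IK by blast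
    then show ?thesis using ev_minus[OF rep(1)[OF that(1)] that(2)] by simp
  qed
  note homE = ring_hom_memE[OF hom, unfolded subr_simps]
  show thesis
  proof (rule that[of "\<lambda>x. ev (rep x)"])
    fix x y assume x: "x \<in> T" and y: "y \<in> T"
    show "ev (rep (x + y)) = ev (rep x) + ev (rep y)"
      using rep[OF x] rep[OF y] subring_setD[OF T] x y
      by (subst key[of "x + y" "rep x \<oplus>\<^bsub>?M\<^esub> rep y"]) (simp_all add: ev_add cos(1,3) homE(3) subring_setD(2))
    show "ev (rep (x * y)) = ev (rep x) * ev (rep y)"
      using rep[OF x] rep[OF y] subring_setD[OF T] x y
      by (subst key[of "x * y" "rep x \<otimes>\<^bsub>?M\<^esub> rep y"]) (simp_all add: ev_mult cos(1,2) homE(2) subring_setD(3))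
  next
    fix a assume a: "a \<in> A"
    have "a \<in> T" using h_in[OF a] homE(1) ring_hom_memE(1)[OF base_change_in_hom[where \<phi>=id, OF bc]] a by (metis subr_simps(1))
    then show "ev (rep a) = \<iota> a"
      using h_in[OF a] by (subst key[of a "mvar (subr k) a"]) (auto simp: v a ev_var base_change_in_def)
  next
    fix a assume a: "a \<in> k"
    have "a \<in> T" using h_const[OF a] homE(1) ring_hom_memE(1)[OF base_change_const_hom[where \<phi>=id, OF bc]] a by (metis subr_simps(1))
    then show "ev (rep a) = \<kappa> a"
      using h_const[OF a] by (subst key[of a "mconst (subr k) a"]) (auto simp: c a ev_const base_change_const_def)
  qed
qed

section \<open>Kaehler differentials and derivations\<close>

lemma derivationsD:
  assumes "D \<in> derivations S C"
  shows "x \<in> carrier C \<Longrightarrow> D x \<in> carrier C"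
    "x \<in> carrier C \<Longrightarrow> y \<in> carrier C \<Longrightarrow> D (x \<oplus>\<^bsub>C\<^esub> y) = D x \<oplus>\<^bsub>C\<^esub> D y"
    "x \<in> carrier C \<Longrightarrow> y \<in> carrier C \<Longrightarrow> D (x \<otimes>\<^bsub>C\<^esub> y) = x \<otimes>\<^bsub>C\<^esub> D y \<oplus>\<^bsub>C\<^esub> y \<otimes>\<^bsub>C\<^esub> D x"
    "c \<in> S \<Longrightarrow> D c = \<zero>\<^bsub>C\<^esub>"
  using assms by (auto simp: derivations_def)

lemma contract_Nil [simp]: "contract C D [] = \<zero>\<^bsub>C\<^esub>"
  and contract_Cons [simp]: "contract C D ((a, b) # w) = a \<otimes>\<^bsub>C\<^esub> D b \<oplus>\<^bsub>C\<^esub> contract C D w"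
  by (simp_all add: contract_def)

lemma kforms_Nil [simp]: "[] \<in> kforms C"
  and kforms_Cons [simp]: "(a, b) # w \<in> kforms C \<longleftrightarrow> a \<in> carrier C \<and> b \<in> carrier C \<and> w \<in> kforms C"
  and kforms_append [simp]: "v @ w \<in> kforms C \<longleftrightarrow> v \<in> kforms C \<and> w \<in> kforms C"
  by (auto simp: kforms_def)

lemma kforms_induct [consumes 1, case_names Nil Cons]:
  assumes "w \<in> kforms C" and "P []"
    and "\<And>a b w. a \<in> carrier C \<Longrightarrow> b \<in> carrier C \<Longrightarrow> w \<in> kforms C \<Longrightarrow> P w \<Longrightarrow> P ((a, b) # w)"
  shows "P w"
  using assms(1) by (induction w) (auto intro: assms(2,3))

abbreviation (input) coord_form :: "nat \<Rightarrow> (nat \<Rightarrow> 'a) \<Rightarrow> (nat \<Rightarrow> 'a) \<Rightarrow> 'a kform" where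
  "coord_form d x c \<equiv> map (\<lambda>i. (c i, x i)) [0..<d]"

definition scale_form :: "('a, 'm) ring_scheme \<Rightarrow> 'a \<Rightarrow> 'a kform \<Rightarrow> 'a kform" where
  "scale_form C a w = map (\<lambda>(f, g). (a \<otimes>\<^bsub>C\<^esub> f, g)) w"

lemma scale_form_simps [simp]:
  "scale_form C a [] = []" "scale_form C a ((f, g) # w) = (a \<otimes>\<^bsub>C\<^esub> f, g) # scale_form C a w"
  "scale_form C a (v @ w) = scale_form C a v @ scale_form C a w"
  by (simp_all add: scale_form_def)

context
  fixes C :: "('a, 'm) ring_scheme" and S :: "'a set"
  assumes C: "cring C"
begin

interpretation cring C by (rule C)

lemma contract_closed: "D \<in> derivations S C \<Longrightarrow> w \<in> kforms C \<Longrightarrow> contract C D w \<in> carrier C"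
  by (induction w) (auto simp: derivationsD(1)[of D S C])

lemma contract_append:
  "D \<in> derivations S C \<Longrightarrow> v \<in> kforms C \<Longrightarrow> w \<in> kforms C \<Longrightarrow>
    contract C D (v @ w) = contract C D v \<oplus>\<^bsub>C\<^esub> contract C D w"
  by (induction v) (auto simp: contract_closed a_assoc derivationsD(1)[of D S])

lemma kaehler_eq_kforms: "kaehler_eq C S v w \<Longrightarrow> v \<in> kforms C \<and> w \<in> kforms C"
  by (induction rule: kaehler_eq.induct) auto

lemma kaehler_eq_contract:
  assumes D: "D \<in> derivations S C"
  shows "kaehler_eq C S v w \<Longrightarrow> contract C D v = contract C D w"
proof (induction rule: kaehler_eq.induct)
  case (cong v v' w w')
  then show ?case by (metis contract_append[OF D] kaehler_eq_kforms)
qed (auto simp: contract_append[OF D] contract_closed[OF D] derivationsD[OF D] a_comm l_distr r_distr m_assoc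
      a_assoc)

lemma scale_form_kforms: "a \<in> carrier C \<Longrightarrow> w \<in> kforms C \<Longrightarrow> scale_form C a w \<in> kforms C"
  by (induction w) auto

lemma kaehler_eq_scale:
  assumes a: "a \<in> carrier C"
  shows "kaehler_eq C S v w \<Longrightarrow> kaehler_eq C S (scale_form C a v) (scale_form C a w)"
proof (induction rule: kaehler_eq.induct)
  case (d_mult b c f)
  then show ?case using kaehler_eq.d_mult[of "a \<otimes>\<^bsub>C\<^esub> b" C c f S] a by (simp add: m_assoc)
next
  case (coeff_add b c f)
  then show ?case using kaehler_eq.coeff_add[of "a \<otimes>\<^bsub>C\<^esub> b" C "a \<otimes>\<^bsub>C\<^esub> c" f S] a by (simp add: r_distr)
next
  case (trans u v w)
  then show ?case by (rule_tac kaehler_eq.trans) auto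
next
  case (sym v w)
  then show ?case by (rule_tac kaehler_eq.sym) auto
qed (auto intro: kaehler_eq.refl kaehler_eq.comm kaehler_eq.cong kaehler_eq.coeff_zero kaehler_eq.d_const
      kaehler_eq.d_add simp: scale_form_kforms a)

lemma kaehler_eq_add_coeffs:
  assumes "f \<in> set is \<rightarrow> carrier C" "g \<in> set is \<rightarrow> carrier C" "x \<in> set is \<rightarrow> carrier C"
  shows "kaehler_eq C S (map (\<lambda>i. (f i \<oplus>\<^bsub>C\<^esub> g i, x i)) is)
    (map (\<lambda>i. (f i, x i)) is @ map (\<lambda>i. (g i, x i)) is)"
  using assms
proof (induction "is")
  case (Cons i "is")
  let ?F = "map (\<lambda>i. (f i, x i)) is" and ?G = "map (\<lambda>i. (g i, x i)) is"
  have kf: "?F \<in> kforms C" "?G \<in> kforms C" "[(f i, x i)] \<in> kforms C" "[(g i, x i)] \<in> kforms C"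
    using Cons.prems by (auto simp: kforms_def Pi_def)
  have "kaehler_eq C S ([(f i \<oplus>\<^bsub>C\<^esub> g i, x i)] @ map (\<lambda>i. (f i \<oplus>\<^bsub>C\<^esub> g i, x i)) is)
      ([(f i, x i), (g i, x i)] @ (?F @ ?G))"
    using Cons by (intro kaehler_eq.cong kaehler_eq.coeff_add Cons.IH) auto
  moreover have "kaehler_eq C S ([(f i, x i)] @ ([(g i, x i)] @ ?F) @ ?G) ([(f i, x i)] @ (?F @ [(g i, x i)]) @ ?G)"
    by (intro kaehler_eq.cong kaehler_eq.comm kaehler_eq.refl kf)
  ultimately have "kaehler_eq C S ([(f i \<oplus>\<^bsub>C\<^esub> g i, x i)] @ map (\<lambda>i. (f i \<oplus>\<^bsub>C\<^esub> g i, x i)) is)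
      ([(f i, x i)] @ (?F @ [(g i, x i)]) @ ?G)"
    by (simp add: kaehler_eq.trans)
  then show ?case by simp
qed (auto intro: kaehler_eq.refl)

lemma kaehler_eq_zero_coeffs:
  assumes "\<And>i. i \<in> set is \<Longrightarrow> f i = \<zero>\<^bsub>C\<^esub>" "x \<in> set is \<rightarrow> carrier C"
  shows "kaehler_eq C S (map (\<lambda>i. (f i, x i)) is) []"
  using assms
proof (induction "is")
  case (Cons i "is")
  then have "kaehler_eq C S ([(f i, x i)] @ map (\<lambda>i. (f i, x i)) is) ([] @ [])"
    by (intro kaehler_eq.cong) (auto intro: kaehler_eq.coeff_zero)
  then show ?case by simp
qed (auto intro: kaehler_eq.refl)

context
  fixes d and x :: "nat \<Rightarrow> 'a"
  assumes coord: "coordinates C S d x"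
begin

lemma coord_x: "i < d \<Longrightarrow> x i \<in> carrier C"
  using coord by (auto simp: coordinates_def)

lemma coord_ex: "w \<in> kforms C \<Longrightarrow> \<exists>c. (\<forall>i<d. c i \<in> carrier C) \<and> kaehler_eq C S w (coord_form d x c)"
proof -
  assume "w \<in> kforms C"
  then obtain c where "c \<in> {..<d} \<rightarrow> carrier C" "kaehler_eq C S w (coord_form d x c)"
    using coord unfolding coordinates_def by blast
  then show ?thesis by (intro exI[of _ c]) auto
qed

lemma coord_zero:
  "(\<And>i. i < d \<Longrightarrow> c i \<in> carrier C) \<Longrightarrow> kaehler_eq C S (coord_form d x c) [] \<Longrightarrow> i < d \<Longrightarrow> c i = \<zero>\<^bsub>C\<^esub>"
  using coord unfolding coordinates_def by (auto simp: Pi_def)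

lemma coord_unique:
  assumes c: "\<And>i. i < d \<Longrightarrow> c i \<in> carrier C" and c': "\<And>i. i < d \<Longrightarrow> c' i \<in> carrier C"
    and eq: "kaehler_eq C S (coord_form d x c) (coord_form d x c')" and i: "i < d"
  shows "c i = c' i"
proof -
  let ?n = "\<lambda>i. \<ominus>\<^bsub>C\<^esub> c' i"
  have 1: "kaehler_eq C S (coord_form d x (\<lambda>i. c i \<oplus>\<^bsub>C\<^esub> ?n i)) (coord_form d x c @ coord_form d x ?n)"
    by (rule kaehler_eq_add_coeffs) (use c c' coord_x in auto)
  have "coord_form d x ?n \<in> kforms C" using c' coord_x by (auto simp: kforms_def)
  then have 2: "kaehler_eq C S (coord_form d x c @ coord_form d x ?n) (coord_form d x c' @ coord_form d x ?n)"
    by (intro kaehler_eq.cong eq kaehler_eq.refl)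
  have 3: "kaehler_eq C S (coord_form d x (\<lambda>i. c' i \<oplus>\<^bsub>C\<^esub> ?n i)) (coord_form d x c' @ coord_form d x ?n)"
    by (rule kaehler_eq_add_coeffs) (use c' coord_x in auto)
  have 4: "kaehler_eq C S (coord_form d x (\<lambda>i. c' i \<oplus>\<^bsub>C\<^esub> ?n i)) []"
    by (rule kaehler_eq_zero_coeffs) (use c' coord_x in \<open>auto simp: r_neg\<close>)
  have "kaehler_eq C S (coord_form d x (\<lambda>i. c i \<oplus>\<^bsub>C\<^esub> ?n i)) []"
    by (rule kaehler_eq.trans[OF 1 kaehler_eq.trans[OF 2 kaehler_eq.trans[OF kaehler_eq.sym[OF 3] 4]]])
  from coord_zero[OF _ this i] have "c i \<oplus>\<^bsub>C\<^esub> ?n i = \<zero>\<^bsub>C\<^esub>"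
    by (simp add: c c')
  then have "c i \<ominus>\<^bsub>C\<^esub> c' i = \<zero>\<^bsub>C\<^esub>" by (simp add: a_minus_def)
  then show ?thesis using c[OF i] c'[OF i] by simp
qed

definition "components w = (SOME c. (\<forall>i<d. c i \<in> carrier C) \<and> kaehler_eq C S w (coord_form d x c))"

lemma components:
  assumes "w \<in> kforms C"
  shows "i < d \<Longrightarrow> components w i \<in> carrier C" "kaehler_eq C S w (coord_form d x (components w))"
  using someI_ex[OF coord_ex[OF assms]] by (auto simp: components_def)

lemma components_eqI:
  assumes "kaehler_eq C S w (coord_form d x c)" "\<And>i. i < d \<Longrightarrow> c i \<in> carrier C" "i < d"
  shows "components w i = c i"
proof (rule coord_unique[OF components(1) _ _ assms(3)])
  have w: "w \<in> kforms C" using assms(1) kaehler_eq_kforms by blast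
  show "w \<in> kforms C" by fact
  show "kaehler_eq C S (coord_form d x (components w)) (coord_form d x c)"
    by (rule kaehler_eq.trans[OF kaehler_eq.sym[OF components(2)[OF w]] assms(1)])
qed (use assms in auto)

lemma components_add:
  assumes v: "v \<in> kforms C" and w: "w \<in> kforms C" and u: "kaehler_eq C S u (v @ w)" and i: "i < d"
  shows "components u i = components v i \<oplus>\<^bsub>C\<^esub> components w i"
proof -
  have 1: "kaehler_eq C S (v @ w) (coord_form d x (components v) @ coord_form d x (components w))"
    by (intro kaehler_eq.cong components v w)
  have 2: "kaehler_eq C S (coord_form d x (\<lambda>i. components v i \<oplus>\<^bsub>C\<^esub> components w i)) (coord_form d x (components v) @ coord_form d x (components w))"
    by (rule kaehler_eq_add_coeffs) (use v w coord_x components in auto)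
  have "kaehler_eq C S u (coord_form d x (\<lambda>i. components v i \<oplus>\<^bsub>C\<^esub> components w i))"
    by (rule kaehler_eq.trans[OF u kaehler_eq.trans[OF 1 kaehler_eq.sym[OF 2]]])
  from components_eqI[OF this _ i] show ?thesis using components(1)[OF v] components(1)[OF w] by auto
qed

lemma components_scale:
  assumes v: "v \<in> kforms C" and a: "a \<in> carrier C" and i: "i < d"
  shows "components (scale_form C a v) i = a \<otimes>\<^bsub>C\<^esub> components v i"
proof (rule components_eqI[OF _ _ i])
  show "kaehler_eq C S (scale_form C a v) (coord_form d x (\<lambda>i. a \<otimes>\<^bsub>C\<^esub> components v i))"
    using kaehler_eq_scale[OF a components(2)[OF v]] by (simp add: scale_form_def comp_def)
qed (use a components(1)[OF v] in auto)

lemma components_zero: "kaehler_eq C S w [] \<Longrightarrow> i < d \<Longrightarrow> components w i = \<zero>\<^bsub>C\<^esub>"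
proof -
  assume w: "kaehler_eq C S w []" and i: "i < d"
  have "kaehler_eq C S (coord_form d x (\<lambda>_. \<zero>\<^bsub>C\<^esub>)) []"
    by (rule kaehler_eq_zero_coeffs) (use coord_x in auto)
  then show ?thesis
    using components_eqI[OF kaehler_eq.trans[OF w kaehler_eq.sym], of "\<lambda>_. \<zero>\<^bsub>C\<^esub>" i] i by simp
qed

text \<open>
  With a basis of differentials \<open>dx\<^sub>i\<close>, the \<open>i\<close>-th component of
  \<open>dy\<close> is the partial derivative of \<open>y\<close>.
\<close>

lemma dual_derivation:
  assumes S: "S \<subseteq> carrier C" and i: "i < d"
  shows "(\<lambda>y. components [(\<one>\<^bsub>C\<^esub>, y)] i) \<in> derivations S C"
  unfolding derivations_def
proof (intro CollectI conjI ballI funcsetI)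
  fix y assume y: "y \<in> carrier C"
  show "components [(\<one>\<^bsub>C\<^esub>, y)] i \<in> carrier C" by (rule components) (use y i in auto)
  fix z assume z: "z \<in> carrier C"
  show "components [(\<one>\<^bsub>C\<^esub>, y \<oplus>\<^bsub>C\<^esub> z)] i = components [(\<one>\<^bsub>C\<^esub>, y)] i \<oplus>\<^bsub>C\<^esub> components [(\<one>\<^bsub>C\<^esub>, z)] i"
    by (rule components_add[OF _ _ _ i]) (use y z kaehler_eq.d_add[of "\<one>\<^bsub>C\<^esub>" C y z S] in auto)
  have "components [(\<one>\<^bsub>C\<^esub>, y \<otimes>\<^bsub>C\<^esub> z)] i =
      components (scale_form C y [(\<one>\<^bsub>C\<^esub>, z)]) i \<oplus>\<^bsub>C\<^esub> components (scale_form C z [(\<one>\<^bsub>C\<^esub>, y)]) i"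
    by (rule components_add[OF _ _ _ i]) (use y z kaehler_eq.d_mult[of "\<one>\<^bsub>C\<^esub>" C y z S] in auto)
  then show "components [(\<one>\<^bsub>C\<^esub>, y \<otimes>\<^bsub>C\<^esub> z)] i =
      y \<otimes>\<^bsub>C\<^esub> components [(\<one>\<^bsub>C\<^esub>, z)] i \<oplus>\<^bsub>C\<^esub> z \<otimes>\<^bsub>C\<^esub> components [(\<one>\<^bsub>C\<^esub>, y)] i"
    using y z i by (simp only: components_scale kforms_Cons kforms_Nil one_closed)
next
  fix c assume "c \<in> S"
  then show "components [(\<one>\<^bsub>C\<^esub>, c)] i = \<zero>\<^bsub>C\<^esub>"
    using S i by (intro components_zero kaehler_eq.d_const) auto
qed

lemma contract_dual_derivation:
  assumes S: "S \<subseteq> carrier C" and i: "i < d" and w: "w \<in> kforms C"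
  shows "contract C (\<lambda>y. components [(\<one>\<^bsub>C\<^esub>, y)] i) w = components w i"
  using w
proof (induction w rule: kforms_induct)
  case Nil
  then show ?case using components_zero[OF kaehler_eq.refl i] by simp
next
  case (Cons a b w)
  have "components ((a, b) # w) i = components (scale_form C a [(\<one>\<^bsub>C\<^esub>, b)]) i \<oplus>\<^bsub>C\<^esub> components w i"
    by (rule components_add[OF _ _ _ i]) (use Cons in \<open>auto intro: kaehler_eq.refl\<close>)
  then show ?case using Cons i by (simp only: components_scale kforms_Cons kforms_Nil one_closed contract_Cons)
qed

text \<open>
  The components of a form are its contractions with the partial derivatives.
\<close>

lemma kaehler_eq_zero_if_contract_zero:
  assumes S: "S \<subseteq> carrier C" and w: "w \<in> kforms C"
    and z: "\<And>D. D \<in> derivations S C \<Longrightarrow> contract C D w = \<zero>\<^bsub>C\<^esub>"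
  shows "kaehler_eq C S w []"
proof -
  have "components w i = \<zero>\<^bsub>C\<^esub>" if "i < d" for i
    using z[OF dual_derivation[OF S that]] contract_dual_derivation[OF S that w] by simp
  then have "kaehler_eq C S (coord_form d x (components w)) []"
    by (intro kaehler_eq_zero_coeffs) (use coord_x in auto)
  then show ?thesis by (rule kaehler_eq.trans[OF components(2)[OF w]])
qed

text \<open>
  A derivation is a contraction of the universal differential, and the coordinates generate the
  differentials.
\<close>

lemma derivation_zero_if_zero_on_coordinates:
  assumes E: "E \<in> derivations S C" and z: "\<And>i. i < d \<Longrightarrow> E (x i) = \<zero>\<^bsub>C\<^esub>" and y: "y \<in> carrier C"
  shows "E y = \<zero>\<^bsub>C\<^esub>"
proof -
  have w: "[(\<one>\<^bsub>C\<^esub>, y)] \<in> kforms C" using y by simp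
  have zero: "contract C E (map (\<lambda>i. (c i, x i)) is) = \<zero>\<^bsub>C\<^esub>"
    if "set is \<subseteq> {..<d}" "\<And>i. i < d \<Longrightarrow> c i \<in> carrier C" for c "is"
    using that by (induction "is") (auto simp: z)
  have "contract C E [(\<one>\<^bsub>C\<^esub>, y)] = contract C E (coord_form d x (components [(\<one>\<^bsub>C\<^esub>, y)]))"
    by (rule kaehler_eq_contract[OF E components(2)[OF w]])
  also have "\<dots> = \<zero>\<^bsub>C\<^esub>"
    by (rule zero) (auto simp: components(1)[OF w])
  finally show ?thesis using y derivationsD(1)[OF E y] by simp
qed

end

end

text \<open>
  The binomial coefficients in Leibniz's rule are divisible by \<open>p\<close>, so
  \<open>D\<^sup>p\<close> is again a derivation.
\<close>

lemma (in derivation) pow_p_mult: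
  assumes p: "Factorial_Ring.prime p" and pm: "\<And>x. of_nat p * D x = 0"
  shows "(D ^^ p) (x * y) = x * (D ^^ p) y + y * (D ^^ p) x"
proof -
  have c: "(cov 1 (\<lambda>_ _. 0) ^^ k) v 0 = (D ^^ k) (v 0)" for k v
    by (induction k arbitrary: v) (auto simp: cov_def)
  have z: "of_nat (p choose i) * ((D ^^ i) x * z) = 0" if i: "i \<in> {..p} - {0, p}" for i z
  proof -
    from i have "p dvd (p choose i)"
      using p by (intro dvd_choose_prime) auto
    then obtain m where m: "p choose i = p * m" by blast
    obtain l where l: "i = Suc l" using i by (cases i) auto
    have "of_nat (p choose i) * ((D ^^ i) x * z) = of_nat m * z * (of_nat p * (D ^^ i) x)"
      by (simp add: m ac_simps)
    also have "of_nat p * (D ^^ i) x = 0" by (simp add: l pm)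
    finally show ?thesis by simp
  qed
  have "0 < p" using p by (rule prime_gt_0_nat)
  have "(D ^^ p) (x * y) = (\<Sum>i\<le>p. of_nat (p choose i) * ((D ^^ i) x * (D ^^ (p - i)) y))"
    using cov_pow_leibniz[where a = 0 and N = 1 and W = "\<lambda>_ _. 0" and k = p and f = x and v = "\<lambda>_. y"] by (simp add: c[unfolded One_nat_def])
  also have "\<dots> = (\<Sum>i\<in>{0, p}. of_nat (p choose i) * ((D ^^ i) x * (D ^^ (p - i)) y))"
    by (rule sum.mono_neutral_right) (use z in auto)
  finally show ?thesis using \<open>0 < p\<close> by (simp add: ac_simps)
qed

section \<open>Passage from local rings to an affine ring\<close>

definition sub_ideal :: "'a::comm_ring_1 set \<Rightarrow> 'a set \<Rightarrow> bool" where
  "sub_ideal A I \<longleftrightarrow> I \<subseteq> A \<and> 0 \<in> I \<and> (\<forall>x\<in>I. \<forall>y\<in>I. x + y \<in> I) \<and> (\<forall>a\<in>A. \<forall>x\<in>I. a * x \<in> I)"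

lemma sub_idealD:
  assumes "sub_ideal A I"
  shows "x \<in> I \<Longrightarrow> x \<in> A" "0 \<in> I" "x \<in> I \<Longrightarrow> y \<in> I \<Longrightarrow> x + y \<in> I" "a \<in> A \<Longrightarrow> x \<in> I \<Longrightarrow> a * x \<in> I"
  using assms by (auto simp: sub_ideal_def)

context
  fixes A :: "'a::field set"
  assumes A: "subring_set A"
begin

interpretation A: cring "subr A" by (rule cring_subr[OF A])

lemmas AD = subring_setD[OF A]

lemma sub_ideal_imp_ideal:
  assumes I: "sub_ideal A I"
  shows "ideal I (subr A)"
proof (rule idealI)
  show "Ring.ring (subr A)" ..
  have um: "- x \<in> I" if "x \<in> I" for x
    using sub_idealD(4)[OF I _ that, of "- 1"] AD by simp
  show "subgroup I (add_monoid (subr A))"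
    by (rule A.add.subgroupI)
      (use sub_idealD[OF I] um in \<open>auto simp: subr_uminus[OF A]\<close>)
next
  fix a x assume "a \<in> I" "x \<in> carrier (subr A)"
  then show "x \<otimes>\<^bsub>subr A\<^esub> a \<in> I" "a \<otimes>\<^bsub>subr A\<^esub> x \<in> I"
    using sub_idealD(4)[OF I, of x a] by (simp_all add: mult.commute)
qed

lemma prime_above:
  assumes I: "sub_ideal A I" "1 \<notin> I"
  obtains P where "primeideal P (subr A)" "I \<subseteq> P"
proof -
  define S where "S = {J. sub_ideal A J \<and> 1 \<notin> J \<and> I \<subseteq> J}"
  have "\<exists>M\<in>S. (\<forall>Z\<in>S. M \<subseteq> Z \<longrightarrow> Z = M)"
  proof (rule subset_Zorn_nonempty)
    show "S \<noteq> {}" using I by (auto simp: S_def)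
    fix C assume C: "C \<noteq> {}" "subset.chain S C"
    have mem: "sub_ideal A Z" "1 \<notin> Z" "I \<subseteq> Z" if "Z \<in> C" for Z
      using C that by (auto simp: subset_chain_def S_def)
    obtain Z0 where Z0: "Z0 \<in> C" using C(1) by blast
    have "sub_ideal A (\<Union>C)"
      unfolding sub_ideal_def
    proof (intro conjI ballI)
      show "\<Union>C \<subseteq> A" using sub_idealD(1)[OF mem(1)] by blast
      show "0 \<in> \<Union>C" using sub_idealD(2)[OF mem(1)[OF Z0]] Z0 by blast
      fix x assume "x \<in> \<Union>C"
      then obtain Z where Z: "Z \<in> C" "x \<in> Z" by blast
      show "a * x \<in> \<Union>C" if "a \<in> A" for a
        using sub_idealD(4)[OF mem(1)[OF Z(1)] that Z(2)] Z(1) by blast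
      fix y assume "y \<in> \<Union>C"
      then obtain Z' where Z': "Z' \<in> C" "y \<in> Z'" by blast
      from C(2) Z(1) Z'(1) have "Z \<subseteq> Z' \<or> Z' \<subseteq> Z" unfolding subset_chain_def by blast
      then show "x + y \<in> \<Union>C"
      proof
        assume "Z \<subseteq> Z'"
        then show ?thesis using sub_idealD(3)[OF mem(1)[OF Z'(1)], of x y] Z Z' by blast
      next
        assume "Z' \<subseteq> Z"
        then show ?thesis using sub_idealD(3)[OF mem(1)[OF Z(1)], of x y] Z Z' by blast
      qed
    qed
    moreover have "1 \<notin> \<Union>C" using mem(2) by blast
    moreover have "I \<subseteq> \<Union>C" using mem(3)[OF Z0] Z0 by blast
    ultimately show "\<Union>C \<in> S" by (simp add: S_def)
  qed
  then obtain M where M: "M \<in> S" and max: "\<forall>Z\<in>S. M \<subseteq> Z \<longrightarrow> Z = M" by (rule bexE)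
  have MI: "sub_ideal A M" "1 \<notin> M" "I \<subseteq> M" using M by (auto simp: S_def)
  have one: "\<exists>m\<in>M. \<exists>r\<in>A. 1 = m + r * a" if a: "a \<in> A" "a \<notin> M" for a
  proof -
    define J where "J = {m + r * a | m r. m \<in> M \<and> r \<in> A}"
    have sub: "M \<subseteq> J" unfolding J_def using AD(6) by force
    have "a = 0 + 1 * a" by simp
    then have "a \<in> J" unfolding J_def using sub_idealD(2)[OF MI(1)] AD(1) by blast
    have "sub_ideal A J"
      unfolding sub_ideal_def
    proof (intro conjI ballI)
      show "J \<subseteq> A" unfolding J_def using sub_idealD(1)[OF MI(1)] a AD by blast
      show "0 \<in> J" using sub sub_idealD(2)[OF MI(1)] by blast
      fix x assume "x \<in> J"
      then obtain m r where x: "x = m + r * a" "m \<in> M" "r \<in> A" by (auto simp: J_def)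
      show "b * x \<in> J" if "b \<in> A" for b
      proof -
        have "b * x = b * m + (b * r) * a" by (simp add: x algebra_simps)
        then show ?thesis unfolding J_def using sub_idealD(4)[OF MI(1) that x(2)] AD(3)[OF that x(3)] by blast
      qed
      fix y assume "y \<in> J"
      then obtain m' r' where y: "y = m' + r' * a" "m' \<in> M" "r' \<in> A" by (auto simp: J_def)
      have "x + y = (m + m') + (r + r') * a" by (simp add: x y algebra_simps)
      then show "x + y \<in> J" unfolding J_def using sub_idealD(3)[OF MI(1) x(2) y(2)] AD(2)[OF x(3) y(3)] by blast
    qed
    moreover have "J \<noteq> M" using \<open>a \<in> J\<close> a by blast
    ultimately have "1 \<in> J" using max sub MI unfolding S_def by blast
    then show ?thesis unfolding J_def by blast
  qed
  have "primeideal M (subr A)"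
  proof (rule primeidealI[OF sub_ideal_imp_ideal[OF MI(1)] A.is_cring])
    show "carrier (subr A) \<noteq> M" using MI(2) AD(1) by auto
    fix a b assume ab: "a \<in> carrier (subr A)" "b \<in> carrier (subr A)" "a \<otimes>\<^bsub>subr A\<^esub> b \<in> M"
    show "a \<in> M \<or> b \<in> M"
    proof (rule ccontr)
      assume "\<not> (a \<in> M \<or> b \<in> M)"
      then obtain m r m' r' where *: "m \<in> M" "r \<in> A" "1 = m + r * a" "m' \<in> M" "r' \<in> A" "1 = m' + r' * b"
        using one[of a] one[of b] ab by auto
      have "1 = (m + r * a) * (m' + r' * b)" using *(3,6) by simp
      also have "\<dots> = (m' + r' * b) * m + ((r * a) * m' + (r * r') * (a * b))" by (simp add: algebra_simps)
      also have "\<dots> \<in> M"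
      proof -
        have "m' + r' * b \<in> A" "r * a \<in> A" "r * r' \<in> A"
          using * ab sub_idealD(1)[OF MI(1) *(4)] by (simp_all add: AD(1-3))
        note in_M = sub_idealD(4)[OF MI(1) this(1) *(1)] sub_idealD(4)[OF MI(1) this(2) *(4)]
          sub_idealD(4)[OF MI(1) this(3), of "a * b"]
        show ?thesis
          by (rule sub_idealD(3)[OF MI(1) in_M(1) sub_idealD(3)[OF MI(1) in_M(2) in_M(3)]]) (use ab in simp)
      qed
      finally show False using MI(2) by simp
    qed
  qed
  then show thesis using that MI(3) by blast
qed

text \<open>
  An ideal that lies in no prime ideal is the unit ideal. This is the partition of unity behind
  all statements below that pass from the local rings to the whole ring.
\<close>

lemma local_global:
  assumes I: "sub_ideal A I" and loc: "\<And>P. primeideal P (subr A) \<Longrightarrow> \<exists>x\<in>I. x \<notin> P"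
  shows "1 \<in> I"
proof (rule ccontr)
  assume "1 \<notin> I"
  from prime_above[OF I this] obtain P where "primeideal P (subr A)" "I \<subseteq> P" by blast
  then show False using loc by blast
qed

lemma primeD:
  assumes P: "primeideal P (subr A)"
  shows "P \<subseteq> A" "0 \<in> P" "1 \<notin> P" "a \<in> A - P \<Longrightarrow> b \<in> A - P \<Longrightarrow> a * b \<in> A - P"
proof -
  interpret primeideal P "subr A" by (rule P)
  show "P \<subseteq> A" "0 \<in> P" using a_subset zero_closed by auto
  show "1 \<notin> P" using one_imp_carrier I_notcarr by auto
  show "a \<in> A - P \<Longrightarrow> b \<in> A - P \<Longrightarrow> a * b \<in> A - P"
    using I_prime[of a b] AD(3) by auto
qed

lemma in_localization: "primeideal P (subr A) \<Longrightarrow> a \<in> A \<Longrightarrow> b \<in> A - P \<Longrightarrow> a / b \<in> localization_at A P"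
  by (auto simp: localization_at_def)

lemma A_subset_localization: "primeideal P (subr A) \<Longrightarrow> A \<subseteq> localization_at A P"
  using in_localization[of P _ 1] primeD(3)[of P] AD(1) by auto

lemma localizationE:
  assumes P: "primeideal P (subr A)" and x: "x \<in> localization_at A P"
  obtains a b where "x = a / b" "a \<in> A" "b \<in> A" "b \<notin> P" "b \<noteq> 0"
  using x primeD(2)[OF P] by (auto simp: localization_at_def)

lemma subring_localization:
  assumes P: "primeideal P (subr A)"
  shows "subring_set (localization_at A P)"
  unfolding subring_set_def
proof (intro conjI ballI)
  show "1 \<in> localization_at A P" using A_subset_localization[OF P] AD(1) by blast
  fix x assume "x \<in> localization_at A P"
  then obtain a b where x: "x = a / b" "a \<in> A" "b \<in> A" "b \<notin> P" "b \<noteq> 0"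
    by (rule localizationE[OF P])
  show "- x \<in> localization_at A P"
    using in_localization[OF P, of "- a" b] x AD(4) by simp
  fix y assume "y \<in> localization_at A P"
  then obtain c d where y: "y = c / d" "c \<in> A" "d \<in> A" "d \<notin> P" "d \<noteq> 0"
    by (rule localizationE[OF P])
  have bd: "b * d \<in> A - P" using primeD(4)[OF P] x y by blast
  have "(a * d + c * b) / (b * d) \<in> localization_at A P" "(a * c) / (b * d) \<in> localization_at A P"
    by (intro in_localization[OF P _ bd] AD x y)+
  then show "x + y \<in> localization_at A P" "x * y \<in> localization_at A P"
    using x y by (simp_all add: add_frac_eq)
qed

text \<open>
  The denominators of \<open>x\<close> form an ideal that lies in no prime ideal.
\<close>

lemma regular_in_ring:
  assumes "\<And>L. L \<in> spec A \<Longrightarrow> x \<in> L"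
  shows "x \<in> A"
proof -
  define I where "I = {b \<in> A. b * x \<in> A}"
  have "sub_ideal A I"
    unfolding sub_ideal_def I_def by (auto simp: AD distrib_right mult.assoc)
  moreover have "\<exists>b\<in>I. b \<notin> P" if P: "primeideal P (subr A)" for P
  proof -
    have "x \<in> localization_at A P" using assms P by (auto simp: spec_def)
    then obtain a b where "x = a / b" "a \<in> A" "b \<in> A" "b \<notin> P" "b \<noteq> 0"
      by (rule localizationE[OF P])
    then show ?thesis by (intro bexI[of _ b]) (auto simp: I_def)
  qed
  ultimately have "1 \<in> I" by (rule local_global)
  then show ?thesis by (simp add: I_def)
qed

end

lemma field_derivationD:
  fixes D :: "'a::field \<Rightarrow> 'a"
  assumes "D \<in> derivations k ring_of_type_algebra"
  shows "D (x + y) = D x + D y" "D (x * y) = x * D y + y * D x" "c \<in> k \<Longrightarrow> D c = 0"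
    "D 0 = 0" "D 1 = 0" "D (- x) = - D x" "D (x - y) = D x - D y"
    "y \<noteq> 0 \<Longrightarrow> D (x / y) = (y * D x - x * D y) / (y * y)"
proof -
  show a: "D (x + y) = D x + D y" and m: "D (x * y) = x * D y + y * D x" and c: "c \<in> k \<Longrightarrow> D c = 0" for x y c
    using derivationsD[OF assms] by auto
  show z: "D 0 = 0" using a[of 0 0] by (metis add_cancel_right_right)
  show "D 1 = 0" using m[of 1 1] by (metis add_cancel_right_right mult_1)
  show um: "D (- x) = - D x" for x using a[of x "- x"] z by (simp add: eq_neg_iff_add_eq_0 add.commute)
  show "D (x - y) = D x - D y" using a[of x "- y"] um by simp
  show "D (x / y) = (y * D x - x * D y) / (y * y)" if "y \<noteq> 0"
    using m[of "x / y" y] that by (simp add: field_simps)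
qed

lemma contract_type: "contract ring_of_type_algebra D w = (\<Sum>(a, b)\<leftarrow>w. a * D b)"
  and contract_subr: "contract (subr A) D w = (\<Sum>(a, b)\<leftarrow>w. a * D b)"
  by (induction w) (auto simp: contract_def)

text \<open>
  Equality of rational forms, in a shape that survives a change of the ring in which the
  coefficients are written.
\<close>

definition same_contractions :: "'a::field set \<Rightarrow> 'a kform \<Rightarrow> 'a kform \<Rightarrow> bool" where
  "same_contractions k v w \<longleftrightarrow>
     (\<forall>D\<in>derivations k ring_of_type_algebra. (\<Sum>(a, b)\<leftarrow>v. a * D b) = (\<Sum>(a, b)\<leftarrow>w. a * D b))"

lemma kaehler_eq_same_contractions:
  "kaehler_eq ring_of_type_algebra k v w \<Longrightarrow> same_contractions k v w"
  unfolding same_contractions_def contract_type[symmetric]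
  using kaehler_eq_contract[OF cring_from_type_algebra] by blast

text \<open>
  The elements \<open>b\<close> for which \<open>b w\<close> can be written with coefficients in
  \<open>A\<close> form an ideal, and regularity at a prime provides such a \<open>b\<close>
  outside of it.
\<close>

lemma regular_form_in_ring:
  fixes w :: "'a::field kform"
  assumes A: "subring_set A"
    and reg: "\<And>L. L \<in> spec A \<Longrightarrow> \<exists>w'\<in>kforms (subr L). kaehler_eq ring_of_type_algebra k w' w"
  obtains w' where "w' \<in> kforms (subr A)" "same_contractions k w' w"
proof -
  note AD = subring_setD[OF A]
  define I where "I = {b \<in> A. \<exists>w'\<in>kforms (subr A). \<forall>D\<in>derivations k ring_of_type_algebra.
     (\<Sum>(x, y)\<leftarrow>w'. x * D y) = b * (\<Sum>(x, y)\<leftarrow>w. x * D y)}"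
  have scale: "(\<Sum>(x, y)\<leftarrow>map (\<lambda>(x, y). (b * x, y)) v. x * D y) = b * (\<Sum>(x, y)\<leftarrow>v. x * D y)"
    for b and D :: "'a \<Rightarrow> 'a" and v
    by (induction v) (auto simp: algebra_simps)
  have scale_in: "map (\<lambda>(x, y). (b * x, y)) v \<in> kforms (subr A)" if "b \<in> A" "v \<in> kforms (subr A)" for b v
    using that by (auto simp: kforms_def intro!: AD)
  have "sub_ideal A I"
    unfolding sub_ideal_def
  proof (intro conjI ballI)
    show "I \<subseteq> A" by (auto simp: I_def)
    show "0 \<in> I" by (auto simp: I_def AD intro!: bexI[of _ "[]"])
    fix x assume x: "x \<in> I"
    then obtain v where v: "v \<in> kforms (subr A)" "\<forall>D\<in>derivations k ring_of_type_algebra.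
       (\<Sum>(x, y)\<leftarrow>v. x * D y) = x * (\<Sum>(x, y)\<leftarrow>w. x * D y)" by (auto simp: I_def)
    show "a * x \<in> I" if "a \<in> A" for a
      unfolding I_def using x that v
      by (auto simp: I_def AD scale mult.assoc intro!: bexI[of _ "map (\<lambda>(x, y). (a * x, y)) v"] scale_in simp del: map_map)
    fix y assume y: "y \<in> I"
    then obtain v' where v': "v' \<in> kforms (subr A)" "\<forall>D\<in>derivations k ring_of_type_algebra.
       (\<Sum>(x, y)\<leftarrow>v'. x * D y) = y * (\<Sum>(x, y)\<leftarrow>w. x * D y)" by (auto simp: I_def)
    show "x + y \<in> I"
      unfolding I_def using x y v v'
      by (auto simp: I_def AD distrib_right intro!: bexI[of _ "v @ v'"])
  qed
  moreover have "\<exists>b\<in>I. b \<notin> P" if P: "primeideal P (subr A)" for P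
  proof -
    have clear: "\<exists>e\<in>A - P. \<exists>w''\<in>kforms (subr A). \<forall>D\<in>derivations k ring_of_type_algebra.
         (\<Sum>(x, y)\<leftarrow>w''. x * D y) = e * (\<Sum>(x, y)\<leftarrow>v. x * D y)"
      if "v \<in> kforms (subr (localization_at A P))" for v
      using that
    proof (induction v rule: kforms_induct)
      case Nil
      then show ?case using AD(1) primeD(3)[OF A P] by (auto intro!: bexI[of _ 1] bexI[of _ "[]"])
    next
      case (Cons a c v)
      from Cons obtain a1 a2 where a: "a = a1 / a2" "a1 \<in> A" "a2 \<in> A" "a2 \<notin> P" "a2 \<noteq> 0"
        using localizationE[OF A P, of a] by auto
      from Cons obtain c1 c2 where c: "c = c1 / c2" "c1 \<in> A" "c2 \<in> A" "c2 \<notin> P" "c2 \<noteq> 0"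
        using localizationE[OF A P, of c] by auto
      from Cons.IH obtain e w'' where e: "e \<in> A - P" "w'' \<in> kforms (subr A)"
        "\<forall>D\<in>derivations k ring_of_type_algebra. (\<Sum>(x, y)\<leftarrow>w''. x * D y) = e * (\<Sum>(x, y)\<leftarrow>v. x * D y)" by blast
      define f where "f = a2 * (c2 * c2)"
      have f: "f \<in> A - P" using a c primeD(4)[OF A P] by (auto simp: f_def)
      define u where "u = map (\<lambda>(x, y). (e * x, y)) [(a1 * c2, c1), (- (a1 * c1), c2)]
         @ map (\<lambda>(x, y). (f * x, y)) w''"
      show ?case
      proof (intro bexI[of _ "e * f"] bexI[of _ u] ballI)
        show "e * f \<in> A - P" by (rule primeD(4)[OF A P e(1) f])
        show "u \<in> kforms (subr A)"
          unfolding u_def using e f a c by (auto simp: AD intro!: scale_in)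
        fix D assume D: "D \<in> derivations k (ring_of_type_algebra :: 'a ring)"
        have q: "D c = (c2 * D c1 - c1 * D c2) / (c2 * c2)"
          unfolding c(1) by (rule field_derivationD(8)[OF D c(5)])
        have "a1 * c2 * D c1 - a1 * c1 * D c2 = f * (a * D c)"
        proof -
          have "f * (a * D c) = (a2 * a) * (c2 * c2 * D c)" by (simp add: f_def ac_simps)
          also have "a2 * a = a1" using a by simp
          also have "c2 * c2 * D c = c2 * D c1 - c1 * D c2" using q c(5) by simp
          finally show ?thesis by (simp add: algebra_simps)
        qed
        then have "(\<Sum>(x, y)\<leftarrow>u. x * D y) = e * (f * (a * D c)) + f * (e * (\<Sum>(x, y)\<leftarrow>v. x * D y))"
          using e(3) D unfolding u_def map_append sum_list_append scale by (simp add: algebra_simps)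
        then show "(\<Sum>(x, y)\<leftarrow>u. x * D y) = e * f * (\<Sum>(x, y)\<leftarrow>(a, c) # v. x * D y)"
          by (simp add: algebra_simps)
      qed
    qed
    have "localization_at A P \<in> spec A" using P by (auto simp: spec_def)
    then obtain w' where w': "w' \<in> kforms (subr (localization_at A P))"
      "kaehler_eq ring_of_type_algebra k w' w" using reg by blast
    from clear[OF w'(1)] kaehler_eq_same_contractions[OF w'(2)] show ?thesis
      by (auto simp: I_def same_contractions_def)
  qed
  ultimately have "1 \<in> I" by (rule local_global[OF A])
  then show thesis using that by (auto simp: I_def same_contractions_def)
qed

text \<open>
  A homomorphism \<open>\<Psi>\<close> to a ring together with a derivation along it. The target
  has no unit of its own; \<open>unit_d\<close> says that \<open>\<Psi> 1\<close> acts as one on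
  the differentials.
\<close>

locale derivation_pair =
  fixes A k :: "'a::field set" and \<Psi> d :: "'a \<Rightarrow> 'c::comm_ring"
  assumes A: "subring_set A" and k: "k \<subseteq> A"
    and \<Psi>_add: "x \<in> A \<Longrightarrow> y \<in> A \<Longrightarrow> \<Psi> (x + y) = \<Psi> x + \<Psi> y"
    and \<Psi>_mult: "x \<in> A \<Longrightarrow> y \<in> A \<Longrightarrow> \<Psi> (x * y) = \<Psi> x * \<Psi> y"
    and d_add: "x \<in> A \<Longrightarrow> y \<in> A \<Longrightarrow> d (x + y) = d x + d y"
    and d_mult: "x \<in> A \<Longrightarrow> y \<in> A \<Longrightarrow> d (x * y) = \<Psi> x * d y + \<Psi> y * d x"
    and d_const: "c \<in> k \<Longrightarrow> d c = 0"
    and unit_d: "x \<in> A \<Longrightarrow> \<Psi> 1 * d x = d x"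
begin

lemmas AD = subring_setD[OF A]

text \<open>
  The image of \<open>\<Sum> a dc\<close> under the map of differentials that \<open>(\<Psi>,
  d)\<close> induces. It is defined on expressions only; \<open>pair_form_zero\<close> shows
  that it respects equality at all local rings.
\<close>

definition pair_form :: "'a kform \<Rightarrow> 'c" where
  "pair_form w = (\<Sum>(a, c)\<leftarrow>w. \<Psi> a * d c)"

lemma pair_form_simps [simp]:
  "pair_form [] = 0" "pair_form ((a, c) # w) = \<Psi> a * d c + pair_form w"
  "pair_form (v @ w) = pair_form v + pair_form w"
  by (simp_all add: pair_form_def)

lemma \<Psi>_zero [simp]: "\<Psi> 0 = 0"
  using \<Psi>_add[of 0 0] AD by simp

lemma d_zero [simp]: "d 0 = 0"
  using d_add[of 0 0] AD by simp

context
  fixes P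
  assumes P: "primeideal P (subr A)"
begin

definition cleared :: "'a \<Rightarrow> 'a kform \<Rightarrow> bool" where
  "cleared b w \<longleftrightarrow> b \<in> A - P \<and> (\<forall>(a, c)\<in>set w. b * a \<in> A \<and> b * c \<in> A)"

definition pair_cleared :: "'a \<Rightarrow> 'a kform \<Rightarrow> 'c" where
  "pair_cleared b w = (\<Sum>(a, c)\<leftarrow>w. \<Psi> (b * a) * (\<Psi> b * d (b * c) - \<Psi> (b * c) * d b))"

lemma cleared_simps [simp]:
  "cleared b [] \<longleftrightarrow> b \<in> A - P" "cleared b ((a, c) # w) \<longleftrightarrow> b * a \<in> A \<and> b * c \<in> A \<and> cleared b w"
  "cleared b (v @ w) \<longleftrightarrow> cleared b v \<and> cleared b w"
  by (auto simp: cleared_def)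

lemma pair_cleared_simps [simp]:
  "pair_cleared b [] = 0"
  "pair_cleared b ((a, c) # w) = \<Psi> (b * a) * (\<Psi> b * d (b * c) - \<Psi> (b * c) * d b) + pair_cleared b w"
  "pair_cleared b (v @ w) = pair_cleared b v + pair_cleared b w"
  by (simp_all add: pair_cleared_def)

lemma cleared_mult: "cleared b w \<Longrightarrow> g \<in> A - P \<Longrightarrow> cleared (b * g) w"
  unfolding cleared_def using primeD(4)[OF A P] AD(3)
  by (auto simp: mult.assoc mult.left_commute[of b g] mult.commute[of b g] dest!: bspec)

lemma common_denominator:
  assumes "finite S" "S \<subseteq> localization_at A P"
  shows "\<exists>b\<in>A - P. \<forall>x\<in>S. b * x \<in> A"
  using assms
proof (induction S rule: finite_induct)
  case empty
  then show ?case using AD(1) primeD(3)[OF A P] by blast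
next
  case (insert x S)
  then obtain b where b: "b \<in> A - P" "\<forall>y\<in>S. b * y \<in> A" by blast
  from insert obtain c e where x: "x = c / e" "c \<in> A" "e \<in> A" "e \<notin> P" "e \<noteq> 0"
    using localizationE[OF A P, of x] by auto
  have "b * e \<in> A - P" using primeD(4)[OF A P, of b e] b x by blast
  moreover have "b * e * x \<in> A" using x b AD(3)[of b c] by simp
  moreover have "b * e * y \<in> A" if "y \<in> S" for y
    using AD(3)[of e "b * y"] b x that by (simp add: ac_simps)
  ultimately show ?case by blast
qed

lemma exists_cleared:
  assumes "w \<in> kforms (subr (localization_at A P))"
  shows "\<exists>b\<in>A - P. cleared b w"
proof -
  have "fst ` set w \<union> snd ` set w \<subseteq> localization_at A P"
    using assms by (auto simp: kforms_def)
  from common_denominator[OF _ this] obtain b where "b \<in> A - P" "\<forall>x\<in>fst ` set w \<union> snd ` set w. b * x \<in> A"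
    by auto
  then show ?thesis by (intro bexI[of _ b]) (force simp: cleared_def)+
qed

definition cleared_eq :: "'a kform \<Rightarrow> 'a kform \<Rightarrow> bool" where
  "cleared_eq v w \<longleftrightarrow> (\<exists>b\<in>A - P. \<forall>g\<in>A - P. cleared (b * g) v \<and> cleared (b * g) w \<and>
     \<Psi> (b * g) * pair_cleared (b * g) v = \<Psi> (b * g) * pair_cleared (b * g) w)"

lemma cleared_eqI:
  assumes b: "b \<in> A - P" "cleared b v" "cleared b w"
    and eq: "\<And>b'. b' \<in> A \<Longrightarrow> cleared b' v \<Longrightarrow> cleared b' w \<Longrightarrow> (\<exists>g\<in>A. b' = b * g) \<Longrightarrow>
       \<Psi> b' * pair_cleared b' v = \<Psi> b' * pair_cleared b' w"
  shows "cleared_eq v w"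
  unfolding cleared_eq_def
proof (intro bexI[of _ b] ballI conjI)
  fix g assume g: "g \<in> A - P"
  show c: "cleared (b * g) v" "cleared (b * g) w" using cleared_mult b g by auto
  show "\<Psi> (b * g) * pair_cleared (b * g) v = \<Psi> (b * g) * pair_cleared (b * g) w"
    by (rule eq) (use b g c AD(3) in auto)
qed (use b in auto)

lemma kaehler_eq_cleared_eq:
  "kaehler_eq (subr (localization_at A P)) k v w \<Longrightarrow> cleared_eq v w"
proof (induction rule: kaehler_eq.induct)
  case (refl w)
  from exists_cleared[OF refl] obtain b where "b \<in> A - P" "cleared b w" by blast
  then show ?case by (intro cleared_eqI) auto
next
  case (sym v w)
  then show ?case unfolding cleared_eq_def by (auto intro!: bexI)
next
  case (trans u v w)
  from trans.IH obtain b b' where b: "b \<in> A - P" "b' \<in> A - P"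
    "\<And>g. g \<in> A - P \<Longrightarrow> cleared (b * g) u \<and> cleared (b * g) v \<and>
     \<Psi> (b * g) * pair_cleared (b * g) u = \<Psi> (b * g) * pair_cleared (b * g) v"
    "\<And>g. g \<in> A - P \<Longrightarrow> cleared (b' * g) v \<and> cleared (b' * g) w \<and>
     \<Psi> (b' * g) * pair_cleared (b' * g) v = \<Psi> (b' * g) * pair_cleared (b' * g) w"
    unfolding cleared_eq_def by auto
  show ?case unfolding cleared_eq_def
  proof (intro bexI[of _ "b * b'"] ballI)
    fix g assume g: "g \<in> A - P"
    show "cleared (b * b' * g) u \<and> cleared (b * b' * g) w \<and>
       \<Psi> (b * b' * g) * pair_cleared (b * b' * g) u = \<Psi> (b * b' * g) * pair_cleared (b * b' * g) w"
      using b(3)[OF primeD(4)[OF A P b(2) g]] b(4)[OF primeD(4)[OF A P b(1) g]]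
      by (simp add: mult.assoc mult.left_commute[of b'])
  qed (rule primeD(4)[OF A P b(1,2)])
next
  case (comm v w)
  then have "v @ w \<in> kforms (subr (localization_at A P))" by simp
  from exists_cleared[OF this] obtain b where "b \<in> A - P" "cleared b (v @ w)" by blast
  then show ?case by (intro cleared_eqI) (auto simp: algebra_simps)
next
  case (cong v v' w w')
  from cong.IH obtain b b' where b: "b \<in> A - P" "b' \<in> A - P"
    "\<And>g. g \<in> A - P \<Longrightarrow> cleared (b * g) v \<and> cleared (b * g) v' \<and>
     \<Psi> (b * g) * pair_cleared (b * g) v = \<Psi> (b * g) * pair_cleared (b * g) v'"
    "\<And>g. g \<in> A - P \<Longrightarrow> cleared (b' * g) w \<and> cleared (b' * g) w' \<and>
     \<Psi> (b' * g) * pair_cleared (b' * g) w = \<Psi> (b' * g) * pair_cleared (b' * g) w'"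
    unfolding cleared_eq_def by auto
  show ?case unfolding cleared_eq_def
  proof (intro bexI[of _ "b * b'"] ballI)
    fix g assume g: "g \<in> A - P"
    show "cleared (b * b' * g) (v @ w) \<and> cleared (b * b' * g) (v' @ w') \<and>
       \<Psi> (b * b' * g) * pair_cleared (b * b' * g) (v @ w) = \<Psi> (b * b' * g) * pair_cleared (b * b' * g) (v' @ w')"
      using b(3)[OF primeD(4)[OF A P b(2) g]] b(4)[OF primeD(4)[OF A P b(1) g]]
      by (simp add: mult.assoc mult.left_commute[of b'] distrib_left)
  qed (rule primeD(4)[OF A P b(1,2)])
next
  case (coeff_zero c)
  from common_denominator[of "{c}"] coeff_zero obtain b where b: "b \<in> A - P" "b * c \<in> A" by auto
  show ?case by (rule cleared_eqI[OF b(1)]) (use b AD in auto)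
next
  case (coeff_add x y z)
  from common_denominator[of "{x, y, z}"] coeff_add obtain b where b: "b \<in> A - P" "b * x \<in> A" "b * y \<in> A" "b * z \<in> A" by auto
  show ?case
    by (rule cleared_eqI[OF b(1)]) (use b AD in \<open>auto simp: distrib_left distrib_right \<Psi>_add algebra_simps\<close>)
next
  case (d_const a c)
  from common_denominator[of "{a}"] d_const obtain b where b: "b \<in> A - P" "b * a \<in> A" by auto
  have c: "c \<in> A" "d c = 0" using d_const k derivation_pair.d_const[OF derivation_pair_axioms] by auto
  show ?case
  proof (rule cleared_eqI[OF b(1)])
    fix f assume "f \<in> A"
    then show "\<Psi> f * pair_cleared f [(a, c)] = \<Psi> f * pair_cleared f []"
      using c by (simp add: derivation_pair.d_mult[OF derivation_pair_axioms] \<Psi>_mult mult.assoc)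
  qed (use b c AD in auto)
next
  case (d_add x y z)
  from common_denominator[of "{x, y, z}"] d_add obtain b where b: "b \<in> A - P" "b * x \<in> A" "b * y \<in> A" "b * z \<in> A" by auto
  show ?case
    by (rule cleared_eqI[OF b(1)]) (use b AD in \<open>auto simp: distrib_left \<Psi>_add derivation_pair.d_add[OF derivation_pair_axioms] algebra_simps\<close>)
next
  case (d_mult x y z)
  from common_denominator[of "{x, y, z}"] d_mult obtain b where b: "b \<in> A - P" "b * x \<in> A" "b * y \<in> A" "b * z \<in> A" by auto
  have *: "b * b * x \<in> A" "b * b * y \<in> A" "b * b * z \<in> A" "b * b * (x * y) \<in> A" "b * b * (x * z) \<in> A" "b * b * (y * z) \<in> A"
    using AD(3)[of b "b * x"] AD(3)[of b "b * y"] AD(3)[of b "b * z"]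
      AD(3)[of "b * x" "b * y"] AD(3)[of "b * x" "b * z"] AD(3)[of "b * y" "b * z"] b
    by (simp_all add: ac_simps)
  show ?case
  proof (rule cleared_eqI[of "b * b"])
    show "b * b \<in> A - P" using primeD(4)[OF A P b(1,1)] .
    then show "cleared (b * b) [(x, y \<otimes>\<^bsub>subr (localization_at A P)\<^esub> z)]"
      "cleared (b * b) [(x \<otimes>\<^bsub>subr (localization_at A P)\<^esub> y, z), (x \<otimes>\<^bsub>subr (localization_at A P)\<^esub> z, y)]"
      using * by auto
    fix f assume f: "f \<in> A" and f1: "cleared f [(x, y \<otimes>\<^bsub>subr (localization_at A P)\<^esub> z)]"
      and f2: "cleared f [(x \<otimes>\<^bsub>subr (localization_at A P)\<^esub> y, z), (x \<otimes>\<^bsub>subr (localization_at A P)\<^esub> z, y)]"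
    have fA: "f * x \<in> A" "f * (y * z) \<in> A" "f * (x * y) \<in> A" "f * (x * z) \<in> A" "f * z \<in> A" "f * y \<in> A"
      using f1 f2 by auto
    have p1: "\<Psi> f * \<Psi> (f * (x * y)) = \<Psi> (f * x) * \<Psi> (f * y)"
      using f fA by (simp flip: \<Psi>_mult add: ac_simps)
    have p2: "\<Psi> f * \<Psi> (f * (x * z)) = \<Psi> (f * x) * \<Psi> (f * z)"
      using f fA by (simp flip: \<Psi>_mult add: ac_simps)
    have p3: "\<Psi> f * \<Psi> (f * (y * z)) = \<Psi> (f * y) * \<Psi> (f * z)"
      using f fA by (simp flip: \<Psi>_mult add: ac_simps)
    have e: "f * (f * (y * z)) = (f * y) * (f * z)" by (simp add: ac_simps)
    have p4: "\<Psi> f * d (f * (y * z)) + \<Psi> (f * (y * z)) * d f = \<Psi> (f * y) * d (f * z) + \<Psi> (f * z) * d (f * y)"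
      using arg_cong[OF e, of d] f fA by (simp add: derivation_pair.d_mult[OF derivation_pair_axioms])
    have "\<Psi> f * (\<Psi> (f * (x * y)) * (\<Psi> f * d (f * z) - \<Psi> (f * z) * d f) + \<Psi> (f * (x * z)) * (\<Psi> f * d (f * y) - \<Psi> (f * y) * d f))
        = \<Psi> (f * x) * (\<Psi> f * (\<Psi> (f * y) * d (f * z) + \<Psi> (f * z) * d (f * y)) - (\<Psi> (f * y) * \<Psi> (f * z) + \<Psi> (f * y) * \<Psi> (f * z)) * d f)"
    proof -
      have "\<Psi> f * (\<Psi> (f * (x * y)) * (\<Psi> f * d (f * z) - \<Psi> (f * z) * d f) + \<Psi> (f * (x * z)) * (\<Psi> f * d (f * y) - \<Psi> (f * y) * d f))
        = (\<Psi> f * \<Psi> (f * (x * y))) * (\<Psi> f * d (f * z) - \<Psi> (f * z) * d f) + (\<Psi> f * \<Psi> (f * (x * z))) * (\<Psi> f * d (f * y) - \<Psi> (f * y) * d f)"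
        by (simp only: distrib_left mult.assoc)
      then show ?thesis unfolding p1 p2 by (simp add: algebra_simps)
    qed
    also have "\<dots> = \<Psi> (f * x) * (\<Psi> f * (\<Psi> f * d (f * (y * z)) + \<Psi> (f * (y * z)) * d f) - (\<Psi> f * \<Psi> (f * (y * z)) + \<Psi> f * \<Psi> (f * (y * z))) * d f)"
      by (simp only: p4 p3)
    also have "\<dots> = \<Psi> f * (\<Psi> (f * x) * (\<Psi> f * d (f * (y * z)) - \<Psi> (f * (y * z)) * d f))"
      by (simp add: algebra_simps)
    finally show "\<Psi> f * pair_cleared f [(x, y \<otimes>\<^bsub>subr (localization_at A P)\<^esub> z)] =
       \<Psi> f * pair_cleared f [(x \<otimes>\<^bsub>subr (localization_at A P)\<^esub> y, z), (x \<otimes>\<^bsub>subr (localization_at A P)\<^esub> z, y)]"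
      by simp
  qed
qed

text \<open>
  Clearing denominators in \<open>a dc\<close> means writing it as \<open>b\<^sup>-\<^sup>3 (b
  a) (b d(bc) - (bc) db)\<close>, where only the elements \<open>b\<close>, \<open>b a\<close>
  and \<open>b c\<close> of the ring occur.
\<close>

lemma pair_cleared_eq:
  assumes b: "b \<in> A" and w: "w \<in> kforms (subr A)"
  shows "pair_cleared b w = \<Psi> (b ^ 3) * pair_form w"
  using w
proof (induction w rule: kforms_induct)
  case (Cons a c w)
  have ac: "a \<in> A" "c \<in> A" using Cons by auto
  have "\<Psi> (b ^ 3) = \<Psi> b * \<Psi> b * \<Psi> b"
    using b by (simp add: power3_eq_cube \<Psi>_mult AD)
  then have "\<Psi> (b * a) * (\<Psi> b * d (b * c) - \<Psi> (b * c) * d b) = \<Psi> (b ^ 3) * (\<Psi> a * d c)"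
    using ac b by (simp add: \<Psi>_mult d_mult algebra_simps)
  then show ?case using Cons by (simp add: algebra_simps)
qed simp

text \<open>
  A proof of equality in the local ring uses finitely many elements, and becomes a proof about
  elements of \<open>A\<close> after multiplication with a common denominator \<open>b\<close>.
\<close>

lemma locally_zero:
  assumes w: "w \<in> kforms (subr A)" and eq: "kaehler_eq (subr (localization_at A P)) k w []"
  shows "\<exists>b\<in>A - P. \<Psi> b * pair_form w = 0"
proof -
  from kaehler_eq_cleared_eq[OF eq] obtain b where b: "b \<in> A - P"
    "\<And>g. g \<in> A - P \<Longrightarrow> \<Psi> (b * g) * pair_cleared (b * g) w = 0"
    unfolding cleared_eq_def by auto
  have "\<Psi> b * pair_cleared b w = 0"
    using b(2)[of 1] primeD(3)[OF A P] AD(1) by simp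
  then have "\<Psi> (b * b ^ 3) * pair_form w = 0"
    using b(1) w by (simp add: pair_cleared_eq \<Psi>_mult AD mult.assoc)
  moreover have "b ^ j \<in> A - P" for j
    using b(1) primeD(3,4)[OF A P] AD(1) by (induction j) auto
  ultimately show ?thesis using primeD(4)[OF A P b(1)] by blast
qed

end

lemma unit_pair_form: "w \<in> kforms (subr A) \<Longrightarrow> \<Psi> 1 * pair_form w = pair_form w"
proof (induction w rule: kforms_induct)
  case (Cons a c w)
  then show ?case using unit_d[of c] by (simp add: distrib_left mult.left_commute[of "\<Psi> 1" "\<Psi> a"])
qed simp

text \<open>
  The annihilator of the value is an ideal that lies in no prime ideal.
\<close>

lemma pair_form_zero:
  assumes w: "w \<in> kforms (subr A)"
    and eq: "\<And>L. L \<in> spec A \<Longrightarrow> kaehler_eq (subr L) k w []"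
  shows "pair_form w = 0"
proof -
  define I where "I = {b \<in> A. \<Psi> b * pair_form w = 0}"
  have "sub_ideal A I"
    unfolding sub_ideal_def I_def by (auto simp: AD \<Psi>_add \<Psi>_mult distrib_right mult.assoc)
  moreover have "\<exists>b\<in>I. b \<notin> P" if P: "primeideal P (subr A)" for P
  proof -
    have "localization_at A P \<in> spec A" using P by (auto simp: spec_def)
    from locally_zero[OF P w eq[OF this]] show ?thesis by (auto simp: I_def)
  qed
  ultimately have "1 \<in> I" by (rule local_global[OF A])
  then show ?thesis using unit_pair_form[OF w] by (simp add: I_def)
qed

end

section \<open>Rational functions of the parameters\<close>

type_synonym 'a mpolynomial = "(nat \<Rightarrow>\<^sub>0 nat) \<Rightarrow>\<^sub>0 'a"

lemma poly_mapping_eq_sum_single: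
  "P = (\<Sum>m\<in>Poly_Mapping.keys P. Poly_Mapping.single m (Poly_Mapping.lookup P m))"
  by (rule poly_mapping_eqI) (auto simp: lookup_sum lookup_single when_def in_keys_iff)

lemma polysD:
  assumes "P \<in> polys n A"
  shows "m \<in> Poly_Mapping.keys P \<Longrightarrow> Poly_Mapping.lookup P m \<in> A"
    "m \<in> Poly_Mapping.keys P \<Longrightarrow> Poly_Mapping.keys m \<subseteq> {..<n}"
    "0 \<in> A \<Longrightarrow> Poly_Mapping.lookup P m \<in> A"
  using assms by (auto simp: polys_def in_keys_iff)

lemma polys_mono: "A \<subseteq> B \<Longrightarrow> polys n A \<subseteq> polys n B"
  by (auto simp: polys_def)

context
  fixes A :: "'a::comm_ring_1 set"
  assumes A: "subring_set A"
begin

lemma polys_add: "P \<in> polys n A \<Longrightarrow> Q \<in> polys n A \<Longrightarrow> P + Q \<in> polys n A"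
proof -
  assume P: "P \<in> polys n A" and Q: "Q \<in> polys n A"
  note z = subring_setD(6)[OF A]
  show ?thesis
    unfolding polys_def
  proof (intro CollectI ballI conjI)
    fix m assume "m \<in> Poly_Mapping.keys (P + Q)"
    then have "m \<in> Poly_Mapping.keys P \<or> m \<in> Poly_Mapping.keys Q" using keys_add[of P Q] by blast
    then show "Poly_Mapping.keys m \<subseteq> {..<n}" using polysD(2)[OF P] polysD(2)[OF Q] by blast
    show "Poly_Mapping.lookup (P + Q) m \<in> A"
      using polysD(3)[OF P z] polysD(3)[OF Q z] subring_setD(2)[OF A] by (simp add: lookup_add)
  qed
qed

lemma polys_zero: "0 \<in> polys n A"
  by (simp add: polys_def)

lemma polys_single: "c \<in> A \<Longrightarrow> Poly_Mapping.keys m \<subseteq> {..<n} \<Longrightarrow> Poly_Mapping.single m c \<in> polys n A"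
  by (auto simp: polys_def lookup_single when_def split: if_splits)

lemma polys_sum: "(\<And>i. i \<in> I \<Longrightarrow> f i \<in> polys n A) \<Longrightarrow> sum f I \<in> polys n A"
  by (induction I rule: infinite_finite_induct) (auto intro: polys_add polys_zero)

lemma polys_induct [consumes 1, case_names zero add]:
  assumes P: "P \<in> polys n A" and "Q 0"
    and "\<And>m c P. Poly_Mapping.keys m \<subseteq> {..<n} \<Longrightarrow> c \<in> A \<Longrightarrow> P \<in> polys n A \<Longrightarrow> Q P \<Longrightarrow>
       Q (Poly_Mapping.single m c + P)"
  shows "Q P"
proof -
  have "Q (\<Sum>m\<in>M. Poly_Mapping.single m (Poly_Mapping.lookup P m))"
    if "finite M" "M \<subseteq> Poly_Mapping.keys P" for M
    using that
  proof (induction M rule: finite_induct)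
    case (insert m M)
    show ?case
      unfolding sum.insert[OF insert.hyps]
      by (rule assms(3)) (use insert polysD[OF P] in \<open>auto intro!: polys_sum polys_single\<close>)
  qed (simp add: assms(2))
  from this[of "Poly_Mapping.keys P"] show ?thesis
    using poly_mapping_eq_sum_single[of P] by simp
qed

lemma polys_mult: "P \<in> polys n A \<Longrightarrow> Q \<in> polys n A \<Longrightarrow> P * Q \<in> polys n A"
proof (induction P rule: polys_induct)
  case (add m c P)
  have "Poly_Mapping.single m c * Q \<in> polys n A"
    using \<open>Q \<in> polys n A\<close>
  proof (induction Q rule: polys_induct)
    case (add m' c' Q)
    have "Poly_Mapping.keys (m + m') \<subseteq> {..<n}"
      using keys_add[of m m'] add.hyps(1) \<open>Poly_Mapping.keys m \<subseteq> {..<n}\<close> by blast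
    then show ?case using add \<open>c \<in> A\<close> subring_setD(3)[OF A]
      by (auto simp: distrib_left mult_single intro!: polys_add polys_single)
  qed (simp add: polys_zero)
  then show ?case using add by (simp add: distrib_right polys_add)
qed (simp add: polys_zero)

lemma subring_set_polys: "subring_set (polys n A)"
proof -
  have one: "1 \<in> polys n A"
    using polys_single[of 1 0 n] subring_setD(1)[OF A] by (simp add: single_one)
  have "- P \<in> polys n A" if "P \<in> polys n A" for P
    using polys_mult[OF polys_single[of "- 1" 0 n] that] subring_setD[OF A] by (simp add: single_uminus single_one)
  then show ?thesis by (simp add: subring_set_def one polys_add polys_mult)
qed

end

lemma polys_var: "i < n \<Longrightarrow> subring_set A \<Longrightarrow> Poly_Mapping.single (Poly_Mapping.single i 1) 1 \<in> polys n A"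
  by (rule polys_single) (auto dest: subring_setD)

lemma derivation_to_fractions:
  fixes A :: "'f::field set" and D :: "'f \<Rightarrow> 'f"
  assumes A: "subring_set A"
    and add: "\<And>x y. x \<in> A \<Longrightarrow> y \<in> A \<Longrightarrow> D (x + y) = D x + D y"
    and mult: "\<And>x y. x \<in> A \<Longrightarrow> y \<in> A \<Longrightarrow> D (x * y) = x * D y + y * D x"
  obtains E where "\<And>x. x \<in> A \<Longrightarrow> E x = D x"
    "\<And>a b. a \<in> A \<Longrightarrow> b \<in> A \<Longrightarrow> b \<noteq> 0 \<Longrightarrow> E (a / b) = (b * D a - a * D b) / (b * b)"
    "\<And>x y. x \<in> {a / b | a b. a \<in> A \<and> b \<in> A \<and> b \<noteq> 0} \<Longrightarrow> y \<in> {a / b | a b. a \<in> A \<and> b \<in> A \<and> b \<noteq> 0} \<Longrightarrow>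
        E (x + y) = E x + E y \<and> E (x * y) = x * E y + y * E x"
proof -
  note AD = subring_setD[OF A]
  define E where "E x = (SOME y. \<exists>a\<in>A. \<exists>b\<in>A. b \<noteq> 0 \<and> x = a / b \<and> y = (b * D a - a * D b) / (b * b))" for x
  have E: "E (a / b) = (b * D a - a * D b) / (b * b)" if ab: "a \<in> A" "b \<in> A" "b \<noteq> 0" for a b
    unfolding E_def
  proof (rule some_equality)
    show "\<exists>a'\<in>A. \<exists>b'\<in>A. b' \<noteq> 0 \<and> a / b = a' / b' \<and> (b * D a - a * D b) / (b * b) = (b' * D a' - a' * D b') / (b' * b')"
      using ab by blast
    fix y assume "\<exists>a'\<in>A. \<exists>b'\<in>A. b' \<noteq> 0 \<and> a / b = a' / b' \<and> y = (b' * D a' - a' * D b') / (b' * b')"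
    then obtain a' b' where *: "a' \<in> A" "b' \<in> A" "b' \<noteq> 0" "a / b = a' / b'" "y = (b' * D a' - a' * D b') / (b' * b')" by blast
    define x where "x = a / b"
    have "x = a' / b'" using *(4) by (simp add: x_def)
    then have a': "a' = x * b'" using *(3) by simp
    have a: "a = x * b" using ab by (simp add: x_def)
    have "a * b' = a' * b" by (simp add: a a')
    then have "D (a * b') = D (a' * b)" by simp
    then have "a * D b' + b' * D a = a' * D b + b * D a'" using ab * by (simp add: mult)
    then have key: "b' * (D a - x * D b) = b * (D a' - x * D b')" by (simp add: a a' algebra_simps)
    have "b' * D a' - a' * D b' = b' * (D a' - x * D b')" "b * D a - a * D b = b * (D a - x * D b)"
      using a a' by (simp_all add: right_diff_distrib mult.left_commute mult.commute)
    note factor = this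
    have "y = (D a' - x * D b') / b'" using *(3) unfolding *(5) factor by simp
    also have "\<dots> = (D a - x * D b) / b" using key ab(3) *(3) by (simp add: frac_eq_eq mult.commute)
    also have "\<dots> = (b * D a - a * D b) / (b * b)" using ab(3) unfolding factor by simp
    finally show "y = (b * D a - a * D b) / (b * b)" .
  qed
  have D1: "D 1 = 0" using mult[OF AD(1) AD(1)] by (metis add_cancel_right_right mult_1)
  show thesis
  proof (rule that[of E])
    show "E x = D x" if "x \<in> A" for x using E[OF that AD(1)] by (simp add: D1)
    show "E (a / b) = (b * D a - a * D b) / (b * b)" if "a \<in> A" "b \<in> A" "b \<noteq> 0" for a b using E that .
    fix x y assume "x \<in> {a / b | a b. a \<in> A \<and> b \<in> A \<and> b \<noteq> 0}" "y \<in> {a / b | a b. a \<in> A \<and> b \<in> A \<and> b \<noteq> 0}"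
    then obtain a b c e where *: "x = a / b" "a \<in> A" "b \<in> A" "b \<noteq> 0" "y = c / e" "c \<in> A" "e \<in> A" "e \<noteq> 0" by blast
    have be: "b * e \<in> A" "b * e \<noteq> 0" using * AD by auto
    have D: "D (a * e + c * b) = a * D e + e * D a + (c * D b + b * D c)" "D (b * e) = b * D e + e * D b"
      "D (a * c) = a * D c + c * D a"
      using * AD by (simp_all add: add mult)
    have "x + y = (a * e + c * b) / (b * e)" using * by (simp add: field_simps)
    then have "E (x + y) = (b * e * D (a * e + c * b) - (a * e + c * b) * D (b * e)) / (b * e * (b * e))"
      using E[OF _ be, of "a * e + c * b"] * AD by simp
    also have "\<dots> = (b * D a - a * D b) / (b * b) + (e * D c - c * D e) / (e * e)"
      unfolding D using * by (simp add: divide_simps) (simp add: algebra_simps)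
    finally have "E (x + y) = E x + E y" using E * by simp
    moreover have "E (x * y) = x * E y + y * E x"
    proof -
    have "x * y = (a * c) / (b * e)" using * by simp
    then have "E (x * y) = (b * e * D (a * c) - (a * c) * D (b * e)) / (b * e * (b * e))"
      using E[OF _ be, of "a * c"] * AD by simp
    moreover have "(b * e * (a * Dc + c * Da) - (a * c) * (b * De + e * Db)) / (b * e * (b * e)) =
        (a / b) * ((e * Dc - c * De) / (e * e)) + (c / e) * ((b * Da - a * Db) / (b * b))" for Da Db Dc De
      using * by (simp add: divide_simps) (simp add: algebra_simps)
    ultimately have "E (x * y) = (a / b) * ((e * D c - c * D e) / (e * e)) + (c / e) * ((b * D a - a * D b) / (b * b))"
      unfolding D by simp
    then show ?thesis using E * by simp
    qed
    ultimately show "E (x + y) = E x + E y \<and> E (x * y) = x * E y + y * E x" by blast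
  qed
qed

text \<open>
  The quotient rule.
\<close>

lemma extend_derivation_to_field:
  fixes L :: "'a::field set"
  assumes L: "subring_set L" and D: "D \<in> derivations k (subr L)" and k: "k \<subseteq> L"
    and frac: "{a / b | a b. a \<in> L \<and> b \<in> L \<and> b \<noteq> 0} = UNIV"
  obtains E where "E \<in> derivations k ring_of_type_algebra" "\<And>x. x \<in> L \<Longrightarrow> E x = D x"
proof -
  have add: "\<And>x y. x \<in> L \<Longrightarrow> y \<in> L \<Longrightarrow> D (x + y) = D x + D y"
    and mult: "\<And>x y. x \<in> L \<Longrightarrow> y \<in> L \<Longrightarrow> D (x * y) = x * D y + y * D x"
    using derivationsD(2,3)[OF D] by simp_all
  obtain E where E: "\<And>x. x \<in> L \<Longrightarrow> E x = D x"
    "\<And>x y. x \<in> {a / b | a b. a \<in> L \<and> b \<in> L \<and> b \<noteq> 0} \<Longrightarrow> y \<in> {a / b | a b. a \<in> L \<and> b \<in> L \<and> b \<noteq> 0} \<Longrightarrow>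
        E (x + y) = E x + E y \<and> E (x * y) = x * E y + y * E x"
    by (rule derivation_to_fractions[OF L add mult]) blast+
  have "E \<in> derivations k ring_of_type_algebra"
    using E derivationsD(4)[OF D] k by (auto simp: derivations_def frac subset_iff)
  then show thesis using that E(1) by blast
qed

definition coeff_map :: "('a::comm_ring_1 \<Rightarrow> 'a) \<Rightarrow> 'a mpolynomial \<Rightarrow> 'a mpolynomial" where
  "coeff_map D P = (\<Sum>m\<in>Poly_Mapping.keys P. Poly_Mapping.single m (D (Poly_Mapping.lookup P m)))"

lemma lookup_coeff_map: "D 0 = 0 \<Longrightarrow> Poly_Mapping.lookup (coeff_map D P) m = D (Poly_Mapping.lookup P m)"
  by (auto simp: coeff_map_def lookup_sum lookup_single when_def in_keys_iff)

lemma coeff_map_derivation: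
  fixes D :: "'a::comm_ring_1 \<Rightarrow> 'a"
  assumes add: "\<And>x y. D (x + y) = D x + D y" and mult: "\<And>x y. D (x * y) = x * D y + y * D x"
  shows "coeff_map D (P + Q) = coeff_map D P + coeff_map D Q"
    "coeff_map D (P * Q) = P * coeff_map D Q + Q * coeff_map D P"
    "coeff_map D (Poly_Mapping.single m c) = Poly_Mapping.single m (D c)"
proof -
  have z: "D 0 = 0" using add[of 0 0] by simp
  show a: "coeff_map D (P + Q) = coeff_map D P + coeff_map D Q" for P Q
    by (rule poly_mapping_eqI) (simp add: lookup_coeff_map z lookup_add add)
  show s: "coeff_map D (Poly_Mapping.single m c) = Poly_Mapping.single m (D c)" for m c
    by (rule poly_mapping_eqI) (simp add: lookup_coeff_map z lookup_single when_def)
  have z': "coeff_map D 0 = 0" by (simp add: coeff_map_def)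
  have ind: "R P" if "R 0" "\<And>m c P. R P \<Longrightarrow> R (Poly_Mapping.single m c + P)" for R and P :: "'a mpolynomial"
  proof -
    have "R (\<Sum>m\<in>M. Poly_Mapping.single m (Poly_Mapping.lookup P m))" if "finite M" for M
      using that by (induction M rule: finite_induct) (auto intro: \<open>R 0\<close> \<open>\<And>m c P. R P \<Longrightarrow> R (Poly_Mapping.single m c + P)\<close>)
    from this[of "Poly_Mapping.keys P"] show ?thesis using poly_mapping_eq_sum_single[of P] by simp
  qed
  have single: "coeff_map D (Poly_Mapping.single m c * Q) = Poly_Mapping.single m c * coeff_map D Q + Q * Poly_Mapping.single m (D c)" for m c Q
    by (induction Q rule: ind)
      (auto simp: z' a s distrib_left distrib_right mult_single mult single_add add.commute[of m] algebra_simps)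
  show "coeff_map D (P * Q) = P * coeff_map D Q + Q * coeff_map D P"
  proof (induction P rule: ind)
    case (2 m c P)
    show ?case
      unfolding distrib_right a s single 2 by (simp add: algebra_simps)
  qed (simp add: z')
qed

lemma ratfunsE:
  assumes "x \<in> ratfuns n A B"
  obtains P Q where "x = Fract P Q" "P \<in> polys n A" "Q \<in> polys n B" "Q \<noteq> 0"
  using assms by (auto simp: ratfuns_def)

lemma Fract_in_ratfuns: "P \<in> polys n A \<Longrightarrow> Q \<in> polys n B \<Longrightarrow> Q \<noteq> 0 \<Longrightarrow> Fract P Q \<in> ratfuns n A B"
  by (auto simp: ratfuns_def)

lemma subring_set_ratfuns:
  assumes A: "subring_set A" and B: "subring_set B" and BA: "B \<subseteq> A"
  shows "subring_set (ratfuns n A B)"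
  unfolding subring_set_def
proof (intro conjI ballI)
  note PA = subring_setD[OF subring_set_polys[OF A]] and PB = subring_setD[OF subring_set_polys[OF B]]
  show "1 \<in> ratfuns n A B"
    unfolding One_fract_def by (intro Fract_in_ratfuns PA PB) auto
  fix x assume "x \<in> ratfuns n A B"
  then obtain P Q where x: "x = Fract P Q" "P \<in> polys n A" "Q \<in> polys n B" "Q \<noteq> 0" by (rule ratfunsE)
  show "- x \<in> ratfuns n A B" using x PA by (auto intro!: Fract_in_ratfuns)
  fix y assume "y \<in> ratfuns n A B"
  then obtain P' Q' where y: "y = Fract P' Q'" "P' \<in> polys n A" "Q' \<in> polys n B" "Q' \<noteq> 0" by (rule ratfunsE)
  have "Q \<in> polys n A" "Q' \<in> polys n A" using x y polys_mono[OF BA] by auto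
  then show "x + y \<in> ratfuns n A B" "x * y \<in> ratfuns n A B"
    using x y PA PB by (auto intro!: Fract_in_ratfuns)
qed

lemma Fract_sum: "Fract (\<Sum>i\<in>I. f i) 1 = (\<Sum>i\<in>I. Fract (f i) (1 :: 'b::idom))"
proof -
  have s: "Fract (x + y) 1 = Fract x 1 + Fract y (1 :: 'b)" for x y by simp
  show ?thesis
    by (induction I rule: infinite_finite_induct) (simp_all add: s Zero_fract_def[symmetric] del: add_fract)
qed

lemma fun_field_s_simps: "fun_field_s n = subr (ratfuns n UNIV UNIV)"
  by (simp add: fun_field_s_def)

lemma subring_fun_field: "subring_set (ratfuns n UNIV (UNIV :: 'a::field set))"
  by (rule subring_set_ratfuns) (auto simp: subring_set_UNIV)

lemma Fract_in_fun_field: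
  "P \<in> polys n UNIV \<Longrightarrow> Fract P 1 \<in> ratfuns n UNIV (UNIV :: 'a::field set)"
  using subring_setD(1)[OF subring_set_polys[OF subring_set_UNIV]] by (intro Fract_in_ratfuns) auto

lemma const_in_fun_field: "const_fun c \<in> ratfuns n UNIV (UNIV :: 'a::field set)"
  unfolding const_fun_def by (intro Fract_in_fun_field polys_single[OF subring_set_UNIV]) auto

lemma param_in_fun_field: "i < n \<Longrightarrow> param i \<in> ratfuns n UNIV (UNIV :: 'a::field set)"
  unfolding param_def by (intro Fract_in_fun_field polys_var subring_set_UNIV)

text \<open>
  The derivation acts on the coefficients and kills the parameters; the quotient rule extends it
  from polynomials to their fractions.
\<close>

lemma extend_derivation_to_parameters:
  fixes D :: "'a::field \<Rightarrow> 'a"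
  assumes D: "D \<in> derivations k ring_of_type_algebra"
  obtains E where "E \<in> derivations (const_field_s n k) (fun_field_s n)"
    "\<And>P. P \<in> polys n UNIV \<Longrightarrow> E (Fract P 1) = Fract (coeff_map D P) 1"
proof -
  note DD = field_derivationD[OF D]
  note cm = coeff_map_derivation[of D, OF DD(1,2)]
  define B where "B = (\<lambda>P. Fract P 1) ` (polys n UNIV :: 'a mpolynomial set)"
  have Bf: "subring_set B"
    unfolding subring_set_def
  proof (intro conjI ballI)
    note PD = subring_setD[OF subring_set_polys[OF subring_set_UNIV, of n]]
    show "1 \<in> B" unfolding B_def One_fract_def by (intro imageI PD)
    fix x assume "x \<in> B"
    then obtain P where P: "x = Fract P 1" "P \<in> polys n UNIV" by (auto simp: B_def)
    show "- x \<in> B" using P imageI[OF PD(4)[OF P(2)], of "\<lambda>P. Fract P 1"] by (simp add: B_def)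
    fix y assume "y \<in> B"
    then obtain Q where Q: "y = Fract Q 1" "Q \<in> polys n UNIV" by (auto simp: B_def)
    show "x + y \<in> B" using P Q imageI[OF PD(2)[OF P(2) Q(2)], of "\<lambda>P. Fract P 1"] by (simp add: B_def)
    show "x * y \<in> B" using P Q imageI[OF PD(3)[OF P(2) Q(2)], of "\<lambda>P. Fract P 1"] by (simp add: B_def)
  qed
  define E0 where "E0 x = Fract (coeff_map D (THE P. x = Fract P 1)) 1" for x :: "'a ratfun"
  have E0: "E0 (Fract P 1) = Fract (coeff_map D P) 1" for P
  proof -
    have "(THE Q. Fract P 1 = Fract Q 1) = P" by (rule the_equality) (auto simp: eq_fract)
    then show ?thesis by (simp add: E0_def)
  qed
  have add: "E0 (x + y) = E0 x + E0 y" if "x \<in> B" "y \<in> B" for x y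
    using that by (auto simp: B_def E0 cm)
  have mult: "E0 (x * y) = x * E0 y + y * E0 x" if "x \<in> B" "y \<in> B" for x y
    using that by (auto simp: B_def E0 cm)
  have fracs: "{a / b | a b. a \<in> B \<and> b \<in> B \<and> b \<noteq> 0} = ratfuns n UNIV UNIV"
  proof (rule equalityI; rule subsetI)
    fix x assume "x \<in> {a / b | a b. a \<in> B \<and> b \<in> B \<and> b \<noteq> 0}"
    then obtain P Q where "x = Fract P 1 / Fract Q 1" "P \<in> polys n UNIV" "Q \<in> polys n UNIV" "Fract Q 1 \<noteq> 0"
      by (auto simp: B_def)
    moreover then have "Q \<noteq> 0" by (auto simp: Zero_fract_def)
    ultimately show "x \<in> ratfuns n UNIV UNIV" by (auto intro: Fract_in_ratfuns)
  next
    fix x :: "'a ratfun" assume "x \<in> ratfuns n UNIV UNIV"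
    then obtain P Q where x: "x = Fract P Q" "P \<in> polys n UNIV" "Q \<in> polys n UNIV" "Q \<noteq> 0" by (rule ratfunsE)
    then have "x = Fract P 1 / Fract Q 1" "Fract Q 1 \<noteq> 0" by (auto simp: Zero_fract_def eq_fract)
    moreover have "Fract P 1 \<in> B" "Fract Q 1 \<in> B" using x by (auto simp: B_def)
    ultimately show "x \<in> {a / b | a b. a \<in> B \<and> b \<in> B \<and> b \<noteq> 0}" by blast
  qed
  obtain E where E: "\<And>x. x \<in> B \<Longrightarrow> E x = E0 x"
    "\<And>a b. a \<in> B \<Longrightarrow> b \<in> B \<Longrightarrow> b \<noteq> 0 \<Longrightarrow> E (a / b) = (b * E0 a - a * E0 b) / (b * b)"
    "\<And>x y. x \<in> ratfuns n UNIV UNIV \<Longrightarrow> y \<in> ratfuns n UNIV UNIV \<Longrightarrow>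
        E (x + y) = E x + E y \<and> E (x * y) = x * E y + y * E x"
    by (rule derivation_to_fractions[OF Bf add mult, unfolded fracs]) blast+
  have cm_polys: "coeff_map D P \<in> polys n UNIV" if "P \<in> polys n UNIV" for P
    using that unfolding coeff_map_def
    by (intro polys_sum[OF subring_set_UNIV] polys_single[OF subring_set_UNIV]) (auto dest: polysD(2))
  have cm_zero: "coeff_map D P = 0" if "P \<in> polys n k" for P
    using polysD(1)[OF that] DD(3) by (simp add: coeff_map_def)
  have EF: "E (Fract P Q) = (Fract Q 1 * Fract (coeff_map D P) 1 - Fract P 1 * Fract (coeff_map D Q) 1) / (Fract Q 1 * Fract Q 1)"
    if "P \<in> polys n UNIV" "Q \<in> polys n UNIV" "Q \<noteq> 0" for P Q
  proof -
    have "Fract P Q = Fract P 1 / Fract Q 1" by simp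
    moreover have "Fract Q 1 \<noteq> 0" using that by (auto simp: Zero_fract_def eq_fract)
    ultimately show ?thesis
      using E(2)[of "Fract P 1" "Fract Q 1"] that unfolding E0 by (simp add: B_def del: divide_fract mult_fract diff_fract)
  qed
  have "E \<in> derivations (const_field_s n k) (fun_field_s n)"
    unfolding derivations_def fun_field_s_simps subr_simps
  proof (intro CollectI conjI ballI funcsetI)
    fix x :: "'a ratfun" assume "x \<in> ratfuns n UNIV UNIV"
    then obtain P Q where x: "x = Fract P Q" "P \<in> polys n UNIV" "Q \<in> polys n UNIV" "Q \<noteq> 0" by (rule ratfunsE)
    note PD = subring_setD[OF subring_set_polys[OF subring_set_UNIV, of n]]
    have "E x = Fract (Q * coeff_map D P - P * coeff_map D Q) (Q * Q)"
      unfolding x(1) EF[OF x(2-4)] using x(4) by simp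
    moreover have "Q * coeff_map D P - P * coeff_map D Q \<in> polys n UNIV"
      by (rule PD(5)[OF PD(3)[OF x(3) cm_polys[OF x(2)]] PD(3)[OF x(2) cm_polys[OF x(3)]]])
    moreover have "Q * Q \<in> polys n UNIV" by (rule PD(3)[OF x(3) x(3)])
    ultimately show "E x \<in> ratfuns n UNIV UNIV"
      using x(4) by (simp add: Fract_in_ratfuns)
  next
    fix c assume "c \<in> const_field_s n k"
    then obtain P Q where c: "c = Fract P Q" "P \<in> polys n k" "Q \<in> polys n k" "Q \<noteq> 0"
      unfolding const_field_s_def by (rule ratfunsE)
    then have "P \<in> polys n UNIV" "Q \<in> polys n UNIV" using polys_mono[of k UNIV n] by auto
    then show "E c = 0" using c by (simp add: EF cm_zero fract_collapse)
  qed (use E(3) in auto)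
  moreover have "E (Fract P 1) = Fract (coeff_map D P) 1" if "P \<in> polys n UNIV" for P
    using E(1)[of "Fract P 1"] that by (auto simp: B_def E0)
  ultimately show thesis by (rule that)
qed

lemma common_denominator_ratfuns:
  fixes x :: "'i \<Rightarrow> 'a::field ratfun"
  assumes A: "subring_set A" and k: "subring_set k" "k \<subseteq> A" and I: "finite I" "\<And>i. i \<in> I \<Longrightarrow> x i \<in> ratfuns n A k"
  obtains Q P where "Q \<in> polys n k" "Q \<noteq> 0" "\<And>i. i \<in> I \<Longrightarrow> P i \<in> polys n A" "\<And>i. i \<in> I \<Longrightarrow> x i * Fract Q 1 = Fract (P i) 1"
proof -
  have "\<exists>Q. Q \<in> polys n k \<and> Q \<noteq> 0 \<and> (\<forall>i\<in>I. \<exists>P\<in>polys n A. x i * Fract Q 1 = Fract P 1)"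
    using I
  proof (induction I rule: finite_induct)
    case empty
    then show ?case using subring_setD(1)[OF subring_set_polys[OF k(1)]] by (intro exI[of _ 1]) auto
  next
    case (insert i I)
    then obtain Q where Q: "Q \<in> polys n k" "Q \<noteq> 0" "\<And>i. i \<in> I \<Longrightarrow> \<exists>P\<in>polys n A. x i * Fract Q 1 = Fract P 1" by auto
    from insert.prems[of i] obtain P' Q' where x: "x i = Fract P' Q'" "P' \<in> polys n A" "Q' \<in> polys n k" "Q' \<noteq> 0"
      by (auto elim: ratfunsE)
    have QA: "Q \<in> polys n A" "Q' \<in> polys n A" using Q x polys_mono[OF k(2)] by auto
    show ?case
    proof (intro exI[of _ "Q * Q'"] conjI ballI)
      show "Q * Q' \<in> polys n k" by (rule polys_mult[OF k(1) Q(1) x(3)])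
      show "Q * Q' \<noteq> 0" using Q x by simp
      fix l assume "l \<in> insert i I"
      then consider "l = i" | "l \<in> I" by blast
      then show "\<exists>P\<in>polys n A. x l * Fract (Q * Q') 1 = Fract P 1"
      proof cases
        case 1
        have "x i * Fract (Q * Q') 1 = Fract (P' * Q) 1" using x by (simp add: eq_fract ac_simps)
        then show ?thesis using 1 polys_mult[OF A x(2) QA(1)] by blast
      next
        case 2
        then obtain P where P: "P \<in> polys n A" "x l * Fract Q 1 = Fract P 1" using Q(3) by blast
        have "x l * Fract (Q * Q') 1 = (x l * Fract Q 1) * Fract Q' 1" by (simp add: mult.assoc)
        then have "x l * Fract (Q * Q') 1 = Fract (P * Q') 1" by (simp add: P(2))
        then show ?thesis using polys_mult[OF A P(1) QA(2)] by blast
      qed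
    qed
  qed
  then obtain Q where Q: "Q \<in> polys n k" "Q \<noteq> 0" "\<forall>i\<in>I. \<exists>P\<in>polys n A. x i * Fract Q 1 = Fract P 1" by blast
  then have "\<forall>i\<in>I. \<exists>P. P \<in> polys n A \<and> x i * Fract Q 1 = Fract P 1" by blast
  from bchoice[OF this] obtain P where "\<forall>i\<in>I. P i \<in> polys n A \<and> x i * Fract Q 1 = Fract (P i) 1" by blast
  then show thesis using that Q(1,2) by blast
qed

section \<open>Periodic pencils in terms of polynomials\<close>

lemma mat_app_subr:
  assumes "subring_set K" "\<And>a b. a < N \<Longrightarrow> b < N \<Longrightarrow> U a b \<in> K" "\<And>b. b < N \<Longrightarrow> v b \<in> K" "a < N"
  shows "mat_app (subr K) N U v a = (\<Sum>b<N. U a b * v b)"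
  using assms subring_setD(3)[OF assms(1)] by (simp add: mat_app_def finsum_subr Pi_def)

lemma cov_deriv_subr:
  assumes K: "subring_set K" and W: "\<And>a b. a < N \<Longrightarrow> b < N \<Longrightarrow> W a b \<in> kforms (subr K)"
    and D: "D \<in> derivations S (subr K)" and v: "\<And>b. b < N \<Longrightarrow> v b \<in> K" and a: "a < N"
  shows "cov_deriv (subr K) N W D v a = D (v a) - (\<Sum>b<N. (\<Sum>(f, g)\<leftarrow>W a b. f * D g) * v b)"
proof -
  have c: "contract (subr K) D (W a b) \<in> K" if "a < N" "b < N" for a b
    using contract_closed[OF cring_subr[OF K] D W[OF that]] by simp
  have "mat_app (subr K) N (\<lambda>a b. contract (subr K) D (W a b)) v a = (\<Sum>b<N. contract (subr K) D (W a b) * v b)"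
    by (rule mat_app_subr[OF K c v a])
  moreover have "\<dots> \<in> K" by (intro subring_set_sum[OF K] subring_setD(3)[OF K] c v a) auto
  ultimately show ?thesis
    using a v D by (simp add: cov_deriv_def subr_minus[OF K] derivationsD(1)[OF D, simplified] contract_subr)
qed

lemma pencil_Suc: "pencil C (Suc n) B s a b = pencil C n B s a b @ map (\<lambda>(f, g). (s n \<otimes>\<^bsub>C\<^esub> f, g)) (B n a b)"
  by (simp add: pencil_def)

lemma pencil_kforms:
  assumes K: "subring_set K" and "\<And>i. i < n \<Longrightarrow> B i a b \<in> kforms (subr K)" "\<And>i. i < n \<Longrightarrow> s i \<in> K"
  shows "pencil (subr K) n B s a b \<in> kforms (subr K)"
  using assms(2,3)
proof (induction n)
  case (Suc n)
  have "map (\<lambda>(f, g). (s n \<otimes>\<^bsub>subr K\<^esub> f, g)) (B n a b) \<in> kforms (subr K)"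
    using Suc.prems(1)[of n] Suc.prems(2)[of n] by (auto simp: kforms_def intro!: subring_setD(3)[OF K])
  then show ?case using Suc by (simp add: pencil_Suc)
qed (simp add: pencil_def)

lemma pencil_contraction:
  "(\<Sum>(f, g)\<leftarrow>pencil (subr K) n B s a b. f * D g) = (\<Sum>i<n. s i * (\<Sum>(f, g)\<leftarrow>B i a b. f * D g))"
proof (induction n)
  case (Suc n)
  have "(\<Sum>(f, g)\<leftarrow>map (\<lambda>(f, g). (s n \<otimes>\<^bsub>subr K\<^esub> f, g)) w. f * D g) = s n * (\<Sum>(f, g)\<leftarrow>w. f * D g)" for w
    by (induction w) (auto simp: algebra_simps)
  then show ?case using Suc by (simp add: pencil_Suc del: map_map)
qed (simp add: pencil_def)

lemma const_fun_hom: "const_fun (x + y) = const_fun x + const_fun y" "const_fun (x * y) = const_fun x * const_fun y"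
    "const_fun 0 = 0"
  by (simp_all add: const_fun_def single_add mult_single Zero_fract_def)

lemma lookup_single_0_mult:
  "Poly_Mapping.lookup (Poly_Mapping.single 0 c * P) m = c * Poly_Mapping.lookup P m"
  for P :: "'a::comm_ring_1 mpolynomial"
proof -
  have "Poly_Mapping.single 0 c * P =
     (\<Sum>m\<in>Poly_Mapping.keys P. Poly_Mapping.single m (c * Poly_Mapping.lookup P m))"
    by (subst (1) poly_mapping_eq_sum_single[of P]) (simp add: sum_distrib_left mult_single)
  then show ?thesis by (auto simp: lookup_sum lookup_single when_def in_keys_iff)
qed

definition variable :: "nat \<Rightarrow> 'a::comm_ring_1 mpolynomial" where
  "variable i = Poly_Mapping.single (Poly_Mapping.single i 1) 1"

text \<open>
  The matrix \<open>A\<close> and its inverse become polynomial after multiplication with a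
  common denominator free of coordinates, which is a constant for the derivations in question.
  The commutation relation is applied to the unit vectors and to derivations that act on
  coefficients; comparing the coefficients of the monomials in the parameters gives relations in
  the function field alone.
\<close>

lemma periodic_pencil_polynomials:
  fixes Y :: "'a::field set set"
  assumes k: "subring_set k" and R: "subring_set (regular_functions Y)" and kR: "k \<subseteq> regular_functions Y"
    and per: "periodic_pencil k Y n N B" and j: "j < n"
  obtains P P' Q where
    "\<And>a b. a < N \<Longrightarrow> b < N \<Longrightarrow> P a b \<in> polys n (regular_functions Y)"
    "\<And>a b. a < N \<Longrightarrow> b < N \<Longrightarrow> P' a b \<in> polys n (regular_functions Y)"
    "Q \<in> polys n k" "Q \<noteq> 0"
    "\<And>a b. a < N \<Longrightarrow> b < N \<Longrightarrow> (\<Sum>c<N. P a c * P' c b) = (if a = b then Q else 0)"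
    "\<And>D a b m. D \<in> derivations k ring_of_type_algebra \<Longrightarrow> a < N \<Longrightarrow> b < N \<Longrightarrow>
       D (Poly_Mapping.lookup (P a b) m) =
         (\<Sum>c<N. \<Sum>i<n. (\<Sum>(f, g)\<leftarrow>B i a c. f * D g) *
            Poly_Mapping.lookup ((variable i + (if i = j then 1 else 0)) * P c b) m)
       - (\<Sum>c<N. \<Sum>i<n. (\<Sum>(f, g)\<leftarrow>B i c b. f * D g) * Poly_Mapping.lookup (variable i * P a c) m)"
proof -
  let ?K = "ratfuns n UNIV (UNIV :: 'a set)"
  let ?R = "regular_functions Y"
  define B' where "B' = (\<lambda>i a b. map (map_prod const_fun const_fun) (B i a b))"
  define t where "t = (\<lambda>i. param i + (if i = j then 1 else 0 :: 'a ratfun))"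
  note K = subring_fun_field[of n, where 'a = 'a]
  note KD = subring_setD[OF K]
  from per j obtain A where A: "A \<in> GL (subr ?K) N (regular_functions_s n k Y)"
    and comm: "\<And>D v. D \<in> derivations (const_field_s n k) (subr ?K) \<Longrightarrow> v \<in> vecs (subr ?K) N \<Longrightarrow>
       cov_deriv (subr ?K) N (pencil (subr ?K) n B' t) D (mat_app (subr ?K) N A v) =
       mat_app (subr ?K) N A (cov_deriv (subr ?K) N (pencil (subr ?K) n B' param) D v)"
    unfolding periodic_pencil_def Let_def fun_field_s_simps B'_def t_def by blast
  from A obtain A' where AR: "\<And>a b. a < N \<Longrightarrow> b < N \<Longrightarrow> A a b \<in> ratfuns n ?R k"
    and A'R: "\<And>a b. a < N \<Longrightarrow> b < N \<Longrightarrow> A' a b \<in> ratfuns n ?R k"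
    and inv: "\<And>v. v \<in> vecs (subr ?K) N \<Longrightarrow> mat_app (subr ?K) N A (mat_app (subr ?K) N A' v) = v"
    unfolding GL_def regular_functions_s_def by blast
  have sub: "ratfuns n ?R k \<subseteq> ?K"
    using polys_mono[of ?R UNIV n] polys_mono[of k UNIV n] by (auto simp: ratfuns_def)
  have AK: "A a b \<in> ?K" "A' a b \<in> ?K" if "a < N" "b < N" for a b
    using AR A'R that sub by blast+
  define e where "e b = (\<lambda>a\<in>{..<N}. if a = b then 1 else 0 :: 'a ratfun)" for b
  have eV: "e b \<in> vecs (subr ?K) N" for b
    using KD by (auto simp: e_def vecs_def)
  have e_app: "a < N \<Longrightarrow> e b a = (if a = b then 1 else 0)" for a b
    by (simp add: e_def)
  have eK: "a < N \<Longrightarrow> e b a \<in> ?K" for a b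
    using KD by (simp add: e_def)
  have sum_e: "(\<Sum>c<N. h c * e b c) = h b" if "b < N" for h b
  proof -
    have "(\<Sum>c<N. h c * e b c) = (\<Sum>c<N. if c = b then h c else 0)"
      by (rule sum.cong) (auto simp: e_app)
    then show ?thesis using that by simp
  qed
  have app_e: "mat_app (subr ?K) N U (e b) a = U a b"
    if "\<And>a b. a < N \<Longrightarrow> b < N \<Longrightarrow> U a b \<in> ?K" "a < N" "b < N" for U a b
    using mat_app_subr[OF K that(1) eK[of _ b] that(2)] sum_e[OF that(3)] by simp
  have inv': "(\<Sum>c<N. A a c * A' c b) = (if a = b then 1 else 0)" if "a < N" "b < N" for a b
  proof -
    have "(if a = b then 1 else 0) = mat_app (subr ?K) N A (mat_app (subr ?K) N A' (e b)) a"
      using inv[OF eV[of b]] e_app[OF that(1), of b] by simp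
    also have "\<dots> = (\<Sum>c<N. A a c * mat_app (subr ?K) N A' (e b) c)"
      by (rule mat_app_subr[OF K AK(1) _ that(1)]) (use AK(2) app_e[of A'] that in auto)
    also have "\<dots> = (\<Sum>c<N. A a c * A' c b)"
      by (rule sum.cong) (use AK(2) app_e[of A'] that in auto)
    finally show ?thesis by simp
  qed
  obtain Q P where Q: "Q \<in> polys n k" "Q \<noteq> 0" and P: "\<And>x. x \<in> {..<N} \<times> {..<N} \<Longrightarrow> P x \<in> polys n ?R"
    and PQ: "\<And>x. x \<in> {..<N} \<times> {..<N} \<Longrightarrow> (case x of (a, b) \<Rightarrow> A a b) * Fract Q 1 = Fract (P x) 1"
    by (rule common_denominator_ratfuns[OF R k kR, of "{..<N} \<times> {..<N}" "\<lambda>(a, b). A a b" n]) (use AR in auto)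
  obtain Q' P' where Q': "Q' \<in> polys n k" "Q' \<noteq> 0" and P': "\<And>x. x \<in> {..<N} \<times> {..<N} \<Longrightarrow> P' x \<in> polys n ?R"
    and PQ': "\<And>x. x \<in> {..<N} \<times> {..<N} \<Longrightarrow> (case x of (a, b) \<Rightarrow> A' a b) * Fract Q' 1 = Fract (P' x) 1"
    by (rule common_denominator_ratfuns[OF R k kR, of "{..<N} \<times> {..<N}" "\<lambda>(a, b). A' a b" n]) (use A'R in auto)
  have PA: "Fract (P (a, b)) 1 = A a b * Fract Q 1" "Fract (P' (a, b)) 1 = A' a b * Fract Q' 1"
    if "a < N" "b < N" for a b
    using PQ[of "(a, b)"] PQ'[of "(a, b)"] that by auto
  have F1: "Fract x 1 = Fract y 1 \<longleftrightarrow> x = y" for x y :: "'a mpolynomial"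
    by (simp add: eq_fract)
  have Fm: "Fract (x * y) 1 = Fract x 1 * Fract y 1" for x y :: "'a mpolynomial"
    by simp
  show thesis
  proof (rule that[of "\<lambda>a b. P (a, b)" "\<lambda>a b. P' (a, b)" "Q * Q'"])
    show "Q * Q' \<in> polys n k" by (rule polys_mult[OF k Q(1) Q'(1)])
    show "Q * Q' \<noteq> 0" using Q Q' by simp
    fix a b assume ab: "a < N" "b < N"
    show "P (a, b) \<in> polys n ?R" "P' (a, b) \<in> polys n ?R" using ab P P' by auto
    have "Fract (\<Sum>c<N. P (a, c) * P' (c, b)) 1 = (\<Sum>c<N. (A a c * Fract Q 1) * (A' c b * Fract Q' 1))"
      unfolding Fract_sum Fm by (rule sum.cong) (use ab PA in auto)
    also have "\<dots> = (\<Sum>c<N. A a c * A' c b) * (Fract Q 1 * Fract Q' 1)"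
      unfolding sum_distrib_right by (rule sum.cong) (simp_all only: ac_simps)
    also have "\<dots> = Fract (if a = b then Q * Q' else 0) 1"
      using inv'[OF ab] by (simp add: Zero_fract_def)
    finally show "(\<Sum>c<N. P (a, c) * P' (c, b)) = (if a = b then Q * Q' else 0)"
      unfolding F1 .
    fix D :: "'a \<Rightarrow> 'a" and m assume D: "D \<in> derivations k ring_of_type_algebra"
    obtain E where E: "E \<in> derivations (const_field_s n k) (subr ?K)"
      "\<And>P. P \<in> polys n UNIV \<Longrightarrow> E (Fract P 1) = Fract (coeff_map D P) 1"
      using extend_derivation_to_parameters[OF D, of n] unfolding fun_field_s_simps by blast
    note ED = derivationsD[OF E(1), unfolded subr_simps]
    note cm = coeff_map_derivation[of D, OF field_derivationD(1,2)[OF D]]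
    note DD = field_derivationD[OF D]
    have Ec: "E (const_fun c) = const_fun (D c)" for c
      unfolding const_fun_def using E(2)[OF polys_single[OF subring_set_UNIV, of c 0 n]] by (simp add: cm(3))
    define \<beta> where "\<beta> i a b = (\<Sum>(f, g)\<leftarrow>B i a b. f * D g)" for i a b
    have B': "(\<Sum>(f, g)\<leftarrow>B' i a b. f * E g) = const_fun (\<beta> i a b)" for i a b
    proof -
      have "(\<Sum>(f, g)\<leftarrow>map (map_prod const_fun const_fun) w. f * E g) = const_fun (\<Sum>(f, g)\<leftarrow>w. f * D g)" for w
        by (induction w) (auto simp: const_fun_hom Ec)
      then show ?thesis by (simp add: B'_def \<beta>_def del: map_map)
    qed
    have B'k: "B' i a b \<in> kforms (subr ?K)" for i a b
      by (auto simp: B'_def kforms_def intro: const_in_fun_field)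
    have tK: "t i \<in> ?K" "param i \<in> ?K" if "i < n" for i
      using param_in_fun_field[OF that] KD by (auto simp: t_def)
    have W: "pencil (subr ?K) n B' t a b \<in> kforms (subr ?K)" "pencil (subr ?K) n B' param a b \<in> kforms (subr ?K)" for a b
      by (simp_all add: pencil_kforms[OF K] B'k tK)
    have E1: "E 1 = 0" "E 0 = 0"
      using E(2)[of 1] E(2)[of 0] subring_setD(1,6)[OF subring_set_polys[OF subring_set_UNIV, of n]] cm(3)[of 0 1] DD
      by (auto simp: One_fract_def[symmetric] Zero_fract_def[symmetric] single_one coeff_map_def)
    have cov_e: "cov_deriv (subr ?K) N (pencil (subr ?K) n B' param) E (e b) c = - (\<Sum>i<n. param i * const_fun (\<beta> i c b))"
      if c: "c < N" for c
    proof -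
      have "E (e b c) = 0" using e_app[OF c, of b] E1 by simp
      then show ?thesis
        using cov_deriv_subr[OF K W(2) E(1) eK[of _ b] c] sum_e[OF ab(2)]
        by (simp add: pencil_contraction B')
    qed
    have app_eq: "mat_app (subr ?K) N A (e b) = (\<lambda>a\<in>{..<N}. A a b)"
    proof (rule ext)
      fix c show "mat_app (subr ?K) N A (e b) c = (\<lambda>a\<in>{..<N}. A a b) c"
        using app_e[of A, OF AK(1) _ ab(2), of c] by (cases "c < N") (simp_all add: mat_app_def)
    qed
    have "cov_deriv (subr ?K) N (pencil (subr ?K) n B' t) E (\<lambda>a\<in>{..<N}. A a b) a =
        E (A a b) - (\<Sum>c<N. (\<Sum>i<n. t i * const_fun (\<beta> i a c)) * A c b)"
      using cov_deriv_subr[OF K W(1) E(1) _ ab(1), of "\<lambda>a\<in>{..<N}. A a b"] AK(1) ab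
      by (simp add: pencil_contraction B')
    moreover have "mat_app (subr ?K) N A (cov_deriv (subr ?K) N (pencil (subr ?K) n B' param) E (e b)) a =
        (\<Sum>c<N. A a c * (- (\<Sum>i<n. param i * const_fun (\<beta> i c b))))"
    proof -
      have cK: "cov_deriv (subr ?K) N (pencil (subr ?K) n B' param) E (e b) c \<in> ?K" if "c < N" for c
        unfolding cov_e[OF that]
        by (intro KD(4) subring_set_sum[OF K] KD(3) tK const_in_fun_field) auto
      show ?thesis
        using mat_app_subr[OF K AK(1) cK ab(1)] by (simp add: cov_e)
    qed
    ultimately have star: "E (A a b) = (\<Sum>c<N. (\<Sum>i<n. t i * const_fun (\<beta> i a c)) * A c b)
        - (\<Sum>c<N. A a c * (\<Sum>i<n. param i * const_fun (\<beta> i c b)))"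
      using comm[OF E(1) eV[of b]] unfolding app_eq by (simp add: sum_negf algebra_simps)
    have Eq: "E (Fract Q 1) = 0"
      using E(2)[of Q] Q(1) polys_mono[of k UNIV n] polysD(1)[OF Q(1)] DD(3)
      by (auto simp: coeff_map_def Zero_fract_def)
    have PU: "P (a, b) \<in> polys n UNIV" using P ab polys_mono[of ?R UNIV n] by auto
    have qK: "Fract Q 1 \<in> ?K" using Q(1) polys_mono[of k UNIV n] by (intro Fract_in_fun_field) auto
    have "Fract (coeff_map D (P (a, b))) 1 = E (A a b * Fract Q 1)"
      using E(2)[OF PU] PA[OF ab] by simp
    also have "\<dots> = Fract Q 1 * E (A a b)"
      using ED(3)[OF AK(1)[OF ab] qK] Eq by simp
    also have "\<dots> = (\<Sum>c<N. \<Sum>i<n. const_fun (\<beta> i a c) * (t i * (A c b * Fract Q 1)))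
        - (\<Sum>c<N. \<Sum>i<n. const_fun (\<beta> i c b) * (param i * (A a c * Fract Q 1)))"
      unfolding star right_diff_distrib sum_distrib_left sum_distrib_right by (simp only: ac_simps)
    also have "\<dots> = (\<Sum>c<N. \<Sum>i<n. Fract (Poly_Mapping.single 0 (\<beta> i a c) * ((variable i + (if i = j then 1 else 0)) * P (c, b))) 1)
        - (\<Sum>c<N. \<Sum>i<n. Fract (Poly_Mapping.single 0 (\<beta> i c b) * (variable i * P (a, c))) 1)"
    proof -
      have t': "t i = Fract (variable i + (if i = j then 1 else 0)) 1" "param i = Fract (variable i) 1" for i
        by (auto simp: t_def param_def variable_def One_fract_def)
      have "const_fun (\<beta> i a c) * (t i * (A c b * Fract Q 1)) =
          Fract (Poly_Mapping.single 0 (\<beta> i a c) * ((variable i + (if i = j then 1 else 0)) * P (c, b))) 1"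
        "const_fun (\<beta> i c b) * (param i * (A a c * Fract Q 1)) =
          Fract (Poly_Mapping.single 0 (\<beta> i c b) * (variable i * P (a, c))) 1" if "c < N" for c i
        unfolding Fm PA(1)[OF that ab(2)] PA(1)[OF ab(1) that] t' const_fun_def by (simp_all only:)
      then show ?thesis by (simp cong: sum.cong_simp del: mult_fract)
    qed
    also have "\<dots> = Fract ((\<Sum>c<N. \<Sum>i<n. Poly_Mapping.single 0 (\<beta> i a c) * ((variable i + (if i = j then 1 else 0)) * P (c, b)))
        - (\<Sum>c<N. \<Sum>i<n. Poly_Mapping.single 0 (\<beta> i c b) * (variable i * P (a, c)))) 1"
    proof -
      have Fd: "Fract (x - y) 1 = Fract x 1 - Fract y 1" for x y :: "'a mpolynomial" by simp
      show ?thesis unfolding Fd Fract_sum ..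
    qed
    finally have "coeff_map D (P (a, b)) = (\<Sum>c<N. \<Sum>i<n. Poly_Mapping.single 0 (\<beta> i a c) * ((variable i + (if i = j then 1 else 0)) * P (c, b)))
        - (\<Sum>c<N. \<Sum>i<n. Poly_Mapping.single 0 (\<beta> i c b) * (variable i * P (a, c)))"
      unfolding F1 .
    from arg_cong[OF this, of "\<lambda>p. Poly_Mapping.lookup p m"]
    show "D (Poly_Mapping.lookup (P (a, b)) m) =
         (\<Sum>c<N. \<Sum>i<n. (\<Sum>(f, g)\<leftarrow>B i a c. f * D g) *
            Poly_Mapping.lookup ((variable i + (if i = j then 1 else 0)) * P (c, b)) m)
       - (\<Sum>c<N. \<Sum>i<n. (\<Sum>(f, g)\<leftarrow>B i c b. f * D g) * Poly_Mapping.lookup (variable i * P (a, c)) m)"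
      unfolding \<beta>_def[symmetric]
      by (simp only: lookup_coeff_map[of D, OF DD(4)] lookup_minus lookup_sum lookup_single_0_mult)
  qed
qed

section \<open>The algebraic closure of a prime field\<close>

lemma emb_eval:
  assumes R: "cring R" and f: "\<And>i. f i \<in> carrier R" and x: "x \<in> carrier R"
  shows "emb R (ring.eval R (rev (map f [0..<d])) x) = (\<Sum>i<d. emb R (f i) * emb R x ^ i)"
proof -
  interpret cring R by (rule R)
  have mem: "ring.eval R (rev (map f [0..<d])) x \<in> carrier R" for d
    by (rule eval_in_carrier) (use f x in auto)
  show ?thesis
  proof (induction d)
    case (Suc d)
    then show ?case
      using mem[of d] f x
      by (simp add: emb_add[OF R] emb_mult[OF R] emb_pow[OF R] mult.left_commute[of _ "emb R \<one>\<^bsub>R\<^esub>"])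
        (simp add: mult.assoc[symmetric] emb_one_mult[OF R])
  qed (simp add: emb_zero[OF R])
qed

context
  fixes p :: nat
  assumes p: "Factorial_Ring.prime p"
begin

lemma residue_field: "Ring.field (residue_ring (int p))"
proof -
  interpret residues_prime p "residue_ring (int p)" by unfold_locales (use p in auto)
  show ?thesis by (rule is_field)
qed

interpretation R: Ring.field "residue_ring (int p)" by (rule residue_field)
interpretation L: algebraic_closure "Fpbar p" "R.indexed_const ` carrier (residue_ring (int p))"
  unfolding Fpbar_def by (rule R.alg_closureE)


lemma cring_Fpbar: "cring (Fpbar p)" ..

lemma Fpbar_char: "of_nat p * emb (Fpbar p) \<one>\<^bsub>Fpbar p\<^esub> = 0"
proof -
  have p1: "1 < p" using p by (rule prime_gt_1_nat)
  have h: "R.indexed_const \<in> Ring.ring_hom (residue_ring (int p)) (Fpbar p)"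
    unfolding Fpbar_def by (rule R.alg_closureE)
  have "[n] \<cdot>\<^bsub>Fpbar p\<^esub> \<one>\<^bsub>Fpbar p\<^esub> = R.indexed_const (int n mod int p)" for n
  proof (induction n)
    case 0
    have "R.indexed_const \<zero>\<^bsub>residue_ring (int p)\<^esub> = \<zero>\<^bsub>Fpbar p\<^esub>"
      by (rule ring_hom_zero[OF h R.ring_axioms L.ring_axioms])
    then show ?case by (simp add: residue_ring_def)
  next
    case (Suc n)
    have "(int n mod int p) \<in> carrier (residue_ring (int p))" "1 \<in> carrier (residue_ring (int p))"
      using p1 by (auto simp: residue_ring_def)
    then have "R.indexed_const ((int n mod int p + 1) mod int p) =
        R.indexed_const (int n mod int p) \<oplus>\<^bsub>Fpbar p\<^esub> R.indexed_const 1"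
      using ring_hom_memE(3)[OF h, of "int n mod int p" 1] by (simp add: residue_ring_def)
    moreover have "R.indexed_const 1 = \<one>\<^bsub>Fpbar p\<^esub>"
      using ring_hom_memE(4)[OF h] by (simp add: residue_ring_def)
    ultimately show ?case using Suc by (simp add: mod_simps add.commute)
  qed
  from this[of p] have "[p] \<cdot>\<^bsub>Fpbar p\<^esub> \<one>\<^bsub>Fpbar p\<^esub> = R.indexed_const \<zero>\<^bsub>residue_ring (int p)\<^esub>"
    by (simp add: residue_ring_def)
  also have "\<dots> = \<zero>\<^bsub>Fpbar p\<^esub>"
    by (rule ring_hom_zero[OF h R.ring_axioms L.ring_axioms])
  finally show ?thesis
    using emb_ring_of_nat[OF cring_Fpbar, of p] by (simp add: emb_zero[OF cring_Fpbar])
qed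

lemma closed_field_Fpbar:
  "closed_field_in_ring (emb (Fpbar p) ` carrier (Fpbar p)) (emb (Fpbar p) \<one>\<^bsub>Fpbar p\<^esub>)"
proof -
  let ?F = "Fpbar p"
  note c = cring_Fpbar
  show ?thesis
  proof
    show "emb ?F \<one>\<^bsub>?F\<^esub> \<in> emb ?F ` carrier ?F" by auto
    show "emb ?F \<one>\<^bsub>?F\<^esub> \<noteq> 0"
      using emb_inject[OF c, of "\<one>\<^bsub>?F\<^esub>" "\<zero>\<^bsub>?F\<^esub>"] L.one_not_zero by (simp add: emb_zero[OF c])
  next
    fix x y assume "x \<in> emb ?F ` carrier ?F" "y \<in> emb ?F ` carrier ?F"
    then obtain a b where *: "x = emb ?F a" "a \<in> carrier ?F" "y = emb ?F b" "b \<in> carrier ?F" by blast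
    have "x + y = emb ?F (a \<oplus>\<^bsub>?F\<^esub> b)" "x * y = emb ?F (a \<otimes>\<^bsub>?F\<^esub> b)"
      using * by (simp_all add: emb_add[OF c] emb_mult[OF c])
    then show "x + y \<in> emb ?F ` carrier ?F" "x * y \<in> emb ?F ` carrier ?F"
      using * by auto
  next
    fix x assume "x \<in> emb ?F ` carrier ?F"
    then obtain a where *: "x = emb ?F a" "a \<in> carrier ?F" by blast
    have "- x = emb ?F (\<ominus>\<^bsub>?F\<^esub> a)" using * by (simp add: emb_uminus[OF c])
    then show "- x \<in> emb ?F ` carrier ?F" using * by auto
    show "emb ?F \<one>\<^bsub>?F\<^esub> * x = x" using * by (simp add: emb_one_mult[OF c])
    assume "x \<noteq> 0"
    then have "a \<noteq> \<zero>\<^bsub>?F\<^esub>" using * by (auto simp: emb_zero[OF c])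
    then have u: "a \<in> Units ?F" using * L.field_Units by auto
    have "x * emb ?F (inv\<^bsub>?F\<^esub> a) = emb ?F \<one>\<^bsub>?F\<^esub>"
      using * u L.Units_r_inv[OF u] L.Units_inv_closed[OF u] by (simp add: emb_mult[OF c, symmetric])
    then show "\<exists>y\<in>emb ?F ` carrier ?F. x * y = emb ?F \<one>\<^bsub>?F\<^esub>"
      using L.Units_inv_closed[OF u] by blast
  next
    fix cf :: "nat \<Rightarrow> ((int list \<times> nat) multiset \<Rightarrow> int) ring_product" and d :: nat
    assume cf: "\<And>i. cf i \<in> emb ?F ` carrier ?F" "0 < d" "cf d \<noteq> 0"
    define f where "f i = proj ?F (cf i)" for i
    have f: "f i \<in> carrier ?F" "emb ?F (f i) = cf i" for i
      using cf(1)[of i] by (auto simp: f_def proj_emb[OF c])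
    define P where "P = rev (map f [0..<Suc d])"
    have fd: "f d \<noteq> \<zero>\<^bsub>?F\<^esub>" using cf(3) f(2)[of d] by (auto simp: emb_zero[OF c])
    have P: "P = f d # rev (map f [0..<d])" by (simp add: P_def)
    have deg: "Polynomials.degree P = d" by (simp add: P)
    have carr: "P \<in> carrier (poly_ring ?F)"
      using f fd by (auto simp: univ_poly_def polynomial_def P)
    have "L.splitted P" by (rule L.roots_over_carrier[OF carr])
    then have "L.roots P \<noteq> {#}"
      unfolding L.splitted_def using deg cf(2) by auto
    then obtain x where "x \<in># L.roots P" by blast
    then have "L.is_root P x" using L.roots_mem_iff_is_root[OF carr] by auto
    then have x: "x \<in> carrier ?F" "L.eval P x = \<zero>\<^bsub>?F\<^esub>" by (auto simp: L.is_root_def)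
    have "(\<Sum>i\<le>d. cf i * emb ?F x ^ i) = emb ?F (L.eval P x)"
      unfolding P_def emb_eval[OF c f(1) x(1)] by (simp add: f lessThan_Suc_atMost)
    then show "\<exists>\<beta>\<in>emb ?F ` carrier ?F. (\<Sum>i\<le>d. cf i * \<beta> ^ i) = 0"
      using x by (auto simp: emb_zero[OF c])
  qed
qed

end

text \<open>
  If \<open>x\<close> is outside of the valuation ring then \<open>1/x\<close> has value
  \<open>0\<close>, and an equation of \<open>x\<close> divided by a power of \<open>x\<close>
  shows that its leading coefficient has value \<open>0\<close>.
\<close>

lemma (in closed_field_in_ring) algebraic_in_domain:
  fixes G :: "('a::field_char_0 \<times> 'r) set"
  assumes G: "partial_hom G" and val: "\<And>x. (\<exists>y. (x, y) \<in> G) \<or> (x \<noteq> 0 \<and> (inverse x, 0) \<in> G)"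
    and f: "poly (map_poly of_int f) x = 0" and nz: "of_int (Polynomial.lead_coeff f) * e \<noteq> 0"
  shows "\<exists>y. (x, y) \<in> G"
proof (rule ccontr)
  assume "\<not> ?thesis"
  then have x: "x \<noteq> 0" "(inverse x, 0) \<in> G" using val by blast+
  define d where "d = Polynomial.degree f"
  have deg: "Polynomial.degree (map_poly of_int f :: 'a poly) = d"
    unfolding d_def by (rule degree_map_poly) auto
  have "(\<Sum>i\<le>d. of_int (Polynomial.coeff f i) * x ^ i) = 0"
    using f by (simp add: poly_altdef deg coeff_map_poly)
  then have "0 = inverse x ^ d * (\<Sum>i\<le>d. of_int (Polynomial.coeff f i) * x ^ i)" by simp
  also have "\<dots> = (\<Sum>i\<le>d. of_int (Polynomial.coeff f i) * inverse x ^ (d - i))"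
    unfolding sum_distrib_left
  proof (rule sum.cong)
    fix i assume "i \<in> {..d}"
    then have "inverse x ^ d = inverse x ^ (d - i) * inverse x ^ i" by (simp flip: power_add)
    then show "inverse x ^ d * (of_int (Polynomial.coeff f i) * x ^ i) = of_int (Polynomial.coeff f i) * inverse x ^ (d - i)"
      using x(1) by (simp add: power_inverse field_simps)
  qed simp
  finally have "(0, \<Sum>i\<le>d. (of_int (Polynomial.coeff f i) * e) * (e * 0 ^ (d - i))) \<in> G"
    using hom_sum[OF G, of "{..d}" "\<lambda>i. of_int (Polynomial.coeff f i) * inverse x ^ (d - i)"
        "\<lambda>i. (of_int (Polynomial.coeff f i) * e) * (e * 0 ^ (d - i))"]
      hom_mult[OF G hom_of_int[OF G] hom_power[OF G x(2)]] by simp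
  also have "(\<Sum>i\<le>d. (of_int (Polynomial.coeff f i) * e) * (e * 0 ^ (d - i))) =
      (\<Sum>i\<in>{d}. (of_int (Polynomial.coeff f i) * e) * (e * 0 ^ (d - i)))"
    by (rule sum.mono_neutral_right) (auto simp: power_0_left split: if_splits)
  also have "\<dots> = of_int (Polynomial.lead_coeff f) * e"
    using unit[OF e_in] by (simp add: d_def mult.assoc)
  finally show False using nz hom_unique[OF G _ hom_zero[OF G]] by blast
qed

lemma of_int_unit_nonzero:
  fixes e :: "'r::comm_ring_1"
  assumes p: "Factorial_Ring.prime p" "of_nat p * e = 0" "e \<noteq> 0" and c: "c \<noteq> 0" "nat \<bar>c\<bar> < p"
  shows "of_int c * e \<noteq> 0"
proof
  assume z: "of_int c * e = 0"
  have "\<not> int p dvd c"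
    using c zdvd_imp_le[of "int p" "\<bar>c\<bar>"] by auto
  then have "coprime (int p) c" using p(1) by (intro prime_imp_coprime) auto
  then obtain u v where "u * int p + v * c = 1" by (metis coprime_iff_gcd_eq_1 bezout_int)
  then have "of_int (u * int p + v * c) * e = e" by simp
  then have "of_int u * (of_nat p * e) + of_int v * (of_int c * e) = e"
    by (simp add: algebra_simps)
  then show False using p z by simp
qed

section \<open>Evaluation of the periodicity relations on a line\<close>

lemma digits_unique:
  fixes a b :: "nat \<Rightarrow> nat"
  assumes "\<And>i. i < n \<Longrightarrow> a i < M" "\<And>i. i < n \<Longrightarrow> b i < M"
    and "(\<Sum>i<n. a i * M ^ i) = (\<Sum>i<n. b i * M ^ i)" and "i < n"
  shows "a i = b i"
  using assms
proof (induction n arbitrary: a b i)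
  case (Suc n)
  have expand: "(\<Sum>i<Suc n. c i * M ^ i) = c 0 + M * (\<Sum>i<n. c (Suc i) * M ^ i)" for c :: "nat \<Rightarrow> nat"
    unfolding sum.lessThan_Suc_shift by (simp add: sum_distrib_left ac_simps)
  have eq: "a 0 + M * (\<Sum>i<n. a (Suc i) * M ^ i) = b 0 + M * (\<Sum>i<n. b (Suc i) * M ^ i)"
    using Suc.prems(3) unfolding expand .
  have lt: "a 0 < M" "b 0 < M" using Suc.prems(1,2) by auto
  have z: "a 0 = b 0"
    using arg_cong[OF eq, of "\<lambda>x. x mod M"] lt by simp
  have sums: "(\<Sum>i<n. a (Suc i) * M ^ i) = (\<Sum>i<n. b (Suc i) * M ^ i)"
    using eq lt z by simp
  have "a (Suc l) = b (Suc l)" if "l < n" for l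
    by (rule Suc.IH[OF _ _ sums that]) (use Suc.prems(1,2) in simp_all)
  then show ?case using Suc.prems(4) z by (cases i) auto
qed simp

definition monomial_value :: "(nat \<Rightarrow> 'b::comm_monoid_mult) \<Rightarrow> (nat \<Rightarrow>\<^sub>0 nat) \<Rightarrow> 'b" where
  "monomial_value s m = (\<Prod>i\<in>Poly_Mapping.keys m. s i ^ Poly_Mapping.lookup m i)"

lemma monomial_value_super:
  assumes "finite S" "Poly_Mapping.keys m \<subseteq> S"
  shows "monomial_value s m = (\<Prod>i\<in>S. s i ^ Poly_Mapping.lookup m i)"
  unfolding monomial_value_def using assms by (intro prod.mono_neutral_left) (auto simp: in_keys_iff)

lemma monomial_value_add: "monomial_value s (m + m') = monomial_value s m * monomial_value s m'"
proof -
  let ?S = "Poly_Mapping.keys m \<union> Poly_Mapping.keys m'"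
  have "Poly_Mapping.keys (m + m') \<subseteq> ?S" by (rule keys_add)
  then show ?thesis
    by (simp add: monomial_value_super[of ?S] lookup_add power_add prod.distrib)
qed

text \<open>
  Kronecker's substitution \<open>s\<^sub>i = t ^ (M ^ i)\<close> with large \<open>M\<close>
  keeps the monomials apart, and a nonzero polynomial in \<open>t\<close> has a natural
  non-root.
\<close>

lemma exists_nonzero_value:
  fixes Q :: "'a::field_char_0 mpolynomial"
  assumes Q: "Q \<in> polys n k" "Q \<noteq> 0"
  shows "\<exists>z. (\<Sum>m\<in>Poly_Mapping.keys Q. Poly_Mapping.lookup Q m * of_nat (monomial_value z m)) \<noteq> 0"
proof -
  \<comment> \<open>\<open>M\<close> exceeds all exponents, so that they are digits in base \<open>M\<close>\<close>
  define M where "M = Suc (\<Sum>m\<in>Poly_Mapping.keys Q. \<Sum>i<n. Poly_Mapping.lookup m i)"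
  define code where "code m = (\<Sum>i<n. Poly_Mapping.lookup m i * M ^ i)" for m :: "nat \<Rightarrow>\<^sub>0 nat"
  have small: "Poly_Mapping.lookup m i < M" if "m \<in> Poly_Mapping.keys Q" "i < n" for m i
  proof -
    have "Poly_Mapping.lookup m i \<le> (\<Sum>i<n. Poly_Mapping.lookup m i)"
      using that by (intro member_le_sum) auto
    also have "\<dots> \<le> (\<Sum>m\<in>Poly_Mapping.keys Q. \<Sum>i<n. Poly_Mapping.lookup m i)"
      using that by (intro member_le_sum[of m _ "\<lambda>m. \<Sum>i<n. Poly_Mapping.lookup m i"]) auto
    finally show ?thesis by (simp add: M_def)
  qed
  have inj: "m = m'" if m: "m \<in> Poly_Mapping.keys Q" "m' \<in> Poly_Mapping.keys Q" and eq: "code m = code m'" for m m'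
  proof (rule poly_mapping_eqI)
    fix i
    show "Poly_Mapping.lookup m i = Poly_Mapping.lookup m' i"
    proof (cases "i < n")
      case True
      then show ?thesis
        using digits_unique[of n "Poly_Mapping.lookup m" M "Poly_Mapping.lookup m'" i] small m eq by (simp add: code_def)
    next
      case False
      then have "i \<notin> Poly_Mapping.keys m" "i \<notin> Poly_Mapping.keys m'" using polysD(2)[OF Q(1)] m by auto
      then show ?thesis by (simp add: in_keys_iff)
    qed
  qed
  define p where "p = (\<Sum>m\<in>Poly_Mapping.keys Q. Polynomial.monom (Poly_Mapping.lookup Q m) (code m))"
  obtain m0 where m0: "m0 \<in> Poly_Mapping.keys Q" using Q(2) by (metis keys_eq_empty ex_in_conv)
  have "Polynomial.coeff p (code m0) = (\<Sum>m\<in>Poly_Mapping.keys Q. if m = m0 then Poly_Mapping.lookup Q m else 0)"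
    unfolding p_def coeff_sum by (rule sum.cong) (use inj m0 in auto)
  also have "\<dots> = Poly_Mapping.lookup Q m0" using m0 by simp
  finally have "p \<noteq> 0" using m0 by (auto simp: in_keys_iff)
  then have "finite {x. poly p x = 0}" by (rule poly_roots_finite)
  then have "\<not> range (of_nat :: nat \<Rightarrow> 'a) \<subseteq> {x. poly p x = 0}"
    using finite_subset[of "range (of_nat :: nat \<Rightarrow> 'a)"] by (auto simp: range_inj_infinite inj_of_nat)
  then obtain t where t: "poly p (of_nat t) \<noteq> 0" by auto
  have "monomial_value (\<lambda>i. t ^ (M ^ i)) m = t ^ code m" if "m \<in> Poly_Mapping.keys Q" for m
    using polysD(2)[OF Q(1) that]
    by (simp add: monomial_value_super[of "{..<n}"] code_def power_sum power_mult[symmetric] mult.commute)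
  then have "(\<Sum>m\<in>Poly_Mapping.keys Q. Poly_Mapping.lookup Q m * of_nat (monomial_value (\<lambda>i. t ^ (M ^ i)) m)) = poly p (of_nat t)"
    by (simp add: p_def poly_sum poly_monom)
  then show ?thesis using t by metis
qed

text \<open>
  The reduction \<open>f\<close> is applied to the coefficients, and the parameters are replaced
  by polynomials in the coordinate of a line.
\<close>

definition ev :: "('a::zero \<Rightarrow> 'r::comm_ring_1) \<Rightarrow> (nat \<Rightarrow> 'r poly) \<Rightarrow> 'a mpolynomial \<Rightarrow> 'r poly" where
  "ev f s P = (\<Sum>m\<in>Poly_Mapping.keys P. [:f (Poly_Mapping.lookup P m):] * monomial_value s m)"

lemma ev_super:
  assumes "f 0 = 0" "finite S" "Poly_Mapping.keys P \<subseteq> S"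
  shows "ev f s P = (\<Sum>m\<in>S. [:f (Poly_Mapping.lookup P m):] * monomial_value s m)"
  unfolding ev_def using assms by (intro sum.mono_neutral_left) (auto simp: in_keys_iff)

lemma ev_zero: "ev f s 0 = 0"
  by (simp add: ev_def)

lemma ev_single: "f 0 = 0 \<Longrightarrow> ev f s (Poly_Mapping.single m c) = [:f c:] * monomial_value s m"
  by (subst ev_super[of _ "{m}"]) auto

text \<open>
  The maps \<open>f \<nu>\<close> are additive and multiplicative on any given elements only for
  almost all \<open>\<nu>\<close>.
\<close>

locale limit_hom =
  fixes T :: "'a::comm_ring_1 set" and f :: "nat \<Rightarrow> 'a \<Rightarrow> 'r::comm_ring_1" and e :: "nat \<Rightarrow> 'r"
  assumes T: "subring_set T"
    and f_add: "x \<in> T \<Longrightarrow> y \<in> T \<Longrightarrow> \<forall>\<^sub>F \<nu> in sequentially. f \<nu> (x + y) = f \<nu> x + f \<nu> y"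
    and f_mult: "x \<in> T \<Longrightarrow> y \<in> T \<Longrightarrow> \<forall>\<^sub>F \<nu> in sequentially. f \<nu> (x * y) = f \<nu> x * f \<nu> y"
    and f_one: "\<forall>\<^sub>F \<nu> in sequentially. f \<nu> 1 = e \<nu>"
    and e_f: "e \<nu> * f \<nu> x = f \<nu> x"
begin

lemmas TD = subring_setD[OF T]

lemma f_e: "f \<nu> x * e \<nu> = f \<nu> x"
  using e_f[of \<nu> x] by (simp add: mult.commute)

lemma f_zero: "\<forall>\<^sub>F \<nu> in sequentially. f \<nu> 0 = 0"
  using f_add[of 0 0] TD(6) by (auto elim: eventually_mono)

lemma f_of_nat: "\<forall>\<^sub>F \<nu> in sequentially. f \<nu> (of_nat j) = of_nat j * e \<nu>"
proof (induction j)
  case 0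
  then show ?case using f_zero by simp
next
  case (Suc j)
  have "\<forall>\<^sub>F \<nu> in sequentially. f \<nu> (1 + of_nat j) = f \<nu> 1 + f \<nu> (of_nat j)"
    by (intro f_add TD)
  then show ?case using Suc f_one by eventually_elim (simp add: algebra_simps)
qed

lemma f_sum:
  "finite S \<Longrightarrow> (\<And>i. i \<in> S \<Longrightarrow> g i \<in> T) \<Longrightarrow> \<forall>\<^sub>F \<nu> in sequentially. f \<nu> (\<Sum>i\<in>S. g i) = (\<Sum>i\<in>S. f \<nu> (g i))"
proof (induction S rule: finite_induct)
  case empty
  then show ?case using f_zero by simp
next
  case (insert i S)
  have "\<forall>\<^sub>F \<nu> in sequentially. f \<nu> (g i + sum g S) = f \<nu> (g i) + f \<nu> (sum g S)"
    by (intro f_add subring_set_sum[OF T]) (use insert in auto)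
  moreover have "\<forall>\<^sub>F \<nu> in sequentially. f \<nu> (sum g S) = (\<Sum>i\<in>S. f \<nu> (g i))"
    using insert by simp
  ultimately show ?case by eventually_elim (use insert in simp)
qed

lemma ev_add:
  assumes P: "P \<in> polys n T" and Q: "Q \<in> polys n T"
  shows "\<forall>\<^sub>F \<nu> in sequentially. \<forall>s. ev (f \<nu>) s (P + Q) = ev (f \<nu>) s P + ev (f \<nu>) s Q"
proof -
  let ?S = "Poly_Mapping.keys P \<union> Poly_Mapping.keys Q"
  have "\<forall>\<^sub>F \<nu> in sequentially. \<forall>m\<in>?S. f \<nu> (Poly_Mapping.lookup P m + Poly_Mapping.lookup Q m) =
      f \<nu> (Poly_Mapping.lookup P m) + f \<nu> (Poly_Mapping.lookup Q m)"
    by (intro eventually_ball_finite ballI f_add polysD(3)[OF P] polysD(3)[OF Q] TD) auto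
  with f_zero show ?thesis
  proof eventually_elim
    case (elim \<nu>)
    show ?case
    proof
      fix s
      have "ev (f \<nu>) s (P + Q) = (\<Sum>m\<in>?S. [:f \<nu> (Poly_Mapping.lookup (P + Q) m):] * monomial_value s m)"
        by (rule ev_super) (use elim keys_add[of P Q] in auto)
      also have "\<dots> = (\<Sum>m\<in>?S. [:f \<nu> (Poly_Mapping.lookup P m):] * monomial_value s m
          + [:f \<nu> (Poly_Mapping.lookup Q m):] * monomial_value s m)"
        by (rule sum.cong) (use elim in \<open>auto simp: lookup_add smult_add_left\<close>)
      also have "\<dots> = ev (f \<nu>) s P + ev (f \<nu>) s Q"
        unfolding sum.distrib by (subst (1 2) ev_super[of _ ?S]) (use elim in auto)
      finally show "ev (f \<nu>) s (P + Q) = ev (f \<nu>) s P + ev (f \<nu>) s Q" .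
    qed
  qed
qed

lemma ev_mult:
  assumes P: "P \<in> polys n T" and Q: "Q \<in> polys n T"
  shows "\<forall>\<^sub>F \<nu> in sequentially. \<forall>s. ev (f \<nu>) s (P * Q) = ev (f \<nu>) s P * ev (f \<nu>) s Q"
  using P
proof (induction P rule: polys_induct[OF T, consumes 1, case_names zero add])
  case zero
  then show ?case by (simp add: ev_zero)
next
  case (add m c P)
  have sm: "Poly_Mapping.single m c \<in> polys n T" by (rule polys_single[OF T add.hyps(2,1)])
  have single: "\<forall>\<^sub>F \<nu> in sequentially. \<forall>s. ev (f \<nu>) s (Poly_Mapping.single m c * Q) =
      ev (f \<nu>) s (Poly_Mapping.single m c) * ev (f \<nu>) s Q"
    using Q
  proof (induction Q rule: polys_induct[OF T, consumes 1, case_names zero add])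
    case zero
    then show ?case by (simp add: ev_zero)
  next
    case (add m' c' Q)
    have sm': "Poly_Mapping.single m' c' \<in> polys n T" by (rule polys_single[OF T add.hyps(2,1)])
    note ev_add[OF polys_mult[OF T sm sm'] polys_mult[OF T sm add.hyps(3)]] ev_add[OF sm' add.hyps(3)]
      f_mult[OF \<open>c \<in> T\<close> \<open>c' \<in> T\<close>] f_zero add.IH
    then show ?case
    proof eventually_elim
      case (elim \<nu>)
      then show ?case
        by (auto simp: distrib_left mult_single ev_single monomial_value_add ac_simps)
    qed
  qed
  note ev_add[OF polys_mult[OF T sm Q] polys_mult[OF T add.hyps(3) Q]] ev_add[OF sm add.hyps(3)] single add.IH
  then show ?case by eventually_elim (auto simp: distrib_right)
qed

lemma ev_sum:
  assumes "finite S" "\<And>i. i \<in> S \<Longrightarrow> g i \<in> polys n T"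
  shows "\<forall>\<^sub>F \<nu> in sequentially. \<forall>s. ev (f \<nu>) s (\<Sum>i\<in>S. g i) = (\<Sum>i\<in>S. ev (f \<nu>) s (g i))"
  using assms
proof (induction S rule: finite_induct)
  case empty
  then show ?case by (simp add: ev_zero)
next
  case (insert i S)
  have "sum g S \<in> polys n T" by (intro polys_sum[OF T]) (use insert in auto)
  moreover have "g i \<in> polys n T" by (rule insert.prems) simp
  ultimately have "\<forall>\<^sub>F \<nu> in sequentially. \<forall>s. ev (f \<nu>) s (g i + sum g S) = ev (f \<nu>) s (g i) + ev (f \<nu>) s (sum g S)"
    by (intro ev_add)
  moreover have "\<forall>\<^sub>F \<nu> in sequentially. \<forall>s. ev (f \<nu>) s (sum g S) = (\<Sum>i\<in>S. ev (f \<nu>) s (g i))"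
    using insert by simp
  ultimately show ?case
    by eventually_elim (use insert in auto)
qed

lemma e_ev: "[:e \<nu>:] * ev (f \<nu>) s P = ev (f \<nu>) s P"
  unfolding ev_def sum_distrib_left by (rule sum.cong) (auto simp: e_f mult.commute[of _ "e \<nu>"])

lemma ev_variable: "f \<nu> 0 = 0 \<Longrightarrow> ev (f \<nu>) s (variable i) = [:f \<nu> 1:] * s i"
  unfolding variable_def by (subst ev_single) (auto simp: monomial_value_def)

lemma ev_shift_variable:
  assumes P: "P \<in> polys n T" and i: "i < n"
  shows "\<forall>\<^sub>F \<nu> in sequentially. \<forall>s. ev (f \<nu>) s ((variable i + (if c then 1 else 0)) * P) =
     (s i + (if c then 1 else 0)) * ev (f \<nu>) s P"
proof -
  have X: "variable i \<in> polys n T" unfolding variable_def by (rule polys_var[OF i T])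
  have d: "(if c then 1 else 0) \<in> polys n T" using subring_setD(1,6)[OF subring_set_polys[OF T]] by auto
  note ev_mult[OF polys_add[OF T X d] P] ev_add[OF X d] f_zero f_one
  then show ?thesis
  proof eventually_elim
    case (elim \<nu>)
    have one: "ev (f \<nu>) s 1 = [:f \<nu> 1:]" for s
      using ev_single[of "f \<nu>" s 0 1, OF elim(3)] by (simp add: single_one monomial_value_def)
    show ?case
    proof
      fix s
      have "ev (f \<nu>) s ((variable i + (if c then 1 else 0)) * P) =
          (s i + (if c then 1 else 0)) * ([:e \<nu>:] * ev (f \<nu>) s P)"
        using elim by (simp add: ev_variable one ev_zero smult_add_right algebra_simps)
      then show "ev (f \<nu>) s ((variable i + (if c then 1 else 0)) * P) =
          (s i + (if c then 1 else 0)) * ev (f \<nu>) s P"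
        by (simp only: e_ev)
    qed
  qed
qed

text \<open>
  At the origin \<open>z\<close> of the line the denominator is the reduction of its value at
  \<open>z\<close>, which has an inverse.
\<close>

lemma ev_constant_term_unit:
  assumes Q: "Q \<in> polys n k" "Q \<noteq> 0" and k: "k \<subseteq> T"
    and z: "c = (\<Sum>m\<in>Poly_Mapping.keys Q. Poly_Mapping.lookup Q m * of_nat (monomial_value z m))"
    and c: "c * c' = 1" "c' \<in> T"
  shows "\<forall>\<^sub>F \<nu> in sequentially. \<forall>s. (\<forall>i<n. Polynomial.coeff (s i) 0 = of_nat (z i)) \<longrightarrow>
     Polynomial.coeff (ev (f \<nu>) s Q) 0 * f \<nu> c' = e \<nu>"
proof -
  have QT: "Poly_Mapping.lookup Q m \<in> T" if "m \<in> Poly_Mapping.keys Q" for m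
    using polysD(1)[OF Q(1) that] k by blast
  have cT: "c \<in> T" unfolding z by (intro subring_set_sum[OF T] TD QT)
  have "\<forall>\<^sub>F \<nu> in sequentially. f \<nu> c = (\<Sum>m\<in>Poly_Mapping.keys Q. f \<nu> (Poly_Mapping.lookup Q m * of_nat (monomial_value z m)))"
    unfolding z by (rule f_sum) (auto intro: TD QT)
  moreover have "\<forall>\<^sub>F \<nu> in sequentially. \<forall>m\<in>Poly_Mapping.keys Q.
      f \<nu> (Poly_Mapping.lookup Q m * of_nat (monomial_value z m)) = f \<nu> (Poly_Mapping.lookup Q m) * f \<nu> (of_nat (monomial_value z m))"
    by (intro eventually_ball_finite ballI f_mult QT TD) auto
  moreover have "\<forall>\<^sub>F \<nu> in sequentially. \<forall>m\<in>Poly_Mapping.keys Q.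
      f \<nu> (of_nat (monomial_value z m)) = of_nat (monomial_value z m) * e \<nu>"
    by (intro eventually_ball_finite ballI f_of_nat) auto
  moreover have "\<forall>\<^sub>F \<nu> in sequentially. f \<nu> (c * c') = f \<nu> c * f \<nu> c'"
    by (rule f_mult[OF cT c(2)])
  ultimately show ?thesis using f_one
  proof eventually_elim
    case (elim \<nu>)
    show ?case
    proof (intro allI impI)
      fix s :: "nat \<Rightarrow> 'r poly" assume s: "\<forall>i<n. Polynomial.coeff (s i) 0 = of_nat (z i)"
      have s': "poly (s i) 0 = of_nat (z i)" if "i < n" for i
        using s that by (simp add: poly_0_coeff_0)
      have mv: "poly (monomial_value s m) 0 = of_nat (monomial_value z m)" if "m \<in> Poly_Mapping.keys Q" for m
        using polysD(2)[OF Q(1) that]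
        by (simp add: monomial_value_super[of "{..<n}"] poly_prod s')
      have "Polynomial.coeff (ev (f \<nu>) s Q) 0 = (\<Sum>m\<in>Poly_Mapping.keys Q. f \<nu> (Poly_Mapping.lookup Q m) * of_nat (monomial_value z m))"
        unfolding poly_0_coeff_0[symmetric] ev_def poly_sum by (rule sum.cong) (auto simp: mv)
      also have "\<dots> = f \<nu> c"
        unfolding elim(1) by (rule sum.cong) (use elim in \<open>auto simp: mult.commute[of "of_nat _" "e \<nu>"] mult.assoc[symmetric] f_e\<close>)
      finally show "Polynomial.coeff (ev (f \<nu>) s Q) 0 * f \<nu> c' = e \<nu>"
        using elim c(1) by simp
    qed
  qed
qed

text \<open>
  Finitely many identities between coefficients are reduced, each of them at almost all
  \<open>\<nu>\<close>, and are then assembled on the line.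
\<close>

theorem shifts_along_lines:
  fixes D :: "nat \<Rightarrow> 'r \<Rightarrow> 'r" and b :: "nat \<Rightarrow> nat \<Rightarrow> nat \<Rightarrow> nat \<Rightarrow> 'r"
  assumes D: "\<And>\<nu>. derivation (D \<nu>)"
    and P: "\<And>a b. a < N \<Longrightarrow> b < N \<Longrightarrow> P a b \<in> polys n T" "\<And>a b. a < N \<Longrightarrow> b < N \<Longrightarrow> P' a b \<in> polys n T"
    and Q: "Q \<in> polys n k" "Q \<noteq> 0" and k: "k \<subseteq> T" "\<And>c. c \<in> k \<Longrightarrow> c \<noteq> 0 \<Longrightarrow> \<exists>c'\<in>k. c * c' = 1"
    and kr: "subring_set k"
    and PP: "\<And>a b. a < N \<Longrightarrow> b < N \<Longrightarrow> (\<Sum>c<N. P a c * P' c b) = (if a = b then Q else 0)"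
    and DP: "\<And>c d m. c < N \<Longrightarrow> d < N \<Longrightarrow> \<forall>\<^sub>F \<nu> in sequentially.
       D \<nu> (f \<nu> (Poly_Mapping.lookup (P c d) m)) =
         (\<Sum>a<N. \<Sum>i<n. b \<nu> i c a * f \<nu> (Poly_Mapping.lookup ((variable i + (if i = j then 1 else 0)) * P a d) m))
       - (\<Sum>a<N. \<Sum>i<n. b \<nu> i a d * f \<nu> (Poly_Mapping.lookup (variable i * P c a) m))"
    and z: "(\<Sum>m\<in>Poly_Mapping.keys Q. Poly_Mapping.lookup Q m * of_nat (monomial_value z m)) \<noteq> 0"
    and j: "j < n"
  shows "\<forall>\<^sub>F \<nu> in sequentially. \<forall>m. derivation.shifts_along_line (D \<nu>) n N (b \<nu>) (e \<nu>) j z m"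
proof -
  define S where "S c d = Poly_Mapping.keys (P c d) \<union>
     (\<Union>a<N. \<Union>i<n. Poly_Mapping.keys ((variable i + (if i = j then 1 else 0)) * P a d) \<union> Poly_Mapping.keys (variable i * P c a))" for c d
  have fS: "finite (S c d)" for c d by (auto simp: S_def)
  have X: "variable i \<in> polys n T" if "i < n" for i
    unfolding variable_def by (rule polys_var[OF that T])
  have all: "\<forall>\<^sub>F \<nu> in sequentially. \<forall>c\<in>{..<N}. \<forall>d\<in>{..<N}. \<forall>m\<in>S c d.
       D \<nu> (f \<nu> (Poly_Mapping.lookup (P c d) m)) =
         (\<Sum>a<N. \<Sum>i<n. b \<nu> i c a * f \<nu> (Poly_Mapping.lookup ((variable i + (if i = j then 1 else 0)) * P a d) m))
       - (\<Sum>a<N. \<Sum>i<n. b \<nu> i a d * f \<nu> (Poly_Mapping.lookup (variable i * P c a) m))"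
    by (intro eventually_ball_finite ballI DP fS) auto
  have shift: "\<forall>\<^sub>F \<nu> in sequentially. \<forall>c\<in>{..<N}. \<forall>d\<in>{..<N}. \<forall>i\<in>{..<n}. \<forall>s.
      ev (f \<nu>) s ((variable i + (if i = j then 1 else 0)) * P c d) = (s i + (if i = j then 1 else 0)) * ev (f \<nu>) s (P c d)"
    by (intro eventually_ball_finite ballI ev_shift_variable[where n = n] P(1)) auto
  have shift1: "\<forall>\<^sub>F \<nu> in sequentially. \<forall>s. ev (f \<nu>) s (variable i * P c d) = s i * ev (f \<nu>) s (P c d)"
    if "c < N" "d < N" "i < n" for c d i
    using ev_shift_variable[OF P(1)[OF that(1,2)] that(3), where c = False] by simp
  have shift0: "\<forall>\<^sub>F \<nu> in sequentially. \<forall>c\<in>{..<N}. \<forall>d\<in>{..<N}. \<forall>i\<in>{..<n}. \<forall>s.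
      ev (f \<nu>) s (variable i * P c d) = s i * ev (f \<nu>) s (P c d)"
    by (intro eventually_ball_finite ballI shift1) auto
  have prod: "\<forall>\<^sub>F \<nu> in sequentially. \<forall>c\<in>{..<N}. \<forall>d\<in>{..<N}. \<forall>a\<in>{..<N}. \<forall>s.
      ev (f \<nu>) s (P c a * P' a d) = ev (f \<nu>) s (P c a) * ev (f \<nu>) s (P' a d)"
    by (intro eventually_ball_finite ballI ev_mult[where n = n] P) auto
  have sums: "\<forall>\<^sub>F \<nu> in sequentially. \<forall>c\<in>{..<N}. \<forall>d\<in>{..<N}. \<forall>s.
      ev (f \<nu>) s (\<Sum>a<N. P c a * P' a d) = (\<Sum>a<N. ev (f \<nu>) s (P c a * P' a d))"
    by (intro eventually_ball_finite ballI ev_sum[where n = n] polys_mult[OF T] P) auto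
  define v where "v = (\<Sum>m\<in>Poly_Mapping.keys Q. Poly_Mapping.lookup Q m * of_nat (monomial_value z m))"
  have "v \<in> k" unfolding v_def
    by (intro subring_set_sum[OF kr] subring_setD[OF kr] polysD(1)[OF Q(1)])
  then obtain v' where v': "v' \<in> k" "v * v' = 1" using k(2) z unfolding v_def by blast
  have unit: "\<forall>\<^sub>F \<nu> in sequentially. \<forall>s. (\<forall>i<n. Polynomial.coeff (s i) 0 = of_nat (z i)) \<longrightarrow>
     Polynomial.coeff (ev (f \<nu>) s Q) 0 * f \<nu> v' = e \<nu>"
    by (rule ev_constant_term_unit[OF Q k(1) v_def v'(2)]) (use v' k in auto)
  from all shift shift0 prod sums unit f_zero show ?thesis
  proof eventually_elim
    case (elim \<nu>)
    interpret D: derivation "D \<nu>" by (rule D)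
    interpret P: derivation "map_poly (D \<nu>)" by (rule D.derivation_map_poly)
    note al = elim(1)[rule_format, simplified] and sh = elim(2)[rule_format, simplified]
      and sh0 = elim(3)[rule_format, simplified] and pr = elim(4)[rule_format, simplified]
      and su = elim(5)[rule_format, simplified] and un = elim(6)[rule_format] and f0 = elim(7)
    show ?case
    proof
      fix m :: "nat \<Rightarrow> nat"
      let ?s = "line z m :: nat \<Rightarrow> 'r poly"
      let ?E = "\<lambda>p. ev (f \<nu>) ?s p"
      have "map_poly (D \<nu>) [:x, y:] = [:D \<nu> x, D \<nu> y:]" for x y
        by (simp add: map_poly_pCons)
      then have sc: "map_poly (D \<nu>) (?s i) = 0" for i by (simp add: line_def D.minus)
      have mc: "map_poly (D \<nu>) (monomial_value ?s \<mu>) = 0" for \<mu>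
        unfolding monomial_value_def by (intro P.const_prod P.const_power sc)
      have const: "map_poly (D \<nu>) [:c:] = [:D \<nu> c:]" for c
        by (simp add: map_poly_pCons)
      have gauge: "P.gauge N (\<lambda>c d. \<Sum>i<n. ?s i * [:b \<nu> i c d:])
          (\<lambda>c d. (\<Sum>i<n. ?s i * [:b \<nu> i c d:]) + [:b \<nu> j c d:]) (\<lambda>c d. ?E (P c d))"
        unfolding P.gauge_def
      proof (intro allI impI)
        fix c d assume cd: "c < N" "d < N"
        have keys: "Poly_Mapping.keys (P c d) \<subseteq> S c d"
          "\<And>a i. a < N \<Longrightarrow> i < n \<Longrightarrow> Poly_Mapping.keys ((variable i + (if i = j then 1 else 0)) * P a d) \<subseteq> S c d"
          "\<And>a i. a < N \<Longrightarrow> i < n \<Longrightarrow> Poly_Mapping.keys (variable i * P c a) \<subseteq> S c d"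
          unfolding S_def by blast+
        have sums: "(\<Sum>i\<in>I. [:g i:]) = [:\<Sum>i\<in>I. g i:]" for g :: "nat \<Rightarrow> 'r" and I
          by (induction I rule: infinite_finite_induct) auto
        have "map_poly (D \<nu>) (?E (P c d)) = (\<Sum>\<mu>\<in>S c d. [:D \<nu> (f \<nu> (Poly_Mapping.lookup (P c d) \<mu>)):] * monomial_value ?s \<mu>)"
          unfolding ev_super[of "f \<nu>", OF f0 fS[of c d] keys(1)] P.sum
          by (rule sum.cong) (simp_all only: P.mult mc const mult_zero_right mult_zero_left add_0 add_0_right mult.commute)
        also have "\<dots> = (\<Sum>\<mu>\<in>S c d. (\<Sum>a<N. \<Sum>i<n. [:b \<nu> i c a:] * ([:f \<nu> (Poly_Mapping.lookup ((variable i + (if i = j then 1 else 0)) * P a d) \<mu>):] * monomial_value ?s \<mu>))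
            - (\<Sum>a<N. \<Sum>i<n. [:b \<nu> i a d:] * ([:f \<nu> (Poly_Mapping.lookup (variable i * P c a) \<mu>):] * monomial_value ?s \<mu>)))"
        proof (rule sum.cong)
          fix \<mu> assume mu: "\<mu> \<in> S c d"
          have pc: "[:x - y:] = [:x:] - [:y:]" "[:x * y:] = [:x:] * [:y:]" for x y :: 'r by simp_all
          show "[:D \<nu> (f \<nu> (Poly_Mapping.lookup (P c d) \<mu>)):] * monomial_value ?s \<mu> =
            (\<Sum>a<N. \<Sum>i<n. [:b \<nu> i c a:] * ([:f \<nu> (Poly_Mapping.lookup ((variable i + (if i = j then 1 else 0)) * P a d) \<mu>):] * monomial_value ?s \<mu>))
            - (\<Sum>a<N. \<Sum>i<n. [:b \<nu> i a d:] * ([:f \<nu> (Poly_Mapping.lookup (variable i * P c a) \<mu>):] * monomial_value ?s \<mu>))"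
            unfolding al[OF cd mu] pc sums[symmetric] left_diff_distrib sum_distrib_right mult.assoc ..
        qed simp
        also have "\<dots> = (\<Sum>a<N. \<Sum>i<n. [:b \<nu> i c a:] * ?E ((variable i + (if i = j then 1 else 0)) * P a d))
            - (\<Sum>a<N. \<Sum>i<n. [:b \<nu> i a d:] * ?E (variable i * P c a))"
        proof -
          have "(\<Sum>\<mu>\<in>S c d. \<Sum>a<N. \<Sum>i<n. [:b \<nu> i c a:] * ([:f \<nu> (Poly_Mapping.lookup ((variable i + (if i = j then 1 else 0)) * P a d) \<mu>):] * monomial_value ?s \<mu>))
             = (\<Sum>a<N. \<Sum>i<n. [:b \<nu> i c a:] * ?E ((variable i + (if i = j then 1 else 0)) * P a d))"
            unfolding sum.swap[of _ _ "S c d"] sum_distrib_left[symmetric]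
            by (intro sum.cong refl arg_cong2[where f = "(*)"] ev_super[of "f \<nu>", symmetric, OF f0 fS[of c d]] keys(2)) auto
          moreover have "(\<Sum>\<mu>\<in>S c d. \<Sum>a<N. \<Sum>i<n. [:b \<nu> i a d:] * ([:f \<nu> (Poly_Mapping.lookup (variable i * P c a) \<mu>):] * monomial_value ?s \<mu>))
             = (\<Sum>a<N. \<Sum>i<n. [:b \<nu> i a d:] * ?E (variable i * P c a))"
            unfolding sum.swap[of _ _ "S c d"] sum_distrib_left[symmetric]
            by (intro sum.cong refl arg_cong2[where f = "(*)"] ev_super[of "f \<nu>", symmetric, OF f0 fS[of c d]] keys(3)) auto
          ultimately show ?thesis unfolding sum_subtractf by simp
        qed
        also have "(\<Sum>a<N. \<Sum>i<n. [:b \<nu> i c a:] * ?E ((variable i + (if i = j then 1 else 0)) * P a d)) =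
            (\<Sum>a<N. ((\<Sum>i<n. ?s i * [:b \<nu> i c a:]) + [:b \<nu> j c a:]) * ?E (P a d))"
        proof (rule sum.cong)
          fix a assume "a \<in> {..<N}"
          then have a: "a < N" by simp
          have "(\<Sum>i<n. [:b \<nu> i c a:] * ?E ((variable i + (if i = j then 1 else 0)) * P a d)) =
             (\<Sum>i<n. (?s i * [:b \<nu> i c a:] + (if i = j then [:b \<nu> i c a:] else 0)) * ?E (P a d))"
            by (rule sum.cong) (use sh[OF a cd(2)] in \<open>auto simp: distrib_left distrib_right ac_simps\<close>)
          also have "\<dots> = ((\<Sum>i<n. ?s i * [:b \<nu> i c a:]) + [:b \<nu> j c a:]) * ?E (P a d)"
            unfolding sum_distrib_right[symmetric] sum.distrib using j by simp
          finally show "(\<Sum>i<n. [:b \<nu> i c a:] * ?E ((variable i + (if i = j then 1 else 0)) * P a d)) =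
             ((\<Sum>i<n. ?s i * [:b \<nu> i c a:]) + [:b \<nu> j c a:]) * ?E (P a d)" .
        qed simp
        also have "(\<Sum>a<N. \<Sum>i<n. [:b \<nu> i a d:] * ?E (variable i * P c a)) =
            (\<Sum>a<N. ?E (P c a) * (\<Sum>i<n. ?s i * [:b \<nu> i a d:]))"
          unfolding sum_distrib_left
          by (intro sum.cong refl) (simp_all only: lessThan_iff sh0[OF cd(1)] ac_simps)
        finally show "map_poly (D \<nu>) (?E (P c d)) =
          (\<Sum>a<N. ((\<Sum>i<n. ?s i * [:b \<nu> i c a:]) + [:b \<nu> j c a:]) * ?E (P a d))
          - (\<Sum>a<N. ?E (P c a) * (\<Sum>i<n. ?s i * [:b \<nu> i a d:]))" .
      qed
      have inv: "(\<Sum>a<N. ?E (P c a) * ?E (P' a d)) = (if c = d then ?E Q else 0)" if "c < N" "d < N" for c d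
      proof -
        have "(\<Sum>a<N. ?E (P c a) * ?E (P' a d)) = ?E (\<Sum>a<N. P c a * P' a d)"
          unfolding su[OF that] by (rule sum.cong) (use pr[OF that] in auto)
        then show ?thesis unfolding PP[OF that] by (simp add: ev_zero)
      qed
      have w: "Polynomial.coeff (?E Q) 0 * f \<nu> v' = e \<nu>"
        by (rule un) (simp add: line_def)
      show "D.shifts_along_line n N (b \<nu>) (e \<nu>) j z m"
        unfolding D.shifts_along_line_def
        by (intro exI[of _ "\<lambda>c d. ?E (P c d)"] exI[of _ "\<lambda>c d. ?E (P' c d)"] exI[of _ "?E Q"] exI[of _ "f \<nu> v'"] conjI gauge w)
          (auto simp: inv)
    qed
  qed
qed

end

section \<open>Covariant derivatives in a product of rings\<close>

lemma (in derivation_pair) linear_combination: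
  assumes "finite I" "\<And>x. x \<in> I \<Longrightarrow> r x \<in> A" "\<And>x. x \<in> I \<Longrightarrow> w x \<in> kforms (subr A)"
  shows "\<exists>v\<in>kforms (subr A). pair_form v = (\<Sum>x\<in>I. \<Psi> (r x) * pair_form (w x)) \<and>
     (\<forall>E. (\<Sum>(a, b)\<leftarrow>v. a * E b) = (\<Sum>x\<in>I. r x * (\<Sum>(a, b)\<leftarrow>w x. a * E b)))"
  using assms
proof (induction I rule: finite_induct)
  case empty
  then show ?case by (intro bexI[of _ "[]"]) auto
next
  case (insert x I)
  then obtain v where v: "v \<in> kforms (subr A)" "pair_form v = (\<Sum>x\<in>I. \<Psi> (r x) * pair_form (w x))"
     "\<And>E. (\<Sum>(a, b)\<leftarrow>v. a * E b) = (\<Sum>x\<in>I. r x * (\<Sum>(a, b)\<leftarrow>w x. a * E b))" by auto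
  define u where "u = map (\<lambda>(a, b). (r x * a, b)) (w x)"
  have rx: "r x \<in> A" and wx: "w x \<in> kforms (subr A)" using insert.prems by auto
  have "u \<in> kforms (subr A) \<and> pair_form u = \<Psi> (r x) * pair_form (w x) \<and>
      (\<forall>E. (\<Sum>(a, b)\<leftarrow>u. a * E b) = r x * (\<Sum>(a, b)\<leftarrow>w x. a * E b))"
    unfolding u_def using wx
  proof (induction rule: kforms_induct)
    case (Cons a c w)
    then show ?case using rx AD(3)[OF rx, of a] by (simp add: \<Psi>_mult algebra_simps del: map_map)
  qed simp
  then show ?case
    using insert.hyps v by (intro bexI[of _ "u @ v"]) auto
qed

text \<open>
  In a local ring with coordinates a form is determined by its contractions, and every
  derivation of the local ring extends to the function field.
\<close>

lemma (in derivation_pair) pair_form_zero_if_killed: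
  assumes kr: "subring_set k"
    and coord: "\<And>L. L \<in> spec A \<Longrightarrow> \<exists>d x. coordinates (subr L) k d x"
    and frac: "\<And>L. L \<in> spec A \<Longrightarrow> {a / b | a b. a \<in> L \<and> b \<in> L \<and> b \<noteq> 0} = UNIV"
    and w: "w \<in> kforms (subr A)"
    and z: "\<And>E. E \<in> derivations k ring_of_type_algebra \<Longrightarrow> (\<Sum>(a, b)\<leftarrow>w. a * E b) = 0"
  shows "pair_form w = 0"
proof (rule pair_form_zero[OF w])
  fix L assume L: "L \<in> spec A"
  then obtain P where P: "primeideal P (subr A)" "L = localization_at A P" by (auto simp: spec_def)
  have sub: "subring_set L" unfolding P(2) by (rule subring_localization[OF A P(1)])
  have AL: "A \<subseteq> L" unfolding P(2) by (rule A_subset_localization[OF A P(1)])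
  obtain d' x where c: "coordinates (subr L) k d' x" using coord[OF L] by blast
  have wL: "w \<in> kforms (subr L)" using w AL by (auto simp: kforms_def)
  show "kaehler_eq (subr L) k w []"
  proof (rule kaehler_eq_zero_if_contract_zero[OF cring_subr[OF sub] c _ wL])
    show "k \<subseteq> carrier (subr L)" using k AL by simp
    fix D assume D: "D \<in> derivations k (subr L)"
    obtain E where E: "E \<in> derivations k ring_of_type_algebra" "\<And>x. x \<in> L \<Longrightarrow> E x = D x"
      by (rule extend_derivation_to_field[OF sub D _ frac[OF L]]) (use k AL in auto)
    have "(\<Sum>(a, b)\<leftarrow>w. a * D b) = (\<Sum>(a, b)\<leftarrow>w. a * E b)"
      by (rule arg_cong[where f = sum_list], rule map_cong) (use wL E(2) in \<open>auto simp: kforms_def\<close>)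
    then show "contract (subr L) D w = \<zero>\<^bsub>subr L\<^esub>"
      using z[OF E(1)] by (simp add: contract_subr)
  qed
qed

definition emb_derivation :: "'b ring \<Rightarrow> ('b \<Rightarrow> 'b) \<Rightarrow> 'b ring_product \<Rightarrow> 'b ring_product" where
  "emb_derivation C D u = emb C (D (proj C u))"

lemma derivation_zero_one:
  assumes C: "cring C" and D: "D \<in> derivations S C"
  shows "D \<zero>\<^bsub>C\<^esub> = \<zero>\<^bsub>C\<^esub>" "D \<one>\<^bsub>C\<^esub> = \<zero>\<^bsub>C\<^esub>"
proof -
  interpret cring C by (rule C)
  show "D \<zero>\<^bsub>C\<^esub> = \<zero>\<^bsub>C\<^esub>"
    using derivationsD(2)[OF D zero_closed zero_closed] derivationsD(1)[OF D zero_closed]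
    by (simp add: add.l_cancel_one')
  show "D \<one>\<^bsub>C\<^esub> = \<zero>\<^bsub>C\<^esub>"
    using derivationsD(3)[OF D one_closed one_closed] derivationsD(1)[OF D one_closed]
    by (simp add: add.l_cancel_one')
qed

context
  fixes C :: "'b ring" and S D
  assumes C: "cring C" and D: "D \<in> derivations S C"
begin

interpretation C: cring C by (rule C)

lemma derivation_emb: "derivation (emb_derivation C D)"
proof
  note pc = proj_closed[OF C]
  fix u v :: "'b ring_product"
  show "emb_derivation C D (u + v) = emb_derivation C D u + emb_derivation C D v"
    by (simp add: emb_derivation_def proj_add[OF C] derivationsD[OF D] emb_add[OF C] pc)
  have e: "emb C (D x) * emb C \<one>\<^bsub>C\<^esub> = emb C (D x)" if "x \<in> carrier C" for x
    using emb_one_mult[OF C derivationsD(1)[OF D that]] by (simp add: mult.commute)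
  show "emb_derivation C D (u * v) = u * emb_derivation C D v + v * emb_derivation C D u"
    by (simp add: emb_derivation_def proj_mult[OF C] derivationsD[OF D] emb_add[OF C] emb_mult[OF C] pc
        emb_proj[OF C] e mult.assoc[symmetric] mult.commute[of "emb C \<one>\<^bsub>C\<^esub>"])
      (simp add: mult.assoc mult.commute[of "emb C \<one>\<^bsub>C\<^esub>"] e pc)
qed

lemma derivation_pow_closed: "x \<in> carrier C \<Longrightarrow> (D ^^ j) x \<in> carrier C"
  by (induction j) (auto intro: derivationsD(1)[OF D])

lemma emb_derivation_emb: "x \<in> carrier C \<Longrightarrow> emb_derivation C D (emb C x) = emb C (D x)"
  by (simp add: emb_derivation_def proj_emb[OF C])

lemma emb_derivation_pow_emb: "x \<in> carrier C \<Longrightarrow> (emb_derivation C D ^^ j) (emb C x) = emb C ((D ^^ j) x)"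
  by (induction j) (auto simp: emb_derivation_emb derivation_pow_closed)

lemma one_emb_derivation: "emb C \<one>\<^bsub>C\<^esub> * emb_derivation C D u = emb_derivation C D u"
  by (simp add: emb_derivation_def emb_one_mult[OF C] derivationsD(1)[OF D] proj_closed[OF C])

lemma char_emb_derivation:
  assumes "of_nat p * emb C \<one>\<^bsub>C\<^esub> = 0"
  shows "of_nat p * emb_derivation C D u = 0"
  using arg_cong[OF assms, of "\<lambda>x. x * emb_derivation C D u"]
  by (simp add: mult.assoc one_emb_derivation)

lemma derivation_pow_p:
  assumes p: "Factorial_Ring.prime p" and char: "of_nat p * emb C \<one>\<^bsub>C\<^esub> = 0"
  shows "D ^^ p \<in> derivations S C"
proof -
  interpret E: derivation "emb_derivation C D" by (rule derivation_emb)
  note cl = derivation_pow_closed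
  obtain l where l: "p = Suc l" using prime_gt_0_nat[OF p] by (cases p) auto
  show ?thesis
    unfolding derivations_def
  proof (intro CollectI conjI ballI funcsetI cl)
    fix x y assume x: "x \<in> carrier C" and y: "y \<in> carrier C"
    have "(D ^^ j) (x \<oplus>\<^bsub>C\<^esub> y) = (D ^^ j) x \<oplus>\<^bsub>C\<^esub> (D ^^ j) y" for j
      by (induction j) (auto simp: derivationsD[OF D] cl x y)
    then show "(D ^^ p) (x \<oplus>\<^bsub>C\<^esub> y) = (D ^^ p) x \<oplus>\<^bsub>C\<^esub> (D ^^ p) y" .
    have "emb C ((D ^^ p) (x \<otimes>\<^bsub>C\<^esub> y)) = emb C (x \<otimes>\<^bsub>C\<^esub> (D ^^ p) y \<oplus>\<^bsub>C\<^esub> y \<otimes>\<^bsub>C\<^esub> (D ^^ p) x)"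
      using E.pow_p_mult[OF p char_emb_derivation[OF char], of "emb C x" "emb C y"] x y cl
      by (simp add: emb_mult[OF C, symmetric] emb_derivation_pow_emb emb_add[OF C, symmetric])
    then show "(D ^^ p) (x \<otimes>\<^bsub>C\<^esub> y) = x \<otimes>\<^bsub>C\<^esub> (D ^^ p) y \<oplus>\<^bsub>C\<^esub> y \<otimes>\<^bsub>C\<^esub> (D ^^ p) x"
      using x y cl by (simp add: emb_inject[OF C])
  next
    fix c assume "c \<in> S"
    then have "D c = \<zero>\<^bsub>C\<^esub>" by (rule derivationsD(4)[OF D])
    moreover have "(D ^^ j) \<zero>\<^bsub>C\<^esub> = \<zero>\<^bsub>C\<^esub>" for j
      by (induction j) (auto simp: derivation_zero_one[OF C D])
    ultimately show "(D ^^ p) c = \<zero>\<^bsub>C\<^esub>" by (simp add: l funpow_Suc_right del: funpow.simps)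
  qed
qed

lemma p_derivation_emb:
  assumes p: "Factorial_Ring.prime p" and char: "of_nat p * emb C \<one>\<^bsub>C\<^esub> = 0"
    and z: "\<And>x. x \<in> carrier C \<Longrightarrow> (D ^^ p) x = \<zero>\<^bsub>C\<^esub>"
  shows "p_derivation (emb_derivation C D) p"
proof (intro p_derivation.intro derivation_emb p_derivation_axioms.intro p char_emb_derivation[OF char])
  fix u
  obtain l where l: "p = Suc l" using prime_gt_0_nat[OF p] by (cases p) auto
  have "(emb_derivation C D ^^ p) u = (emb_derivation C D ^^ l) (emb C (D (proj C u)))"
    unfolding l funpow_Suc_right by (simp add: emb_derivation_def)
  also have "\<dots> = emb C ((D ^^ l) (D (proj C u)))"
    by (rule emb_derivation_pow_emb) (rule derivationsD(1)[OF D proj_closed[OF C]])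
  also have "(D ^^ l) (D (proj C u)) = (D ^^ p) (proj C u)"
    unfolding l funpow_Suc_right by simp
  finally show "(emb_derivation C D ^^ p) u = 0"
    by (simp add: z[OF proj_closed[OF C]] emb_zero[OF C])
qed

lemma contract_emb:
  "w \<in> kforms C \<Longrightarrow> emb C (contract C D w) = (\<Sum>(a, b)\<leftarrow>w. emb C a * emb C (D b))"
  by (induction w rule: kforms_induct)
    (auto simp: emb_zero[OF C] emb_add[OF C] emb_mult[OF C] contract_closed[OF C D] derivationsD(1)[OF D])

lemma cov_deriv_emb:
  assumes W: "\<And>a b. a < N \<Longrightarrow> b < N \<Longrightarrow> W a b \<in> kforms C"
    and \<omega>: "\<And>a b. a < N \<Longrightarrow> b < N \<Longrightarrow> \<omega> a b = emb C (contract C D (W a b))"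
    and v: "v \<in> vecs C N"
  shows "(cov_deriv C N W D ^^ j) v \<in> vecs C N"
    "a < N \<Longrightarrow> emb C ((cov_deriv C N W D ^^ j) v a) =
        (derivation.cov (emb_derivation C D) N \<omega> ^^ j) (\<lambda>a. if a < N then emb C (v a) else 0) a"
proof -
  interpret E: derivation "emb_derivation C D" by (rule derivation_emb)
  have step: "cov_deriv C N W D v \<in> vecs C N \<and> (\<forall>a<N. emb C (cov_deriv C N W D v a) =
      emb_derivation C D (emb C (v a)) - (\<Sum>b<N. \<omega> a b * emb C (v b)))" if v: "v \<in> vecs C N" for v
  proof -
    have vc: "v b \<in> carrier C" if "b < N" for b using v that by (auto simp: vecs_def)
    have cc: "contract C D (W a b) \<in> carrier C" if "a < N" "b < N" for a b
      by (rule contract_closed[OF C D W[OF that]])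
    have app: "mat_app C N (\<lambda>a b. contract C D (W a b)) v a = (\<Oplus>\<^bsub>C\<^esub>b\<in>{..<N}. contract C D (W a b) \<otimes>\<^bsub>C\<^esub> v b)" if "a < N" for a
      using that by (simp add: mat_app_def)
    have term_closed: "(\<lambda>b. contract C D (W a b) \<otimes>\<^bsub>C\<^esub> v b) \<in> {..<N} \<rightarrow> carrier C" if "a < N" for a
      using cc vc that by auto
    have app_closed: "mat_app C N (\<lambda>a b. contract C D (W a b)) v a \<in> carrier C" if "a < N" for a
      unfolding app[OF that] by (rule C.finsum_closed[OF term_closed[OF that]])
    have app_emb: "emb C (mat_app C N (\<lambda>a b. contract C D (W a b)) v a) = (\<Sum>b<N. \<omega> a b * emb C (v b))" if "a < N" for a
      unfolding app[OF that] emb_finsum[OF C finite_lessThan term_closed[OF that]]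
      by (rule sum.cong) (use that cc vc \<omega> in \<open>auto simp: emb_mult[OF C]\<close>)
    show ?thesis
      using vc app_closed app_emb derivationsD(1)[OF D]
      by (auto simp: cov_deriv_def vecs_def emb_minus[OF C] emb_derivation_emb)
  qed
  have both: "(cov_deriv C N W D ^^ j) v \<in> vecs C N \<and> (\<forall>a<N. emb C ((cov_deriv C N W D ^^ j) v a) =
        (E.cov N \<omega> ^^ j) (\<lambda>a. if a < N then emb C (v a) else 0) a)"
  proof (induction j)
    case (Suc j)
    define u where "u = (cov_deriv C N W D ^^ j) v"
    define w where "w = (E.cov N \<omega> ^^ j) (\<lambda>a. if a < N then emb C (v a) else 0)"
    from Suc have u: "u \<in> vecs C N" "\<And>a. a < N \<Longrightarrow> emb C (u a) = w a"
      by (auto simp: u_def w_def)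
    have eqs: "(cov_deriv C N W D ^^ Suc j) v = cov_deriv C N W D u"
      "(E.cov N \<omega> ^^ Suc j) (\<lambda>a. if a < N then emb C (v a) else 0) = E.cov N \<omega> w"
      by (simp_all add: u_def w_def)
    show ?case
      unfolding eqs using step[OF u(1)] u(2) by (simp add: E.cov_def)
  qed (use v in simp)
  then show "(cov_deriv C N W D ^^ j) v \<in> vecs C N"
    "a < N \<Longrightarrow> emb C ((cov_deriv C N W D ^^ j) v a) =
        (E.cov N \<omega> ^^ j) (\<lambda>a. if a < N then emb C (v a) else 0) a" by auto
qed

end

text \<open>
  The p-th power is a derivation, and it kills the coordinates because the first power already
  sends them to constants.
\<close>

lemma coordinate_field_pow_p:
  assumes C: "cring C" and coord: "coordinates C S d x" and fields: "coordinate_fields C S d x \<delta>" and i: "i < d"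
    and p: "Factorial_Ring.prime p" and char: "of_nat p * emb C \<one>\<^bsub>C\<^esub> = 0" and y: "y \<in> carrier C"
  shows "(\<delta> i ^^ p) y = \<zero>\<^bsub>C\<^esub>"
proof -
  interpret C: cring C by (rule C)
  have D: "\<delta> i \<in> derivations S C" and x: "\<And>j. j < d \<Longrightarrow> \<delta> i (x j) = (if i = j then \<one>\<^bsub>C\<^esub> else \<zero>\<^bsub>C\<^esub>)"
    using fields i by (auto simp: coordinate_fields_def)
  obtain l where l: "p = Suc (Suc l)"
    using prime_ge_2_nat[OF p] by (metis add_2_eq_Suc le_Suc_ex)
  have z: "(\<delta> i ^^ j) \<zero>\<^bsub>C\<^esub> = \<zero>\<^bsub>C\<^esub>" for j
    by (induction j) (auto simp: derivation_zero_one[OF C D])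
  have "(\<delta> i ^^ p) (x j) = \<zero>\<^bsub>C\<^esub>" if "j < d" for j
    using x[OF that] derivation_zero_one[OF C D] z
    by (cases "i = j") (simp_all add: l funpow_Suc_right del: funpow.simps)
  then show ?thesis
    by (intro derivation_zero_if_zero_on_coordinates[OF C coord derivation_pow_p[OF C D p char] _ y])
qed


lemma eventually_less_strict_mono:
  "strict_mono p \<Longrightarrow> \<forall>\<^sub>F \<nu> in sequentially. c < (p \<nu> :: nat)"
  by (rule eventually_sequentiallyI[of "Suc c"]) (metis Suc_le_eq less_le_trans strict_mono_imp_increasing)

text \<open>
  Modulo a prime larger than the denominator \<open>v\<close> an inverse of \<open>v\<close> is
  an integer.
\<close>

lemma rational_reduces_to_natural:
  fixes f :: "nat \<Rightarrow> 'a::field_char_0 \<Rightarrow> 'r::comm_ring_1"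
  assumes lim: "limit_hom T f e" and sT: "of_rat s \<in> T"
    and p: "strict_mono p" "\<And>\<nu>. Factorial_Ring.prime (p \<nu>)" "\<And>\<nu>. of_nat (p \<nu>) * e \<nu> = 0"
  shows "\<forall>\<^sub>F \<nu> in sequentially. \<exists>m. f \<nu> (of_rat s) = of_nat m * e \<nu>"
proof -
  interpret limit_hom T f e by (rule lim)
  obtain u v where s: "s = of_int u / of_int v" "v > 0"
    using quotient_of_div[of s] quotient_of_denom_pos[of s] by (cases "quotient_of s") auto
  obtain u' :: nat and u'' :: nat where u: "u = int u' - int u''" by (metis int_diff_cases)
  have eq: "of_nat (nat v) * of_rat s + of_nat u'' = (of_nat u' :: 'a)"
  proof -
    have "of_nat (nat v) * (of_rat s :: 'a) = of_int u"
      using s by (simp add: of_rat_divide)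
    then show ?thesis by (simp add: u)
  qed
  have "\<forall>\<^sub>F \<nu> in sequentially. f \<nu> (of_nat (nat v) * of_rat s + of_nat u'') = f \<nu> (of_nat (nat v) * of_rat s) + f \<nu> (of_nat u'')"
    by (intro f_add TD sT)
  moreover have "\<forall>\<^sub>F \<nu> in sequentially. f \<nu> (of_nat (nat v) * of_rat s) = f \<nu> (of_nat (nat v)) * f \<nu> (of_rat s)"
    by (intro f_mult TD sT)
  moreover note f_of_nat[of "nat v"] f_of_nat[of u'] f_of_nat[of u'']
  moreover have "\<forall>\<^sub>F \<nu> in sequentially. nat v < p \<nu>"
    by (rule eventually_less_strict_mono[OF p(1)])
  ultimately show ?thesis
  proof eventually_elim
    case (elim \<nu>)
    have "\<not> int (p \<nu>) dvd v" using elim(6) s(2) zdvd_imp_le[of "int (p \<nu>)" v] by auto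
    then have "coprime (int (p \<nu>)) v" using p(2)[of \<nu>] by (intro prime_imp_coprime) auto
    then obtain x y where xy: "x * int (p \<nu>) + y * v = 1" by (metis coprime_iff_gcd_eq_1 bezout_int)
    have pf: "of_nat (p \<nu>) * f \<nu> a = 0" for a
      using arg_cong[OF p(3)[of \<nu>], of "\<lambda>z. z * f \<nu> a"] by (simp add: mult.assoc e_f)
    have vs: "of_int v * f \<nu> (of_rat s) = of_int u * e \<nu>"
    proof -
      have "of_nat (nat v) * e \<nu> * f \<nu> (of_rat s) + of_nat u'' * e \<nu> = of_nat u' * e \<nu>"
        using elim eq by simp
      then show ?thesis using s(2) by (simp add: u mult.assoc e_f algebra_simps)
    qed
    define m where "m = nat ((y * u) mod int (p \<nu>))"
    have pp: "0 < int (p \<nu>)" using p(2)[of \<nu>] by (simp add: prime_gt_0_nat)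
    then have m: "int m = (y * u) mod int (p \<nu>)" by (simp add: m_def)
    have "f \<nu> (of_rat s) = of_int (x * int (p \<nu>) + y * v) * f \<nu> (of_rat s)" by (simp add: xy)
    also have "\<dots> = of_int x * (of_nat (p \<nu>) * f \<nu> (of_rat s)) + of_int y * (of_int v * f \<nu> (of_rat s))"
      by (simp add: algebra_simps)
    also have "\<dots> = of_int (y * u) * e \<nu>" unfolding pf vs by simp
    also have "y * u = int m + int (p \<nu>) * ((y * u) div int (p \<nu>))" unfolding m by simp
    also have "of_int \<dots> * e \<nu> = of_nat m * e \<nu> + of_int ((y * u) div int (p \<nu>)) * (of_nat (p \<nu>) * e \<nu>)"
      by (simp add: algebra_simps)
    finally show ?case using p(3)[of \<nu>] by auto
  qed
qed

section \<open>The limit of a sequence of reductions\<close>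

lemma abs_reduced_rep_add:
  "c = a + b \<Longrightarrow> \<forall>\<^sub>F \<nu> in sequentially. rep_reduced c \<nu> = rep_reduced a \<nu> + rep_reduced b \<nu>"
  using abs_reduced_eq_iff[of "rep_reduced c" "\<lambda>\<nu>. rep_reduced a \<nu> + rep_reduced b \<nu>"]
  by (simp add: plus_reduced.abs_eq[symmetric] abs_rep_reduced)

lemma abs_reduced_rep_mult:
  "c = a * b \<Longrightarrow> \<forall>\<^sub>F \<nu> in sequentially. rep_reduced c \<nu> = rep_reduced a \<nu> * rep_reduced b \<nu>"
  using abs_reduced_eq_iff[of "rep_reduced c" "\<lambda>\<nu>. rep_reduced a \<nu> * rep_reduced b \<nu>"]
  by (simp add: times_reduced.abs_eq[symmetric] abs_rep_reduced)

lemma abs_reduced_rep: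
  "c = abs_reduced a \<Longrightarrow> \<forall>\<^sub>F \<nu> in sequentially. rep_reduced c \<nu> = a \<nu>"
  using abs_reduced_eq_iff[of "rep_reduced c" a] by (simp add: abs_rep_reduced)

lemma eventually_val:
  fixes p :: "nat \<Rightarrow> nat" and x :: "'a::field_char_0"
  assumes p: "strict_mono p" "\<And>\<nu>. Factorial_Ring.prime (p \<nu>)"
    and cf: "\<And>\<nu>. closed_field_in_ring (F \<nu>) (e \<nu>)"
    and ch: "\<And>\<nu>. of_nat (p \<nu>) * e \<nu> = 0"
    and G: "\<And>\<nu>. closed_field_in_ring.partial_hom (F \<nu>) (e \<nu>) (G \<nu>)"
    and val: "\<And>\<nu> x. (\<exists>y. (x, y) \<in> G \<nu>) \<or> (x \<noteq> 0 \<and> (inverse x, 0) \<in> G \<nu>)"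
    and x: "algebraic x"
  shows "\<forall>\<^sub>F \<nu> in sequentially. \<exists>y. (x, y) \<in> G \<nu>"
proof -
  obtain q where q: "poly (map_poly of_int q) x = 0" "q \<noteq> 0"
    using x by (rule algebraicE')
  have "\<forall>\<^sub>F \<nu> in sequentially. nat \<bar>Polynomial.lead_coeff q\<bar> < p \<nu>"
    by (rule eventually_less_strict_mono[OF p(1)])
  then show ?thesis
  proof eventually_elim
    case (elim \<nu>)
    interpret closed_field_in_ring "F \<nu>" "e \<nu>" by (rule cf)
    show ?case
      by (rule algebraic_in_domain[OF G val q(1) of_int_unit_nonzero[OF p(2) ch e_nz _ elim]]) (use q(2) in simp)
  qed
qed

text \<open>
  On \<open>k\<close> the homomorphism is given by the places, on \<open>A\<close> by the
  reductions themselves, and the two agree on \<open>R\<close>. The universal property of the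
  base change combines them into a homomorphism to the reduced product, whose representatives
  are the maps \<open>f \<nu>\<close>.
\<close>

theorem limit_of_reductions:
  fixes k A R T :: "'a::field_char_0 set" and C :: "nat \<Rightarrow> 'b ring"
    and \<phi> :: "nat \<Rightarrow> 'a \<Rightarrow> (int list \<times> nat) multiset \<Rightarrow> int"
    and \<iota> :: "nat \<Rightarrow> 'a \<Rightarrow> 'b"
  assumes k: "subring_set k" "\<And>x. x \<in> k \<Longrightarrow> algebraic x"
    and A: "subring_set A" and R: "subring_set R" "R \<subseteq> A" "R \<subseteq> k"
    and T: "subring_set T" "k \<subseteq> T"
    and h: "h \<in> ring_iso (base_change R id (subr A) (subr k)) (subr T)"
      "\<And>a. a \<in> A \<Longrightarrow> h (base_change_in R id (subr A) (subr k) a) = a"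
      "\<And>c. c \<in> k \<Longrightarrow> h (base_change_const R id (subr A) (subr k) c) = c"
    and p: "strict_mono p" "\<And>\<nu>. Factorial_Ring.prime (p \<nu>)"
    and \<phi>: "\<And>\<nu>. \<phi> \<nu> \<in> Ring.ring_hom (subr R) (Fpbar (p \<nu>))"
    and C: "\<And>\<nu>. cring (C \<nu>)"
    and \<iota>: "\<And>\<nu>. \<iota> \<nu> \<in> Ring.ring_hom (subr A) (C \<nu>)"
    and \<sigma>: "\<And>\<nu>. \<sigma> \<nu> \<in> Ring.ring_hom (Fpbar (p \<nu>)) (C \<nu>)"
    and agree: "\<And>\<nu> r. r \<in> R \<Longrightarrow> \<iota> \<nu> r = \<sigma> \<nu> (\<phi> \<nu> r)"
    and D: "\<And>\<nu>. D \<nu> \<in> derivations (\<sigma> \<nu> ` carrier (Fpbar (p \<nu>))) (C \<nu>)"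
  obtains f :: "nat \<Rightarrow> 'a \<Rightarrow> 'b ring_product" where
    "limit_hom T f (\<lambda>\<nu>. emb (C \<nu>) \<one>\<^bsub>C \<nu>\<^esub>)"
    "derivation_pair T k (\<lambda>x. abs_reduced (\<lambda>\<nu>. f \<nu> x))
       (\<lambda>x. abs_reduced (\<lambda>\<nu>. emb_derivation (C \<nu>) (D \<nu>) (f \<nu> x)))"
    "\<And>a. a \<in> A \<Longrightarrow> \<forall>\<^sub>F \<nu> in sequentially. f \<nu> a = emb (C \<nu>) (\<iota> \<nu> a)"
proof -
  define F where "F \<nu> = Fpbar (p \<nu>)" for \<nu>
  define FF where "FF \<nu> = emb (F \<nu>) ` carrier (F \<nu>)" for \<nu>
  define eF where "eF \<nu> = emb (F \<nu>) \<one>\<^bsub>F \<nu>\<^esub>" for \<nu>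
  define e where "e \<nu> = emb (C \<nu>) \<one>\<^bsub>C \<nu>\<^esub>" for \<nu>
  note cF = cring_Fpbar[OF p(2), folded F_def]
  have cf: "closed_field_in_ring (FF \<nu>) (eF \<nu>)" for \<nu>
    unfolding FF_def eF_def F_def by (rule closed_field_Fpbar[OF p(2)])
  have ch: "of_nat (p \<nu>) * eF \<nu> = 0" for \<nu>
    unfolding eF_def F_def by (rule Fpbar_char[OF p(2)])
  note RD = subring_setD[OF R(1)] and kD = subring_setD[OF k(1)]
  have one: "\<phi> \<nu> 1 = \<one>\<^bsub>F \<nu>\<^esub>" for \<nu> using ring_hom_one[OF \<phi>] by (simp add: F_def)
  have closed: "\<phi> \<nu> r \<in> carrier (F \<nu>)" if "r \<in> R" for \<nu> r
    using ring_hom_closed[OF \<phi>, of r] that by (simp add: F_def)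
  have add: "\<phi> \<nu> (r + r') = \<phi> \<nu> r \<oplus>\<^bsub>F \<nu>\<^esub> \<phi> \<nu> r'" if "r \<in> R" "r' \<in> R" for \<nu> r r'
    using ring_hom_add[OF \<phi>, of r r'] that by (simp add: F_def)
  have mult: "\<phi> \<nu> (r * r') = \<phi> \<nu> r \<otimes>\<^bsub>F \<nu>\<^esub> \<phi> \<nu> r'" if "r \<in> R" "r' \<in> R" for \<nu> r r'
    using ring_hom_mult[OF \<phi>, of r r'] that by (simp add: F_def)
  define G0 where "G0 \<nu> = {(r, emb (F \<nu>) (\<phi> \<nu> r)) | r. r \<in> R}" for \<nu>
  have zero: "emb (F \<nu>) (\<phi> \<nu> 0) = 0" for \<nu>
    using arg_cong[OF add[OF RD(6) RD(6)], of "emb (F \<nu>)" \<nu>] by (simp add: emb_add[OF cF] closed RD)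
  have uminus: "emb (F \<nu>) (\<phi> \<nu> (- r)) = - emb (F \<nu>) (\<phi> \<nu> r)" if r: "r \<in> R" for \<nu> r
    using arg_cong[OF add[OF r RD(4)[OF r]], of "emb (F \<nu>)" \<nu>]
    by (simp add: emb_add[OF cF] closed RD r zero eq_neg_iff_add_eq_0 add.commute)
  have G0: "closed_field_in_ring.partial_hom (FF \<nu>) (eF \<nu>) (G0 \<nu>)" for \<nu>
    unfolding closed_field_in_ring.partial_hom_def[OF cf] unfolding G0_def FF_def eF_def
    using closed RD by (auto simp: zero uminus emb_add[OF cF, symmetric] emb_mult[OF cF, symmetric] add mult one
        intro!: exI[of _ 1] zero)
  have "\<exists>G. G0 \<nu> \<subseteq> G \<and> closed_field_in_ring.partial_hom (FF \<nu>) (eF \<nu>) G \<and>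
      (\<forall>x. (\<exists>y. (x, y) \<in> G) \<or> (x \<noteq> 0 \<and> (inverse x, 0) \<in> G))" for \<nu>
    by (rule closed_field_in_ring.extension_to_valuation_ring[OF cf G0]) blast
  then obtain G where G: "\<And>\<nu>. G0 \<nu> \<subseteq> G \<nu>" "\<And>\<nu>. closed_field_in_ring.partial_hom (FF \<nu>) (eF \<nu>) (G \<nu>)"
      "\<And>\<nu> x. (\<exists>y. (x, y) \<in> G \<nu>) \<or> (x \<noteq> 0 \<and> (inverse x, 0) \<in> G \<nu>)" by metis
  note GD = closed_field_in_ring.hom_add[OF cf G(2)] closed_field_in_ring.hom_mult[OF cf G(2)]
    and uniq = closed_field_in_ring.hom_unique[OF cf G(2)]
    and one_G = closed_field_in_ring.hom_one[OF cf G(2)]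
  define val where "val \<nu> x = (SOME y. (x, y) \<in> G \<nu>)" for \<nu> x
  have val_eq: "val \<nu> x = y" if "(x, y) \<in> G \<nu>" for \<nu> x y
    using someI[of "\<lambda>y. (x, y) \<in> G \<nu>", OF that] uniq that by (auto simp: val_def)
  have val: "\<forall>\<^sub>F \<nu> in sequentially. (x, val \<nu> x) \<in> G \<nu>" if "x \<in> k" for x
    using eventually_val[OF p cf ch G(2,3) k(2)[OF that]] by (rule eventually_mono) (auto simp: val_eq)
  define \<tau> where "\<tau> \<nu> y = emb (C \<nu>) (\<sigma> \<nu> (proj (F \<nu>) y))" for \<nu> y
  note \<sigma>' = \<sigma>[folded F_def] and pF = proj_closed[OF cF]
  note \<sigma>c = ring_hom_closed[OF \<sigma>' pF]
  have \<tau>_add: "\<tau> \<nu> (x + y) = \<tau> \<nu> x + \<tau> \<nu> y" for \<nu> x y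
    by (simp add: \<tau>_def proj_add[OF cF] ring_hom_add[OF \<sigma>'] pF emb_add[OF C] \<sigma>c)
  have \<tau>_mult: "\<tau> \<nu> (x * y) = \<tau> \<nu> x * \<tau> \<nu> y" for \<nu> x y
    by (simp add: \<tau>_def proj_mult[OF cF] ring_hom_mult[OF \<sigma>'] pF emb_mult[OF C] \<sigma>c)
  have \<tau>_emb: "\<tau> \<nu> (emb (F \<nu>) c) = emb (C \<nu>) (\<sigma> \<nu> c)" if "c \<in> carrier (F \<nu>)" for \<nu> c
    by (simp add: \<tau>_def proj_emb[OF cF that])
  define \<kappa> where "\<kappa> c = abs_reduced (\<lambda>\<nu>. \<tau> \<nu> (val \<nu> c))" for c
  define \<iota>' where "\<iota>' a = abs_reduced (\<lambda>\<nu>. emb (C \<nu>) (\<iota> \<nu> a))" for a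
  have \<kappa>_add: "\<kappa> (x + y) = \<kappa> x + \<kappa> y" if xy: "x \<in> k" "y \<in> k" for x y
    unfolding \<kappa>_def plus_reduced.abs_eq abs_reduced_eq_iff
    using val[OF xy(1)] val[OF xy(2)] by eventually_elim (simp add: val_eq[OF GD(1)] \<tau>_add)
  have \<kappa>_mult: "\<kappa> (x * y) = \<kappa> x * \<kappa> y" if xy: "x \<in> k" "y \<in> k" for x y
    unfolding \<kappa>_def times_reduced.abs_eq abs_reduced_eq_iff
    using val[OF xy(1)] val[OF xy(2)] by eventually_elim (simp add: val_eq[OF GD(2)] \<tau>_mult)
  have \<iota>c: "\<iota> \<nu> a \<in> carrier (C \<nu>)" if "a \<in> A" for \<nu> a
    using ring_hom_closed[OF \<iota>, of a] that by simp
  have \<iota>_add: "\<iota>' (x + y) = \<iota>' x + \<iota>' y" if xy: "x \<in> A" "y \<in> A" for x y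
    using ring_hom_add[OF \<iota>, of x y] xy
    by (simp add: \<iota>'_def plus_reduced.abs_eq emb_add[OF C] \<iota>c)
  have \<iota>_mult: "\<iota>' (x * y) = \<iota>' x * \<iota>' y" if xy: "x \<in> A" "y \<in> A" for x y
    using ring_hom_mult[OF \<iota>, of x y] xy
    by (simp add: \<iota>'_def times_reduced.abs_eq emb_mult[OF C] \<iota>c)
  have val_R: "val \<nu> r = emb (F \<nu>) (\<phi> \<nu> r)" if "r \<in> R" for \<nu> r
    by (rule val_eq) (use G(1)[of \<nu>] that in \<open>auto simp: G0_def\<close>)
  have agree': "\<iota>' r = \<kappa> r" if "r \<in> R" for r
    using that by (simp add: \<iota>'_def \<kappa>_def val_R \<tau>_emb closed agree)
  obtain \<Psi> where \<Psi>: "\<And>x y. x \<in> T \<Longrightarrow> y \<in> T \<Longrightarrow> \<Psi> (x + y) = \<Psi> x + \<Psi> y"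
      "\<And>x y. x \<in> T \<Longrightarrow> y \<in> T \<Longrightarrow> \<Psi> (x * y) = \<Psi> x * \<Psi> y"
      "\<And>a. a \<in> A \<Longrightarrow> \<Psi> a = \<iota>' a" "\<And>c. c \<in> k \<Longrightarrow> \<Psi> c = \<kappa> c"
    by (rule base_change_universal[OF k(1) A R(2,3) RD(1) T(1) h \<iota>_add \<iota>_mult \<kappa>_add \<kappa>_mult agree']) auto
  \<comment> \<open>an arbitrary representative is projected to the factor \<open>C \<nu>\<close> by its unit\<close>
  define f where "f \<nu> x = e \<nu> * rep_reduced (\<Psi> x) \<nu>" for \<nu> x
  have e_emb: "e \<nu> * emb (C \<nu>) c = emb (C \<nu>) c" if "c \<in> carrier (C \<nu>)" for \<nu> c
    unfolding e_def by (rule emb_one_mult[OF C that])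
  have ee: "e \<nu> * e \<nu> = e \<nu>" for \<nu>
    unfolding e_def by (rule emb_one_mult[OF C]) (simp add: C cring.cring_simprules)
  have eex: "e \<nu> * (e \<nu> * x) = e \<nu> * x" for \<nu> x by (simp add: mult.assoc[symmetric] ee)
  have f_A: "\<forall>\<^sub>F \<nu> in sequentially. f \<nu> a = emb (C \<nu>) (\<iota> \<nu> a)" if a: "a \<in> A" for a
    using abs_reduced_rep[OF \<Psi>(3)[OF a, unfolded \<iota>'_def]]
    by eventually_elim (simp add: f_def e_emb \<iota>c a)
  have f_k: "\<forall>\<^sub>F \<nu> in sequentially. f \<nu> c = \<tau> \<nu> (val \<nu> c)" if c: "c \<in> k" for c
    using abs_reduced_rep[OF \<Psi>(4)[OF c, unfolded \<kappa>_def]]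
    by eventually_elim (simp add: f_def \<tau>_def e_emb \<sigma>c)
  have lim: "limit_hom T f e"
  proof
    show "subring_set T" by (rule T)
    show "\<forall>\<^sub>F \<nu> in sequentially. f \<nu> (x + y) = f \<nu> x + f \<nu> y" if "x \<in> T" "y \<in> T" for x y
      using abs_reduced_rep_add[OF \<Psi>(1)[OF that]] by eventually_elim (simp add: f_def distrib_left)
    show "\<forall>\<^sub>F \<nu> in sequentially. f \<nu> (x * y) = f \<nu> x * f \<nu> y" if "x \<in> T" "y \<in> T" for x y
      using abs_reduced_rep_mult[OF \<Psi>(2)[OF that]]
      by eventually_elim (simp add: f_def eex mult.assoc mult.left_commute[of "rep_reduced _ _" "e _"])
    show "\<forall>\<^sub>F \<nu> in sequentially. f \<nu> 1 = e \<nu>"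
      using f_A[OF subring_setD(1)[OF A]] ring_hom_one[OF \<iota>] by (simp add: e_def)
    show "e \<nu> * f \<nu> x = f \<nu> x" for \<nu> x by (simp add: f_def eex)
  qed
  have der: "derivation (emb_derivation (C \<nu>) (D \<nu>))" for \<nu> by (rule derivation_emb[OF C D])
  note dD = derivation.add[OF der] derivation.mult[OF der] derivation.zero[OF der]
  have pair: "derivation_pair T k (\<lambda>x. abs_reduced (\<lambda>\<nu>. f \<nu> x))
       (\<lambda>x. abs_reduced (\<lambda>\<nu>. emb_derivation (C \<nu>) (D \<nu>) (f \<nu> x)))"
  proof
    show "subring_set T" "k \<subseteq> T" by (rule T)+
    fix x y assume xy: "x \<in> T" "y \<in> T"
    note add = limit_hom.f_add[OF lim xy] and mult = limit_hom.f_mult[OF lim xy]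
    show "abs_reduced (\<lambda>\<nu>. f \<nu> (x + y)) = abs_reduced (\<lambda>\<nu>. f \<nu> x) + abs_reduced (\<lambda>\<nu>. f \<nu> y)"
      unfolding plus_reduced.abs_eq abs_reduced_eq_iff by (rule add)
    show "abs_reduced (\<lambda>\<nu>. f \<nu> (x * y)) = abs_reduced (\<lambda>\<nu>. f \<nu> x) * abs_reduced (\<lambda>\<nu>. f \<nu> y)"
      unfolding times_reduced.abs_eq abs_reduced_eq_iff by (rule mult)
    show "abs_reduced (\<lambda>\<nu>. emb_derivation (C \<nu>) (D \<nu>) (f \<nu> (x + y))) =
        abs_reduced (\<lambda>\<nu>. emb_derivation (C \<nu>) (D \<nu>) (f \<nu> x)) + abs_reduced (\<lambda>\<nu>. emb_derivation (C \<nu>) (D \<nu>) (f \<nu> y))"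
      unfolding plus_reduced.abs_eq abs_reduced_eq_iff
      using add by eventually_elim (simp add: dD)
    show "abs_reduced (\<lambda>\<nu>. emb_derivation (C \<nu>) (D \<nu>) (f \<nu> (x * y))) =
        abs_reduced (\<lambda>\<nu>. f \<nu> x) * abs_reduced (\<lambda>\<nu>. emb_derivation (C \<nu>) (D \<nu>) (f \<nu> y)) +
        abs_reduced (\<lambda>\<nu>. f \<nu> y) * abs_reduced (\<lambda>\<nu>. emb_derivation (C \<nu>) (D \<nu>) (f \<nu> x))"
      unfolding plus_reduced.abs_eq times_reduced.abs_eq abs_reduced_eq_iff
      using mult by eventually_elim (simp add: dD)
  next
    fix c assume c: "c \<in> k"
    have "emb_derivation (C \<nu>) (D \<nu>) (\<tau> \<nu> u) = 0" for \<nu> u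
      using derivationsD(4)[OF D[folded F_def] imageI[OF pF], of \<nu> u]
      by (simp add: \<tau>_def emb_derivation_def proj_emb[OF C \<sigma>c] emb_zero[OF C] F_def[symmetric])
    then have "abs_reduced (\<lambda>\<nu>. emb_derivation (C \<nu>) (D \<nu>) (f \<nu> c)) = abs_reduced (\<lambda>_. 0)"
      unfolding abs_reduced_eq_iff using f_k[OF c] by (auto elim!: eventually_mono)
    then show "abs_reduced (\<lambda>\<nu>. emb_derivation (C \<nu>) (D \<nu>) (f \<nu> c)) = 0"
      by (simp only: abs_reduced_zero)
  next
    fix x assume "x \<in> T"
    show "abs_reduced (\<lambda>\<nu>. f \<nu> 1) * abs_reduced (\<lambda>\<nu>. emb_derivation (C \<nu>) (D \<nu>) (f \<nu> x)) =
        abs_reduced (\<lambda>\<nu>. emb_derivation (C \<nu>) (D \<nu>) (f \<nu> x))"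
      unfolding times_reduced.abs_eq abs_reduced_eq_iff
      using limit_hom.f_one[OF lim] by eventually_elim (simp add: e_def one_emb_derivation[OF C D])
  qed
  show thesis
    by (rule that[OF lim[unfolded e_def[abs_def]] pair f_A])
qed

section \<open>Nilpotence at almost all members of a sequence of reductions\<close>

lemma char_of_algebra:
  assumes p: "Factorial_Ring.prime p" and C: "cring C" and \<sigma>: "\<sigma> \<in> Ring.ring_hom (Fpbar p) C"
  shows "of_nat p * emb C \<one>\<^bsub>C\<^esub> = 0"
proof -
  interpret F: cring "Fpbar p" by (rule cring_Fpbar[OF p])
  interpret C: cring C by (rule C)
  have "emb (Fpbar p) ([p] \<cdot>\<^bsub>Fpbar p\<^esub> \<one>\<^bsub>Fpbar p\<^esub>) = emb (Fpbar p) \<zero>\<^bsub>Fpbar p\<^esub>"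
    unfolding emb_ring_of_nat[OF F.is_cring] emb_zero[OF F.is_cring] by (rule Fpbar_char[OF p])
  then have z: "[p] \<cdot>\<^bsub>Fpbar p\<^esub> \<one>\<^bsub>Fpbar p\<^esub> = \<zero>\<^bsub>Fpbar p\<^esub>"
    by (subst (asm) emb_inject[OF F.is_cring]) auto
  have "\<sigma> ([l] \<cdot>\<^bsub>Fpbar p\<^esub> \<one>\<^bsub>Fpbar p\<^esub>) = [l] \<cdot>\<^bsub>C\<^esub> \<one>\<^bsub>C\<^esub>" for l :: nat
    by (induction l) (simp_all add: ring_hom_zero[OF \<sigma> F.ring_axioms C.ring_axioms] ring_hom_add[OF \<sigma>] ring_hom_one[OF \<sigma>])
  from this[of p] have "[p] \<cdot>\<^bsub>C\<^esub> \<one>\<^bsub>C\<^esub> = \<zero>\<^bsub>C\<^esub>"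
    by (simp add: z ring_hom_zero[OF \<sigma> F.ring_axioms C.ring_axioms])
  then show ?thesis
    using emb_ring_of_nat[OF C, of p] by (simp add: emb_zero[OF C])
qed

lemma abs_reduced_form:
  "abs_reduced (\<lambda>\<nu>. \<Sum>(x, y)\<leftarrow>w. g \<nu> x * h \<nu> y) =
     (\<Sum>(x, y)\<leftarrow>w. abs_reduced (\<lambda>\<nu>. g \<nu> x) * abs_reduced (\<lambda>\<nu>. h \<nu> y))"
proof (induction w)
  case (Cons xy w)
  then show ?case
    by (cases xy) (simp add: plus_reduced.abs_eq[symmetric] times_reduced.abs_eq[symmetric])
qed (simp add: abs_reduced_zero)

lemma (in derivation_pair) \<Psi>_uminus: "x \<in> A \<Longrightarrow> \<Psi> (- x) = - \<Psi> x"
  using \<Psi>_add[of x "- x"] AD(4)[of x] by (simp add: eq_neg_iff_add_eq_0 add.commute)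

lemma polys_lookup_in: "subring_set T \<Longrightarrow> P \<in> polys n T \<Longrightarrow> Poly_Mapping.lookup P m \<in> T"
  using polysD(1)[of P n T m] subring_setD(6)[of T] by (cases "m \<in> Poly_Mapping.keys P") (auto simp: in_keys_iff)

lemma kformsD: "v \<in> kforms C \<Longrightarrow> (x, y) \<in> set v \<Longrightarrow> x \<in> carrier C \<and> y \<in> carrier C"
  unfolding kforms_def in_lists_conv_set by blast

lemma kforms_map:
  assumes "h \<in> Ring.ring_hom R C"
  shows "v \<in> kforms R \<Longrightarrow> map (map_prod h h) v \<in> kforms C"
  by (induction v) (auto simp: kforms_def ring_hom_closed[OF assms])

text \<open>
  All data of the pencil are carried over by the maps \<open>f \<nu>\<close>: the relations that
  express periodicity, the equality between the given form and the pencil, and the congruence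
  between the parameters and natural numbers. For almost all \<open>\<nu>\<close> they hold
  simultaneously.
\<close>

theorem eventually_nilpotent:
  fixes k A R T :: "'a::field_char_0 set" and C :: "nat \<Rightarrow> 'b ring"
    and \<phi> :: "nat \<Rightarrow> 'a \<Rightarrow> (int list \<times> nat) multiset \<Rightarrow> int"
    and \<iota> :: "nat \<Rightarrow> 'a \<Rightarrow> 'b"
  assumes k: "subring_set k" "\<And>x. x \<in> k \<Longrightarrow> algebraic x" "\<And>x. x \<in> k \<Longrightarrow> inverse x \<in> k"
    and A: "subring_set A" "A \<subseteq> T" and R: "subring_set R" "R \<subseteq> A" "R \<subseteq> k"
    and T: "subring_set T" "k \<subseteq> T"
    and h: "h \<in> ring_iso (base_change R id (subr A) (subr k)) (subr T)"
      "\<And>a. a \<in> A \<Longrightarrow> h (base_change_in R id (subr A) (subr k) a) = a"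
      "\<And>c. c \<in> k \<Longrightarrow> h (base_change_const R id (subr A) (subr k) c) = c"
    and Y: "spec T \<subseteq> Y" "\<And>L. L \<in> Y \<Longrightarrow> subring_set L" "\<And>L. L \<in> Y \<Longrightarrow> k \<subseteq> L"
      "\<And>L. L \<in> Y \<Longrightarrow> {a / b | a b. a \<in> L \<and> b \<in> L \<and> b \<noteq> 0} = UNIV" "smooth k Y"
    and B: "periodic_pencil k Y n N B"
    and w: "\<And>a b. a < N \<Longrightarrow> b < N \<Longrightarrow> w a b \<in> kforms (subr A)"
      "\<And>a b. a < N \<Longrightarrow> b < N \<Longrightarrow>
         kaehler_eq ring_of_type_algebra k (w a b) (pencil ring_of_type_algebra n B (\<lambda>j. of_rat (s j)) a b)"
    and p: "strict_mono p" "\<And>\<nu>. Factorial_Ring.prime (p \<nu>)"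
    and \<phi>: "\<And>\<nu>. \<phi> \<nu> \<in> Ring.ring_hom (subr R) (Fpbar (p \<nu>))"
    and C: "\<And>\<nu>. cring (C \<nu>)"
    and \<iota>: "\<And>\<nu>. \<iota> \<nu> \<in> Ring.ring_hom (subr A) (C \<nu>)"
    and \<sigma>: "\<And>\<nu>. \<sigma> \<nu> \<in> Ring.ring_hom (Fpbar (p \<nu>)) (C \<nu>)"
    and agree: "\<And>\<nu> r. r \<in> R \<Longrightarrow> \<iota> \<nu> r = \<sigma> \<nu> (\<phi> \<nu> r)"
    and D: "\<And>\<nu>. D \<nu> \<in> derivations (\<sigma> \<nu> ` carrier (Fpbar (p \<nu>))) (C \<nu>)"
    and D_p: "\<And>\<nu> x. x \<in> carrier (C \<nu>) \<Longrightarrow> (D \<nu> ^^ p \<nu>) x = \<zero>\<^bsub>C \<nu>\<^esub>"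
  shows "\<forall>\<^sub>F \<nu> in sequentially. \<exists>l. \<forall>v\<in>vecs (C \<nu>) N.
     ((cov_deriv (C \<nu>) N (\<lambda>a b. map (map_prod (\<iota> \<nu>) (\<iota> \<nu>)) (w a b)) (D \<nu>) ^^ p \<nu>) ^^ l) v
       = (\<lambda>a\<in>{..<N}. \<zero>\<^bsub>C \<nu>\<^esub>)"
proof -
  obtain f :: "nat \<Rightarrow> 'a \<Rightarrow> 'b ring_product" where lim: "limit_hom T f (\<lambda>\<nu>. emb (C \<nu>) \<one>\<^bsub>C \<nu>\<^esub>)"
    and pair: "derivation_pair T k (\<lambda>x. abs_reduced (\<lambda>\<nu>. f \<nu> x))
       (\<lambda>x. abs_reduced (\<lambda>\<nu>. emb_derivation (C \<nu>) (D \<nu>) (f \<nu> x)))"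
    and f_A: "\<And>a. a \<in> A \<Longrightarrow> \<forall>\<^sub>F \<nu> in sequentially. f \<nu> a = emb (C \<nu>) (\<iota> \<nu> a)"
  proof (rule limit_of_reductions[OF k(1,2) A(1) R T h p \<phi> C \<iota> \<sigma> agree D])
    fix f
    assume *: "limit_hom T f (\<lambda>\<nu>. emb (C \<nu>) \<one>\<^bsub>C \<nu>\<^esub>)"
      "derivation_pair T k (\<lambda>x. abs_reduced (\<lambda>\<nu>. f \<nu> x))
       (\<lambda>x. abs_reduced (\<lambda>\<nu>. emb_derivation (C \<nu>) (D \<nu>) (f \<nu> x)))"
      "\<And>a. a \<in> A \<Longrightarrow> \<forall>\<^sub>F \<nu> in sequentially. f \<nu> a = emb (C \<nu>) (\<iota> \<nu> a)"
    show thesis by (rule that[OF *])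
  qed
  define e where "e \<nu> = emb (C \<nu>) \<one>\<^bsub>C \<nu>\<^esub>" for \<nu>
  define E where "E \<nu> = emb_derivation (C \<nu>) (D \<nu>)" for \<nu>
  note TD = subring_setD[OF T(1)] and kD = subring_setD[OF k(1)]
  interpret L: limit_hom T f e using lim by (simp add: e_def[abs_def])
  interpret P: derivation_pair T k "\<lambda>x. abs_reduced (\<lambda>\<nu>. f \<nu> x)" "\<lambda>x. abs_reduced (\<lambda>\<nu>. E \<nu> (f \<nu> x))"
    using pair by (simp add: E_def)
  have E: "derivation (E \<nu>)" for \<nu> unfolding E_def by (rule derivation_emb[OF C D])
  have killed: "P.pair_form v = 0" if "v \<in> kforms (subr T)"
     "\<And>E. E \<in> derivations k ring_of_type_algebra \<Longrightarrow> (\<Sum>(a, b)\<leftarrow>v. a * E b) = 0" for v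
  proof (rule P.pair_form_zero_if_killed[OF k(1) _ _ that])
    fix L assume "L \<in> spec T"
    then have "L \<in> Y" using Y(1) by blast
    then show "\<exists>d x. coordinates (subr L) k d x" "{a / b | a b. a \<in> L \<and> b \<in> L \<and> b \<noteq> 0} = UNIV"
      using Y(5) Y(4)[of L] by (auto simp: smooth_def)
  qed
  have RT: "regular_functions Y \<subseteq> T"
  proof
    fix x assume "x \<in> regular_functions Y"
    then show "x \<in> T" using Y(1) by (intro regular_in_ring[OF T(1)]) (auto simp: regular_functions_def)
  qed
  have RS: "subring_set (regular_functions Y)"
    using Y(2) subring_setD(1,2,3,4) unfolding subring_set_def[of "regular_functions Y"] unfolding regular_functions_def by blast
  have kR: "k \<subseteq> regular_functions Y" using Y(3) by (auto simp: regular_functions_def)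
  have "\<exists>B'. \<forall>i<n. \<forall>c<N. \<forall>d<N. B' i c d \<in> kforms (subr T) \<and> same_contractions k (B' i c d) (B i c d)"
  proof -
    have "\<exists>w'. w' \<in> kforms (subr T) \<and> same_contractions k w' (B i c d)" if "i < n" "c < N" "d < N" for i c d
    proof -
      have "regular_form k Y (B i c d)" using B that by (auto simp: periodic_pencil_def flat_pencil_def)
      then have "\<exists>w'\<in>kforms (subr L). kaehler_eq ring_of_type_algebra k w' (B i c d)" if "L \<in> spec T" for L
        using Y(1) that by (auto simp: regular_form_def)
      then show ?thesis by (rule regular_form_in_ring[OF T(1)]) blast+
    qed
    then show ?thesis by metis
  qed
  then obtain B' where B': "\<And>i c d. i < n \<Longrightarrow> c < N \<Longrightarrow> d < N \<Longrightarrow> B' i c d \<in> kforms (subr T)"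
      "\<And>i c d. i < n \<Longrightarrow> c < N \<Longrightarrow> d < N \<Longrightarrow> same_contractions k (B' i c d) (B i c d)"
    by blast
  have B'_contr: "(\<Sum>(f, g)\<leftarrow>B' i c d. f * E g) = (\<Sum>(f, g)\<leftarrow>B i c d. f * E g)"
    if "E \<in> derivations k ring_of_type_algebra" "i < n" "c < N" "d < N" for E i c d
    using B'(2)[OF that(2-4)] that(1) by (auto simp: same_contractions_def)
  define b where "b \<nu> i c d = (\<Sum>(x, y)\<leftarrow>B' i c d. f \<nu> x * E \<nu> (f \<nu> y))" for \<nu> i c d
  have b_form: "abs_reduced (\<lambda>\<nu>. b \<nu> i c d) = P.pair_form (B' i c d)" for i c d
    unfolding b_def P.pair_form_def by (rule abs_reduced_form)
  have e_b: "e \<nu> * b \<nu> i c d = b \<nu> i c d" for \<nu> i c d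
  proof -
    have "e \<nu> * (\<Sum>(x, y)\<leftarrow>w. f \<nu> x * E \<nu> (f \<nu> y)) = (\<Sum>(x, y)\<leftarrow>w. f \<nu> x * E \<nu> (f \<nu> y))" for w
      by (induction w) (auto simp: distrib_left mult.assoc[symmetric] L.e_f)
    then show ?thesis by (simp add: b_def)
  qed
  have shifts: "\<exists>z. \<forall>\<^sub>F \<nu> in sequentially. \<forall>m. derivation.shifts_along_line (E \<nu>) n N (b \<nu>) (e \<nu>) j z m" if j: "j < n" for j
  proof -
    obtain P P' Q where P: "\<And>a b. a < N \<Longrightarrow> b < N \<Longrightarrow> P a b \<in> polys n (regular_functions Y)"
      and P': "\<And>a b. a < N \<Longrightarrow> b < N \<Longrightarrow> P' a b \<in> polys n (regular_functions Y)"
      and Q: "Q \<in> polys n k" "Q \<noteq> 0"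
      and PP: "\<And>a b. a < N \<Longrightarrow> b < N \<Longrightarrow> (\<Sum>c<N. P a c * P' c b) = (if a = b then Q else 0)"
      and DP: "\<And>D a b m. D \<in> derivations k ring_of_type_algebra \<Longrightarrow> a < N \<Longrightarrow> b < N \<Longrightarrow>
       D (Poly_Mapping.lookup (P a b) m) =
         (\<Sum>c<N. \<Sum>i<n. (\<Sum>(f, g)\<leftarrow>B i a c. f * D g) *
            Poly_Mapping.lookup ((variable i + (if i = j then 1 else 0)) * P c b) m)
       - (\<Sum>c<N. \<Sum>i<n. (\<Sum>(f, g)\<leftarrow>B i c b. f * D g) * Poly_Mapping.lookup (variable i * P a c) m)"
      by (rule periodic_pencil_polynomials[OF k(1) RS kR B j]) blast
    note mono = polys_mono[OF RT, of n]
    have PT: "P c d \<in> polys n T" "P' c d \<in> polys n T" if "c < N" "d < N" for c d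
      using P[OF that] P'[OF that] mono by blast+
    have var: "variable i \<in> polys n T" if "i < n" for i
      unfolding variable_def by (rule polys_var[OF that T(1)])
    note pT = subring_setD[OF subring_set_polys[OF T(1), of n]]
    obtain z where z: "(\<Sum>m\<in>Poly_Mapping.keys Q. Poly_Mapping.lookup Q m * of_nat (monomial_value z m)) \<noteq> 0"
      using exists_nonzero_value[OF Q] by blast
    have ev: "\<forall>\<^sub>F \<nu> in sequentially. E \<nu> (f \<nu> (Poly_Mapping.lookup (P c d) m)) =
         (\<Sum>a<N. \<Sum>i<n. b \<nu> i c a * f \<nu> (Poly_Mapping.lookup ((variable i + (if i = j then 1 else 0)) * P a d) m))
       - (\<Sum>a<N. \<Sum>i<n. b \<nu> i a d * f \<nu> (Poly_Mapping.lookup (variable i * P c a) m))"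
      if cd: "c < N" "d < N" for c d m
    proof -
      define u where "u = Poly_Mapping.lookup (P c d) m"
      define r1 where "r1 = (\<lambda>(a, i). - Poly_Mapping.lookup ((variable i + (if i = j then 1 else 0)) * P a d) m)"
      define r2 where "r2 = (\<lambda>(a, i). Poly_Mapping.lookup (variable i * P c a) m)"
      let ?I = "{..<N} \<times> {..<n}"
      have u: "u \<in> T" unfolding u_def by (rule polys_lookup_in[OF T(1) PT(1)[OF cd]])
      have var': "variable i + (if i = j then 1 else 0) \<in> polys n T" if "i < n" for i
        using var[OF that] pT by simp
      have r1T: "- r1 (a, i) \<in> T" if "a < N" "i < n" for a i
        unfolding r1_def using polys_lookup_in[OF T(1) pT(3)[OF var'[OF that(2)] PT(1)[OF that(1) cd(2)]]] by simp
      then have r1: "r1 x \<in> T" if "x \<in> ?I" for x using that TD(4)[of "- r1 x"] by auto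
      have r2: "r2 x \<in> T" if "x \<in> ?I" for x
        using that polys_lookup_in[OF T(1) pT(3)[OF var PT(1)[OF cd(1)]]] by (auto simp: r2_def)
      have fin: "finite ?I" by simp
      have Bc: "B' (snd x) c (fst x) \<in> kforms (subr T)" and Bd: "B' (snd x) (fst x) d \<in> kforms (subr T)"
        if "x \<in> ?I" for x
        using that B'(1) cd by auto
      obtain v1 where v1: "v1 \<in> kforms (subr T)"
        "P.pair_form v1 = (\<Sum>x\<in>?I. abs_reduced (\<lambda>\<nu>. f \<nu> (r1 x)) * P.pair_form (B' (snd x) c (fst x)))"
        "\<And>E. (\<Sum>(a, b)\<leftarrow>v1. a * E b) = (\<Sum>x\<in>?I. r1 x * (\<Sum>(a, b)\<leftarrow>B' (snd x) c (fst x). a * E b))"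
        using P.linear_combination[of ?I r1 "\<lambda>x. B' (snd x) c (fst x)", OF fin r1 Bc] by blast
      obtain v2 where v2: "v2 \<in> kforms (subr T)"
        "P.pair_form v2 = (\<Sum>x\<in>?I. abs_reduced (\<lambda>\<nu>. f \<nu> (r2 x)) * P.pair_form (B' (snd x) (fst x) d))"
        "\<And>E. (\<Sum>(a, b)\<leftarrow>v2. a * E b) = (\<Sum>x\<in>?I. r2 x * (\<Sum>(a, b)\<leftarrow>B' (snd x) (fst x) d. a * E b))"
        using P.linear_combination[of ?I r2 "\<lambda>x. B' (snd x) (fst x) d", OF fin r2 Bd] by blast
      \<comment> \<open>the form \<open>du\<close> plus the two sums of the periodicity relation, moved to one side\<close>
      have "P.pair_form ((1, u) # v1 @ v2) = 0"
      proof (rule killed)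
        show "(1, u) # v1 @ v2 \<in> kforms (subr T)"
          using v1(1) v2(1) u TD(1) by (auto simp: kforms_def)
        fix D assume D: "D \<in> derivations k ring_of_type_algebra"
        have "(\<Sum>(a, b)\<leftarrow>v1. a * D b) = - (\<Sum>a<N. \<Sum>i<n. (\<Sum>(f, g)\<leftarrow>B i c a. f * D g) *
            Poly_Mapping.lookup ((variable i + (if i = j then 1 else 0)) * P a d) m)"
          unfolding v1(3) sum_negf[symmetric] sum.cartesian_product
          by (rule sum.cong) (auto simp: r1_def B'_contr[OF D] cd)
        moreover have "(\<Sum>(a, b)\<leftarrow>v2. a * D b) = (\<Sum>a<N. \<Sum>i<n. (\<Sum>(f, g)\<leftarrow>B i a d. f * D g) *
            Poly_Mapping.lookup (variable i * P c a) m)"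
          unfolding v2(3) sum.cartesian_product
          by (rule sum.cong) (auto simp: r2_def B'_contr[OF D] cd)
        ultimately show "(\<Sum>(a, b)\<leftarrow>(1, u) # v1 @ v2. a * D b) = 0"
          using DP[OF D cd, of m] by (simp add: u_def)
      qed
      then have eq: "abs_reduced (\<lambda>\<nu>. E \<nu> (f \<nu> u)) = - P.pair_form v1 - P.pair_form v2"
        using P.unit_d[OF u] by (simp add: eq_diff_eq eq_neg_iff_add_eq_0 add.assoc add.commute add.left_commute)
      have pf1: "- P.pair_form v1 = abs_reduced (\<lambda>\<nu>. \<Sum>a<N. \<Sum>i<n. b \<nu> i c a *
          f \<nu> (Poly_Mapping.lookup ((variable i + (if i = j then 1 else 0)) * P a d) m))"
        unfolding v1(2) sum_negf[symmetric] abs_reduced_sum sum.cartesian_product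
        using P.\<Psi>_uminus[OF r1T] by (intro sum.cong) (auto simp: times_reduced.abs_eq[symmetric] b_form r1_def mult.commute)
      have pf2: "P.pair_form v2 = abs_reduced (\<lambda>\<nu>. \<Sum>a<N. \<Sum>i<n. b \<nu> i a d *
          f \<nu> (Poly_Mapping.lookup (variable i * P c a) m))"
        unfolding v2(2) abs_reduced_sum sum.cartesian_product
        by (intro sum.cong) (auto simp: times_reduced.abs_eq[symmetric] b_form r2_def mult.commute)
      show ?thesis
        using eq unfolding pf1 pf2 minus_reduced.abs_eq abs_reduced_eq_iff u_def .
    qed
    show ?thesis
      by (intro exI[of _ z] L.shifts_along_lines[OF E PT Q T(2) _ k(1) PP ev z j])
        (use k(3) in \<open>auto intro: right_inverse\<close>)
  qed
  have all_shifts: "\<forall>\<^sub>F \<nu> in sequentially. \<forall>j\<in>{..<n}. \<exists>z. \<forall>m. derivation.shifts_along_line (E \<nu>) n N (b \<nu>) (e \<nu>) j z m"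
  proof (rule eventually_ball_finite[OF finite_lessThan], rule ballI)
    fix j assume "j \<in> {..<n}"
    then have "j < n" by simp
    from shifts[OF this] show "\<forall>\<^sub>F \<nu> in sequentially. \<exists>z. \<forall>m. derivation.shifts_along_line (E \<nu>) n N (b \<nu>) (e \<nu>) j z m"
    proof
      fix z assume "\<forall>\<^sub>F \<nu> in sequentially. \<forall>m. derivation.shifts_along_line (E \<nu>) n N (b \<nu>) (e \<nu>) j z m"
      then show ?thesis by (rule eventually_mono) (rule exI)
    qed
  qed
  have sk: "of_rat (s i) \<in> k" for i
  proof -
    obtain a d where "s i = of_int a / of_int d" using quotient_of_div[of "s i"] by (cases "quotient_of (s i)") auto
    then have "of_rat (s i) = (of_int a / of_int d :: 'a)" by (simp add: of_rat_divide)
    also have "\<dots> = of_int a * inverse (of_int d)" by (rule Fields.field_class.field_divide_inverse)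
    finally show ?thesis by (simp add: kD k(3))
  qed
  have ch: "of_nat (p \<nu>) * e \<nu> = 0" for \<nu> unfolding e_def by (rule char_of_algebra[OF p(2) C \<sigma>])
  have s_nat: "\<forall>\<^sub>F \<nu> in sequentially. \<forall>i\<in>{..<n}. \<exists>m. f \<nu> (of_rat (s i)) = of_nat m * e \<nu>"
    by (intro eventually_ball_finite ballI rational_reduces_to_natural[OF L.limit_hom_axioms _ p ch]) (use sk T in auto)
  have \<omega>: "\<forall>\<^sub>F \<nu> in sequentially. emb (C \<nu>) (contract (C \<nu>) (D \<nu>) (map (map_prod (\<iota> \<nu>) (\<iota> \<nu>)) (w c d))) =
      (\<Sum>i<n. f \<nu> (of_rat (s i)) * b \<nu> i c d)" if cd: "c < N" "d < N" for c d
  proof -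
    have wA: "w c d \<in> kforms (subr A)" by (rule w(1)[OF cd])
    have wT: "w c d \<in> kforms (subr T)" using wA A(2) by (auto simp: kforms_def)
    obtain v where v: "v \<in> kforms (subr T)"
      "P.pair_form v = (\<Sum>i<n. abs_reduced (\<lambda>\<nu>. f \<nu> (- of_rat (s i))) * P.pair_form (B' i c d))"
      "\<And>E. (\<Sum>(a, b)\<leftarrow>v. a * E b) = (\<Sum>i<n. - of_rat (s i) * (\<Sum>(a, b)\<leftarrow>B' i c d. a * E b))"
      using P.linear_combination[of "{..<n}" "\<lambda>i. - of_rat (s i)" "\<lambda>i. B' i c d", OF finite_lessThan TD(4)[OF subsetD[OF T(2) sk]] B'(1)[OF _ cd]] by blast
    have "P.pair_form (w c d @ v) = 0"
    proof (rule killed)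
      show "w c d @ v \<in> kforms (subr T)" using wT v(1) by (auto simp: kforms_def)
      fix D assume D: "D \<in> derivations k ring_of_type_algebra"
      have "(\<Sum>(a, b)\<leftarrow>w c d. a * D b) = (\<Sum>i<n. of_rat (s i) * (\<Sum>(a, b)\<leftarrow>B i c d. a * D b))"
        using kaehler_eq_same_contractions[OF w(2)[OF cd]] D
        by (simp add: same_contractions_def pencil_contraction[where K = UNIV, unfolded subr_UNIV])
      moreover have "(\<Sum>(a, b)\<leftarrow>v. a * D b) = - (\<Sum>i<n. of_rat (s i) * (\<Sum>(a, b)\<leftarrow>B i c d. a * D b))"
        unfolding v(3) sum_negf[symmetric] by (rule sum.cong) (auto simp: B'_contr[OF D] cd)
      ultimately show "(\<Sum>(a, b)\<leftarrow>w c d @ v. a * D b) = 0" by simp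
    qed
    then have "P.pair_form (w c d) = - P.pair_form v" by (simp add: eq_neg_iff_add_eq_0)
    also have "\<dots> = abs_reduced (\<lambda>\<nu>. \<Sum>i<n. f \<nu> (of_rat (s i)) * b \<nu> i c d)"
      unfolding v(2) sum_negf[symmetric] abs_reduced_sum
      using P.\<Psi>_uminus[OF subsetD[OF T(2) sk]] by (intro sum.cong) (auto simp: times_reduced.abs_eq[symmetric] b_form)
    finally have "\<forall>\<^sub>F \<nu> in sequentially. (\<Sum>(x, y)\<leftarrow>w c d. f \<nu> x * E \<nu> (f \<nu> y)) = (\<Sum>i<n. f \<nu> (of_rat (s i)) * b \<nu> i c d)"
      unfolding P.pair_form_def abs_reduced_form[symmetric] abs_reduced_eq_iff .
    moreover have "\<forall>\<^sub>F \<nu> in sequentially. \<forall>xy\<in>set (w c d). f \<nu> (fst xy) = emb (C \<nu>) (\<iota> \<nu> (fst xy)) \<and> f \<nu> (snd xy) = emb (C \<nu>) (\<iota> \<nu> (snd xy))"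
      by (intro eventually_ball_finite ballI eventually_conj f_A) (use wA in \<open>auto simp: kforms_def\<close>)
    ultimately show ?thesis
    proof eventually_elim
      case (elim \<nu>)
      have wC: "map (map_prod (\<iota> \<nu>) (\<iota> \<nu>)) (w c d) \<in> kforms (C \<nu>)"
        by (rule kforms_map[OF \<iota> wA])
      have "emb (C \<nu>) (contract (C \<nu>) (D \<nu>) (map (map_prod (\<iota> \<nu>) (\<iota> \<nu>)) (w c d))) =
          (\<Sum>(x, y)\<leftarrow>w c d. emb (C \<nu>) (\<iota> \<nu> x) * emb (C \<nu>) (D \<nu> (\<iota> \<nu> y)))"
        unfolding contract_emb[OF C D wC] by (simp add: comp_def case_prod_unfold)
      also have "\<dots> = (\<Sum>(x, y)\<leftarrow>w c d. f \<nu> x * E \<nu> (f \<nu> y))"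
      proof (rule arg_cong[where f = sum_list], rule map_cong)
        fix xy assume xy: "xy \<in> set (w c d)"
        obtain x y where [simp]: "xy = (x, y)" by (cases xy)
        have "\<iota> \<nu> y \<in> carrier (C \<nu>)" using ring_hom_closed[OF \<iota>, of y] kformsD[OF wA] xy by simp
        then show "(case xy of (x, y) \<Rightarrow> emb (C \<nu>) (\<iota> \<nu> x) * emb (C \<nu>) (D \<nu> (\<iota> \<nu> y))) =
            (case xy of (x, y) \<Rightarrow> f \<nu> x * E \<nu> (f \<nu> y))"
          using bspec[OF elim(2) xy] by (simp add: E_def emb_derivation_emb[OF C D])
      qed simp
      finally show ?case using elim(1) by simp
    qed
  qed
  have all_\<omega>: "\<forall>\<^sub>F \<nu> in sequentially. \<forall>c\<in>{..<N}. \<forall>d\<in>{..<N}.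
      emb (C \<nu>) (contract (C \<nu>) (D \<nu>) (map (map_prod (\<iota> \<nu>) (\<iota> \<nu>)) (w c d))) = (\<Sum>i<n. f \<nu> (of_rat (s i)) * b \<nu> i c d)"
    by (intro eventually_ball_finite ballI \<omega>) auto
  from all_shifts s_nat all_\<omega> show ?thesis
  proof eventually_elim
    case (elim \<nu>)
    interpret p_derivation "E \<nu>" "p \<nu>"
      unfolding E_def by (rule p_derivation_emb[OF C D p(2) ch[unfolded e_def] D_p])
    obtain m where m: "\<And>i. i < n \<Longrightarrow> f \<nu> (of_rat (s i)) = of_nat (m i) * e \<nu>"
      using elim(2) by (metis lessThan_iff)
    have c1: "\<one>\<^bsub>C \<nu>\<^esub> \<in> carrier (C \<nu>)" "\<zero>\<^bsub>C \<nu>\<^esub> \<in> carrier (C \<nu>)" by (simp_all add: C cring.cring_simprules)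
    have ee: "e \<nu> * e \<nu> = e \<nu>" unfolding e_def by (rule emb_one_mult[OF C c1(1)])
    obtain l where l: "\<And>v a. a < N \<Longrightarrow> e \<nu> * ((cov N (pencil_matrix n (b \<nu>) m) ^^ p \<nu>) ^^ l) v a = 0"
      using periodic_imp_nilpotent[OF ee elim(1)[rule_format, OF iffD2[OF lessThan_iff]], of m] by blast
    define W where "W = (\<lambda>a b. map (map_prod (\<iota> \<nu>) (\<iota> \<nu>)) (w a b))"
    have W: "W c d \<in> kforms (C \<nu>)" if "c < N" "d < N" for c d
      unfolding W_def by (rule kforms_map[OF \<iota> w(1)[OF that]])
    have W_emb: "pencil_matrix n (b \<nu>) m c d = emb (C \<nu>) (contract (C \<nu>) (D \<nu>) (W c d))" if "c < N" "d < N" for c d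
      using elim(3) that m by (auto simp: W_def pencil_matrix_def mult.assoc e_b intro!: sum.cong)
    show ?case
      unfolding W_def[symmetric] funpow_mult
    proof (intro exI[of _ l] ballI ext)
      fix v a assume v: "v \<in> vecs (C \<nu>) N"
      let ?u = "(cov_deriv (C \<nu>) N W (D \<nu>) ^^ (p \<nu> * l)) v"
      have u1: "?u \<in> vecs (C \<nu>) N"
        by (rule cov_deriv_emb(1)[where \<omega> = "pencil_matrix n (b \<nu>) m", OF C D W W_emb v])
      have u2: "emb (C \<nu>) (?u a) = (cov N (pencil_matrix n (b \<nu>) m) ^^ (p \<nu> * l)) (\<lambda>a. if a < N then emb (C \<nu>) (v a) else 0) a"
        if "a < N" for a
        unfolding E_def by (rule cov_deriv_emb(2)[OF C D W W_emb v that])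
      show "?u a = (\<lambda>a\<in>{..<N}. \<zero>\<^bsub>C \<nu>\<^esub>) a"
      proof (cases "a < N")
        case True
        then have ua: "?u a \<in> carrier (C \<nu>)" using u1 by (auto simp: vecs_def)
        have "emb (C \<nu>) (?u a) = e \<nu> * emb (C \<nu>) (?u a)"
          unfolding e_def by (rule emb_one_mult[OF C ua, symmetric])
        also have "\<dots> = 0"
          using l[OF True] u2[OF True] unfolding funpow_mult by simp
        finally show ?thesis
          using True emb_inject[OF C ua c1(2)] by (simp add: emb_zero[OF C])
      next
        case False
        then show ?thesis using PiE_arb[OF u1[unfolded vecs_def], of a] by simp
      qed
    qed
  qed
qed

section \<open>Global nilpotence\<close>

lemma gen_minimal:
  assumes A: "subring_set A" and G: "G \<subseteq> A"
  shows "gen G \<subseteq> A"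
proof
  fix x assume "x \<in> gen G"
  then show "x \<in> A"
  proof (induction rule: generate_ring.induct)
    case (a_inv x)
    have "\<ominus>\<^bsub>ring_of_type_algebra\<^esub> x = - x"
      using subr_uminus[OF subring_set_UNIV, of x] by (simp add: subr_UNIV)
    then show ?case using a_inv subring_setD(4)[OF A] by simp
  qed (use G subring_setD[OF A] in auto)
qed

lemma Qbar_field:
  assumes "algebraically_closed (subr (Qbar :: 'a::field_char_0 set))"
  shows "subring_set (Qbar :: 'a set)" "(x :: 'a) \<in> Qbar \<Longrightarrow> inverse x \<in> Qbar"
proof -
  interpret Q: algebraically_closed "subr (Qbar :: 'a set)" by (rule assms)
  have um: "- x \<in> Qbar" if "x \<in> Qbar" for x :: 'a
  proof -
    have "x + \<ominus>\<^bsub>subr Qbar\<^esub> x = 0" using Q.r_neg[of x] that by simp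
    then have "\<ominus>\<^bsub>subr Qbar\<^esub> x = - x" by (simp add: eq_neg_iff_add_eq_0 add.commute)
    then show ?thesis using Q.a_inv_closed[of x] that by simp
  qed
  show "subring_set (Qbar :: 'a set)"
    using Q.one_closed Q.a_closed Q.m_closed um by (auto simp: subring_set_def)
  show "inverse x \<in> Qbar" if x: "x \<in> Qbar"
  proof (cases "x = 0")
    case False
    then have "x \<in> Units (subr Qbar)" using x by (simp add: Q.field_Units)
    then obtain y where "y \<in> Qbar" "x * y = 1" by (auto simp: Units_def)
    then show ?thesis using inverse_unique[of x y] by simp
  qed (use x in simp)
qed

text \<open>
  Each local ring contains a chart, and the fractions of a chart are already the whole function
  field.
\<close>

lemma irreducible_variety_local_rings:
  assumes Y: "irreducible_variety k Y" and L: "L \<in> Y"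
  shows "subring_set L" "k \<subseteq> L" "{a / b | a b. a \<in> L \<and> b \<in> L \<and> b \<noteq> 0} = UNIV"
proof -
  from Y L obtain A P where A: "fg_algebra k A" "{a / b | a b. a \<in> A \<and> b \<in> A \<and> b \<noteq> 0} = UNIV"
    and P: "primeideal P (subr A)" "L = localization_at A P"
    unfolding irreducible_variety_def affine_atlas_def spec_def by blast
  from A(1) obtain G where G: "A = gen (k \<union> G)" by (auto simp: fg_algebra_def)
  have sub: "subring_set A" unfolding G by (rule subring_set_gen)
  show "subring_set L" unfolding P(2) by (rule subring_localization[OF sub P(1)])
  have AL: "A \<subseteq> L" unfolding P(2) by (rule A_subset_localization[OF sub P(1)])
  show "k \<subseteq> L" using gen_incl[of "k \<union> G"] AL G by blast
  have "{a / b | a b. a \<in> A \<and> b \<in> A \<and> b \<noteq> 0} \<subseteq> {a / b | a b. a \<in> L \<and> b \<in> L \<and> b \<noteq> 0}"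
    using AL by blast
  then show "{a / b | a b. a \<in> L \<and> b \<in> L \<and> b \<noteq> 0} = UNIV" unfolding A(2) by blast
qed

theorem corollary3p10:
  fixes Y :: "'a::field_char_0 set set"
    and n N :: nat
    and B :: "nat \<Rightarrow> nat \<Rightarrow> nat \<Rightarrow> 'a kform"
    and s :: "nat \<Rightarrow> rat"
  assumes "algebraically_closed (subr (Qbar :: 'a set))"
    and "irreducible_variety Qbar Y"
    and "smooth Qbar Y"
    and "periodic_pencil Qbar Y n N B"
  shows "globally_nilpotent Y N (pencil ring_of_type_algebra n B (\<lambda>j. of_rat (s j)))"
  unfolding globally_nilpotent_def
proof (intro allI impI, rule ccontr)
  fix R :: "'a set" and \<A> \<omega>
  assume form: "form_over Y N (pencil ring_of_type_algebra n B (\<lambda>j. of_rat (s j))) R \<A> \<omega>"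
    and inf: "infinite {p::nat. Factorial_Ring.prime p \<and>
          \<not> (\<forall>\<phi>\<in>Ring.ring_hom (subr R) (Fpbar p). reduction_nilpotent p N R \<A> \<omega> \<phi>)}"
  note Qk = Qbar_field[OF assms(1)]
  define C where "C A p \<phi> = base_change R \<phi> (subr A) (Fpbar p)" for A p and \<phi> :: "'a \<Rightarrow> (int list \<times> nat) multiset \<Rightarrow> int"
  define \<iota> where "\<iota> A p \<phi> g = (\<lambda>a. away_in (C A p \<phi>) g (base_change_in R \<phi> (subr A) (Fpbar p) a))" for A p \<phi> g
  define \<sigma> where "\<sigma> A p \<phi> g = (\<lambda>c. away_in (C A p \<phi>) g (base_change_const R \<phi> (subr A) (Fpbar p) c))" for A p \<phi> g
  define nil where "nil A p \<phi> g \<longleftrightarrow> nilpotent_p_curvature p (away (C A p \<phi>) g) (\<sigma> A p \<phi> g ` carrier (Fpbar p)) N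
     (\<lambda>a b. map (map_prod (\<iota> A p \<phi> g) (\<iota> A p \<phi> g)) (\<omega> A a b))" for A p \<phi> g
  define bad where "bad A = {p. Factorial_Ring.prime p \<and>
     (\<exists>\<phi>\<in>Ring.ring_hom (subr R) (Fpbar p). \<exists>g\<in>carrier (C A p \<phi>). \<not> nil A p \<phi> g)}" for A
  have red: "reduction_nilpotent p N R \<A> \<omega> \<phi> \<longleftrightarrow> (\<forall>A\<in>\<A>. \<forall>g\<in>carrier (C A p \<phi>). nil A p \<phi> g)" for p \<phi>
    unfolding reduction_nilpotent_def Let_def nil_def \<iota>_def \<sigma>_def C_def ..
  have atlas: "affine_atlas R \<A>" using form by (simp add: form_over_def)
  \<comment> \<open>the atlas is finite, so a single chart is responsible for infinitely many primes\<close>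
  have "infinite (\<Union>A\<in>\<A>. bad A)"
    by (rule infinite_super[OF _ inf]) (auto simp: bad_def red)
  then obtain A where A: "A \<in> \<A>" "infinite (bad A)"
    using atlas by (auto simp: affine_atlas_def)
  define p where "p = enumerate (bad A)"
  have p: "strict_mono p" unfolding p_def by (rule strict_mono_enumerate[OF A(2)])
  have pb: "p \<nu> \<in> bad A" for \<nu> unfolding p_def by (rule enumerate_in_set[OF A(2)])
  then have pp: "Factorial_Ring.prime (p \<nu>)" for \<nu> by (simp add: bad_def)
  have "\<forall>\<nu>. \<exists>\<phi> g. \<phi> \<in> Ring.ring_hom (subr R) (Fpbar (p \<nu>)) \<and> g \<in> carrier (C A (p \<nu>) \<phi>) \<and> \<not> nil A (p \<nu>) \<phi> g"
    using pb unfolding bad_def by blast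
  then obtain \<phi> g where \<phi>: "\<And>\<nu>. \<phi> \<nu> \<in> Ring.ring_hom (subr R) (Fpbar (p \<nu>))"
    and g: "\<And>\<nu>. g \<nu> \<in> carrier (C A (p \<nu>) (\<phi> \<nu>))" and nn: "\<And>\<nu>. \<not> nil A (p \<nu>) (\<phi> \<nu>) (g \<nu>)" by metis
  define K where "K \<nu> = away (C A (p \<nu>) (\<phi> \<nu>)) (g \<nu>)" for \<nu>
  define i where "i \<nu> = \<iota> A (p \<nu>) (\<phi> \<nu>) (g \<nu>)" for \<nu>
  define c where "c \<nu> = \<sigma> A (p \<nu>) (\<phi> \<nu>) (g \<nu>)" for \<nu>
  define W where "W \<nu> = (\<lambda>a b. map (map_prod (i \<nu>) (i \<nu>)) (\<omega> A a b))" for \<nu>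
  have "\<forall>\<nu>. \<exists>d x \<delta> j. coordinates (K \<nu>) (c \<nu> ` carrier (Fpbar (p \<nu>))) d x \<and>
     coordinate_fields (K \<nu>) (c \<nu> ` carrier (Fpbar (p \<nu>))) d x \<delta> \<and> j < d \<and>
     (\<nexists>l. \<forall>v\<in>vecs (K \<nu>) N. ((cov_deriv (K \<nu>) N (W \<nu>) (\<delta> j) ^^ p \<nu>) ^^ l) v = (\<lambda>a\<in>{..<N}. \<zero>\<^bsub>K \<nu>\<^esub>))"
    using nn unfolding nil_def nilpotent_p_curvature_def K_def[symmetric] i_def[symmetric] c_def[symmetric] W_def[symmetric]
    by blast
  then obtain d x \<delta> j where coord: "\<And>\<nu>. coordinates (K \<nu>) (c \<nu> ` carrier (Fpbar (p \<nu>))) (d \<nu>) (x \<nu>)"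
    and fields: "\<And>\<nu>. coordinate_fields (K \<nu>) (c \<nu> ` carrier (Fpbar (p \<nu>))) (d \<nu>) (x \<nu>) (\<delta> \<nu>)"
    and j: "\<And>\<nu>. j \<nu> < d \<nu>"
    and not_nil: "\<And>\<nu>. \<nexists>l. \<forall>v\<in>vecs (K \<nu>) N.
       ((cov_deriv (K \<nu>) N (W \<nu>) (\<delta> \<nu> (j \<nu>)) ^^ p \<nu>) ^^ l) v = (\<lambda>a\<in>{..<N}. \<zero>\<^bsub>K \<nu>\<^esub>)"
    by metis
  obtain G where G: "G \<subseteq> Qbar" "R = gen G" using form by (auto simp: form_over_def)
  have "fg_algebra R A" using atlas A(1) by (simp add: affine_atlas_def)
  then obtain G' where G': "A = gen (R \<union> G')"
    unfolding fg_algebra_def by (elim exE conjE) (rule that)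
  have R: "subring_set R" unfolding G(2) by (rule subring_set_gen)
  have RQ: "R \<subseteq> Qbar" unfolding G(2) by (rule gen_minimal[OF Qk(1) G(1)])
  have A_sub: "subring_set A" unfolding G' by (rule subring_set_gen)
  have RA: "R \<subseteq> A" using gen_incl[of "R \<union> G'"] by (auto simp: G')
  define T where "T = gen (Qbar \<union> A)"
  have T: "subring_set T" "Qbar \<subseteq> T" "A \<subseteq> T" using subring_set_gen gen_incl[of "Qbar \<union> A"] by (auto simp: T_def)
  have "Y = (\<Union>A\<in>\<A>. spec (gen (Qbar \<union> A)))" using form unfolding form_over_def by (elim conjE)
  then have TY: "spec T \<subseteq> Y" using A(1) unfolding T_def by blast
  have charts: "\<forall>A\<in>\<A>. \<exists>h \<in> ring_iso (base_change R id (subr A) (subr Qbar)) (subr (gen (Qbar \<union> A))).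
        (\<forall>a\<in>A. h (base_change_in R id (subr A) (subr Qbar) a) = a) \<and>
        (\<forall>c\<in>Qbar. h (base_change_const R id (subr A) (subr Qbar) c) = c)"
    using form unfolding form_over_def by (elim conjE)
  obtain h where h': "h \<in> ring_iso (base_change R id (subr A) (subr Qbar)) (subr T)"
      "\<forall>a\<in>A. h (base_change_in R id (subr A) (subr Qbar) a) = a"
      "\<forall>c\<in>Qbar. h (base_change_const R id (subr A) (subr Qbar) c) = c"
    using bspec[OF charts A(1), folded T_def] by (elim bexE conjE) (rule that)
  note h = h'(1) h'(2)[rule_format] h'(3)[rule_format]
  have forms: "\<forall>a<N. \<forall>b<N.
        (\<forall>A\<in>\<A>. \<omega> A a b \<in> kforms (subr A) \<and>
           kaehler_eq ring_of_type_algebra Qbar (\<omega> A a b) (pencil ring_of_type_algebra n B (\<lambda>j. of_rat (s j)) a b)) \<and>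
        (\<forall>A\<in>\<A>. \<forall>B\<in>\<A>. kaehler_eq (subr (gen (A \<union> B))) R (\<omega> A a b) (\<omega> B a b))"
    using form unfolding form_over_def by (elim conjE)
  have w: "\<omega> A a b \<in> kforms (subr A)"
     "kaehler_eq ring_of_type_algebra Qbar (\<omega> A a b) (pencil ring_of_type_algebra n B (\<lambda>j. of_rat (s j)) a b)"
    if "a < N" "b < N" for a b
    by (rule bspec[OF conjunct1[OF forms[rule_format, OF that]] A(1), THEN conjunct1],
        rule bspec[OF conjunct1[OF forms[rule_format, OF that]] A(1), THEN conjunct2])
  have base: "R \<subseteq> carrier (subr A)" "\<one>\<^bsub>subr A\<^esub> \<in> R" "\<phi> \<nu> \<in> R \<rightarrow> carrier (Fpbar (p \<nu>))"
     "\<phi> \<nu> \<one>\<^bsub>subr A\<^esub> = \<one>\<^bsub>Fpbar (p \<nu>)\<^esub>" for \<nu>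
    using RA subring_setD(1)[OF R] ring_hom_closed[OF \<phi>] ring_hom_one[OF \<phi>] by auto
  note bc = cring_Fpbar[OF pp] cring_subr[OF A_sub] base
  have cC: "cring (C A (p \<nu>) (\<phi> \<nu>))" for \<nu>
    unfolding C_def by (rule cring_base_change[OF bc])
  have K: "cring (K \<nu>)" for \<nu> unfolding K_def by (rule cring_away_hom[OF cC g])
  have away: "away_in (C A (p \<nu>) (\<phi> \<nu>)) (g \<nu>) \<in> Ring.ring_hom (C A (p \<nu>) (\<phi> \<nu>)) (K \<nu>)" for \<nu>
    unfolding K_def by (rule cring_away_hom[OF cC g])
  have i_hom: "i \<nu> \<in> Ring.ring_hom (subr A) (K \<nu>)" for \<nu>
    using ring_hom_trans[OF base_change_in_hom[OF bc] away[unfolded C_def]]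
    by (simp add: i_def \<iota>_def C_def comp_def)
  have c_hom: "c \<nu> \<in> Ring.ring_hom (Fpbar (p \<nu>)) (K \<nu>)" for \<nu>
    using ring_hom_trans[OF base_change_const_hom[OF bc] away[unfolded C_def]]
    by (simp add: c_def \<sigma>_def C_def comp_def)
  have agree: "i \<nu> r = c \<nu> (\<phi> \<nu> r)" if "r \<in> R" for \<nu> r
    by (simp add: i_def c_def \<iota>_def \<sigma>_def base_change_in_const[OF bc that])
  have D: "\<delta> \<nu> (j \<nu>) \<in> derivations (c \<nu> ` carrier (Fpbar (p \<nu>))) (K \<nu>)" for \<nu>
    using fields j by (auto simp: coordinate_fields_def)
  have D_p: "(\<delta> \<nu> (j \<nu>) ^^ p \<nu>) y = \<zero>\<^bsub>K \<nu>\<^esub>" if "y \<in> carrier (K \<nu>)" for \<nu> y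
    by (rule coordinate_field_pow_p[OF K coord fields j pp char_of_algebra[OF pp K c_hom] that])
  have "\<forall>\<^sub>F \<nu> in sequentially. \<exists>l. \<forall>v\<in>vecs (K \<nu>) N.
     ((cov_deriv (K \<nu>) N (\<lambda>a b. map (map_prod (i \<nu>) (i \<nu>)) (\<omega> A a b)) (\<delta> \<nu> (j \<nu>)) ^^ p \<nu>) ^^ l) v
       = (\<lambda>a\<in>{..<N}. \<zero>\<^bsub>K \<nu>\<^esub>)"
    by (rule eventually_nilpotent[OF Qk(1) _ Qk(2) A_sub T(3) R RA RQ T(1,2) h TY
          irreducible_variety_local_rings[OF assms(2)] assms(3,4) w p pp \<phi> K i_hom c_hom agree D D_p])
      (auto simp: Qbar_def)
  then have "\<forall>\<^sub>F \<nu> in sequentially. False"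
  proof (rule eventually_mono)
    fix \<nu>
    assume "\<exists>l. \<forall>v\<in>vecs (K \<nu>) N.
     ((cov_deriv (K \<nu>) N (\<lambda>a b. map (map_prod (i \<nu>) (i \<nu>)) (\<omega> A a b)) (\<delta> \<nu> (j \<nu>)) ^^ p \<nu>) ^^ l) v
       = (\<lambda>a\<in>{..<N}. \<zero>\<^bsub>K \<nu>\<^esub>)"
    with not_nil[of \<nu>, unfolded W_def] show False by (rule notE)
  qed
  then show False by simp
qed

end
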